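(* For any model $\xi_0$, $RS\subset AT$; that is, if $\beta>0$, $h\ge0$ and the Parisi measure for $(\xi_0,\beta,h)$ consists of exactly one atom, then $\alpha(\beta,h)\le 1$.
   Context: A model is a power series $\xi_0(t)=\sum_{p\ge 2}\beta_p^2t^p$ with real coefficients $\beta_p$, not all zero, such that $\xi_0(1+\epsilon)<\infty$ for some $\epsilon>0$. For $\beta>0$ put $\xi(t)=\beta^2\xi_0(t)$. For a Borel probability measure $\mu\in\Pr([0,1])$, $u_\mu$ is the unique weak solution (continuous on $[0,1]\times\mathbb{R}$, with essentially bounded weak derivative $u_x$, equation tested against $\phi\in C_c^\infty((0,1]\times\mathbb{R})$) of the Parisi PDE $$\partial_tu+\tfrac{\xi''(t)}{2}\bigl(\partial_{xx}u+\mu[0,t](\partial_xu)^2\bigr)=0\ \text{ on }(0,1)\times\mathbb{R},\qquad u(1,x)=\log\cosh x,$$ and the Parisi functional is $$\mathcal{P}(\mu;\xi_0,\beta,h)=u_\mu(0,h)-\tfrac12\int_0^1\xi''(s)\mu[0,s]\,s\,ds .$$ The Parisi measure is its (known to be unique) minimizer over $\Pr([0,1])$. Let $Z$ be a standard Gaussian random variable and define $$Q_*(\beta,h)=\{q\in[0,1]:\mathbb{E}\tanh^2(\sqrt{\xi'(q)}Z+h)=q\},\quad \alpha(q,\beta,h)=\xi''(q)\,\mathbb{E}\,\mathrm{sech}^4(\sqrt{\xi'(q)}Z+h),$$ $$\alpha(\beta,h)=\min_{q\in Q_*(\beta,h)}\alpha(q,\beta,h).$$ Finally $AT=\{(\beta,h):\beta>0,h\ge0,\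 \alpha(\beta,h)\le1\}$ and $RS=\{(\beta,h):\beta>0,h\ge0,\ \text{the Parisi measure is 1-atomic}\}$ (i.e. equals $\delta_q$ for some $q\in[0,1]$). *)

theory Defs
  imports "HOL-Probability.Probability"
begin

subsection \<open>Models\<close>

text \<open>The value of the series at points where it diverges is never used: for a model it
  converges on a neighbourhood of \<open>[0,1]\<close>.\<close>

definition mixture :: "(nat \<Rightarrow> real) \<Rightarrow> real \<Rightarrow> real" where
  "mixture b t = (\<Sum>p. (b (p + 2))\<^sup>2 * t ^ (p + 2))"

definition is_model :: "(real \<Rightarrow> real) \<Rightarrow> bool" where
  "is_model \<xi>\<^sub>0 \<longleftrightarrow> (\<exists>b. \<xi>\<^sub>0 = mixture b \<and> (\<exists>p\<ge>2. b p \<noteq> 0) \<and>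
     (\<exists>\<epsilon>>0. summable (\<lambda>p. (b (p + 2))\<^sup>2 * (1 + \<epsilon>) ^ (p + 2))))"

definition xi :: "(real \<Rightarrow> real) \<Rightarrow> real \<Rightarrow> real \<Rightarrow> real" where
  "xi \<xi>\<^sub>0 \<beta> t = \<beta>\<^sup>2 * \<xi>\<^sub>0 t"

abbreviation xi' :: "(real \<Rightarrow> real) \<Rightarrow> real \<Rightarrow> real \<Rightarrow> real" where
  "xi' \<xi>\<^sub>0 \<beta> \<equiv> deriv (xi \<xi>\<^sub>0 \<beta>)"

abbreviation xi'' :: "(real \<Rightarrow> real) \<Rightarrow> real \<Rightarrow> real \<Rightarrow> real" where
  "xi'' \<xi>\<^sub>0 \<beta> \<equiv> deriv (deriv (xi \<xi>\<^sub>0 \<beta>))"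

abbreviation unit_borel :: "real measure" where
  "unit_borel \<equiv> restrict_space borel {0..1}"

definition Pr01 :: "real measure set" where
  "Pr01 = {\<mu>. prob_space \<mu> \<and> sets \<mu> = sets unit_borel}"

subsection \<open>Weak solutions of the Parisi PDE\<close>

text \<open>Functions of \<open>(t, x)\<close> are functions on pairs. In \<open>smooth_on_strip I \<phi>\<close> the function
  \<open>D i j\<close> is the partial derivative of \<open>\<phi>\<close> of order \<open>i\<close> in \<open>t\<close> and \<open>j\<close> in \<open>x\<close>. The
  \<open>t\<close>-derivatives are taken within \<open>I\<close>, hence are one-sided at an endpoint belonging to \<open>I\<close>,
  so that \<open>test_function {0<..1}\<close> is \<open>C\<^sub>c\<^sup>\<infinity>\<close> of the strip with its boundary \<open>t = 1\<close> included;
  there a test function need not vanish.\<close>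

definition smooth_on_strip :: "real set \<Rightarrow> (real \<times> real \<Rightarrow> real) \<Rightarrow> bool" where
  "smooth_on_strip I \<phi> \<longleftrightarrow> (\<exists>D :: nat \<Rightarrow> nat \<Rightarrow> real \<times> real \<Rightarrow> real.
     (\<forall>t\<in>I. \<forall>x. D 0 0 (t, x) = \<phi> (t, x)) \<and>
     (\<forall>i j. continuous_on (I \<times> UNIV) (D i j) \<and>
       (\<forall>t\<in>I. \<forall>x.
         ((\<lambda>s. D i j (s, x)) has_real_derivative D (Suc i) j (t, x)) (at t within I) \<and>
         ((\<lambda>y. D i j (t, y)) has_real_derivative D i (Suc j) (t, x)) (at x))))"

definition test_function :: "real set \<Rightarrow> (real \<times> real \<Rightarrow> real) \<Rightarrow> bool" where
  "test_function I \<phi> \<longleftrightarrow> smooth_on_strip I \<phi> \<and>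
     (\<exists>K. compact K \<and> K \<subseteq> I \<times> UNIV \<and> (\<forall>z \<in> I \<times> UNIV - K. \<phi> z = 0))"

definition d_t :: "(real \<times> real \<Rightarrow> real) \<Rightarrow> real \<times> real \<Rightarrow> real" where
  "d_t f = (\<lambda>(t, x). deriv (\<lambda>s. f (s, x)) t)"

definition d_x :: "(real \<times> real \<Rightarrow> real) \<Rightarrow> real \<times> real \<Rightarrow> real" where
  "d_x f = (\<lambda>(t, x). deriv (\<lambda>y. f (t, y)) x)"

abbreviation open_strip :: "(real \<times> real) set" where
  "open_strip \<equiv> {0<..<1} \<times> UNIV"

definition ess_bounded_weak_dx :: "(real \<times> real \<Rightarrow> real) \<Rightarrow> (real \<times> real \<Rightarrow> real) \<Rightarrow> bool" where
  "ess_bounded_weak_dx u v \<longleftrightarrow>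
     set_borel_measurable lborel open_strip v \<and>
     (\<exists>C. AE z\<in>open_strip in lborel. \<bar>v z\<bar> \<le> C) \<and>
     (\<forall>\<phi>. test_function {0<..<1} \<phi> \<longrightarrow>
        (LINT z:open_strip|lborel. u z * d_x \<phi> z) = - (LINT z:open_strip|lborel. v z * \<phi> z))"

text \<open>The terminal condition \<open>u(1, x) = log cosh x\<close> is the boundary term that the integration
  by parts in \<open>t\<close> produces.\<close>

definition parisi_weak_solution ::
    "(real \<Rightarrow> real) \<Rightarrow> real \<Rightarrow> real measure \<Rightarrow> (real \<times> real \<Rightarrow> real) \<Rightarrow> bool" where
  "parisi_weak_solution \<xi>\<^sub>0 \<beta> \<mu> u \<longleftrightarrow>
     continuous_on ({0..1} \<times> UNIV) u \<and>
     (\<exists>v. ess_bounded_weak_dx u v \<and>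
       (\<forall>\<phi>. test_function {0<..1} \<phi> \<longrightarrow>
         (LINT z:open_strip|lborel.
            - u z * d_t \<phi> z + xi'' \<xi>\<^sub>0 \<beta> (fst z) / 2 *
              (u z * d_x (d_x \<phi>) z + measure \<mu> {0..fst z} * (v z)\<^sup>2 * \<phi> z))
         + (LINT x|lborel. \<phi> (1, x) * ln (cosh x)) = 0))"

text \<open>A weak solution is a function on \<open>[0,1] \<times> \<real>\<close>; extensionality fixes its irrelevant values
  elsewhere, without which there would be no uniqueness.\<close>

definition parisi_u :: "(real \<Rightarrow> real) \<Rightarrow> real \<Rightarrow> real measure \<Rightarrow> real \<times> real \<Rightarrow> real" where
  "parisi_u \<xi>\<^sub>0 \<beta> \<mu> =
     (THE u. u \<in> extensional ({0..1} \<times> UNIV) \<and> parisi_weak_solution \<xi>\<^sub>0 \<beta> \<mu> u)"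

subsection \<open>Parisi functional and Parisi measure\<close>

definition parisi_functional ::
    "(real \<Rightarrow> real) \<Rightarrow> real \<Rightarrow> real \<Rightarrow> real measure \<Rightarrow> real" where
  "parisi_functional \<xi>\<^sub>0 \<beta> h \<mu> =
     parisi_u \<xi>\<^sub>0 \<beta> \<mu> (0, h)
     - 1 / 2 * (LINT s:{0..1}|lborel. xi'' \<xi>\<^sub>0 \<beta> s * measure \<mu> {0..s} * s)"

definition is_parisi_measure ::
    "(real \<Rightarrow> real) \<Rightarrow> real \<Rightarrow> real \<Rightarrow> real measure \<Rightarrow> bool" where
  "is_parisi_measure \<xi>\<^sub>0 \<beta> h \<mu> \<longleftrightarrow> \<mu> \<in> Pr01 \<and>
     (\<forall>\<nu>\<in>Pr01. parisi_functional \<xi>\<^sub>0 \<beta> h \<mu> \<le> parisi_functional \<xi>\<^sub>0 \<beta> h \<nu>)"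

subsection \<open>The sets AT and RS\<close>

definition gauss_expectation :: "(real \<Rightarrow> real) \<Rightarrow> real" where
  "gauss_expectation f = (\<integral>z. f z \<partial>density lborel std_normal_density)"

definition Q_star :: "(real \<Rightarrow> real) \<Rightarrow> real \<Rightarrow> real \<Rightarrow> real set" where
  "Q_star \<xi>\<^sub>0 \<beta> h =
     {q \<in> {0..1}. gauss_expectation (\<lambda>z. (tanh (sqrt (xi' \<xi>\<^sub>0 \<beta> q) * z + h))\<^sup>2) = q}"

definition alpha_at :: "(real \<Rightarrow> real) \<Rightarrow> real \<Rightarrow> real \<Rightarrow> real \<Rightarrow> real" where
  "alpha_at \<xi>\<^sub>0 q \<beta> h =
     xi'' \<xi>\<^sub>0 \<beta> q * gauss_expectation (\<lambda>z. (1 / cosh (sqrt (xi' \<xi>\<^sub>0 \<beta> q) * z + h)) ^ 4)"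

text \<open>The set of values need not be finite, so \<open>Min\<close> is not available; the minimum exists
  because \<open>Q_star\<close> is nonempty and compact.\<close>

definition alpha :: "(real \<Rightarrow> real) \<Rightarrow> real \<Rightarrow> real \<Rightarrow> real" where
  "alpha \<xi>\<^sub>0 \<beta> h = (LEAST a. a \<in> (\<lambda>q. alpha_at \<xi>\<^sub>0 q \<beta> h) ` Q_star \<xi>\<^sub>0 \<beta> h)"

definition AT :: "(real \<Rightarrow> real) \<Rightarrow> (real \<times> real) set" where
  "AT \<xi>\<^sub>0 = {(\<beta>, h). \<beta> > 0 \<and> h \<ge> 0 \<and> alpha \<xi>\<^sub>0 \<beta> h \<le> 1}"

definition RS :: "(real \<Rightarrow> real) \<Rightarrow> (real \<times> real) set" where
  "RS \<xi>\<^sub>0 = {(\<beta>, h). \<beta> > 0 \<and> h \<ge> 0 \<and>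
     (\<exists>\<mu>. is_parisi_measure \<xi>\<^sub>0 \<beta> h \<mu> \<and> (\<exists>q\<in>{0..1}. \<mu> = return unit_borel q))}"

end

theory Submission
  imports Defs "HOL-Computational_Algebra.Polynomial" "HOL-Real_Asymp.Real_Asymp"
begin

text \<open>If the point mass at \<open>q\<close> minimises the Parisi functional, then moving the atom and splitting
it are both unprofitable, and these two facts already give \<open>\<alpha> \<le> 1\<close>.

Write \<open>T = \<xi>'\<close>, \<open>X = \<xi>''\<close> and \<open>Y = h + sqrt (T q) Z\<close>. Moving the atom: the functional at the
point mass at \<open>r\<close> has derivative \<open>X r / 2 * (r - E tanh^2)\<close> in \<open>r\<close>, the expectation being taken at
\<open>h + sqrt (T r) Z\<close>. As \<open>X > 0\<close> on \<open>(0, 1]\<close>, a minimum at \<open>q\<close> forces \<open>E tanh^2 Y = q\<close>, that is,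
\<open>q\<close> belongs to \<open>Q_star\<close>; since \<open>tanh^2 < 1\<close>, also \<open>q < 1\<close> (\<open>minimal_point\<close>).

Splitting the atom: for \<open>r > q\<close> the measure \<open>m \<delta>\<^sub>q + (1 - m) \<delta>\<^sub>r\<close> must not do better than
\<open>\<delta>\<^sub>q\<close>. The one-sided derivative of the functional at \<open>m = 1\<close> is explicit, and its sign says that the
expectation at \<open>y = Y\<close> of the relative entropy \<open>B (v, y)\<close> of the Gaussian law \<open>N (y, v)\<close> tilted by \<open>cosh\<close>,
with \<open>v = T r - T q\<close>, is at most half of \<open>\<integral> X s * s ds\<close> over \<open>[q, r]\<close> (\<open>tilt_entropy_le\<close>).
Expanding both sides to second order in \<open>r - q\<close>, by
\<open>B (v, y) \<ge> v/2 tanh^2 y + v^2/4 sech^4 y - O(v^3)\<close> (\<open>tilt_entropy_lower\<close>), the first order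
terms cancel because of \<open>E tanh^2 Y = q\<close>, and the second order terms give
\<open>(X q)^2 E sech^4 Y \<le> X q\<close>, hence \<open>\<alpha> (q) \<le> 1\<close> (\<open>stability\<close>). The minimum over \<open>Q_star\<close> is at
most the value at this \<open>q\<close> (\<open>alpha_le\<close>).

All this needs the values of the functional at measures with at most two atoms. There the Parisi PDE
is solved by the Cole--Hopf transformation: \<open>u = log (E exp (m u)) / m\<close> where the distribution
function equals \<open>m > 0\<close>, and the heat equation where it vanishes (\<open>two_atom_solution\<close>). Since the
functional refers to the solution by a definite description, such a formula is only usable together
with a proof that weak solutions are unique (\<open>weak_solution_unique\<close>). For uniqueness, the
difference \<open>w\<close> of two solutions solves the linear equation
\<open>w_t + a (w_xx + c w_x) = 0\<close>, \<open>w(1, x) = 0\<close> with bounded measurable \<open>c\<close>. Mollifying in \<open>x\<close>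
turns it into an equation that holds pointwise after integration in time, up to the commutator of the
mollification with multiplication by \<open>c\<close>; the energy with weight \<open>(1 + x^2)^(-2)\<close> then satisfies a
Gronwall inequality whose error is the size of the commutator, which tends to \<open>0\<close> in a weighted
\<open>L^1\<close> norm (\<open>difference_zero\<close>).\<close>

section \<open>Smooth functions and bumps\<close>

text \<open>Differentiability of order \<open>n\<close> on the whole line, in a form that is closed under sums and
products by a plain induction on \<open>n\<close>.\<close>

primrec n_diff :: "nat \<Rightarrow> (real \<Rightarrow> real) \<Rightarrow> bool" where
  "n_diff 0 f \<longleftrightarrow> True"
| "n_diff (Suc n) f \<longleftrightarrow> (\<exists>f'. (\<forall>x. (f has_real_derivative f' x) (at x)) \<and> n_diff n f')"

lemma n_diff_SucI:
  "(\<And>x. (f has_real_derivative f' x) (at x)) \<Longrightarrow> n_diff n f' \<Longrightarrow> n_diff (Suc n) f"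
  by auto

definition smooth_fun :: "(real \<Rightarrow> real) \<Rightarrow> bool" where
  "smooth_fun f \<longleftrightarrow> (\<forall>n. n_diff n f)"

lemma n_diff_Suc_deriv:
  assumes "n_diff (Suc n) f"
  shows "(f has_real_derivative deriv f x) (at x)" "n_diff n (deriv f)"
proof -
  obtain f' where f': "\<And>x. (f has_real_derivative f' x) (at x)" "n_diff n f'"
    using assms by auto
  have "deriv f = f'" using f'(1) DERIV_imp_deriv by blast
  then show "(f has_real_derivative deriv f x) (at x)" "n_diff n (deriv f)" using f' by auto
qed

lemma smooth_fun_deriv:
  assumes "smooth_fun f"
  shows "(f has_real_derivative deriv f x) (at x)" "smooth_fun (deriv f)"
  using assms n_diff_Suc_deriv unfolding smooth_fun_def by blast+

lemma smooth_fun_deriv_n: "smooth_fun f \<Longrightarrow> smooth_fun ((deriv ^^ n) f)"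
  by (induction n) (auto intro: smooth_fun_deriv)

lemma smooth_fun_continuous: "smooth_fun f \<Longrightarrow> continuous_on A f"
  using smooth_fun_deriv(1) DERIV_isCont by (blast intro: continuous_at_imp_continuous_on)

lemma n_diff_mono: "n_diff (Suc n) f \<Longrightarrow> n_diff n f"
  by (induction n arbitrary: f) auto

lemma n_diff_add: "n_diff n f \<Longrightarrow> n_diff n g \<Longrightarrow> n_diff n (\<lambda>x. f x + g x)"
proof (induction n arbitrary: f g)
  case (Suc n)
  obtain f' g' where f': "\<And>x. (f has_real_derivative f' x) (at x)" "n_diff n f'"
    and g': "\<And>x. (g has_real_derivative g' x) (at x)" "n_diff n g'"
    using Suc.prems by auto
  show ?case
    by (rule n_diff_SucI[OF DERIV_add[OF f'(1) g'(1)] Suc.IH[OF f'(2) g'(2)]])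
qed auto

lemma n_diff_mult: "n_diff n f \<Longrightarrow> n_diff n g \<Longrightarrow> n_diff n (\<lambda>x. f x * g x)"
proof (induction n arbitrary: f g)
  case (Suc n)
  obtain f' g' where f': "\<forall>x. (f has_real_derivative f' x) (at x)" "n_diff n f'"
    and g': "\<forall>x. (g has_real_derivative g' x) (at x)" "n_diff n g'"
    using Suc.prems by auto
  have "n_diff n (\<lambda>x. f' x * g x + g' x * f x)"
    using Suc f'(2) g'(2) n_diff_mono by (intro n_diff_add Suc.IH) auto
  moreover have "\<forall>x. ((\<lambda>x. f x * g x) has_real_derivative f' x * g x + g' x * f x) (at x)"
    using f'(1) g'(1) by (auto intro: DERIV_mult)
  ultimately show ?case by auto
qed auto

lemma n_diff_cmult: "n_diff n f \<Longrightarrow> n_diff n (\<lambda>x. c * f x)"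
proof (induction n arbitrary: f)
  case (Suc n)
  obtain f' where f': "\<And>x. (f has_real_derivative f' x) (at x)" "n_diff n f'"
    using Suc.prems by auto
  show ?case
    by (rule n_diff_SucI[OF DERIV_cmult[OF f'(1)] Suc.IH[OF f'(2)]])
qed auto

lemma n_diff_affine: "n_diff n f \<Longrightarrow> n_diff n (\<lambda>x. f (p * x + q))"
proof (induction n arbitrary: f)
  case (Suc n)
  obtain f' where f': "\<And>x. (f has_real_derivative f' x) (at x)" "n_diff n f'"
    using Suc.prems by auto
  have "((\<lambda>x. p * x + q) has_real_derivative p) (at x)" for x
    by (auto intro!: derivative_eq_intros)
  then have "((\<lambda>x. f (p * x + q)) has_real_derivative f' (p * x + q) * p) (at x)" for x
    by (rule DERIV_chain2[OF f'(1)])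
  then show ?case
    by (rule n_diff_SucI) (use n_diff_cmult[OF Suc.IH[OF f'(2)], of p] in \<open>simp add: mult.commute\<close>)
qed auto

lemma smooth_fun_mult: "smooth_fun f \<Longrightarrow> smooth_fun g \<Longrightarrow> smooth_fun (\<lambda>x. f x * g x)"
  and smooth_fun_cmult: "smooth_fun f \<Longrightarrow> smooth_fun (\<lambda>x. c * f x)"
  and smooth_fun_affine: "smooth_fun f \<Longrightarrow> smooth_fun (\<lambda>x. f (p * x + q))"
  by (auto simp: smooth_fun_def n_diff_mult n_diff_cmult n_diff_affine)

text \<open>This is what lets the time-primitive of a bump serve as a test function.\<close>

lemma smooth_fun_antideriv:
  assumes "smooth_fun f" "\<And>x. (F has_real_derivative f x) (at x)"
  shows "smooth_fun F"
  unfolding smooth_fun_def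
proof
  fix n show "n_diff n F" using assms by (cases n) (auto simp: smooth_fun_def)
qed

text \<open>The derivative of \<open>exp (- 1 / x)\<close>, extended by \<open>0\<close>, is again of this form with another
polynomial; the polynomial parameter makes the family closed under differentiation.\<close>

definition flat_exp :: "real poly \<Rightarrow> real \<Rightarrow> real" where
  "flat_exp P x = (if x > 0 then poly P (1 / x) * exp (- 1 / x) else 0)"

text \<open>The exponential beats every polynomial, which is why all derivatives of \<open>flat_exp\<close>
vanish at \<open>0\<close>.\<close>

lemma tendsto_poly_exp: "((\<lambda>z. poly P z * exp (- z)) \<longlongrightarrow> (0::real)) at_top"
proof -
  have *: "((\<lambda>z. z ^ k * exp (- z)) \<longlongrightarrow> (0::real)) at_top" for k
    using tendsto_power_div_exp_0[of k] by (simp add: exp_minus divide_inverse)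
  have "((\<lambda>z. (\<Sum>i\<le>degree P. coeff P i * (z ^ i * exp (- z)))) \<longlongrightarrow>
      (\<Sum>i\<le>degree P. coeff P i * 0)) at_top"
    by (intro tendsto_intros *)
  then show ?thesis by (simp add: poly_altdef sum_distrib_right mult.assoc)
qed

lemma flat_exp_deriv:
  "(flat_exp P has_real_derivative flat_exp ([:0, 0, 1:] * (P - pderiv P)) x) (at x)"
proof -
  consider "x > 0" | "x < 0" | "x = 0" by linarith
  then show ?thesis
  proof cases
    case 1
    have "((\<lambda>x. poly P (1 / x) * exp (- 1 / x)) has_real_derivative
        flat_exp ([:0, 0, 1:] * (P - pderiv P)) x) (at x)"
      using 1 by (auto intro!: derivative_eq_intros DERIV_chain2[OF poly_DERIV]
          simp: flat_exp_def field_simps power2_eq_square)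
    then show ?thesis
      by (rule has_field_derivative_transform_within_open[where S="{0<..}"])
         (use 1 in \<open>auto simp: flat_exp_def\<close>)
  next
    case 2
    have "((\<lambda>x. 0) has_real_derivative flat_exp ([:0, 0, 1:] * (P - pderiv P)) x) (at x)"
      using 2 by (auto simp: flat_exp_def)
    then show ?thesis
      by (rule has_field_derivative_transform_within_open[where S="{..<0}"])
         (use 2 in \<open>auto simp: flat_exp_def\<close>)
  next
    case 3
    have "((\<lambda>y. poly (pCons 0 P) (1 / y) * exp (- (1 / y))) \<longlongrightarrow> 0) (at_right 0)"
      using filterlim_compose[OF tendsto_poly_exp[of "pCons 0 P"] filterlim_inverse_at_top_right]
      by (simp add: inverse_eq_divide)
    then have "((\<lambda>y. flat_exp P y / y) \<longlongrightarrow> 0) (at_right 0)"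
      by (rule Lim_transform_eventually)
         (auto simp: eventually_at_filter flat_exp_def intro!: always_eventually)
    moreover have "((\<lambda>y. flat_exp P y / y) \<longlongrightarrow> 0) (at_left 0)"
      by (rule tendsto_eventually)
         (auto simp: eventually_at_filter flat_exp_def intro!: always_eventually)
    ultimately have "((\<lambda>y. flat_exp P y / y) \<longlongrightarrow> 0) (at 0)"
      by (simp add: filterlim_at_split)
    then show ?thesis using 3 by (simp add: has_field_derivative_iff flat_exp_def)
  qed
qed

lemma smooth_flat_exp: "smooth_fun (flat_exp P)"
proof -
  have "n_diff n (flat_exp P)" for n
    by (induction n arbitrary: P) (simp, unfold n_diff.simps, intro exI conjI allI, rule flat_exp_deriv)
  then show ?thesis by (simp add: smooth_fun_def)
qed

definition bump :: "real \<Rightarrow> real \<Rightarrow> real \<Rightarrow> real" where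
  "bump c r x = flat_exp 1 (x - (c - r)) * flat_exp 1 (c + r - x)"

lemma bump_smooth: "smooth_fun (bump c r)"
  using smooth_fun_mult[OF smooth_fun_affine[OF smooth_flat_exp, of 1 1 "- (c - r)"]
    smooth_fun_affine[OF smooth_flat_exp, of 1 "-1" "c + r"]]
  unfolding bump_def by (simp add: algebra_simps)

lemma bump_nonneg: "0 \<le> bump c r x"
  and bump_pos: "\<bar>x - c\<bar> < r \<Longrightarrow> 0 < bump c r x"
  and bump_zero: "r \<le> \<bar>x - c\<bar> \<Longrightarrow> bump c r x = 0"
  by (auto simp: bump_def flat_exp_def)

section \<open>Mollification\<close>

lemma lborel_integral_compact_support:
  fixes f :: "real \<Rightarrow> real"
  assumes "continuous_on {a..b} f" "\<And>y. y \<notin> {a..b} \<Longrightarrow> f y = 0"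
  shows "integrable lborel f" "integral\<^sup>L lborel f = integral {a..b} f"
proof -
  have i: "set_integrable lborel {a..b} f"
    using assms(1) by (rule borel_integrable_atLeastAtMost')
  have e: "(\<lambda>x. indicator {a..b} x *\<^sub>R f x) = f"
    using assms(2) by (intro ext) (simp split: split_indicator)
  show "integrable lborel f" using i unfolding set_integrable_def e .
  show "integral\<^sup>L lborel f = integral {a..b} f"
    using set_borel_integral_eq_integral(2)[OF i] unfolding set_lebesgue_integral_def e .
qed

definition convolve :: "(real \<Rightarrow> real) \<Rightarrow> (real \<Rightarrow> real) \<Rightarrow> real \<Rightarrow> real" where
  "convolve f k x = (\<integral>y. f y * k (x - y) \<partial>lborel)"

lemma convolve_flip: "convolve f k x = (\<integral>y. f (x - y) * k y \<partial>lborel)"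
  unfolding convolve_def
  using lborel_integral_real_affine[of "-1" "\<lambda>y. f y * k (x - y)" x] by simp

text \<open>Near a fixed \<open>x\<close> only a fixed compact interval contributes to the convolution, so the
Leibniz rule for integrals over a compact interval applies. The function \<open>F\<close> is merely continuous:
all derivatives fall on the kernel.\<close>

lemma convolve_has_derivative:
  assumes F: "continuous_on UNIV F"
    and k: "\<And>x. (k has_real_derivative k' x) (at x)" "continuous_on UNIV k'"
    and supp: "\<And>x. r < \<bar>x\<bar> \<Longrightarrow> k x = 0" "\<And>x. r < \<bar>x\<bar> \<Longrightarrow> k' x = 0"
  shows "(convolve F k has_real_derivative convolve F k' x) (at x)"
proof -
  define a b where "a = x - 1 - \<bar>r\<bar>" and "b = x + 1 + \<bar>r\<bar>"
  define U where "U = {x - 1..x + 1}"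
  have ck: "continuous_on UNIV k"
    using k(1) DERIV_isCont by (blast intro: continuous_at_imp_continuous_on)
  have z: "k (x' - y) = 0 \<and> k' (x' - y) = 0" if "x' \<in> U" "y \<notin> {a..b}" for x' y
    using that supp unfolding U_def a_def b_def by auto
  have c1: "continuous_on A (\<lambda>y. F y * k (x' - y))" for A x'
    by (intro continuous_intros continuous_on_compose2[OF ck] continuous_on_subset[OF F]) auto
  have c2: "continuous_on A (\<lambda>y. F y * k' (x' - y))" for A x'
    by (intro continuous_intros continuous_on_compose2[OF k(2)] continuous_on_subset[OF F]) auto
  have e1: "convolve F k x' = integral {a..b} (\<lambda>y. F y * k (x' - y))" if "x' \<in> U" for x'
    unfolding convolve_def by (rule lborel_integral_compact_support[OF c1]) (use z[OF that] in auto)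
  have e2: "convolve F k' x' = integral {a..b} (\<lambda>y. F y * k' (x' - y))" if "x' \<in> U" for x'
    unfolding convolve_def by (rule lborel_integral_compact_support[OF c2]) (use z[OF that] in auto)
  have "((\<lambda>x'. integral (cbox a b) (\<lambda>y. F y * k (x' - y))) has_real_derivative
      integral (cbox a b) (\<lambda>y. F y * k' (x - y))) (at x within U)"
  proof (rule leibniz_rule_field_derivative[where f="\<lambda>x' y. F y * k (x' - y)" and fx="\<lambda>x' y. F y * k' (x' - y)"])
    fix x' t
    have "((\<lambda>x. x - t) has_real_derivative 1) (at x' within U)"
      using DERIV_diff[OF DERIV_ident DERIV_const, of t x' U] by simp
    from DERIV_cmult[OF DERIV_chain2[OF k(1) this], of "F t"]
    show "((\<lambda>x. F t * k (x - t)) has_real_derivative F t * k' (x' - t)) (at x' within U)"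
      by simp
  next
    show "(\<lambda>y. F y * k (x' - y)) integrable_on cbox a b" for x'
      using integrable_continuous_interval[OF c1] by simp
    show "continuous_on (U \<times> cbox a b) (\<lambda>(x', t). F t * k' (x' - t))"
      unfolding case_prod_beta
      by (intro continuous_on_mult continuous_on_compose2[OF k(2), of _ "\<lambda>z. fst z - snd z"]
          continuous_on_compose2[OF F, of _ snd] continuous_on_fst continuous_on_snd continuous_on_diff continuous_on_id) auto
  qed (auto simp: U_def)
  then have "(convolve F k has_real_derivative integral (cbox a b) (\<lambda>y. F y * k' (x - y))) (at x within U)"
    by (rule has_field_derivative_transform_within[where d=1]) (use e1 in \<open>auto simp: U_def\<close>)
  then have "(convolve F k has_real_derivative convolve F k' x) (at x within U)"
    using e2[of x] by (simp add: U_def)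
  moreover have "at x within U = at x"
    by (rule at_within_interior) (auto simp: U_def)
  ultimately show ?thesis by simp
qed

definition mollifier :: "real \<Rightarrow> real \<Rightarrow> real" where
  "mollifier r x = bump 0 r x / integral\<^sup>L lborel (bump 0 r)"

lemma bump_integral_pos:
  assumes "r > 0" shows "0 < integral\<^sup>L lborel (bump c r)" "integrable lborel (bump c r)"
proof -
  have c: "continuous_on A (bump c r)" for A by (rule smooth_fun_continuous[OF bump_smooth])
  have z: "bump c r y = 0" if "y \<notin> {c - r..c + r}" for y using that by (intro bump_zero) auto
  show i: "integrable lborel (bump c r)" by (rule lborel_integral_compact_support[OF c z])
  have "integral\<^sup>L lborel (bump c r) \<noteq> 0"
  proof
    assume "integral\<^sup>L lborel (bump c r) = 0"
    then have "AE x in lborel. bump c r x = 0"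
      using integral_nonneg_eq_0_iff_AE[OF i] bump_nonneg by auto
    then have "AE x in lborel. x \<notin> {c - r<..<c + r}"
    proof eventually_elim
      case (elim x)
      then have "\<not> \<bar>x - c\<bar> < r" using bump_pos[of x c r] by auto
      then show ?case by auto
    qed
    then have "{c - r<..<c + r} \<in> null_sets lborel" by (subst AE_iff_null_sets) auto
    then show False using assms by (simp add: null_sets_def)
  qed
  then show "0 < integral\<^sup>L lborel (bump c r)"
    using bump_nonneg by (metis integral_nonneg_AE AE_I2 order_le_less)
qed

lemma mollifier_smooth: "smooth_fun (mollifier r)"
  using smooth_fun_cmult[OF bump_smooth, of "1 / integral\<^sup>L lborel (bump 0 r)" 0 r]
  by (simp add: mollifier_def[abs_def])

lemma mollifier_nonneg: "r > 0 \<Longrightarrow> 0 \<le> mollifier r x"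
  using bump_integral_pos(1)[of r 0] bump_nonneg by (simp add: mollifier_def)

lemma mollifier_zero: "r \<le> \<bar>x\<bar> \<Longrightarrow> mollifier r x = 0"
  using bump_zero[of r x 0] by (simp add: mollifier_def)

lemma mollifier_integral: "r > 0 \<Longrightarrow> integral\<^sup>L lborel (mollifier r) = 1" "r > 0 \<Longrightarrow> integrable lborel (mollifier r)"
  using bump_integral_pos[of r 0] by (auto simp: mollifier_def[abs_def])

lemma mollifier_continuous: "continuous_on A (mollifier r)"
  by (rule smooth_fun_continuous[OF mollifier_smooth])

lemma mollifier_measurable [measurable]: "mollifier r \<in> borel_measurable borel"
  by (rule borel_measurable_continuous_onI[OF mollifier_continuous])

lemma deriv_zero_outside:
  assumes "\<And>x. r < \<bar>x\<bar> \<Longrightarrow> f x = 0" "r < \<bar>x\<bar>"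
  shows "deriv f x = (0::real)"
proof -
  have "open {x::real. r < \<bar>x\<bar>}" by (intro open_Collect_less continuous_intros)
  then have "(f has_real_derivative 0) (at x)"
    using has_field_derivative_transform_within_open[OF DERIV_const[of "0::real"], of "{x. r < \<bar>x\<bar>}" x f]
      assms by simp
  then show ?thesis by (rule DERIV_imp_deriv)
qed

lemma convolve_tendsto:
  assumes g: "continuous_on UNIV g"
  shows "(\<lambda>n. convolve g (mollifier (1 / Suc n)) x) \<longlonglongrightarrow> g x"
proof (rule LIMSEQ_I)
  fix e :: real assume "e > 0"
  have "isCont g x" using g by (simp add: continuous_on_eq_continuous_at)
  then obtain d where d: "d > 0" "\<And>y. \<bar>y - x\<bar> < d \<Longrightarrow> \<bar>g y - g x\<bar> < e / 2"
    using \<open>e > 0\<close> unfolding continuous_at_real_range by (metis half_gt_zero real_norm_def)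
  obtain N where N: "1 / Suc N < d" using d(1) nat_approx_posE by blast
  show "\<exists>no. \<forall>n\<ge>no. norm (convolve g (mollifier (1 / Suc n)) x - g x) < e"
  proof (intro exI allI impI)
    fix n assume "N \<le> n"
    define r :: real where "r = 1 / Suc n"
    have r: "r > 0" "r < d" using \<open>N \<le> n\<close> N
      by (auto simp: r_def intro!: order.strict_trans1[OF _ N] divide_left_mono)
    have i: "integrable lborel (\<lambda>y. g (x - y) * mollifier r y)"
      by (rule lborel_integral_compact_support[of "-r" r])
         (auto intro!: continuous_intros continuous_on_compose2[OF g] mollifier_continuous mollifier_zero)
    have "convolve g (mollifier r) x - g x = (\<integral>y. g (x - y) * mollifier r y - g x * mollifier r y \<partial>lborel)"
      using mollifier_integral[OF r(1)] i by (simp add: convolve_flip)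
    also have "\<bar>\<dots>\<bar> \<le> (\<integral>y. e / 2 * mollifier r y \<partial>lborel)"
    proof (rule integral_abs_bound_integral)
      fix y
      show "\<bar>g (x - y) * mollifier r y - g x * mollifier r y\<bar> \<le> e / 2 * mollifier r y"
      proof (cases "\<bar>y\<bar> < r")
        case True
        then have "\<bar>g (x - y) - g x\<bar> \<le> e / 2" using r d(2)[of "x - y"] by auto
        from mult_right_mono[OF this mollifier_nonneg[OF r(1), of y]] show ?thesis using mollifier_nonneg[OF r(1), of y]
          by (simp add: abs_mult left_diff_distrib[symmetric])
      qed (simp add: mollifier_zero)
    qed (use i mollifier_integral[OF r(1)] in auto)
    also have "\<dots> = e / 2" using mollifier_integral[OF r(1)] by simp
    finally show "norm (convolve g (mollifier (1 / Suc n)) x - g x) < e" using \<open>e > 0\<close> by (simp add: r_def)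
  qed
qed

lemma convolve_bounded:
  assumes [measurable]: "f \<in> borel_measurable borel" and "r > 0" "\<And>x. \<bar>f x\<bar> \<le> C"
  shows "integrable lborel (\<lambda>y. f y * mollifier r (x - y))" "\<bar>convolve f (mollifier r) x\<bar> \<le> C"
proof -
  have i: "integrable lborel (\<lambda>y. C * mollifier r (x - y))"
    using lborel_integrable_real_affine[OF mollifier_integral(2)[OF assms(2)], of "-1" x] by simp
  have l: "\<bar>f y * mollifier r (x - y)\<bar> \<le> C * mollifier r (x - y)" for y
    using assms mollifier_nonneg[OF assms(2)] by (simp add: abs_mult mult_right_mono)
  show i2: "integrable lborel (\<lambda>y. f y * mollifier r (x - y))"
    by (rule Bochner_Integration.integrable_bound[OF i])
       (auto intro!: AE_I2 order_trans[OF l])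
  have "\<bar>convolve f (mollifier r) x\<bar> \<le> (\<integral>y. C * mollifier r (x - y) \<partial>lborel)"
    unfolding convolve_def by (rule integral_abs_bound_integral[OF i2 i l])
  also have "\<dots> = C"
    using lborel_integral_real_affine[of "-1" "mollifier r" x] mollifier_integral[OF assms(2)] by simp
  finally show "\<bar>convolve f (mollifier r) x\<bar> \<le> C" by simp
qed

lemma convolve_measurable [measurable]:
  assumes [measurable]: "f \<in> borel_measurable borel" "k \<in> borel_measurable borel"
  shows "convolve f k \<in> borel_measurable borel"
  unfolding convolve_def by measurable

text \<open>Measurability in the sense of the gauge integral provides continuous functions converging off a
negligible set; truncation at the level \<open>C\<close> keeps them bounded without spoiling the limit.\<close>

lemma AE_continuous_approx:
  fixes f :: "real \<Rightarrow> real"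
  assumes f: "f \<in> borel_measurable borel" and C: "\<And>x. \<bar>f x\<bar> \<le> C"
  obtains g where "\<And>n. continuous_on UNIV (g n)" "\<And>n x. \<bar>g n x\<bar> \<le> C"
    "AE x in lborel. (\<lambda>n. g n x) \<longlonglongrightarrow> f x"
proof -
  have "f \<in> borel_measurable lborel" using f by simp
  then have "f \<in> borel_measurable (lebesgue_on UNIV)"
    unfolding lebesgue_on_UNIV_eq by (rule measurable_completion)
  then have "f measurable_on UNIV" by (intro lebesgue_measurable_imp_measurable_on) auto
  then obtain N g where N: "negligible N" and g: "\<And>n. continuous_on UNIV (g n)"
    and lim: "\<And>x. x \<notin> N \<Longrightarrow> (\<lambda>n. g n x) \<longlonglongrightarrow> f x"
    unfolding measurable_on_def by auto
  define h where "h n x = max (-C) (min C (g n x))" for n :: nat and x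
  have C0: "C \<ge> 0" using C[of 0] by linarith
  have "AE x in lebesgue. (\<lambda>n. h n x) \<longlonglongrightarrow> f x"
  proof (rule AE_I'[of N])
    show "N \<in> null_sets lebesgue" using N by (simp add: negligible_iff_null_sets)
    show "{x \<in> space lebesgue. \<not> (\<lambda>n. h n x) \<longlonglongrightarrow> f x} \<subseteq> N"
    proof safe
      fix x assume n: "\<not> (\<lambda>n. h n x) \<longlonglongrightarrow> f x"
      show "x \<in> N"
      proof (rule ccontr)
        assume "x \<notin> N"
        from tendsto_max[OF tendsto_const[of "-C"] tendsto_min[OF tendsto_const[of C] lim[OF this]]]
        have "(\<lambda>n. h n x) \<longlonglongrightarrow> max (-C) (min C (f x))" by (simp add: h_def)
        moreover have "max (-C) (min C (f x)) = f x" using C[of x] by auto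
        ultimately show False using n by simp
      qed
    qed
  qed
  then have "AE x in lborel. (\<lambda>n. h n x) \<longlonglongrightarrow> f x" by (simp add: AE_completion_iff)
  moreover have "continuous_on UNIV (h n)" for n
    unfolding h_def by (intro continuous_intros g)
  moreover have "\<bar>h n x\<bar> \<le> C" for n x using C0 by (auto simp: h_def)
  ultimately show ?thesis using that by blast
qed

text \<open>An integrable weight which varies by a bounded factor over unit distances. Solutions of the
Parisi PDE grow linearly, so that unweighted \<open>L^2\<close> norms of their differences need not be finite.\<close>

definition weight :: "real \<Rightarrow> real" where "weight x = 1 / (1 + x\<^sup>2)"

lemma one_plus_square_pos: "0 < 1 + (x::real)\<^sup>2"
  by (rule add_pos_nonneg) auto

lemma weight_pos: "0 < weight x" and weight_le_1: "weight x \<le> 1"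
  unfolding weight_def using one_plus_square_pos[of x] by auto

lemma weight_continuous: "continuous_on A weight"
  unfolding weight_def by (intro continuous_intros) (use one_plus_square_pos in \<open>metis less_irrefl\<close>)

lemma weight_measurable [measurable]: "weight \<in> borel_measurable borel"
  by (rule borel_measurable_continuous_onI[OF weight_continuous])

lemma weight_integrable: "integrable lborel weight"
  using integrable_inverse_1_plus_square
  by (simp add: set_integrable_def einterval_def weight_def[abs_def] inverse_eq_divide)

lemma weight_shift: assumes "\<bar>x - y\<bar> \<le> 1" shows "weight x \<le> 3 * weight y"
proof -
  have "y\<^sup>2 \<le> 2 * x\<^sup>2 + 2"
  proof -
    have "y\<^sup>2 = (x - (x - y))\<^sup>2" by simp
    also have "\<dots> \<le> 2 * x\<^sup>2 + 2 * (x - y)\<^sup>2"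
      using zero_le_power2[of "x + (x - y)"] by (simp add: power2_eq_square algebra_simps)
    also have "(x - y)\<^sup>2 \<le> 1" using assms by (simp add: abs_square_le_1)
    finally show ?thesis by simp
  qed
  then show ?thesis
    using one_plus_square_pos[of x] one_plus_square_pos[of y] zero_le_power2[of x]
    by (simp add: weight_def divide_simps) (intro impI, use zero_le_power2[of x] in linarith)
qed

text \<open>Mollification at scale at most \<open>1\<close> is bounded on the weighted \<open>L^1\<close> space: the weight moves
from \<open>x\<close> to \<open>y\<close> at the cost of the factor \<open>3\<close>, and Tonelli integrates out the mollifier.\<close>

lemma convolve_weight_bound:
  assumes [measurable]: "f \<in> borel_measurable borel" and r: "0 < r" "r \<le> 1"
    and C: "\<And>x. \<bar>f x\<bar> \<le> C"
  shows "(\<integral>x. weight x * \<bar>convolve f (mollifier r) x\<bar> \<partial>lborel) \<le> 3 * (\<integral>x. weight x * \<bar>f x\<bar> \<partial>lborel)"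
proof -
  have C0: "0 \<le> C" using C[of 0] by linarith
  have bi: "integrable lborel (\<lambda>x. weight x * g x)"
    if "g \<in> borel_measurable borel" "\<And>x. \<bar>g x\<bar> \<le> C" for g
    by (rule Bochner_Integration.integrable_bound[OF integrable_mult_right[OF weight_integrable, of C]])
       (use that C0 weight_pos in \<open>auto simp: abs_mult mult.commute less_imp_le intro!: mult_mono\<close>)
  have i1: "integrable lborel (\<lambda>x. weight x * \<bar>convolve f (mollifier r) x\<bar>)"
    by (rule bi) (use convolve_bounded(2)[OF _ r(1) C] in auto)
  have i2: "integrable lborel (\<lambda>x. weight x * \<bar>f x\<bar>)"
    by (rule bi) (use C in auto)
  have "ennreal (\<integral>x. weight x * \<bar>convolve f (mollifier r) x\<bar> \<partial>lborel) = (\<integral>\<^sup>+x. weight x * \<bar>convolve f (mollifier r) x\<bar> \<partial>lborel)"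
    using nn_integral_eq_integral[OF i1] weight_pos by (simp add: less_imp_le)
  also have "\<dots> \<le> (\<integral>\<^sup>+x. (\<integral>\<^sup>+y. 3 * (weight y * \<bar>f y\<bar>) * mollifier r (x - y) \<partial>lborel) \<partial>lborel)"
  proof (rule nn_integral_mono)
    fix x
    have a: "integrable lborel (\<lambda>y. \<bar>f y\<bar> * mollifier r (x - y))"
      by (rule convolve_bounded(1)[OF _ r(1), of _ C]) (use C in auto)
    have le: "\<bar>convolve f (mollifier r) x\<bar> \<le> (\<integral>y. \<bar>f y\<bar> * mollifier r (x - y) \<partial>lborel)"
      unfolding convolve_def
      by (rule integral_abs_bound_integral[OF convolve_bounded(1)[OF _ r(1) C] a])
         (use mollifier_nonneg[OF r(1)] in \<open>auto simp: abs_mult\<close>)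
    have "ennreal (weight x * \<bar>convolve f (mollifier r) x\<bar>)
        \<le> ennreal (\<integral>y. weight x * (\<bar>f y\<bar> * mollifier r (x - y)) \<partial>lborel)"
      using le weight_pos[of x] by (intro ennreal_leI) (simp add: mult_left_mono)
    also have "\<dots> = (\<integral>\<^sup>+y. weight x * (\<bar>f y\<bar> * mollifier r (x - y)) \<partial>lborel)"
      using a mollifier_nonneg[OF r(1)] weight_pos[of x]
      by (intro nn_integral_eq_integral[symmetric]) (auto simp: less_imp_le)
    also have "\<dots> \<le> (\<integral>\<^sup>+y. 3 * (weight y * \<bar>f y\<bar>) * mollifier r (x - y) \<partial>lborel)"
    proof (intro nn_integral_mono ennreal_leI)
      fix y
      show "weight x * (\<bar>f y\<bar> * mollifier r (x - y)) \<le> 3 * (weight y * \<bar>f y\<bar>) * mollifier r (x - y)"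
      proof (cases "\<bar>x - y\<bar> < r")
        case True
        then have "weight x \<le> 3 * weight y" using r by (intro weight_shift) linarith
        then have "weight x * (\<bar>f y\<bar> * mollifier r (x - y)) \<le> 3 * weight y * (\<bar>f y\<bar> * mollifier r (x - y))"
          using mollifier_nonneg[OF r(1)] by (intro mult_right_mono) auto
        then show ?thesis by (simp add: mult_ac)
      qed (simp add: mollifier_zero)
    qed
    finally show "ennreal (weight x * \<bar>convolve f (mollifier r) x\<bar>) \<le> (\<integral>\<^sup>+y. 3 * (weight y * \<bar>f y\<bar>) * mollifier r (x - y) \<partial>lborel)" .
  qed
  also have "\<dots> = (\<integral>\<^sup>+y. (\<integral>\<^sup>+x. 3 * (weight y * \<bar>f y\<bar>) * mollifier r (x - y) \<partial>lborel) \<partial>lborel)"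
    by (rule lborel_pair.Fubini') measurable
  also have "\<dots> = (\<integral>\<^sup>+y. 3 * (weight y * \<bar>f y\<bar>) \<partial>lborel)"
  proof (rule nn_integral_cong)
    fix y
    have i: "integrable lborel (\<lambda>x. mollifier r (x - y))"
      using lborel_integrable_real_affine[OF mollifier_integral(2)[OF r(1)], of 1 "- y"] by simp
    have "(\<integral>x. mollifier r (x - y) \<partial>lborel) = 1"
      using lborel_integral_real_affine[of 1 "mollifier r" "- y"] mollifier_integral[OF r(1)] by simp
    then have "(\<integral>\<^sup>+x. mollifier r (x - y) \<partial>lborel) = 1"
      using nn_integral_eq_integral[OF i] mollifier_nonneg[OF r(1)] by simp
    then show "(\<integral>\<^sup>+x. 3 * (weight y * \<bar>f y\<bar>) * mollifier r (x - y) \<partial>lborel) = 3 * (weight y * \<bar>f y\<bar>)"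
      using weight_pos[of y] mollifier_nonneg[OF r(1)]
      by (simp add: ennreal_mult' nn_integral_cmult less_imp_le)
  qed
  also have "\<dots> = ennreal (3 * (\<integral>x. weight x * \<bar>f x\<bar> \<partial>lborel))"
    using nn_integral_eq_integral[OF integrable_mult_right[OF i2, of 3]] weight_pos
    by (simp add: less_imp_le)
  finally show ?thesis
    by (subst (asm) ennreal_le_iff) (auto intro!: integral_nonneg_AE mult_nonneg_nonneg simp: weight_pos less_imp_le)
qed

text \<open>The usual density argument: approximate \<open>f\<close> by a continuous function, for which mollification
converges pointwise, and use that mollification is bounded in the weighted norm.\<close>

lemma convolve_L1_tendsto:
  assumes f [measurable]: "f \<in> borel_measurable borel" and C: "\<And>x. \<bar>f x\<bar> \<le> C"
  shows "(\<lambda>n. \<integral>x. weight x * \<bar>convolve f (mollifier (1 / Suc n)) x - f x\<bar> \<partial>lborel) \<longlonglongrightarrow> 0"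
proof -
  obtain g where g: "\<And>n. continuous_on UNIV (g n)" "\<And>n x. \<bar>g n x\<bar> \<le> C"
    "AE x in lborel. (\<lambda>n. g n x) \<longlonglongrightarrow> f x"
    using AE_continuous_approx[OF assms] by blast
  have gm [measurable]: "g n \<in> borel_measurable borel" for n
    by (rule borel_measurable_continuous_onI[OF g(1)])
  have C0: "0 \<le> C" using C[of 0] by linarith
  have bi: "integrable lborel (\<lambda>x. weight x * h x)"
    if "h \<in> borel_measurable borel" "\<And>x. \<bar>h x\<bar> \<le> 2 * C" for h
    by (rule Bochner_Integration.integrable_bound[OF integrable_mult_right[OF weight_integrable, of "2 * C"]])
       (use that C0 weight_pos in \<open>auto simp: abs_mult mult.commute less_imp_le intro!: mult_mono\<close>)
  have dom: "(\<lambda>n. \<integral>x. weight x * \<bar>h n x\<bar> \<partial>lborel) \<longlonglongrightarrow> 0"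
    if "\<And>n. h n \<in> borel_measurable borel" "\<And>n x. \<bar>h n x\<bar> \<le> 2 * C" "AE x in lborel. (\<lambda>n. h n x) \<longlonglongrightarrow> 0"
    for h :: "nat \<Rightarrow> real \<Rightarrow> real"
  proof -
    note [measurable] = that(1)
    have "(\<lambda>n. \<integral>x. weight x * \<bar>h n x\<bar> \<partial>lborel) \<longlonglongrightarrow> (\<integral>x. 0 \<partial>(lborel :: real measure))"
    proof (rule integral_dominated_convergence[where w="\<lambda>x. 2 * C * weight x"])
      show "AE x in lborel. (\<lambda>n. weight x * \<bar>h n x\<bar>) \<longlonglongrightarrow> 0"
        using that(3) by eventually_elim (auto intro!: tendsto_mult_right_zero tendsto_rabs_zero)
      show "AE x in lborel. norm (weight x * \<bar>h n x\<bar>) \<le> 2 * C * weight x" for n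
        using that(2)[of n] weight_pos by (auto simp: abs_mult mult.commute less_imp_le intro!: mult_mono AE_I2)
    qed (use weight_integrable in auto)
    then show ?thesis by simp
  qed
  have convolve_bd: "\<bar>convolve h (mollifier (1 / Suc n)) x\<bar> \<le> D" if "h \<in> borel_measurable borel" "\<And>x. \<bar>h x\<bar> \<le> D" for n h x D
    by (rule convolve_bounded(2)[OF that(1) _ that(2)]) simp
  show ?thesis
  proof (rule LIMSEQ_I)
    fix e :: real assume "e > 0"
    \<comment> \<open>The approximation error is paid once directly and three times after mollification,
       hence \<open>4 * e / 8\<close> in total; the other half of \<open>e\<close> is for the mollified continuous function.\<close>
    have e8: "0 < e / 8" and e2: "0 < e / 2" using \<open>e > 0\<close> by auto
    have b2: "\<bar>g n x - f x\<bar> \<le> 2 * C" for n x using g(2)[of n x] C[of x] by linarith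
    have "AE x in lborel. (\<lambda>n. g n x - f x) \<longlonglongrightarrow> 0"
      using g(3) by eventually_elim (simp add: LIM_zero)
    from dom[OF _ b2 this] have "(\<lambda>n. \<integral>x. weight x * \<bar>g n x - f x\<bar> \<partial>lborel) \<longlonglongrightarrow> 0" by simp
    from LIMSEQ_D[OF this e8] obtain m where
      "\<forall>n\<ge>m. norm ((\<integral>x. weight x * \<bar>g n x - f x\<bar> \<partial>lborel) - 0) < e / 8" by blast
    then have "norm ((\<integral>x. weight x * \<bar>g m x - f x\<bar> \<partial>lborel) - 0) < e / 8" by blast
    then have m: "(\<integral>x. weight x * \<bar>g m x - f x\<bar> \<partial>lborel) < e / 8" by simp
    have b3: "\<bar>convolve (g m) (mollifier (1 / Suc n)) x - g m x\<bar> \<le> 2 * C" for n x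
      using convolve_bd[OF gm g(2), of m n x] g(2)[of m x] by linarith
    have "(\<lambda>n. convolve (g m) (mollifier (1 / Suc n)) x - g m x) \<longlonglongrightarrow> 0" for x
      using convolve_tendsto[OF g(1)] by (rule LIM_zero)
    then have "(\<lambda>n. \<integral>x. weight x * \<bar>convolve (g m) (mollifier (1 / Suc n)) x - g m x\<bar> \<partial>lborel) \<longlonglongrightarrow> 0"
      by (intro dom b3) auto
    from LIMSEQ_D[OF this e2] obtain N where N: "\<And>n. n \<ge> N \<Longrightarrow>
        norm ((\<integral>x. weight x * \<bar>convolve (g m) (mollifier (1 / Suc n)) x - g m x\<bar> \<partial>lborel) - 0) < e / 2"
      by blast
    show "\<exists>no. \<forall>n\<ge>no. norm ((\<integral>x. weight x * \<bar>convolve f (mollifier (1 / Suc n)) x - f x\<bar> \<partial>lborel) - 0) < e"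
    proof (intro exI allI impI)
      fix n assume "N \<le> n"
      define r :: real where "r = 1 / Suc n"
      have r: "0 < r" "r \<le> 1" by (auto simp: r_def)
      define A where "A x = convolve (\<lambda>y. g m y - f y) (mollifier r) x" for x
      have A: "A x = convolve (g m) (mollifier r) x - convolve f (mollifier r) x" for x
        unfolding A_def convolve_def using convolve_bounded(1)[OF gm r(1) g(2), of m x] convolve_bounded(1)[OF f r(1) C, of x]
        by (simp add: left_diff_distrib)
      have Ab: "\<bar>A x\<bar> \<le> 2 * C" for x
        unfolding A_def by (rule convolve_bounded(2)[OF _ r(1) b2]) simp
      have Am [measurable]: "A \<in> borel_measurable borel" unfolding A_def by measurable
      have i1: "integrable lborel (\<lambda>x. weight x * \<bar>A x\<bar>)" by (rule bi) (use Ab in auto)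
      have i2: "integrable lborel (\<lambda>x. weight x * \<bar>convolve (g m) (mollifier r) x - g m x\<bar>)"
        by (rule bi) (use b3[of n] in \<open>auto simp: r_def\<close>)
      have i3: "integrable lborel (\<lambda>x. weight x * \<bar>g m x - f x\<bar>)" by (rule bi) (use b2 in auto)
      have i4: "integrable lborel (\<lambda>x. weight x * \<bar>convolve f (mollifier r) x - f x\<bar>)"
      proof (rule bi)
        fix x show "\<bar>\<bar>convolve f (mollifier r) x - f x\<bar>\<bar> \<le> 2 * C"
          using convolve_bounded(2)[OF f r(1) C, of x] C[of x] by linarith
      qed measurable
      have "(\<integral>x. weight x * \<bar>convolve f (mollifier r) x - f x\<bar> \<partial>lborel) \<le>
        (\<integral>x. weight x * \<bar>A x\<bar> + weight x * \<bar>convolve (g m) (mollifier r) x - g m x\<bar> + weight x * \<bar>g m x - f x\<bar> \<partial>lborel)"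
      proof (rule integral_mono[OF i4])
        fix x
        have "\<bar>convolve f (mollifier r) x - f x\<bar> \<le> \<bar>A x\<bar> + \<bar>convolve (g m) (mollifier r) x - g m x\<bar> + \<bar>g m x - f x\<bar>"
          unfolding A by linarith
        from mult_left_mono[OF this, of "weight x"] weight_pos[of x]
        show "weight x * \<bar>convolve f (mollifier r) x - f x\<bar> \<le> weight x * \<bar>A x\<bar> + weight x * \<bar>convolve (g m) (mollifier r) x - g m x\<bar> + weight x * \<bar>g m x - f x\<bar>"
          by (simp add: distrib_left)
      qed (use i1 i2 i3 in auto)
      also have "\<dots> = (\<integral>x. weight x * \<bar>A x\<bar> \<partial>lborel) + (\<integral>x. weight x * \<bar>convolve (g m) (mollifier r) x - g m x\<bar> \<partial>lborel)
          + (\<integral>x. weight x * \<bar>g m x - f x\<bar> \<partial>lborel)"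
        using i1 i2 i3 by simp
      also have "(\<integral>x. weight x * \<bar>A x\<bar> \<partial>lborel) \<le> 3 * (\<integral>x. weight x * \<bar>g m x - f x\<bar> \<partial>lborel)"
        unfolding A_def by (rule convolve_weight_bound[OF _ r b2]) simp
      finally have "(\<integral>x. weight x * \<bar>convolve f (mollifier r) x - f x\<bar> \<partial>lborel) < e"
        using m N[OF \<open>N \<le> n\<close>] by (simp add: r_def) 
      moreover have "0 \<le> (\<integral>x. weight x * \<bar>convolve f (mollifier r) x - f x\<bar> \<partial>lborel)"
        using weight_pos by (intro integral_nonneg_AE AE_I2) (simp add: less_imp_le)
      ultimately show "norm ((\<integral>x. weight x * \<bar>convolve f (mollifier (1 / Suc n)) x - f x\<bar> \<partial>lborel) - 0) < e"
        by (simp add: r_def)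
    qed
  qed
qed

section \<open>Integrals over the strip and localisation in time\<close>

lemma integrable_strip:
  fixes f :: "real \<times> real \<Rightarrow> real"
  assumes [measurable]: "f \<in> borel_measurable (borel \<Otimes>\<^sub>M borel)"
    and b: "\<And>t x. \<bar>f (t, x)\<bar> \<le> C * indicator {0..1} t * weight x"
  shows "integrable (lborel \<Otimes>\<^sub>M lborel) f"
proof (rule lborel_pair.Fubini_integrable)
  have f2 [measurable]: "f \<in> borel_measurable (lborel \<Otimes>\<^sub>M lborel)"
    by (simp cong: measurable_cong_sets sets_pair_measure_cong)
  show "f \<in> borel_measurable (lborel \<Otimes>\<^sub>M lborel)" by fact
  have i: "integrable lborel (\<lambda>x. f (t, x))" for t
    by (rule Bochner_Integration.integrable_bound[OF integrable_mult_right[OF weight_integrable, of "C * indicator {0..1} t"]])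
       (auto intro!: AE_I2 order_trans[OF b])
  then show "AE t in lborel. integrable lborel (\<lambda>x. f (t, x))" by simp
  show "integrable lborel (\<lambda>t. \<integral>x. norm (f (t, x)) \<partial>lborel)"
  proof (rule Bochner_Integration.integrable_bound)
    show "integrable lborel (\<lambda>t. (C * integral\<^sup>L lborel weight) * indicator {0..1::real} t :: real)"
      by (intro integrable_mult_right) auto
    show "AE t in lborel. norm (\<integral>x. norm (f (t, x)) \<partial>lborel) \<le> norm ((C * integral\<^sup>L lborel weight) * indicator {0..1::real} t :: real)"
    proof (rule AE_I2)
      fix t
      have "(\<integral>x. norm (f (t, x)) \<partial>lborel) \<le> (\<integral>x. (C * indicator {0..1} t) * weight x \<partial>lborel)"
        using b by (intro integral_mono integrable_norm[OF i] integrable_mult_right weight_integrable) simp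
      also have "\<dots> = (C * integral\<^sup>L lborel weight) * indicator {0..1::real} t" by simp
      finally show "norm (\<integral>x. norm (f (t, x)) \<partial>lborel) \<le> norm ((C * integral\<^sup>L lborel weight) * indicator {0..1::real} t :: real)"
        by simp
    qed
  qed measurable
qed

lemma strip_swap:
  fixes f :: "real \<times> real \<Rightarrow> real"
  assumes "f \<in> borel_measurable (borel \<Otimes>\<^sub>M borel)"
    and "\<And>t x. \<bar>f (t, x)\<bar> \<le> C * indicator {0..1} t * weight x"
  shows "(\<integral>x. \<integral>t. f (t, x) \<partial>lborel \<partial>lborel) = (\<integral>t. \<integral>x. f (t, x) \<partial>lborel \<partial>lborel)"
    and "integrable lborel (\<lambda>t. \<integral>x. f (t, x) \<partial>lborel)"
  using lborel_pair.Fubini_integral[of "\<lambda>t x. f (t, x)"] lborel_pair.integrable_fst'[of f] integrable_strip[OF assms]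
  by (auto simp: case_prod_eta)

lemma square_swap:
  fixes f :: "real \<times> real \<Rightarrow> real"
  assumes m: "f \<in> borel_measurable (borel \<Otimes>\<^sub>M borel)"
    and b: "\<And>t x. \<bar>f (t, x)\<bar> \<le> C * indicator {0..1} t * indicator {0..1} x"
  shows "(\<integral>x. \<integral>t. f (t, x) \<partial>lborel \<partial>lborel) = (\<integral>t. \<integral>x. f (t, x) \<partial>lborel \<partial>lborel)"
proof (rule strip_swap(1)[OF m])
  fix t x :: real
  have C0: "0 \<le> C" using b[of 0 0] by simp
  have "x\<^sup>2 \<le> 1" if "x \<in> {0..1}" using that by (simp add: power_le_one)
  then have "indicator {0..1} x \<le> 2 * weight x"
    using weight_pos[of x] one_plus_square_pos[of x] by (auto simp: indicator_def weight_def divide_simps)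
  then have "C * indicator {0..1} t * indicator {0..1} x \<le> C * indicator {0..1} t * (2 * weight x)"
    using C0 by (intro mult_left_mono) auto
  with b[of t x] show "\<bar>f (t, x)\<bar> \<le> (2 * C) * indicator {0..1} t * weight x" by (simp add: mult_ac)
qed

text \<open>If \<open>R c\<close> is not \<open>0\<close>, then \<open>R\<close> keeps its sign on a neighbourhood of \<open>c\<close>, and a bump
supported there sees it. Continuity carries the conclusion from the open to the closed interval.\<close>

lemma continuous_zero_by_bumps:
  assumes R: "continuous_on {0..1} R"
    and z: "\<And>c r. 0 < r \<Longrightarrow> 0 < c - r \<Longrightarrow> c + r < 1 \<Longrightarrow>
      (LINT t:{0<..<1}|lborel. bump c r t * R t) = 0"
    and t: "t \<in> {0..1}"
  shows "R t = (0::real)"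
proof -
  have int: "R c = 0" if c: "c \<in> {0<..<1}" for c
  proof (rule ccontr)
    assume ne: "R c \<noteq> 0"
    define s where "s = sgn (R c)"
    have s: "s * R c = \<bar>R c\<bar>" by (simp add: s_def abs_sgn mult.commute)
    have "isCont R c" using R c by (intro continuous_on_interior[OF R]) auto
    then obtain d where d: "d > 0" "\<And>y. \<bar>y - c\<bar> < d \<Longrightarrow> \<bar>R y - R c\<bar> < \<bar>R c\<bar> / 2"
      using ne unfolding continuous_at_real_range by (metis half_gt_zero real_norm_def zero_less_abs_iff)
    define r where "r = min (d / 2) (min (c / 2) ((1 - c) / 2))"
    have r: "r > 0" "r < d" "0 < c - r" "c + r < 1"
      using d(1) c by (auto simp: r_def min_def field_simps)
    have eq: "indicator {0<..<1} t * (bump c r t * R t) = bump c r t * R t" for t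
      using bump_zero[of r t c] r by (cases "\<bar>t - c\<bar> < r") (auto simp: indicator_def)
    have ib: "integrable lborel (\<lambda>t. bump c r t * R t)"
      by (rule lborel_integral_compact_support[of "c - r" "c + r"])
         (use r in \<open>auto intro!: continuous_on_mult[OF smooth_fun_continuous[OF bump_smooth] continuous_on_subset[OF R]] bump_zero\<close>)
    have "0 < (\<bar>R c\<bar> / 2) * integral\<^sup>L lborel (bump c r)"
      using ne bump_integral_pos[OF r(1)] by simp
    also have "\<dots> = (\<integral>t. bump c r t * (\<bar>R c\<bar> / 2) \<partial>lborel)" by simp
    also have "\<dots> \<le> (\<integral>t. s * (bump c r t * R t) \<partial>lborel)"
    proof (rule integral_mono)
      fix t
      show "bump c r t * (\<bar>R c\<bar> / 2) \<le> s * (bump c r t * R t)"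
      proof (cases "\<bar>t - c\<bar> < r")
        case True
        then have "\<bar>R t - R c\<bar> < \<bar>R c\<bar> / 2" using d(2) r by simp
        then have "\<bar>R c\<bar> / 2 \<le> s * R t" using s ne by (auto simp: s_def sgn_if abs_if split: if_splits)
        from mult_left_mono[OF this bump_nonneg[of c r t]] show ?thesis by (simp add: mult_ac)
      qed (simp add: bump_zero)
    qed (use ib bump_integral_pos[OF r(1)] in auto)
    also have "\<dots> = s * (LINT t:{0<..<1}|lborel. bump c r t * R t)"
      by (simp add: set_lebesgue_integral_def eq)
    also have "\<dots> = 0" using z[of r c] r by simp
    finally show False by simp
  qed
  show ?thesis
    by (rule continuous_constant_on_closure[of "{0<..<1}" R 0]) (use R int t in auto)
qed

lemma bump_mollifier: "mollifier r (c - t) = bump c r t / integral\<^sup>L lborel (bump 0 r)"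
  by (simp add: mollifier_def bump_def algebra_simps)

text \<open>For merely measurable \<open>f\<close> the hypothesis says that every mollification of \<open>f\<close> vanishes at points
whose distance from the ends of the interval exceeds the scale; the mollifications converge to
\<open>f\<close> in the weighted \<open>L^1\<close> norm.\<close>

lemma AE_zero_by_bumps:
  assumes [measurable]: "f \<in> borel_measurable borel" and C: "\<And>t. \<bar>f t\<bar> \<le> C"
    and z: "\<And>c r. 0 < r \<Longrightarrow> 0 < c - r \<Longrightarrow> c + r < 1 \<Longrightarrow>
      (LINT t:{0<..<1}|lborel. bump c r t * f t) = 0"
  shows "AE t in lborel. t \<in> {0<..<1} \<longrightarrow> f t = (0::real)"
proof -
  define g where "g t = indicator {0<..<1} t * f t" for t
  have gm [measurable]: "g \<in> borel_measurable borel" unfolding g_def by measurable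
  have C0: "0 \<le> C" using C[of 0] by linarith
  have gC: "\<bar>g t\<bar> \<le> C" for t using C[of t] C0 by (auto simp: g_def indicator_def)
  have cz: "convolve g (mollifier r) c = 0" if "0 < r" "0 < c - r" "c + r < 1" for c r
  proof -
    have "convolve g (mollifier r) c = (LINT t:{0<..<1}|lborel. bump c r t * f t) / integral\<^sup>L lborel (bump 0 r)"
      by (simp add: convolve_def bump_mollifier g_def set_lebesgue_integral_def mult_ac)
    then show ?thesis using z[OF that] by simp
  qed
  have "AE t in lborel. t \<in> {1 / Suc m<..<1 - 1 / Suc m} \<longrightarrow> g t = 0" for m
  proof -
    define I where "I = {1 / real (Suc m)<..<1 - 1 / Suc m}"
    have Im [measurable]: "I \<in> sets borel" by (simp add: I_def)
    have bi: "integrable lborel (\<lambda>x. weight x * h x)"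
      if "h \<in> borel_measurable borel" "\<And>x. \<bar>h x\<bar> \<le> 2 * C" for h
      by (rule Bochner_Integration.integrable_bound[OF integrable_mult_right[OF weight_integrable, of "2 * C"]])
         (use that C0 weight_pos in \<open>auto simp: abs_mult mult.commute less_imp_le intro!: mult_mono\<close>)
    have i1: "integrable lborel (\<lambda>x. weight x * (indicator I x * \<bar>g x\<bar>))"
    proof (rule bi)
      fix x show "\<bar>indicator I x * \<bar>g x\<bar>\<bar> \<le> 2 * C" using gC[of x] C0 by (auto simp: indicator_def)
    qed measurable
    have nn: "0 \<le> weight x * (indicator I x * \<bar>g x\<bar>)" for x using weight_pos[of x] by (simp add: less_imp_le)
    have le: "(\<integral>x. weight x * (indicator I x * \<bar>g x\<bar>) \<partial>lborel) \<le> (\<integral>x. weight x * \<bar>convolve g (mollifier (1 / Suc n)) x - g x\<bar> \<partial>lborel)"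
      if "n \<ge> m" for n
    proof (rule integral_mono[OF i1])
      define r :: real where "r = 1 / Suc n"
      have r: "0 < r" "r \<le> 1 / Suc m" using that by (auto simp: r_def frac_le)
      show "integrable lborel (\<lambda>x. weight x * \<bar>convolve g (mollifier (1 / Suc n)) x - g x\<bar>)"
      proof (rule bi)
        fix x show "\<bar>\<bar>convolve g (mollifier (1 / Suc n)) x - g x\<bar>\<bar> \<le> 2 * C"
          using convolve_bounded(2)[OF gm r(1) gC, of x] gC[of x] unfolding r_def by linarith
      qed measurable
      fix x
      show "weight x * (indicator I x * \<bar>g x\<bar>) \<le> weight x * \<bar>convolve g (mollifier (1 / Suc n)) x - g x\<bar>"
      proof (cases "x \<in> I")
        case True
        then have "convolve g (mollifier r) x = 0" using r by (intro cz) (auto simp: I_def)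
        then show ?thesis using True weight_pos[of x] by (simp add: r_def)
      qed (use weight_pos[of x] in \<open>simp add: less_imp_le\<close>)
    qed
    have "(\<integral>x. weight x * (indicator I x * \<bar>g x\<bar>) \<partial>lborel) \<le> 0"
      by (rule LIMSEQ_le_const[OF convolve_L1_tendsto[OF gm gC]]) (use le in auto)
    moreover have "0 \<le> (\<integral>x. weight x * (indicator I x * \<bar>g x\<bar>) \<partial>lborel)"
      by (rule integral_nonneg_AE) (simp only: nn eventually_True simp_thms)
    ultimately have "(\<integral>x. weight x * (indicator I x * \<bar>g x\<bar>) \<partial>lborel) = 0"
      by linarith
    then have "AE x in lborel. weight x * (indicator I x * \<bar>g x\<bar>) = 0"
      using integral_nonneg_eq_0_iff_AE[OF i1 AE_I2[OF nn]] by blast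
    then show ?thesis
    proof eventually_elim
      case (elim x) then show ?case using weight_pos[of x] by (auto simp: I_def)
    qed
  qed
  then have "AE t in lborel. \<forall>m. t \<in> {1 / Suc m<..<1 - 1 / Suc m} \<longrightarrow> g t = 0"
    unfolding AE_all_countable by blast
  then show ?thesis
  proof eventually_elim
    case (elim t)
    show ?case
    proof
      assume t: "t \<in> {0<..<1}"
      then have "0 < min t (1 - t)" by simp
      then obtain m where "1 / Suc m < min t (1 - t)" by (rule nat_approx_posE)
      then have "1 / real (Suc m) < t \<and> 1 / real (Suc m) < 1 - t" by (simp only: min_less_iff_conj)
      then have "t \<in> {1 / Suc m<..<1 - 1 / Suc m}" unfolding greaterThanLessThan_iff by linarith
      then have "g t = 0" using elim by blast
      then show "f t = 0" using t by (simp add: g_def)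
    qed
  qed
qed

text \<open>Testing the weak equation in time with primitives of bumps, instead of with bumps, turns it into
an equation integrated in time.\<close>

lemma bump_antideriv:
  assumes "0 < r" "0 < c - r" "c + r < 1"
  obtains \<alpha> where "smooth_fun \<alpha>" "\<And>t. (\<alpha> has_real_derivative bump c r t) (at t)"
    "\<And>t. t \<le> c - r \<Longrightarrow> \<alpha> t = 0" "\<And>t. t \<in> {0..1} \<Longrightarrow> \<alpha> t = (LINT s:{0<..<t}|lborel. bump c r s)"
proof -
  define \<alpha> where "\<alpha> t = integral {0..t} (bump c r)" for t
  have cb: "continuous_on A (bump c r)" for A by (rule smooth_fun_continuous[OF bump_smooth])
  have z: "\<alpha> t = 0" if "t \<le> c - r" for t
    unfolding \<alpha>_def by (subst integral_cong[of _ _ "\<lambda>_. 0"]) (use that in \<open>auto intro!: bump_zero\<close>)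
  have d: "(\<alpha> has_real_derivative bump c r t) (at t)" for t
  proof (cases "t < c - r")
    case True
    have "((\<lambda>_. 0) has_real_derivative bump c r t) (at t)"
      using True by (auto simp: bump_zero)
    then show ?thesis
      by (rule has_field_derivative_transform_within_open[where S="{..<c - r}"]) (use True z in auto)
  next
    case False
    have "(\<alpha> has_real_derivative bump c r t) (at t within {0..t + 1})"
      unfolding \<alpha>_def using False assms by (intro integral_has_real_derivative cb) auto
    moreover have "at t within {0..t + 1} = at t"
      by (rule at_within_interior) (use False assms in auto)
    ultimately show ?thesis by simp
  qed
  have e: "\<alpha> t = (LINT s:{0<..<t}|lborel. bump c r s)" if "t \<in> {0..1}" for t
  proof -
    have "set_integrable lborel {0..t} (bump c r)" by (rule borel_integrable_atLeastAtMost'[OF cb])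
    then have "set_integrable lborel {0<..<t} (bump c r)" by (rule set_integrable_subset) auto
    then show ?thesis
      by (simp add: set_borel_integral_eq_integral(2) \<alpha>_def integral_open_interval_real)
  qed
  show ?thesis by (rule that[OF smooth_fun_antideriv[OF bump_smooth d] d z e])
qed

lemma tail_integral_continuous:
  fixes G :: "real \<Rightarrow> real"
  assumes [measurable]: "G \<in> borel_measurable borel" and C: "\<And>t. \<bar>G t\<bar> \<le> C"
  shows "continuous_on {0..1} (\<lambda>t. LINT s:{t<..<1}|lborel. G s)"
proof -
  have i: "set_integrable lborel {0..1::real} G"
    unfolding set_integrable_def
  proof (rule Bochner_Integration.integrable_bound[where f="\<lambda>x. C * indicator {0..1::real} x :: real"])
    show "integrable lborel (\<lambda>x. C * indicator {0..1::real} x :: real)"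
      by (intro integrable_mult_right) auto
    show "AE x in lborel. norm (indicator {0..1} x *\<^sub>R G x) \<le> norm (C * indicator {0..1::real} x :: real)"
      by (auto simp: indicator_def intro!: AE_I2 order_trans[OF C])
  qed measurable
  have "continuous_on {0..1} (\<lambda>t. integral {t..1} G)"
    by (rule indefinite_integral_continuous_1') (use set_borel_integral_eq_integral(1)[OF i] in simp)
  moreover have "integral {t..1} G = (LINT s:{t<..<1}|lborel. G s)" if "t \<in> {0..1}" for t
  proof -
    have "set_integrable lborel {t<..<1} G"
      by (rule set_integrable_subset[OF i]) (use that in auto)
    then show ?thesis
      by (simp add: set_borel_integral_eq_integral(2) integral_open_interval_real)
  qed
  ultimately show ?thesis by (rule continuous_on_eq)
qed

text \<open>The chain rule for the square of a primitive of a merely bounded function: the square of an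
integral is a double integral over a square, twice the integral over the triangle below the
diagonal.\<close>

lemma square_tail_integral:
  fixes g :: "real \<Rightarrow> real"
  assumes [measurable]: "g \<in> borel_measurable borel" and C: "\<And>t. \<bar>g t\<bar> \<le> C" and t: "t \<in> {0..1}"
  defines "f \<equiv> \<lambda>t. LINT s:{t<..<1}|lborel. g s"
  shows "(f t)\<^sup>2 = 2 * (LINT s:{t<..<1}|lborel. f s * g s)"
proof -
  define h where "h s = indicator {t<..<1} s * g s" for s
  have hm [measurable]: "h \<in> borel_measurable borel" unfolding h_def by measurable
  have C0: "0 \<le> C" using C[of 0] by linarith
  have hb: "\<bar>h s\<bar> \<le> C * indicator {0..1} s" for s using C[of s] t by (auto simp: h_def indicator_def)
  have hi: "integrable lborel h"
    by (rule Bochner_Integration.integrable_bound[where f="\<lambda>x. C * indicator {0..1::real} x"])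
       (use C0 in \<open>auto intro!: AE_I2 order_trans[OF hb] integrable_mult_right\<close>)
  have hi2: "integrable lborel (\<lambda>r. of_bool (P r) * h r)" if [measurable]: "Measurable.pred borel P" for P
    by (rule Bochner_Integration.integrable_bound[OF hi]) (auto intro!: AE_I2)
  have ft: "f t = (\<integral>s. h s \<partial>lborel)"
    by (simp add: f_def h_def set_lebesgue_integral_def)
  have fs: "h s * (\<integral>r. of_bool (s < r) * h r \<partial>lborel) = indicator {t<..<1} s * (f s * g s)" for s
  proof (cases "s \<in> {t<..<1}")
    case True
    then have "of_bool (s < r) * h r = indicator {s<..<1} r * g r" for r
      by (auto simp: h_def indicator_def)
    then have "(\<integral>r. of_bool (s < r) * h r \<partial>lborel) = f s"
      by (simp only: f_def set_lebesgue_integral_def real_scaleR_def)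
    then show ?thesis using True by (simp add: h_def)
  qed (simp add: h_def)
  have sw: "(\<integral>r. h r * (\<integral>s. of_bool (s < r) * h s \<partial>lborel) \<partial>lborel) = (\<integral>s. h s * (\<integral>r. of_bool (s < r) * h r \<partial>lborel) \<partial>lborel)"
  proof -
    have "(\<integral>r. \<integral>s. (case (s, r) of (s, r) \<Rightarrow> h r * (of_bool (s < r) * h s)) \<partial>lborel \<partial>lborel)
        = (\<integral>s. \<integral>r. (case (s, r) of (s, r) \<Rightarrow> h r * (of_bool (s < r) * h s)) \<partial>lborel \<partial>lborel)"
    proof (rule square_swap[where C="C * C"])
      fix s r
      have "\<bar>h r\<bar> * \<bar>h s\<bar> \<le> (C * indicator {0..1} r) * (C * indicator {0..1} s)"
        using C0 by (intro mult_mono hb) auto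
      then show "\<bar>case (s, r) of (s, r) \<Rightarrow> h r * (of_bool (s < r) * h s)\<bar> \<le> C * C * indicator {0..1} s * indicator {0..1} r"
        by (cases "s < r") (auto simp: abs_mult mult_ac C0)
    qed measurable
    moreover have "(\<integral>r. h r * (of_bool (s < r) * h s) \<partial>lborel) = h s * (\<integral>r. of_bool (s < r) * h r \<partial>lborel)" for s
    proof -
      have "(\<integral>r. h r * (of_bool (s < r) * h s) \<partial>lborel) = (\<integral>r. h s * (of_bool (s < r) * h r) \<partial>lborel)"
        by (rule Bochner_Integration.integral_cong) auto
      then show ?thesis by simp
    qed
    ultimately show ?thesis by simp
  qed
  have "(f t)\<^sup>2 = (\<integral>s. h s * (\<integral>r. h r \<partial>lborel) \<partial>lborel)"
    by (simp add: ft power2_eq_square)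
  also have "\<dots> = (\<integral>s. h s * (\<integral>r. of_bool (s < r) * h r \<partial>lborel) + h s * (\<integral>r. of_bool (r < s) * h r \<partial>lborel) \<partial>lborel)"
  proof (rule Bochner_Integration.integral_cong[OF refl])
    fix s
    have "(\<integral>r. h r \<partial>lborel) = (\<integral>r. of_bool (s < r) * h r + of_bool (r < s) * h r \<partial>lborel)"
    proof (rule integral_cong_AE)
      show "AE r in lborel. h r = of_bool (s < r) * h r + of_bool (r < s) * h r"
        using AE_lborel_singleton[of s] by eventually_elim auto
    qed measurable
    also have "\<dots> = (\<integral>r. of_bool (s < r) * h r \<partial>lborel) + (\<integral>r. of_bool (r < s) * h r \<partial>lborel)"
      by (intro Bochner_Integration.integral_add hi2) measurable
    finally show "h s * (\<integral>r. h r \<partial>lborel) = h s * (\<integral>r. of_bool (s < r) * h r \<partial>lborel) + h s * (\<integral>r. of_bool (r < s) * h r \<partial>lborel)"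
      by (simp add: distrib_left)
  qed
  also have "\<dots> = (\<integral>s. h s * (\<integral>r. of_bool (s < r) * h r \<partial>lborel) \<partial>lborel) + (\<integral>s. h s * (\<integral>r. of_bool (r < s) * h r \<partial>lborel) \<partial>lborel)"
  proof (rule Bochner_Integration.integral_add)
    have b: "\<bar>\<integral>r. of_bool (P r) * h r \<partial>lborel\<bar> \<le> (\<integral>r. \<bar>h r\<bar> \<partial>lborel)" if [measurable]: "Measurable.pred borel P" for P
      by (rule integral_abs_bound_integral[OF hi2 integrable_abs[OF hi]]) auto
    show "integrable lborel (\<lambda>s. h s * (\<integral>r. of_bool (s < r) * h r \<partial>lborel))"
      by (rule Bochner_Integration.integrable_bound[OF integrable_mult_left[OF hi, of "\<integral>r. \<bar>h r\<bar> \<partial>lborel"]])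
         (auto simp: abs_mult intro!: AE_I2 mult_left_mono order_trans[OF b])
    show "integrable lborel (\<lambda>s. h s * (\<integral>r. of_bool (r < s) * h r \<partial>lborel))"
      by (rule Bochner_Integration.integrable_bound[OF integrable_mult_left[OF hi, of "\<integral>r. \<bar>h r\<bar> \<partial>lborel"]])
         (auto simp: abs_mult intro!: AE_I2 mult_left_mono order_trans[OF b])
  qed
  also have "\<dots> = 2 * (\<integral>s. h s * (\<integral>r. of_bool (s < r) * h r \<partial>lborel) \<partial>lborel)" using sw by simp
  finally show ?thesis unfolding fs by (simp add: set_lebesgue_integral_def)
qed

section \<open>Weak equations for the difference of two solutions\<close>

lemma bounded_on_unit:
  fixes f :: "real \<Rightarrow> real"
  assumes "continuous_on {0..1} f"
  shows "\<exists>B. \<forall>t\<in>{0..1}. \<bar>f t\<bar> \<le> B"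
proof -
  have "bounded (f ` {0..1})" by (intro compact_imp_bounded compact_continuous_image assms) auto
  then show ?thesis unfolding bounded_iff by auto
qed

lemma one_plus_abs_square: "(2 + \<bar>x\<bar>)\<^sup>2 * weight x \<le> 8"
proof -
  have "4 * \<bar>x\<bar> \<le> x\<^sup>2 + 4"
    using zero_le_power2[of "2 - \<bar>x\<bar>"] by (simp add: power2_eq_square algebra_simps)
  moreover have "(2 + \<bar>x\<bar>)\<^sup>2 = 4 + 4 * \<bar>x\<bar> + x\<^sup>2"
    by (simp add: power2_eq_square algebra_simps)
  ultimately have "(2 + \<bar>x\<bar>)\<^sup>2 \<le> 8 + 2 * x\<^sup>2" by simp
  also have "\<dots> \<le> 8 * (1 + x\<^sup>2)" by simp
  finally have "(2 + \<bar>x\<bar>)\<^sup>2 \<le> 8 * (1 + x\<^sup>2)" .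
  then show ?thesis
    using one_plus_square_pos[of x] unfolding weight_def by (simp add: divide_le_eq del: distrib_left_numeral)
qed

lemma weight_deriv: "(weight has_real_derivative - 2 * x * (weight x)\<^sup>2) (at x)"
  unfolding weight_def using one_plus_square_pos[of x]
  by (auto intro!: derivative_eq_intros simp: power2_eq_square)

text \<open>The derivative of the weight is dominated by the weight itself; this keeps the commutator terms
of the energy estimate under control.\<close>

lemma weight_deriv_bound: "\<bar>2 * x * (weight x)\<^sup>2\<bar> \<le> weight x"
proof -
  have "2 * \<bar>x\<bar> \<le> 1 + x\<^sup>2"
    using zero_le_power2[of "1 - \<bar>x\<bar>"] by (simp add: power2_eq_square algebra_simps)
  then have "2 * \<bar>x\<bar> * weight x \<le> 1"
    using one_plus_square_pos[of x] by (simp add: weight_def divide_le_eq)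
  from mult_right_mono[OF this less_imp_le[OF weight_pos[of x]]] weight_pos[of x]
  show ?thesis by (simp add: abs_mult power2_eq_square mult_ac)
qed

lemma integral_deriv_zero:
  fixes G G' :: "real \<Rightarrow> real"
  assumes G: "\<And>x. (G has_real_derivative G' x) (at x)" and c: "continuous_on UNIV G'"
    and i: "integrable lborel G'" and l: "(G \<longlongrightarrow> 0) at_top" "(G \<longlongrightarrow> 0) at_bot"
  shows "integral\<^sup>L lborel G' = 0"
proof -
  have "(LBINT x=-\<infinity>..\<infinity>. G' x) = 0 - 0"
  proof (rule interval_integral_FTC_integrable)
    show "(G has_vector_derivative G' x) (at x)" for x
      using G by (simp add: has_real_derivative_iff_has_vector_derivative)
    show "isCont G' x" for x using c by (simp add: continuous_on_eq_continuous_at)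
    show "set_integrable lborel (einterval (-\<infinity>) \<infinity>) G'"
      using i by (simp add: set_integrable_def einterval_def)
    show "((G \<circ> real_of_ereal) \<longlongrightarrow> 0) (at_right (-\<infinity>))" "((G \<circ> real_of_ereal) \<longlongrightarrow> 0) (at_left \<infinity>)"
      using l by (simp_all add: ereal_tendsto_simps)
  qed auto
  then show ?thesis by (simp add: interval_integral_to_infinity_eq set_lebesgue_integral_def interval_lebesgue_integral_def einterval_def)
qed

lemma weight_tendsto: "(weight \<longlongrightarrow> 0) at_top" "(weight \<longlongrightarrow> 0) at_bot"
  unfolding weight_def by real_asymp+

text \<open>Integration by parts for \<open>weight^2 * F * F'\<close>. The weight decays like \<open>x^(-4)\<close>, the functions
\<open>F\<close> and \<open>F''\<close> grow at most linearly and \<open>F'\<close> is bounded, so that all integrands are integrable and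
the boundary terms vanish.\<close>

lemma weighted_by_parts:
  fixes F F' F'' :: "real \<Rightarrow> real"
  assumes d1: "\<And>x. (F has_real_derivative F' x) (at x)" and d2: "\<And>x. (F' has_real_derivative F'' x) (at x)"
    and c: "continuous_on UNIV F''"
    and b: "\<And>x. \<bar>F x\<bar> \<le> M * (2 + \<bar>x\<bar>)" "\<And>x. \<bar>F' x\<bar> \<le> C" "\<And>x. \<bar>F'' x\<bar> \<le> K * (2 + \<bar>x\<bar>)"
  shows "integrable lborel (\<lambda>x. (weight x)\<^sup>2 * F x * F'' x)"
    and "integrable lborel (\<lambda>x. (weight x)\<^sup>2 * (F' x)\<^sup>2)"
    and "integrable lborel (\<lambda>x. weight x * (2 * x * (weight x)\<^sup>2) * F x * F' x)"
    and "(\<integral>x. (weight x)\<^sup>2 * F x * F'' x \<partial>lborel) =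
      - (\<integral>x. (weight x)\<^sup>2 * (F' x)\<^sup>2 \<partial>lborel) + 2 * (\<integral>x. weight x * (2 * x * (weight x)\<^sup>2) * F x * F' x \<partial>lborel)"
proof -
  have cF: "continuous_on A F" "continuous_on A F'" "continuous_on A F''" for A
    using d1 d2 DERIV_isCont by (blast intro: continuous_at_imp_continuous_on continuous_on_subset[OF c])+
  have [measurable]: "F \<in> borel_measurable borel" "F' \<in> borel_measurable borel" "F'' \<in> borel_measurable borel"
    by (intro borel_measurable_continuous_onI cF)+
  have M0: "0 \<le> M" "0 \<le> K" "0 \<le> C" using b(1)[of 0] b(3)[of 0] b(2)[of 0] by auto
  have le: "(2 + \<bar>x\<bar>) \<le> (2 + \<bar>x\<bar>)\<^sup>2" for x :: real by (simp add: power2_eq_square algebra_simps)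
  have t1: "\<bar>(weight x)\<^sup>2 * F x * F'' x\<bar> \<le> (8 * M * K) * weight x" for x
  proof -
    have "\<bar>F x\<bar> * \<bar>F'' x\<bar> \<le> (M * (2 + \<bar>x\<bar>)) * (K * (2 + \<bar>x\<bar>))"
      using b M0 by (intro mult_mono) auto
    then have "weight x * (weight x * (\<bar>F x\<bar> * \<bar>F'' x\<bar>)) \<le> weight x * (weight x * ((M * (2 + \<bar>x\<bar>)) * (K * (2 + \<bar>x\<bar>))))"
      using weight_pos[of x] by (intro mult_left_mono) (auto simp: less_imp_le)
    also have "\<dots> = (weight x * M * K) * ((2 + \<bar>x\<bar>)\<^sup>2 * weight x)" by (simp add: power2_eq_square)
    also have "\<dots> \<le> (weight x * M * K) * 8"
      using M0 weight_pos[of x] by (intro mult_left_mono one_plus_abs_square) (auto simp: less_imp_le)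
    finally show ?thesis using weight_pos[of x] by (simp add: abs_mult power2_eq_square mult_ac)
  qed
  have t2: "\<bar>(weight x)\<^sup>2 * (F' x)\<^sup>2\<bar> \<le> C\<^sup>2 * weight x" for x
  proof -
    have "(F' x)\<^sup>2 \<le> C\<^sup>2" using b(2)[of x] by (rule abs_le_square_iff[THEN iffD1, OF order_trans]) (simp add: M0)
    moreover have "(weight x)\<^sup>2 \<le> weight x" using weight_pos[of x] weight_le_1[of x] by (simp add: power2_eq_square mult_left_le)
    ultimately have "(weight x)\<^sup>2 * (F' x)\<^sup>2 \<le> weight x * C\<^sup>2" using weight_pos[of x] by (intro mult_mono) auto
    then show ?thesis by (simp add: mult.commute)
  qed
  have t3: "\<bar>weight x * (2 * x * (weight x)\<^sup>2) * F x * F' x\<bar> \<le> (8 * M * C) * weight x" for x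
  proof -
    have "\<bar>F x\<bar> * \<bar>F' x\<bar> \<le> (M * (2 + \<bar>x\<bar>)\<^sup>2) * C"
      using b[of x] M0 by (intro mult_mono order_trans[OF b(1)] mult_left_mono le) auto
    then have "(weight x * \<bar>2 * x * (weight x)\<^sup>2\<bar>) * (\<bar>F x\<bar> * \<bar>F' x\<bar>) \<le> (weight x * weight x) * ((M * (2 + \<bar>x\<bar>)\<^sup>2) * C)"
      by (rule mult_mono[OF mult_left_mono[OF weight_deriv_bound less_imp_le[OF weight_pos]]])
         (use weight_pos[of x] in \<open>auto simp: less_imp_le\<close>)
    also have "\<dots> = (weight x * M * C) * ((2 + \<bar>x\<bar>)\<^sup>2 * weight x)" by simp
    also have "\<dots> \<le> (weight x * M * C) * 8"
      using M0 weight_pos[of x] by (intro mult_left_mono one_plus_abs_square) (auto simp: less_imp_le)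
    finally show ?thesis using weight_pos[of x] by (simp add: abs_mult mult_ac)
  qed
  have ib: "integrable lborel g" if [measurable]: "g \<in> borel_measurable borel" and "\<And>x. \<bar>g x\<bar> \<le> D * weight x" for g D
    by (rule Bochner_Integration.integrable_bound[OF integrable_mult_right[OF weight_integrable, of D]])
       (auto intro!: AE_I2 order_trans[OF that(2)])
  show i1: "integrable lborel (\<lambda>x. (weight x)\<^sup>2 * F x * F'' x)" by (rule ib[OF _ t1]) measurable
  show i2: "integrable lborel (\<lambda>x. (weight x)\<^sup>2 * (F' x)\<^sup>2)" by (rule ib[OF _ t2]) measurable
  show i3: "integrable lborel (\<lambda>x. weight x * (2 * x * (weight x)\<^sup>2) * F x * F' x)" by (rule ib[OF _ t3]) measurable
  define G where "G x = (weight x)\<^sup>2 * F x * F' x" for x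
  define G' where "G' x = (weight x)\<^sup>2 * F x * F'' x + (weight x)\<^sup>2 * (F' x)\<^sup>2 - 2 * (weight x * (2 * x * (weight x)\<^sup>2) * F x * F' x)" for x
  have Gb: "\<bar>G x\<bar> \<le> (8 * M * C) * weight x" for x
  proof -
    have "\<bar>F x\<bar> * \<bar>F' x\<bar> \<le> (M * (2 + \<bar>x\<bar>)\<^sup>2) * C"
      using b[of x] M0 by (intro mult_mono order_trans[OF b(1)] mult_left_mono le) auto
    then have "(weight x * weight x) * (\<bar>F x\<bar> * \<bar>F' x\<bar>) \<le> (weight x * weight x) * ((M * (2 + \<bar>x\<bar>)\<^sup>2) * C)"
      using weight_pos[of x] by (intro mult_left_mono) auto
    also have "\<dots> = (weight x * M * C) * ((2 + \<bar>x\<bar>)\<^sup>2 * weight x)" by simp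
    also have "\<dots> \<le> (weight x * M * C) * 8"
      using M0 weight_pos[of x] by (intro mult_left_mono one_plus_abs_square) (auto simp: less_imp_le)
    finally show ?thesis using weight_pos[of x] by (simp add: G_def abs_mult power2_eq_square mult_ac)
  qed
  have "integral\<^sup>L lborel G' = 0"
  proof (rule integral_deriv_zero[of G])
    show "(G has_real_derivative G' x) (at x)" for x
      unfolding G_def G'_def
      by (rule derivative_eq_intros weight_deriv d1 d2 refl)+ (simp add: power2_eq_square algebra_simps)
    show "continuous_on UNIV G'"
      unfolding G'_def by (intro continuous_intros cF weight_continuous)
    show "integrable lborel G'" unfolding G'_def
      by (intro Bochner_Integration.integrable_diff Bochner_Integration.integrable_add integrable_mult_right i1 i2 i3)
    show "(G \<longlongrightarrow> 0) at_top"
      by (rule Lim_null_comparison[OF _ tendsto_mult_right_zero[OF weight_tendsto(1)], of _ "8 * M * C"]) (simp add: Gb)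
    show "(G \<longlongrightarrow> 0) at_bot"
      by (rule Lim_null_comparison[OF _ tendsto_mult_right_zero[OF weight_tendsto(2)], of _ "8 * M * C"]) (simp add: Gb)
  qed
  then show "(\<integral>x. (weight x)\<^sup>2 * F x * F'' x \<partial>lborel) =
      - (\<integral>x. (weight x)\<^sup>2 * (F' x)\<^sup>2 \<partial>lborel) + 2 * (\<integral>x. weight x * (2 * x * (weight x)\<^sup>2) * F x * F' x \<partial>lborel)"
    using Bochner_Integration.integral_diff[OF Bochner_Integration.integrable_add[OF i1 i2] integrable_mult_right[OF i3, of 2]]
      Bochner_Integration.integral_add[OF i1 i2] integral_mult_right_zero[of lborel 2 "\<lambda>x. weight x * (2 * x * (weight x)\<^sup>2) * F x * F' x"]
    unfolding G'_def by linarith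
qed

lemma convolve_linear_bound:
  assumes F: "continuous_on UNIV F" and k: "continuous_on UNIV k" "\<And>x. 1 < \<bar>x\<bar> \<Longrightarrow> k x = 0"
    and b: "\<And>y. \<bar>F y\<bar> \<le> M * (1 + \<bar>y\<bar>)"
  shows "\<bar>convolve F k x\<bar> \<le> (M * (\<integral>y. \<bar>k y\<bar> \<partial>lborel)) * (2 + \<bar>x\<bar>)"
proof -
  have M0: "0 \<le> M" using b[of 0] by simp
  have i: "integrable lborel (\<lambda>y. F (x - y) * k y)"
    by (rule lborel_integral_compact_support[of "-1" 1])
       (auto intro!: continuous_intros continuous_on_compose2[OF F] continuous_on_subset[OF k(1)] k(2))
  have i2: "integrable lborel (\<lambda>y. \<bar>k y\<bar>)"
    by (rule lborel_integral_compact_support[of "-1" 1])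
       (auto intro!: continuous_intros continuous_on_subset[OF k(1)] k(2))
  have "\<bar>convolve F k x\<bar> \<le> (\<integral>y. (M * (2 + \<bar>x\<bar>)) * \<bar>k y\<bar> \<partial>lborel)"
    unfolding convolve_flip
  proof (rule integral_abs_bound_integral[OF i integrable_mult_right[OF i2]])
    fix y
    show "\<bar>F (x - y) * k y\<bar> \<le> (M * (2 + \<bar>x\<bar>)) * \<bar>k y\<bar>"
    proof (cases "1 < \<bar>y\<bar>")
      case False
      have "\<bar>F (x - y)\<bar> \<le> M * (1 + \<bar>x - y\<bar>)" by (rule b)
      also have "\<dots> \<le> M * (2 + \<bar>x\<bar>)" using False M0 by (intro mult_left_mono) auto
      finally show ?thesis by (simp add: abs_mult mult_right_mono)
    qed (simp add: k(2))
  qed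
  then show ?thesis by (simp add: mult_ac)
qed

text \<open>The situation of the difference \<open>w\<close> of two weak solutions: \<open>z\<close> is its weak \<open>x\<close>-derivative and
\<open>c * z\<close> the difference of the quadratic terms. The weak equations are only assumed for products
\<open>\<alpha> t * b x\<close> of test functions. In \<open>weak_t\<close> the function \<open>\<alpha>\<close> need not vanish near \<open>t = 1\<close>, and
no boundary term appears: this encodes the terminal value \<open>w(1, x) = 0\<close>.\<close>

locale weak_difference =
  fixes w z c :: "real \<times> real \<Rightarrow> real" and a :: "real \<Rightarrow> real" and Cz Cc A :: real
  assumes w_cont: "continuous_on ({0..1} \<times> UNIV) w"
    and w_meas [measurable]: "w \<in> borel_measurable (borel \<Otimes>\<^sub>M borel)"
    and z_meas [measurable]: "z \<in> borel_measurable (borel \<Otimes>\<^sub>M borel)"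
    and c_meas [measurable]: "c \<in> borel_measurable (borel \<Otimes>\<^sub>M borel)"
    and z_bound: "\<And>p. \<bar>z p\<bar> \<le> Cz" and c_bound: "\<And>p. \<bar>c p\<bar> \<le> Cc"
    and a_meas [measurable]: "a \<in> borel_measurable borel" and a_nonneg: "\<And>t. 0 \<le> a t" and a_bound: "\<And>t. a t \<le> A"
    and weak_x: "\<And>\<psi> b R. smooth_fun \<psi> \<Longrightarrow> (\<exists>l u. 0 < l \<and> u < 1 \<and> (\<forall>t. t \<notin> {l..u} \<longrightarrow> \<psi> t = 0)) \<Longrightarrow>
        smooth_fun b \<Longrightarrow> (\<And>x. R < \<bar>x\<bar> \<Longrightarrow> b x = 0) \<Longrightarrow>
        (LINT t:{0<..<1}|lborel. \<psi> t * ((\<integral>x. w (t, x) * deriv b x \<partial>lborel) + (\<integral>x. z (t, x) * b x \<partial>lborel))) = 0"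
    and weak_t: "\<And>\<alpha> b R. smooth_fun \<alpha> \<Longrightarrow> (\<exists>l>0. \<forall>t\<le>l. \<alpha> t = 0) \<Longrightarrow>
        smooth_fun b \<Longrightarrow> (\<And>x. R < \<bar>x\<bar> \<Longrightarrow> b x = 0) \<Longrightarrow>
        (LINT t:{0<..<1}|lborel. - deriv \<alpha> t * (\<integral>x. w (t, x) * b x \<partial>lborel) + \<alpha> t * (a t *
          ((\<integral>x. w (t, x) * deriv (deriv b) x \<partial>lborel) + (\<integral>x. c (t, x) * z (t, x) * b x \<partial>lborel)))) = 0"
begin

lemma w_slice: "t \<in> {0..1} \<Longrightarrow> continuous_on S (\<lambda>x. w (t, x))"
  by (intro continuous_on_compose2[OF w_cont] continuous_intros) auto

lemma slice_meas [measurable]: "(\<lambda>x. w (t, x)) \<in> borel_measurable borel"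
  "(\<lambda>x. z (t, x)) \<in> borel_measurable borel" "(\<lambda>x. c (t, x)) \<in> borel_measurable borel"
  by measurable

lemma W_integral:
  assumes "t \<in> {0..1}" "continuous_on UNIV b" "\<And>x. R < \<bar>x\<bar> \<Longrightarrow> b x = 0"
  shows "(\<integral>x. w (t, x) * b x \<partial>lborel) = integral {-R..R} (\<lambda>x. w (t, x) * b x)"
    "integrable lborel (\<lambda>x. w (t, x) * b x)"
proof -
  have "b x = 0" if "x \<notin> {-R..R}" for x using assms(3)[of x] that by auto
  then show "(\<integral>x. w (t, x) * b x \<partial>lborel) = integral {-R..R} (\<lambda>x. w (t, x) * b x)"
    "integrable lborel (\<lambda>x. w (t, x) * b x)"
    by (auto intro!: lborel_integral_compact_support[of "-R" R] continuous_on_mult w_slice assms(1) continuous_on_subset[OF assms(2)])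
qed

lemma W_cont:
  assumes "continuous_on UNIV b" "\<And>x. R < \<bar>x\<bar> \<Longrightarrow> b x = 0"
  shows "continuous_on {0..1} (\<lambda>t. \<integral>x. w (t, x) * b x \<partial>lborel)"
proof -
  have "continuous_on ({0..1} \<times> cbox (-R) R) (\<lambda>(t, x). w (t, x) * b x)"
    unfolding case_prod_beta
    by (intro continuous_on_mult continuous_on_compose2[OF w_cont] continuous_on_compose2[OF assms(1)] continuous_intros) auto
  then have "continuous_on {0..1} (\<lambda>t. integral (cbox (-R) R) (\<lambda>x. w (t, x) * b x))"
    by (rule integral_continuous_on_param)
  then show ?thesis
    by (rule continuous_on_eq) (use W_integral(1)[OF _ assms] in auto)
qed

lemma W_bounded:
  assumes "continuous_on UNIV b" "\<And>x. R < \<bar>x\<bar> \<Longrightarrow> b x = 0"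
  obtains B where "\<And>t. t \<in> {0..1} \<Longrightarrow> \<bar>\<integral>x. w (t, x) * b x \<partial>lborel\<bar> \<le> B"
proof -
  have "\<exists>B. \<forall>t\<in>{0..1}. \<bar>\<integral>x. w (t, x) * b x \<partial>lborel\<bar> \<le> B"
    by (rule bounded_on_unit[OF W_cont[of b R, OF assms]])
  then show ?thesis using that by blast
qed

lemma bounded_slice:
  fixes f :: "real \<times> real \<Rightarrow> real"
  assumes [measurable]: "f \<in> borel_measurable (borel \<Otimes>\<^sub>M borel)" and f: "\<And>p. \<bar>f p\<bar> \<le> C"
    and b: "continuous_on UNIV b" "\<And>x. R < \<bar>x\<bar> \<Longrightarrow> b x = 0"
  shows "\<bar>\<integral>x. f (t, x) * b x \<partial>lborel\<bar> \<le> C * (\<integral>x. \<bar>b x\<bar> \<partial>lborel)"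
proof -
  have [measurable]: "b \<in> borel_measurable borel" by (rule borel_measurable_continuous_onI[OF b(1)])
  have i: "integrable lborel (\<lambda>x. \<bar>b x\<bar>)"
    by (rule lborel_integral_compact_support[of "-R" R]) (use b(2) in \<open>auto intro!: continuous_intros continuous_on_subset[OF b(1)]\<close>)
  have C0: "0 \<le> C" using f[of undefined] by linarith
  have le: "\<bar>f (t, x) * b x\<bar> \<le> C * \<bar>b x\<bar>" for x using f by (simp add: abs_mult mult_right_mono)
  have i2: "integrable lborel (\<lambda>x. f (t, x) * b x)"
    by (rule Bochner_Integration.integrable_bound[OF integrable_mult_right[OF i, of C]])
       (auto intro!: AE_I2 order_trans[OF le] simp: C0)
  have "\<bar>\<integral>x. f (t, x) * b x \<partial>lborel\<bar> \<le> (\<integral>x. C * \<bar>b x\<bar> \<partial>lborel)"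
    by (rule integral_abs_bound_integral[OF i2 integrable_mult_right[OF i] le])
  then show ?thesis by simp
qed

lemma cz_bound: "\<bar>c p * z p\<bar> \<le> Cc * Cz"
  using c_bound[of p] z_bound[of p] by (simp add: abs_mult mult_mono)

text \<open>The exceptional set of times depends on \<open>b\<close>; later this is harmless because \<open>b\<close> is a translate
of a mollifier and Fubini exchanges the roles of \<open>t\<close> and \<open>x\<close>.\<close>

lemma weak_x_ae:
  assumes b: "smooth_fun b" "\<And>x. R < \<bar>x\<bar> \<Longrightarrow> b x = 0"
  shows "AE t in lborel. t \<in> {0<..<1} \<longrightarrow> (\<integral>x. w (t, x) * deriv b x \<partial>lborel) = - (\<integral>x. z (t, x) * b x \<partial>lborel)"
proof -
  note cb = smooth_fun_continuous[OF b(1)] and cb' = smooth_fun_continuous[OF smooth_fun_deriv(2)[OF b(1)]]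
  have z': "\<And>x. R < \<bar>x\<bar> \<Longrightarrow> deriv b x = 0" by (rule deriv_zero_outside[of R]) (use b(2) in auto)
  have [measurable]: "b \<in> borel_measurable borel" "deriv b \<in> borel_measurable borel"
    by (intro borel_measurable_continuous_onI cb cb')+
  define f where "f t = indicator {0..1} t * ((\<integral>x. w (t, x) * deriv b x \<partial>lborel) + (\<integral>x. z (t, x) * b x \<partial>lborel))" for t :: real
  obtain B where B: "\<And>t. t \<in> {0..1} \<Longrightarrow> \<bar>\<integral>x. w (t, x) * deriv b x \<partial>lborel\<bar> \<le> B"
    using W_bounded[OF cb' z'] by blast
  have zb: "\<bar>\<integral>x. z (t, x) * b x \<partial>lborel\<bar> \<le> Cz * (\<integral>x. \<bar>b x\<bar> \<partial>lborel)" for t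
    by (rule bounded_slice[OF z_meas z_bound cb b(2)])
  have "AE t in lborel. t \<in> {0<..<1} \<longrightarrow> f t = 0"
  proof (rule AE_zero_by_bumps)
    show "f \<in> borel_measurable borel" unfolding f_def by measurable
    fix t show "\<bar>f t\<bar> \<le> B + Cz * (\<integral>x. \<bar>b x\<bar> \<partial>lborel)"
    proof (cases "t \<in> {0..1}")
      case True
      have "\<bar>f t\<bar> = \<bar>(\<integral>x. w (t, x) * deriv b x \<partial>lborel) + (\<integral>x. z (t, x) * b x \<partial>lborel)\<bar>"
        using True by (simp add: f_def)
      then show ?thesis using B[OF True] zb[of t] by linarith
    next
      case False
      then have "f t = 0" by (simp add: f_def)
      moreover have "0 \<le> B" using B[of 0] by simp
      ultimately show ?thesis using zb[of 0] by simp
    qed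
  next
    fix c' r :: real assume r: "0 < r" "0 < c' - r" "c' + r < 1"
    have "(LINT t:{0<..<1}|lborel. bump c' r t * f t) =
      (LINT t:{0<..<1}|lborel. bump c' r t * ((\<integral>x. w (t, x) * deriv b x \<partial>lborel) + (\<integral>x. z (t, x) * b x \<partial>lborel)))"
      by (rule set_lebesgue_integral_cong) (auto simp: f_def)
    also have "\<dots> = 0"
      by (rule weak_x[OF bump_smooth _ b], rule exI[of _ "c' - r"], rule exI[of _ "c' + r"])
         (use r in \<open>auto intro!: bump_zero\<close>)
    finally show "(LINT t:{0<..<1}|lborel. bump c' r t * f t) = 0" .
  qed
  then show ?thesis by eventually_elim (auto simp: f_def)
qed

text \<open>The weak equation in time says that the time derivative of the left hand side is minus the
integrand on the right, with value \<open>0\<close> at time \<open>1\<close>. Tested with primitives \<open>\<alpha>\<close> of bumps \<open>\<psi>\<close>, and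
after exchanging the integrals over the triangle \<open>t < s\<close>, it says that all bumps see the two sides
as equal; both are continuous in \<open>t\<close>.\<close>

lemma weak_t_integrated:
  assumes b: "smooth_fun b" "\<And>x. R < \<bar>x\<bar> \<Longrightarrow> b x = 0" and t: "t \<in> {0..1}"
  shows "(\<integral>x. w (t, x) * b x \<partial>lborel) = (LINT s:{t<..<1}|lborel. a s *
          ((\<integral>x. w (s, x) * deriv (deriv b) x \<partial>lborel) + (\<integral>x. c (s, x) * z (s, x) * b x \<partial>lborel)))"
proof -
  note cb = smooth_fun_continuous[OF b(1)]
    and cb'' = smooth_fun_continuous[OF smooth_fun_deriv(2)[OF smooth_fun_deriv(2)[OF b(1)]]]
  have z': "\<And>x. R < \<bar>x\<bar> \<Longrightarrow> deriv b x = 0" by (rule deriv_zero_outside[of R]) (use b(2) in auto)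
  have z'': "\<And>x. R < \<bar>x\<bar> \<Longrightarrow> deriv (deriv b) x = 0" by (rule deriv_zero_outside[of R]) (use z' in auto)
  have [measurable]: "b \<in> borel_measurable borel" "deriv (deriv b) \<in> borel_measurable borel"
    by (intro borel_measurable_continuous_onI cb cb'')+
  define W where "W t = (\<integral>x. w (t, x) * b x \<partial>lborel)" for t
  define G where "G t = indicator {0..1} t * (a t * ((\<integral>x. w (t, x) * deriv (deriv b) x \<partial>lborel)
     + (\<integral>x. c (t, x) * z (t, x) * b x \<partial>lborel)))" for t :: real
  obtain B where B: "\<And>t. t \<in> {0..1} \<Longrightarrow> \<bar>\<integral>x. w (t, x) * deriv (deriv b) x \<partial>lborel\<bar> \<le> B"
    using W_bounded[OF cb'' z''] by blast
  define D where "D = A * (B + (Cc * Cz) * (\<integral>x. \<bar>b x\<bar> \<partial>lborel))"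
  have Gm [measurable]: "G \<in> borel_measurable borel" unfolding G_def by measurable
  have GD: "\<bar>G t\<bar> \<le> D" for t
  proof -
    have n: "\<bar>\<integral>x. c (t, x) * z (t, x) * b x \<partial>lborel\<bar> \<le> (Cc * Cz) * (\<integral>x. \<bar>b x\<bar> \<partial>lborel)" for t
      using bounded_slice[of "\<lambda>p. c p * z p" "Cc * Cz", OF _ cz_bound cb b(2), where t=t] by simp
    have D0: "0 \<le> B + (Cc * Cz) * (\<integral>x. \<bar>b x\<bar> \<partial>lborel)" using B[of 0] n[of 0] by auto
    have A0: "0 \<le> A" using a_nonneg[of 0] a_bound[of 0] by linarith
    show ?thesis
    proof (cases "t \<in> {0..1}")
      case True
      have "\<bar>(\<integral>x. w (t, x) * deriv (deriv b) x \<partial>lborel) + (\<integral>x. c (t, x) * z (t, x) * b x \<partial>lborel)\<bar>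
          \<le> B + (Cc * Cz) * (\<integral>x. \<bar>b x\<bar> \<partial>lborel)" using B[OF True] n[of t] by linarith
      then show ?thesis using True D0 A0 a_nonneg[of t] a_bound[of t]
        by (simp add: G_def D_def abs_mult mult_mono)
    qed (use A0 D0 in \<open>simp add: G_def D_def\<close>)
  qed
  define T where "T t = (LINT s:{t<..<1}|lborel. G s)" for t
  have cT: "continuous_on {0..1} T" unfolding T_def by (rule tail_integral_continuous[OF Gm GD])
  have cW: "continuous_on {0..1} W" unfolding W_def by (rule W_cont[OF cb b(2)])
  have "W t - T t = 0"
  proof (rule continuous_zero_by_bumps[of "\<lambda>t. W t - T t", OF _ _ t])
    show "continuous_on {0..1} (\<lambda>t. W t - T t)" by (intro continuous_intros cT cW)
    fix c' r :: real assume r: "0 < r" "0 < c' - r" "c' + r < 1"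
    define \<psi> where "\<psi> = bump c' r"
    have c\<psi>: "continuous_on S \<psi>" for S unfolding \<psi>_def by (rule smooth_fun_continuous[OF bump_smooth])
    have [measurable]: "\<psi> \<in> borel_measurable borel" by (rule borel_measurable_continuous_onI[OF c\<psi>])
    obtain \<alpha> where \<alpha>: "smooth_fun \<alpha>" "\<And>t. (\<alpha> has_real_derivative \<psi> t) (at t)"
      "\<And>t. t \<le> c' - r \<Longrightarrow> \<alpha> t = 0" "\<And>t. t \<in> {0..1} \<Longrightarrow> \<alpha> t = (LINT s:{0<..<t}|lborel. \<psi> s)"
      using bump_antideriv[OF r] unfolding \<psi>_def by blast
    have d\<alpha>: "deriv \<alpha> t = \<psi> t" for t by (rule DERIV_imp_deriv[OF \<alpha>(2)])
    have c\<alpha>: "continuous_on S \<alpha>" for S by (rule smooth_fun_continuous[OF \<alpha>(1)])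
    have [measurable]: "\<alpha> \<in> borel_measurable borel" by (rule borel_measurable_continuous_onI[OF c\<alpha>])
    have wt: "(LINT t:{0<..<1}|lborel. - \<psi> t * W t + \<alpha> t * G t) = 0"
    proof -
      have "(LINT t:{0<..<1}|lborel. - \<psi> t * W t + \<alpha> t * G t) =
        (LINT t:{0<..<1}|lborel. - deriv \<alpha> t * (\<integral>x. w (t, x) * b x \<partial>lborel) + \<alpha> t * (a t *
          ((\<integral>x. w (t, x) * deriv (deriv b) x \<partial>lborel) + (\<integral>x. c (t, x) * z (t, x) * b x \<partial>lborel))))"
        by (rule set_lebesgue_integral_cong) (auto simp: G_def W_def d\<alpha>)
      also have "\<dots> = 0" by (rule weak_t[OF \<alpha>(1) _ b]) (use \<alpha>(3) r in \<open>auto intro!: exI[of _ "c' - r"]\<close>)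
      finally show ?thesis .
    qed
    obtain P where "\<forall>t\<in>{0..1}. \<bar>\<psi> t\<bar> \<le> P"
      using bounded_on_unit[OF c\<psi>] by (rule exE)
    then have P: "\<bar>\<psi> t\<bar> \<le> P" if "t \<in> {0..1}" for t using that by (rule bspec)
    have P0: "0 \<le> P" using P[of 0] by auto
    \<comment> \<open>Fubini on the triangle \<open>t < s\<close>, since \<open>\<alpha>\<close> is the primitive of \<open>\<psi>\<close> and \<open>T\<close> the tail integral
       of \<open>G\<close>.\<close>
    have sw: "(LINT t:{0<..<1}|lborel. \<psi> t * T t) = (LINT t:{0<..<1}|lborel. \<alpha> t * G t)"
    proof -
      define F where "F = (\<lambda>(s, t). indicator {0<..<1} t * indicator {0<..<1} s * of_bool (t < s) * (\<psi> t * G s))"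
      have "(\<integral>t. \<integral>s. F (s, t) \<partial>lborel \<partial>lborel) = (\<integral>s. \<integral>t. F (s, t) \<partial>lborel \<partial>lborel)"
      proof (rule square_swap[where C="P * D"])
        show "F \<in> borel_measurable (borel \<Otimes>\<^sub>M borel)" unfolding F_def by measurable
        fix s t :: real
        have PD: "0 \<le> P * D" using P0 GD[of 0] by (intro mult_nonneg_nonneg) auto
        show "\<bar>F (s, t)\<bar> \<le> P * D * indicator {0..1} s * indicator {0..1} t"
        proof (cases "t \<in> {0<..<1} \<and> s \<in> {0<..<1} \<and> t < s")
          case True
          then have "\<bar>\<psi> t\<bar> * \<bar>G s\<bar> \<le> P * D" using P[of t] GD[of s] P0 by (intro mult_mono) simp_all
          then show ?thesis using True by (simp add: F_def abs_mult)
        next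
          case False
          then have "F (s, t) = 0" by (auto simp: F_def indicator_def)
          then show ?thesis using PD by simp
        qed
      qed
      moreover have "(\<integral>s. F (s, t) \<partial>lborel) = indicator {0<..<1} t * (\<psi> t * T t)" for t
      proof -
        have "(\<integral>s. F (s, t) \<partial>lborel) = (\<integral>s. (indicator {0<..<1} t * \<psi> t) * (indicator {t<..<1} s * G s) \<partial>lborel)"
          by (rule Bochner_Integration.integral_cong) (auto simp: F_def indicator_def)
        then show ?thesis by (simp add: T_def set_lebesgue_integral_def)
      qed
      moreover have "(\<integral>t. F (s, t) \<partial>lborel) = indicator {0<..<1} s * (\<alpha> s * G s)" for s
      proof -
        have "(\<integral>t. F (s, t) \<partial>lborel) = (\<integral>t. (indicator {0<..<1} s * G s) * (indicator {0<..<s} t * \<psi> t) \<partial>lborel)"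
          by (rule Bochner_Integration.integral_cong) (auto simp: F_def indicator_def)
        then show ?thesis using \<alpha>(4)[of s] by (cases "s \<in> {0<..<1}") (auto simp: set_lebesgue_integral_def)
      qed
      ultimately show ?thesis by (simp add: set_lebesgue_integral_def)
    qed
    have si: "set_integrable lborel {0<..<1} h" if "continuous_on {0..1} h" for h :: "real \<Rightarrow> real"
      by (rule set_integrable_subset[OF borel_integrable_atLeastAtMost'[OF that]]) auto
    have i1: "set_integrable lborel {0<..<1} (\<lambda>t. \<psi> t * W t)" by (intro si continuous_intros c\<psi> cW)
    have i2: "set_integrable lborel {0<..<1} (\<lambda>t. \<psi> t * T t)" by (intro si continuous_intros c\<psi> cT)
    obtain Q where "\<forall>t\<in>{0..1}. \<bar>\<alpha> t\<bar> \<le> Q"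
      using bounded_on_unit[OF c\<alpha>] by (rule exE)
    then have Q: "\<bar>\<alpha> t\<bar> \<le> Q" if "t \<in> {0..1}" for t using that by (rule bspec)
    have i3: "set_integrable lborel {0<..<1} (\<lambda>t. \<alpha> t * G t)"
      unfolding set_integrable_def
    proof (rule Bochner_Integration.integrable_bound[where f="\<lambda>t. Q * D * indicator {0..1::real} t :: real"])
      show "integrable lborel (\<lambda>t. Q * D * indicator {0..1::real} t :: real)"
        by (intro integrable_mult_right) auto
      have "norm (indicator {0<..<1} t *\<^sub>R (\<alpha> t * G t)) \<le> norm (Q * D * indicator {0..1::real} t :: real)" for t
      proof (cases "t \<in> {0<..<1}")
        case True
        have "\<bar>\<alpha> t\<bar> * \<bar>G t\<bar> \<le> Q * D"
          using Q[of t] GD[of t] Q[of 0] True by (intro mult_mono) auto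
        then show ?thesis using True abs_ge_self[of "Q * D"] by (simp add: abs_mult)
      qed simp
      then show "AE t in lborel. norm (indicator {0<..<1} t *\<^sub>R (\<alpha> t * G t)) \<le> norm (Q * D * indicator {0..1::real} t :: real)"
        by (intro AE_I2)
    qed measurable
    have "(LINT t:{0<..<1}|lborel. - \<psi> t * W t + \<alpha> t * G t) =
      - (LINT t:{0<..<1}|lborel. \<psi> t * W t) + (LINT t:{0<..<1}|lborel. \<alpha> t * G t)"
      using set_integral_diff(2)[OF i3 i1] by simp
    then have "(LINT t:{0<..<1}|lborel. \<psi> t * W t) = (LINT t:{0<..<1}|lborel. \<psi> t * T t)"
      using wt sw by linarith
    then show "(LINT t:{0<..<1}|lborel. bump c' r t * (W t - T t)) = 0"
      using set_integral_diff(2)[OF i1 i2] by (simp add: \<psi>_def right_diff_distrib)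
  qed
  moreover have "T t = (LINT s:{t<..<1}|lborel. a s *
          ((\<integral>x. w (s, x) * deriv (deriv b) x \<partial>lborel) + (\<integral>x. c (s, x) * z (s, x) * b x \<partial>lborel)))"
    unfolding T_def by (rule set_lebesgue_integral_cong) (use t in \<open>auto simp: G_def\<close>)
  ultimately show ?thesis by (simp add: W_def)
qed

end

section \<open>The mollified difference\<close>

lemma continuous_bound_by_AE:
  fixes f :: "real \<Rightarrow> real"
  assumes f: "continuous_on {0..1} f" and ae: "AE t in lborel. t \<in> {0<..<1} \<longrightarrow> \<bar>f t\<bar> \<le> C" and t: "t \<in> {0..1}"
  shows "\<bar>f t\<bar> \<le> C"
proof -
  have "max 0 (\<bar>f t\<bar> - C) = 0"
  proof (rule continuous_zero_by_bumps[of "\<lambda>t. max 0 (\<bar>f t\<bar> - C)", OF _ _ t])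
    show "continuous_on {0..1} (\<lambda>t. max 0 (\<bar>f t\<bar> - C))" by (intro continuous_intros f)
    fix c r :: real
    have "(LINT t:{0<..<1}|lborel. bump c r t * max 0 (\<bar>f t\<bar> - C)) = (\<integral>t. 0 \<partial>(lborel :: real measure))"
      unfolding set_lebesgue_integral_def
    proof (rule integral_eq_zero_AE[THEN trans])
      show "AE t in lborel. indicator {0<..<1} t *\<^sub>R (bump c r t * max 0 (\<bar>f t\<bar> - C)) = 0"
        using ae by eventually_elim (auto simp: indicator_def)
    qed simp
    then show "(LINT t:{0<..<1}|lborel. bump c r t * max 0 (\<bar>f t\<bar> - C)) = 0" by simp
  qed
  then show ?thesis by linarith
qed

text \<open>Gronwall's inequality, backwards in time and without continuity of \<open>E\<close>: in the norm
\<open>sup E t exp (- l (1 - t))\<close> the integral operator is a contraction with factor \<open>1/2\<close> as soon as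
\<open>l \<ge> 2 \<kappa>\<close>.\<close>

lemma backward_gronwall:
  fixes E :: "real \<Rightarrow> real"
  assumes [measurable]: "E \<in> borel_measurable borel" and b: "\<And>t. t \<in> {0..1} \<Longrightarrow> 0 \<le> E t" "\<And>t. t \<in> {0..1} \<Longrightarrow> E t \<le> B"
    and k: "0 \<le> \<kappa>" and le: "\<And>t. t \<in> {0..1} \<Longrightarrow> E t \<le> \<kappa> * (LINT s:{t<..<1}|lborel. E s) + \<epsilon>"
    and t: "t \<in> {0..1}"
  shows "E t \<le> 2 * \<epsilon> * exp (2 * \<kappa> + 1)"
proof -
  define l where "l = 2 * \<kappa> + 1"
  have l: "0 < l" "\<kappa> / l \<le> 1 / 2" using k by (auto simp: l_def divide_simps)
  define S where "S = (SUP t\<in>{0..1}. E t * exp (- l * (1 - t)))"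
  have B0: "0 \<le> B" using b[of 0] by simp
  have bdd: "bdd_above ((\<lambda>t. E t * exp (- l * (1 - t))) ` {0..1})"
  proof (rule bdd_aboveI2)
    fix t :: real assume t: "t \<in> {0..1}"
    have "E t * exp (- l * (1 - t)) \<le> B * 1" using b[OF t] l t B0 by (intro mult_mono) auto
    then show "E t * exp (- l * (1 - t)) \<le> B" by simp
  qed
  have ES: "E s \<le> S * exp (l * (1 - s))" if "s \<in> {0..1}" for s
  proof -
    have "E s * exp (- l * (1 - s)) \<le> S" unfolding S_def by (rule cSUP_upper[OF that bdd])
    then have "E s * exp (- l * (1 - s)) * exp (l * (1 - s)) \<le> S * exp (l * (1 - s))" by (intro mult_right_mono) auto
    then show ?thesis by (simp add: mult.assoc exp_add[symmetric])
  qed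
  have S0: "0 \<le> S" using ES[of 1] b(1)[of 1] by simp
  have "S \<le> S / 2 + \<epsilon>"
    unfolding S_def
  proof (rule cSUP_least, simp, fold S_def)
    fix t :: real assume t: "t \<in> {0..1}"
    have iE: "set_integrable lborel {t<..<1} E"
      unfolding set_integrable_def
    proof (rule Bochner_Integration.integrable_bound[where f="\<lambda>s. B * indicator {0..1::real} s :: real"])
      show "integrable lborel (\<lambda>s. B * indicator {0..1::real} s :: real)"
        by (intro integrable_mult_right) auto
      have "norm (indicator {t<..<1} s *\<^sub>R E s) \<le> norm (B * indicator {0..1::real} s :: real)" for s
        using b[of s] B0 t by (cases "s \<in> {t<..<1}") (auto)
      then show "AE s in lborel. norm (indicator {t<..<1} s *\<^sub>R E s) \<le> norm (B * indicator {0..1::real} s :: real)"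
        by (intro AE_I2)
    qed measurable
    have ci: "continuous_on X (\<lambda>s. S * exp (l * (1 - s)))" for X by (intro continuous_intros)
    have iX: "set_integrable lborel {t<..<1} (\<lambda>s. S * exp (l * (1 - s)))"
      by (rule set_integrable_subset[OF borel_integrable_atLeastAtMost'[OF ci, of 0 1]]) (use t in auto)
    have "(LINT s:{t<..<1}|lborel. E s) \<le> (LINT s:{t<..<1}|lborel. S * exp (l * (1 - s)))"
      by (rule set_integral_mono[OF iE iX]) (use t in \<open>auto intro!: ES\<close>)
    also have "\<dots> = integral {t..1} (\<lambda>s. S * exp (l * (1 - s)))"
      by (simp only: set_borel_integral_eq_integral(2)[OF iX] integral_open_interval_real)
    also have "((\<lambda>s. S * exp (l * (1 - s))) has_integral (- S / l * exp (l * (1 - 1)) - - S / l * exp (l * (1 - t)))) {t..1}"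
      by (rule fundamental_theorem_of_calculus)
         (use l t in \<open>auto intro!: derivative_eq_intros simp: has_real_derivative_iff_has_vector_derivative[symmetric]\<close>)
    then have "integral {t..1} (\<lambda>s. S * exp (l * (1 - s))) = - S / l * exp (l * (1 - 1)) - - S / l * exp (l * (1 - t))"
      by (rule integral_unique)
    also have "\<dots> \<le> S / l * exp (l * (1 - t))" using S0 l by simp
    finally have "\<kappa> * (LINT s:{t<..<1}|lborel. E s) \<le> \<kappa> * (S / l * exp (l * (1 - t)))"
      using k by (rule mult_left_mono)
    also have "\<dots> = (\<kappa> / l) * (S * exp (l * (1 - t)))" by simp
    also have "\<dots> \<le> 1 / 2 * (S * exp (l * (1 - t)))" using l S0 by (intro mult_right_mono) auto
    finally have "E t \<le> S / 2 * exp (l * (1 - t)) + \<epsilon>" using le[OF t] by simp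
    then have "E t * exp (- l * (1 - t)) \<le> (S / 2 * exp (l * (1 - t)) + \<epsilon>) * exp (- l * (1 - t))"
      by (rule mult_right_mono) simp
    also have "\<dots> = S / 2 + \<epsilon> * exp (- l * (1 - t))"
      by (simp add: distrib_right mult.assoc exp_add[symmetric])
    also have "\<dots> \<le> S / 2 + \<epsilon> * 1"
    proof -
      have "0 \<le> \<epsilon>" using le[of 1] b(1)[of 1] by (simp add: set_lebesgue_integral_def)
      then show ?thesis using l t by (intro add_left_mono mult_left_mono) auto
    qed
    finally show "E t * exp (- l * (1 - t)) \<le> S / 2 + \<epsilon>" by simp
  qed
  then have S2: "S \<le> 2 * \<epsilon>" by simp
  have "E t \<le> S * exp (l * (1 - t))" by (rule ES[OF t])
  also have "\<dots> \<le> 2 * \<epsilon> * exp l" using S2 S0 l t by (intro mult_mono) auto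
  finally show ?thesis by (simp add: l_def)
qed

lemma deriv_reflect:
  assumes "smooth_fun f"
  shows "deriv (\<lambda>y. f (x - y)) = (\<lambda>y. - deriv f (x - y))" "smooth_fun (\<lambda>y. f (x - y))"
proof -
  have "((\<lambda>y. x - y) has_real_derivative - 1) (at y)" for y
    by (auto intro!: derivative_eq_intros)
  from DERIV_chain2[OF smooth_fun_deriv(1)[OF assms] this]
  have "((\<lambda>y. f (x - y)) has_real_derivative - deriv f (x - y)) (at y)" for y by simp
  then show "deriv (\<lambda>y. f (x - y)) = (\<lambda>y. - deriv f (x - y))" using DERIV_imp_deriv by blast
  show "smooth_fun (\<lambda>y. f (x - y))" using smooth_fun_affine[OF assms, of "-1" x] by simp
qed

lemma deriv2_reflect:
  assumes "smooth_fun f"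
  shows "deriv (deriv (\<lambda>y. f (x - y))) = (\<lambda>y. deriv (deriv f) (x - y))"
proof -
  have "((\<lambda>y. - deriv f (x - y)) has_real_derivative deriv (deriv f) (x - y)) (at y)" for y
    using DERIV_minus[OF smooth_fun_deriv(1)[OF deriv_reflect(2)[OF smooth_fun_deriv(2)[OF assms]], of x y]]
    unfolding deriv_reflect(1)[OF smooth_fun_deriv(2)[OF assms]] by simp
  then show ?thesis unfolding deriv_reflect(1)[OF assms] using DERIV_imp_deriv by blast
qed

text \<open>The pointwise inequality behind the energy estimate. The good term \<open>- p^2\<close> absorbs every
product of \<open>m\<close> and \<open>p\<close>; here \<open>n\<close> is the mollified drift and \<open>e\<close> bounds its distance from
the drift \<open>c * p\<close> of the mollified function.\<close>

lemma young_bound: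
  fixes m p e n c C :: real
  assumes "\<bar>n - c * p\<bar> \<le> e" "\<bar>c\<bar> \<le> C" "\<bar>d\<bar> \<le> 1"
  shows "- p\<^sup>2 + 2 * (d * m * p) + m * n \<le> (2 + C)\<^sup>2 / 4 * m\<^sup>2 + \<bar>m\<bar> * e"
proof -
  have C0: "0 \<le> C" using assms by linarith
  have 1: "d * m * p \<le> \<bar>m\<bar> * \<bar>p\<bar>"
  proof -
    have "\<bar>d * (m * p)\<bar> \<le> 1 * \<bar>m * p\<bar>" unfolding abs_mult[of d] using assms(3) by (intro mult_right_mono) auto
    then show ?thesis using abs_ge_self[of "d * (m * p)"] by (simp add: abs_mult mult.assoc)
  qed
  have 2: "m * n \<le> \<bar>m\<bar> * (C * \<bar>p\<bar>) + \<bar>m\<bar> * e"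
  proof -
    have "\<bar>n\<bar> \<le> \<bar>n - c * p\<bar> + \<bar>c\<bar> * \<bar>p\<bar>" using abs_triangle_ineq[of "n - c * p" "c * p"] by (simp add: abs_mult)
    also have "\<dots> \<le> e + C * \<bar>p\<bar>" using assms by (intro add_mono mult_right_mono) auto
    finally have "\<bar>m\<bar> * \<bar>n\<bar> \<le> \<bar>m\<bar> * (e + C * \<bar>p\<bar>)" by (intro mult_left_mono) auto
    then show ?thesis using abs_ge_self[of "m * n"] by (simp add: abs_mult distrib_left)
  qed
  define k where "k = (2 + C) / 2"
  have k: "(2 + C)\<^sup>2 / 4 = k\<^sup>2" "2 + C = 2 * k" by (simp_all add: k_def power_divide)
  have "0 \<le> (\<bar>p\<bar> - k * \<bar>m\<bar>)\<^sup>2" by simp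
  also have "\<dots> = p\<^sup>2 - (2 * k) * (\<bar>m\<bar> * \<bar>p\<bar>) + k\<^sup>2 * m\<^sup>2"
    by (simp add: power2_diff power_mult_distrib)
  finally have "- p\<^sup>2 + (2 + C) * (\<bar>m\<bar> * \<bar>p\<bar>) \<le> (2 + C)\<^sup>2 / 4 * m\<^sup>2"
    unfolding k(1) unfolding k(2) by linarith
  then have "- p\<^sup>2 + (2 * (\<bar>m\<bar> * \<bar>p\<bar>) + \<bar>m\<bar> * (C * \<bar>p\<bar>)) \<le> (2 + C)\<^sup>2 / 4 * m\<^sup>2"
    by (simp add: algebra_simps)
  with 1 2 show ?thesis by linarith
qed

context weak_difference
begin

text \<open>The mollifications in \<open>x\<close>, at scale \<open>1 / (n + 1)\<close>: \<open>m\<close> of the difference \<open>w\<close> itself, with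
\<open>x\<close>-derivatives \<open>p\<close> and \<open>q\<close> (the derivatives are put on the mollifier), \<open>N\<close> of the drift term
\<open>c * z\<close> and \<open>Z\<close> of the weak derivative \<open>z\<close>.\<close>

definition eps :: "nat \<Rightarrow> real" where "eps n = 1 / real (Suc n)"
definition m :: "nat \<Rightarrow> real \<Rightarrow> real \<Rightarrow> real" where "m n t x = convolve (\<lambda>y. w (t, y)) (mollifier (eps n)) x"
definition p :: "nat \<Rightarrow> real \<Rightarrow> real \<Rightarrow> real" where "p n t x = convolve (\<lambda>y. w (t, y)) (deriv (mollifier (eps n))) x"
definition q :: "nat \<Rightarrow> real \<Rightarrow> real \<Rightarrow> real" where "q n t x = convolve (\<lambda>y. w (t, y)) (deriv (deriv (mollifier (eps n)))) x"
definition N :: "nat \<Rightarrow> real \<Rightarrow> real \<Rightarrow> real" where "N n t x = convolve (\<lambda>y. c (t, y) * z (t, y)) (mollifier (eps n)) x"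
definition Z :: "nat \<Rightarrow> real \<Rightarrow> real \<Rightarrow> real" where "Z n t x = convolve (\<lambda>y. z (t, y)) (mollifier (eps n)) x"

lemma eps: "0 < eps n" "eps n \<le> 1"
  by (auto simp: eps_def)

lemmas mollifier_derivs = mollifier_smooth smooth_fun_deriv(2)[OF mollifier_smooth] smooth_fun_deriv(2)[OF smooth_fun_deriv(2)[OF mollifier_smooth]]
lemmas mollifier_cont = mollifier_derivs[THEN smooth_fun_continuous]

lemma mollifier_meas [measurable]: "deriv (mollifier r) \<in> borel_measurable borel" "deriv (deriv (mollifier r)) \<in> borel_measurable borel"
  by (intro borel_measurable_continuous_onI mollifier_cont)+

lemma mollifier_out: "1 < \<bar>x\<bar> \<Longrightarrow> mollifier (eps n) x = 0" "1 < \<bar>x\<bar> \<Longrightarrow> deriv (mollifier (eps n)) x = 0"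
  "1 < \<bar>x\<bar> \<Longrightarrow> deriv (deriv (mollifier (eps n))) x = 0"
proof -
  have 1: "mollifier (eps n) x = 0" if "1 < \<bar>x\<bar>" for x using that eps[of n] by (intro mollifier_zero) linarith
  have 2: "deriv (mollifier (eps n)) x = 0" if "1 < \<bar>x\<bar>" for x by (rule deriv_zero_outside[of 1, OF 1 that])
  have 3: "deriv (deriv (mollifier (eps n))) x = 0" if "1 < \<bar>x\<bar>" for x by (rule deriv_zero_outside[of 1, OF 2 that])
  show "1 < \<bar>x\<bar> \<Longrightarrow> mollifier (eps n) x = 0" "1 < \<bar>x\<bar> \<Longrightarrow> deriv (mollifier (eps n)) x = 0"
  "1 < \<bar>x\<bar> \<Longrightarrow> deriv (deriv (mollifier (eps n))) x = 0" using 1 2 3 by blast+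
qed

lemma joint_meas [measurable]:
  "(\<lambda>z. m n (fst z) (snd z)) \<in> borel_measurable (borel \<Otimes>\<^sub>M borel)"
  "(\<lambda>z. p n (fst z) (snd z)) \<in> borel_measurable (borel \<Otimes>\<^sub>M borel)"
  "(\<lambda>z. q n (fst z) (snd z)) \<in> borel_measurable (borel \<Otimes>\<^sub>M borel)"
  "(\<lambda>z. N n (fst z) (snd z)) \<in> borel_measurable (borel \<Otimes>\<^sub>M borel)"
  "(\<lambda>z. Z n (fst z) (snd z)) \<in> borel_measurable (borel \<Otimes>\<^sub>M borel)"
  unfolding m_def p_def q_def N_def Z_def convolve_def by measurable

lemma joint_meas2 [measurable (raw)]:
  assumes [measurable]: "f \<in> borel_measurable M" "g \<in> borel_measurable M"
  shows "(\<lambda>z. m n (f z) (g z)) \<in> borel_measurable M" "(\<lambda>z. p n (f z) (g z)) \<in> borel_measurable M"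
    "(\<lambda>z. q n (f z) (g z)) \<in> borel_measurable M" "(\<lambda>z. N n (f z) (g z)) \<in> borel_measurable M"
    "(\<lambda>z. Z n (f z) (g z)) \<in> borel_measurable M"
proof -
  have P: "(\<lambda>z. (f z, g z)) \<in> M \<rightarrow>\<^sub>M borel \<Otimes>\<^sub>M borel" by measurable
  show "(\<lambda>z. m n (f z) (g z)) \<in> borel_measurable M" "(\<lambda>z. p n (f z) (g z)) \<in> borel_measurable M"
    "(\<lambda>z. q n (f z) (g z)) \<in> borel_measurable M" "(\<lambda>z. N n (f z) (g z)) \<in> borel_measurable M"
    "(\<lambda>z. Z n (f z) (g z)) \<in> borel_measurable M"
    using measurable_compose[OF P joint_meas(1)] measurable_compose[OF P joint_meas(2)]
      measurable_compose[OF P joint_meas(3)] measurable_compose[OF P joint_meas(4)]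
      measurable_compose[OF P joint_meas(5)] by simp_all
qed

lemma N_bound: "\<bar>N n t x\<bar> \<le> Cc * Cz" and Z_bound: "\<bar>Z n t x\<bar> \<le> Cz"
  unfolding N_def Z_def by (rule convolve_bounded(2)[OF _ eps(1)]; use cz_bound z_bound in simp)+

text \<open>The weak derivative commutes with mollification: test the weak equation in \<open>x\<close> with a
translated and reflected mollifier.\<close>

lemma p_eq_Z: "AE t in lborel. t \<in> {0<..<1} \<longrightarrow> p n t x = Z n t x"
proof -
  have "AE t in lborel. t \<in> {0<..<1} \<longrightarrow>
    (\<integral>y. w (t, y) * deriv (\<lambda>y. mollifier (eps n) (x - y)) y \<partial>lborel) = - (\<integral>y. z (t, y) * mollifier (eps n) (x - y) \<partial>lborel)"
    by (rule weak_x_ae[OF deriv_reflect(2)[OF mollifier_smooth], of "\<bar>x\<bar> + 1"]) (auto intro!: mollifier_out)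
  then show ?thesis
    unfolding deriv_reflect(1)[OF mollifier_smooth] p_def Z_def convolve_def by eventually_elim simp
qed

text \<open>The mollified equation, integrated in time from \<open>t\<close> to the terminal time.\<close>

lemma m_eq: "t \<in> {0..1} \<Longrightarrow> m n t x = (LINT s:{t<..<1}|lborel. a s * (q n s x + N n s x))"
proof -
  assume t: "t \<in> {0..1}"
  have "(\<integral>y. w (t, y) * mollifier (eps n) (x - y) \<partial>lborel) = (LINT s:{t<..<1}|lborel. a s *
    ((\<integral>y. w (s, y) * deriv (deriv (\<lambda>y. mollifier (eps n) (x - y))) y \<partial>lborel) + (\<integral>y. c (s, y) * z (s, y) * mollifier (eps n) (x - y) \<partial>lborel)))"
    by (rule weak_t_integrated[OF deriv_reflect(2)[OF mollifier_smooth] _ t, of "\<bar>x\<bar> + 1"]) (auto intro!: mollifier_out)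
  then show ?thesis unfolding deriv2_reflect[OF mollifier_smooth] m_def q_def N_def convolve_def .
qed

lemma p_cont_t: "continuous_on {0..1} (\<lambda>t. p n t x)"
  unfolding p_def convolve_def
  by (rule W_cont[of _ "\<bar>x\<bar> + 1"]) (auto intro!: continuous_on_compose2[OF mollifier_cont(2)[of UNIV]] continuous_intros mollifier_out)

text \<open>The bound on \<open>Z\<close> holds for \<open>p\<close> at almost every time, hence at every time because \<open>p\<close> is
continuous in time.\<close>

lemma p_bound: "t \<in> {0..1} \<Longrightarrow> \<bar>p n t x\<bar> \<le> Cz"
proof (rule continuous_bound_by_AE[OF p_cont_t])
  show "AE t in lborel. t \<in> {0<..<1} \<longrightarrow> \<bar>p n t x\<bar> \<le> Cz"
    using p_eq_Z[of n x] by eventually_elim (auto simp: Z_bound)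
qed

lemma m_deriv: "t \<in> {0..1} \<Longrightarrow> (m n t has_real_derivative p n t x) (at x)"
  and p_deriv: "t \<in> {0..1} \<Longrightarrow> (p n t has_real_derivative q n t x) (at x)"
  and q_cont: "t \<in> {0..1} \<Longrightarrow> continuous_on UNIV (q n t)"
proof -
  assume t: "t \<in> {0..1}"
  show "(m n t has_real_derivative p n t x) (at x)"
    unfolding m_def[abs_def] p_def
    by (rule convolve_has_derivative[OF w_slice[OF t] smooth_fun_deriv(1)[OF mollifier_derivs(1)] mollifier_cont(2), of 1]) (auto intro!: mollifier_out)
  show "(p n t has_real_derivative q n t x) (at x)"
    unfolding p_def[abs_def] q_def
    by (rule convolve_has_derivative[OF w_slice[OF t] smooth_fun_deriv(1)[OF mollifier_derivs(2)] mollifier_cont(3), of 1]) (auto intro!: mollifier_out)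
  have "(q n t has_real_derivative convolve (\<lambda>y. w (t, y)) (deriv (deriv (deriv (mollifier (eps n))))) x) (at x)" for x
    unfolding q_def[abs_def]
    by (rule convolve_has_derivative[OF w_slice[OF t] smooth_fun_deriv(1)[OF mollifier_derivs(3)] smooth_fun_continuous[OF smooth_fun_deriv(2)[OF mollifier_derivs(3)]], of 1])
       (auto intro!: mollifier_out deriv_zero_outside[of 1 "deriv (deriv (mollifier (eps n)))"])
  then show "continuous_on UNIV (q n t)" using DERIV_isCont by (blast intro: continuous_at_imp_continuous_on)
qed

text \<open>The mollifications are uniformly Lipschitz, and so is their limit.\<close>

lemma w_lipschitz:
  assumes t: "t \<in> {0..1}" shows "\<bar>w (t, x) - w (t, y)\<bar> \<le> Cz * \<bar>x - y\<bar>"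
proof -
  have "\<bar>m n t x - m n t y\<bar> \<le> Cz * \<bar>x - y\<bar>" for n
    using field_differentiable_bound[of UNIV "m n t" "p n t" Cz x y] m_deriv[OF t] p_bound[OF t] by auto
  moreover have "(\<lambda>n. \<bar>m n t x - m n t y\<bar>) \<longlonglongrightarrow> \<bar>w (t, x) - w (t, y)\<bar>"
    unfolding m_def eps_def by (intro tendsto_intros convolve_tendsto w_slice t)
  ultimately show ?thesis by (intro LIMSEQ_le_const2) auto
qed

lemma w_growth: "\<exists>M\<ge>0. \<forall>t\<in>{0..1}. \<forall>x. \<bar>w (t, x)\<bar> \<le> M * (1 + \<bar>x\<bar>)"
proof -
  have "continuous_on {0..1} (\<lambda>t. w (t, 0))"
    by (intro continuous_on_compose2[OF w_cont] continuous_intros) auto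
  then obtain B where B: "\<forall>t\<in>{0..1}. \<bar>w (t, 0)\<bar> \<le> B" using bounded_on_unit by blast
  have "0 \<le> \<bar>w (0, 0)\<bar>" by simp
  also have "\<dots> \<le> B" using B by simp
  finally have B0: "0 \<le> B" .
  have C0: "0 \<le> Cz" using z_bound[of undefined] by linarith
  have "\<bar>w (t, x)\<bar> \<le> (B + Cz) * (1 + \<bar>x\<bar>)" if t: "t \<in> {0..1}" for t x
  proof -
    have "\<bar>w (t, x)\<bar> \<le> \<bar>w (t, 0)\<bar> + Cz * \<bar>x\<bar>" using w_lipschitz[OF t, of x 0] by simp
    also have "\<dots> \<le> B + Cz * \<bar>x\<bar>" using B t by simp
    also have "\<dots> \<le> (B + Cz) * (1 + \<bar>x\<bar>)" using B0 C0 by (simp add: algebra_simps)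
    finally show ?thesis .
  qed
  then show ?thesis using B0 C0 by (intro exI[of _ "B + Cz"]) auto
qed

end

section \<open>The energy estimate\<close>

lemma weight_int_bound:
  fixes g :: "real \<Rightarrow> real"
  assumes [measurable]: "g \<in> borel_measurable borel" and b: "\<And>x. \<bar>g x\<bar> \<le> D * weight x"
  shows "integrable lborel g" "\<bar>integral\<^sup>L lborel g\<bar> \<le> D * integral\<^sup>L lborel weight"
proof -
  show i: "integrable lborel g"
    by (rule Bochner_Integration.integrable_bound[OF integrable_mult_right[OF weight_integrable, of D]])
       (auto intro!: AE_I2 order_trans[OF b])
  have "\<bar>integral\<^sup>L lborel g\<bar> \<le> (\<integral>x. D * weight x \<partial>lborel)"
    by (rule integral_abs_bound_integral[OF i integrable_mult_right[OF weight_integrable] b])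
  then show "\<bar>integral\<^sup>L lborel g\<bar> \<le> D * integral\<^sup>L lborel weight" by simp
qed

lemma weight_abs_int:
  fixes g :: "real \<Rightarrow> real"
  assumes [measurable]: "g \<in> borel_measurable borel" and b: "\<And>x. \<bar>g x\<bar> \<le> D"
  shows "integrable lborel (\<lambda>x. weight x * \<bar>g x\<bar>)" "\<bar>\<integral>x. weight x * \<bar>g x\<bar> \<partial>lborel\<bar> \<le> D * integral\<^sup>L lborel weight"
proof -
  have "\<bar>weight x * \<bar>g x\<bar>\<bar> \<le> D * weight x" for x
    using mult_right_mono[OF b[of x] less_imp_le[OF weight_pos[of x]]] weight_pos[of x] by (simp add: abs_mult mult.commute)
  then show "integrable lborel (\<lambda>x. weight x * \<bar>g x\<bar>)" "\<bar>\<integral>x. weight x * \<bar>g x\<bar> \<partial>lborel\<bar> \<le> D * integral\<^sup>L lborel weight"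
    by (intro weight_int_bound; measurable)+
qed

text \<open>The squared weight leaves one factor \<open>weight\<close> after compensating two functions of linear growth,
because \<open>(2 + \<bar>x\<bar>)^2 * weight x \<le> 8\<close>.\<close>

lemma weight2_mult_bound:
  assumes "\<bar>f\<bar> \<le> M * (2 + \<bar>x\<bar>)" "\<bar>g\<bar> \<le> K * (2 + \<bar>x\<bar>)"
  shows "\<bar>(weight x)\<^sup>2 * f * g\<bar> \<le> (8 * M * K) * weight x"
proof -
  have M0: "0 \<le> M * (2 + \<bar>x\<bar>)" "0 \<le> K * (2 + \<bar>x\<bar>)" using assms by linarith+
  then have M: "0 \<le> M" "0 \<le> K" using zero_le_mult_iff[of _ "2 + \<bar>x\<bar>"] by fastforce+
  have "\<bar>f\<bar> * \<bar>g\<bar> \<le> (M * (2 + \<bar>x\<bar>)) * (K * (2 + \<bar>x\<bar>))"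
    using assms M0 by (intro mult_mono) auto
  then have "weight x * (weight x * (\<bar>f\<bar> * \<bar>g\<bar>)) \<le> weight x * (weight x * ((M * (2 + \<bar>x\<bar>)) * (K * (2 + \<bar>x\<bar>))))"
    using weight_pos[of x] by (intro mult_left_mono) (auto simp: less_imp_le)
  also have "\<dots> = (weight x * M * K) * ((2 + \<bar>x\<bar>)\<^sup>2 * weight x)" by (simp add: power2_eq_square)
  also have "\<dots> \<le> (weight x * M * K) * 8"
    using M weight_pos[of x] by (intro mult_left_mono one_plus_abs_square) (auto simp: less_imp_le)
  finally show ?thesis using weight_pos[of x] by (simp add: abs_mult power2_eq_square mult_ac)
qed

context weak_difference
begin

text \<open>The weighted energy \<open>E\<close> of the mollified difference, and the size \<open>e\<close> of the commutator of
mollification with multiplication by the drift coefficient \<open>c\<close>.\<close>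

definition E :: "nat \<Rightarrow> real \<Rightarrow> real" where "E n t = (\<integral>x. (weight x)\<^sup>2 * (m n t x)\<^sup>2 \<partial>lborel)"
definition e :: "nat \<Rightarrow> real \<Rightarrow> real" where "e n t = (\<integral>x. weight x * \<bar>N n t x - c (t, x) * Z n t x\<bar> \<partial>lborel)"

lemma E_meas [measurable]: "E n \<in> borel_measurable borel" and e_meas [measurable]: "e n \<in> borel_measurable borel"
  unfolding E_def e_def by measurable

lemma m_bound:
  assumes M: "\<forall>t\<in>{0..1}. \<forall>x. \<bar>w (t, x)\<bar> \<le> M * (1 + \<bar>x\<bar>)" and t: "t \<in> {0..1}"
  shows "\<bar>m n t x\<bar> \<le> M * (2 + \<bar>x\<bar>)"
proof -
  have "\<bar>m n t x\<bar> \<le> (M * (\<integral>y. \<bar>mollifier (eps n) y\<bar> \<partial>lborel)) * (2 + \<bar>x\<bar>)"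
    unfolding m_def by (rule convolve_linear_bound[OF w_slice[OF t] mollifier_cont(1)]) (use M t mollifier_out in auto)
  also have "(\<integral>y. \<bar>mollifier (eps n) y\<bar> \<partial>lborel) = 1"
    using mollifier_integral(1)[OF eps(1)] mollifier_nonneg[OF eps(1)] by simp
  finally show ?thesis by simp
qed

lemma q_bound:
  assumes M: "\<forall>t\<in>{0..1}. \<forall>x. \<bar>w (t, x)\<bar> \<le> M * (1 + \<bar>x\<bar>)"
  shows "\<exists>K\<ge>0. \<forall>t\<in>{0..1}. \<forall>x. \<bar>q n t x\<bar> \<le> K * (2 + \<bar>x\<bar>)"
proof -
  have "0 \<le> \<bar>w (0, 0)\<bar>" by simp
  also have "\<dots> \<le> M" using M[rule_format, of 0 0] by simp
  finally have M0: "0 \<le> M" .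
  have "\<bar>q n t x\<bar> \<le> (M * (\<integral>y. \<bar>deriv (deriv (mollifier (eps n))) y\<bar> \<partial>lborel)) * (2 + \<bar>x\<bar>)" if t: "t \<in> {0..1}" for t x
    unfolding q_def by (rule convolve_linear_bound[OF w_slice[OF t] mollifier_cont(3)]) (use M t mollifier_out in auto)
  moreover have "0 \<le> M * (\<integral>y. \<bar>deriv (deriv (mollifier (eps n))) y\<bar> \<partial>lborel)"
    using M0 by (intro mult_nonneg_nonneg integral_nonneg_AE) auto
  ultimately show ?thesis by blast
qed

lemma c0: "0 \<le> Cc" "0 \<le> Cz" "0 \<le> A"
  using c_bound[of undefined] z_bound[of undefined] a_nonneg[of 0] a_bound[of 0] by linarith+

lemma N_bound2: "\<bar>N n t x\<bar> \<le> (Cc * Cz) * (2 + \<bar>x\<bar>)"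
proof -
  have "\<bar>N n t x\<bar> \<le> (Cc * Cz) * 1" using N_bound by simp
  also have "\<dots> \<le> (Cc * Cz) * (2 + \<bar>x\<bar>)" using c0 by (intro mult_left_mono) auto
  finally show ?thesis .
qed

lemma NcZ_bound: "\<bar>N n t x - c (t, x) * Z n t x\<bar> \<le> 2 * Cc * Cz"
proof -
  have "\<bar>c (t, x) * Z n t x\<bar> \<le> Cc * Cz"
    unfolding abs_mult using c0 by (intro mult_mono c_bound Z_bound) auto
  then show ?thesis using N_bound[of n t x] by linarith
qed

lemma e_bound: "\<bar>e n t\<bar> \<le> 2 * Cc * Cz * integral\<^sup>L lborel weight" "0 \<le> e n t"
proof -
  show "\<bar>e n t\<bar> \<le> 2 * Cc * Cz * integral\<^sup>L lborel weight"
    unfolding e_def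
    by (rule weight_abs_int(2)[OF _ NcZ_bound]) measurable
  show "0 \<le> e n t"
    unfolding e_def using weight_pos by (intro integral_nonneg_AE AE_I2) (simp add: less_imp_le)
qed

text \<open>Integrating by parts produces \<open>- p^2\<close> and a product of \<open>m\<close> and \<open>p\<close> from the derivative of
the weight. Replacing the mollified drift \<open>N\<close> by \<open>c * p\<close> costs the commutator, as \<open>p = Z\<close> almost
everywhere; after this \<open>young_bound\<close> applies pointwise.\<close>

lemma energy_rate:
  assumes M: "\<forall>t\<in>{0..1}. \<forall>x. \<bar>w (t, x)\<bar> \<le> M * (1 + \<bar>x\<bar>)"
  shows "AE s in lborel. s \<in> {0<..<1} \<longrightarrow>
    (\<integral>x. (weight x)\<^sup>2 * m n s x * (q n s x + N n s x) \<partial>lborel) \<le> (2 + Cc)\<^sup>2 / 4 * E n s + 8 * M * e n s"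
proof -
  have "0 \<le> \<bar>w (0, 0)\<bar>" by simp
  also have "\<dots> \<le> M" using M[rule_format, of 0 0] by simp
  finally have M0: "0 \<le> M" .
  obtain K where K: "K \<ge> 0" "\<forall>t\<in>{0..1}. \<forall>x. \<bar>q n t x\<bar> \<le> K * (2 + \<bar>x\<bar>)" using q_bound[OF M] by blast
  have "AE s in lborel. AE x in lborel. s \<in> {0<..<1} \<longrightarrow> p n s x = Z n s x"
  \<comment> \<open>For each \<open>x\<close> the identity \<open>p = Z\<close> holds at almost all times; Fubini yields one null set of
     times outside of which it holds for almost all \<open>x\<close>.\<close>
  proof (subst lborel_pair.AE_commute)
    show "{x \<in> space (lborel \<Otimes>\<^sub>M lborel). fst x \<in> {0<..<1} \<longrightarrow> p n (fst x) (snd x) = Z n (fst x) (snd x)} \<in> sets (lborel \<Otimes>\<^sub>M lborel)"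
      by measurable
  qed (use p_eq_Z in simp)
  then show ?thesis
  proof eventually_elim
    case (elim s)
    show ?case
    proof
      assume s': "s \<in> {0<..<1}"
      then have s: "s \<in> {0..1}" by auto
      note mb = m_bound[OF M s, of n]
      note qb = K(2)[rule_format, OF s]
      note parts = weighted_by_parts[OF m_deriv[OF s] p_deriv[OF s] q_cont[OF s] mb p_bound[OF s] qb]
      have [measurable]: "m n s \<in> borel_measurable borel" "p n s \<in> borel_measurable borel"
        "q n s \<in> borel_measurable borel" "N n s \<in> borel_measurable borel" "Z n s \<in> borel_measurable borel"
        by measurable
      have mN: "\<bar>(weight x)\<^sup>2 * m n s x * N n s x\<bar> \<le> (8 * M * (Cc * Cz)) * weight x" for x
        by (rule weight2_mult_bound[OF mb N_bound2])
      have iN: "integrable lborel (\<lambda>x. (weight x)\<^sup>2 * m n s x * N n s x)"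
        by (rule weight_int_bound(1)[OF _ mN]) measurable
      have imm: "integrable lborel (\<lambda>x. (weight x)\<^sup>2 * (m n s x)\<^sup>2)"
        by (rule weight_int_bound(1)[of _ "8 * M * M"])
           (use weight2_mult_bound[OF mb mb] in \<open>auto simp: power2_eq_square mult_ac\<close>)
      have ie: "integrable lborel (\<lambda>x. weight x * \<bar>N n s x - c (s, x) * Z n s x\<bar>)"
        by (rule weight_abs_int(1)[OF _ NcZ_bound]) measurable
      have "(\<integral>x. (weight x)\<^sup>2 * m n s x * (q n s x + N n s x) \<partial>lborel) =
        (\<integral>x. (weight x)\<^sup>2 * m n s x * q n s x + (weight x)\<^sup>2 * m n s x * N n s x \<partial>lborel)"
        by (simp add: distrib_left)
      also have "\<dots> = (\<integral>x. (weight x)\<^sup>2 * m n s x * q n s x \<partial>lborel) + (\<integral>x. (weight x)\<^sup>2 * m n s x * N n s x \<partial>lborel)"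
        by (rule Bochner_Integration.integral_add[OF parts(1) iN])
      also have "\<dots> = (\<integral>x. - ((weight x)\<^sup>2 * (p n s x)\<^sup>2) + 2 * (weight x * (2 * x * (weight x)\<^sup>2) * m n s x * p n s x)
          + (weight x)\<^sup>2 * m n s x * N n s x \<partial>lborel)"
        unfolding parts(4)
        by (simp only: Bochner_Integration.integral_add Bochner_Integration.integral_minus integral_mult_right_zero
            Bochner_Integration.integrable_add Bochner_Integration.integrable_minus integrable_mult_right parts(2) parts(3) iN)
      also have "\<dots> \<le> (\<integral>x. (2 + Cc)\<^sup>2 / 4 * ((weight x)\<^sup>2 * (m n s x)\<^sup>2) + (8 * M) * (weight x * \<bar>N n s x - c (s, x) * Z n s x\<bar>) \<partial>lborel)"
      proof (rule integral_mono_AE)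
        show "integrable lborel (\<lambda>x. - ((weight x)\<^sup>2 * (p n s x)\<^sup>2) + 2 * (weight x * (2 * x * (weight x)\<^sup>2) * m n s x * p n s x)
          + (weight x)\<^sup>2 * m n s x * N n s x)"
          by (intro Bochner_Integration.integrable_add Bochner_Integration.integrable_minus integrable_mult_right parts(2) parts(3) iN)
        show "integrable lborel (\<lambda>x. (2 + Cc)\<^sup>2 / 4 * ((weight x)\<^sup>2 * (m n s x)\<^sup>2) + (8 * M) * (weight x * \<bar>N n s x - c (s, x) * Z n s x\<bar>))"
          by (intro Bochner_Integration.integrable_add integrable_mult_right imm ie)
        show "AE x in lborel. - ((weight x)\<^sup>2 * (p n s x)\<^sup>2) + 2 * (weight x * (2 * x * (weight x)\<^sup>2) * m n s x * p n s x)
          + (weight x)\<^sup>2 * m n s x * N n s x \<le>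
          (2 + Cc)\<^sup>2 / 4 * ((weight x)\<^sup>2 * (m n s x)\<^sup>2) + (8 * M) * (weight x * \<bar>N n s x - c (s, x) * Z n s x\<bar>)"
          using elim
        proof eventually_elim
          case (elim x)
          then have pZ: "p n s x = Z n s x" using s' by simp
          have d: "\<bar>2 * x * weight x\<bar> \<le> 1"
          proof -
            have "\<bar>2 * x * weight x\<bar> * weight x \<le> 1 * weight x"
              using weight_deriv_bound[of x] weight_pos[of x] by (simp add: abs_mult power2_eq_square mult_ac)
            then show ?thesis by (rule mult_right_le_imp_le[OF _ weight_pos])
          qed
          define r where "r = \<bar>N n s x - c (s, x) * Z n s x\<bar>"
          have "- (p n s x)\<^sup>2 + 2 * ((2 * x * weight x) * m n s x * p n s x) + m n s x * N n s x
              \<le> (2 + Cc)\<^sup>2 / 4 * (m n s x)\<^sup>2 + \<bar>m n s x\<bar> * r"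
            by (rule young_bound[OF _ c_bound[of "(s, x)"] d]) (simp add: pZ r_def)
          from mult_left_mono[OF this, of "(weight x)\<^sup>2"]
          have "- ((weight x)\<^sup>2 * (p n s x)\<^sup>2) + 2 * (weight x * (2 * x * (weight x)\<^sup>2) * m n s x * p n s x)
          + (weight x)\<^sup>2 * m n s x * N n s x \<le> (2 + Cc)\<^sup>2 / 4 * ((weight x)\<^sup>2 * (m n s x)\<^sup>2) + (weight x)\<^sup>2 * \<bar>m n s x\<bar> * r"
            by (simp add: algebra_simps power2_eq_square)
          moreover have "(weight x)\<^sup>2 * \<bar>m n s x\<bar> * r \<le> (8 * M) * (weight x * r)"
          proof -
            have "\<bar>(weight x)\<^sup>2 * m n s x * 1\<bar> \<le> (8 * M * 1) * weight x" by (rule weight2_mult_bound[OF mb]) simp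
            then have "((weight x)\<^sup>2 * \<bar>m n s x\<bar>) * r \<le> (8 * M * weight x) * r"
              by (intro mult_right_mono) (auto simp: abs_mult r_def)
            then show ?thesis by simp
          qed
          ultimately show ?case unfolding r_def by linarith
        qed
      qed
      also have "\<dots> = (2 + Cc)\<^sup>2 / 4 * E n s + 8 * M * e n s"
        unfolding E_def e_def
        by (simp only: Bochner_Integration.integral_add[OF integrable_mult_right[OF imm] integrable_mult_right[OF ie]] integral_mult_right_zero)
      finally show "(\<integral>x. (weight x)\<^sup>2 * m n s x * (q n s x + N n s x) \<partial>lborel) \<le> (2 + Cc)\<^sup>2 / 4 * E n s + 8 * M * e n s" .
    qed
  qed
qed

text \<open>For fixed \<open>x\<close> the function \<open>m\<close> is a tail integral in time, so its square is given by
\<open>square_tail_integral\<close>; integrate over \<open>x\<close> with the weight and exchange the integrals.\<close>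

lemma energy_identity:
  assumes M: "\<forall>t\<in>{0..1}. \<forall>x. \<bar>w (t, x)\<bar> \<le> M * (1 + \<bar>x\<bar>)" and t: "t \<in> {0..1}"
  shows "E n t = 2 * (LINT s:{t<..<1}|lborel. a s * (\<integral>x. (weight x)\<^sup>2 * m n s x * (q n s x + N n s x) \<partial>lborel))"
    and "set_integrable lborel {t<..<1} (\<lambda>s. a s * (\<integral>x. (weight x)\<^sup>2 * m n s x * (q n s x + N n s x) \<partial>lborel))"
proof -
  obtain K0 where K0: "K0 \<ge> 0" "\<forall>t\<in>{0..1}. \<forall>x. \<bar>q n t x\<bar> \<le> K0 * (2 + \<bar>x\<bar>)" using q_bound[OF M] by blast
  define K where "K = K0 + Cc * Cz"
  have K: "\<bar>q n s x + N n s x\<bar> \<le> K * (2 + \<bar>x\<bar>)" if "s \<in> {0..1}" for s x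
    using N_bound2[of n s x] K0(2)[rule_format, OF that, of x] by (simp add: K_def distrib_right)
  have Kx: "0 \<le> K * (2 + \<bar>x\<bar>)" for x using K[of 0 x] by simp
  have sq: "(m n t x)\<^sup>2 = 2 * (LINT s:{t<..<1}|lborel. m n s x * (a s * (q n s x + N n s x)))" for x
  proof -
    define g where "g s = indicator {0..1} s * (a s * (q n s x + N n s x))" for s :: real
    have gm: "g \<in> borel_measurable borel" unfolding g_def by measurable
    have gb: "\<bar>g s\<bar> \<le> A * (K * (2 + \<bar>x\<bar>))" for s
    proof (cases "s \<in> {0..1}")
      case True
      then have "\<bar>a s\<bar> * \<bar>q n s x + N n s x\<bar> \<le> A * (K * (2 + \<bar>x\<bar>))"
        using a_nonneg[of s] a_bound[of s] c0 by (intro mult_mono K) auto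
      then show ?thesis using True by (simp add: g_def abs_mult)
    qed (use c0 Kx in \<open>simp add: g_def\<close>)
    have f: "(LINT r:{s<..<1}|lborel. g r) = m n s x" if "s \<in> {0..1}" for s
      unfolding m_eq[OF that] by (rule set_lebesgue_integral_cong) (use that in \<open>auto simp: g_def\<close>)
    have "(m n t x)\<^sup>2 = (LINT s:{t<..<1}|lborel. g s)\<^sup>2" using f[OF t] by simp
    also have "\<dots> = 2 * (LINT s:{t<..<1}|lborel. (LINT r:{s<..<1}|lborel. g r) * g s)"
      by (rule square_tail_integral[OF gm gb t])
    also have "(LINT s:{t<..<1}|lborel. (LINT r:{s<..<1}|lborel. g r) * g s) = (LINT s:{t<..<1}|lborel. m n s x * (a s * (q n s x + N n s x)))"
      by (rule set_lebesgue_integral_cong) (use t f in \<open>auto simp: g_def\<close>)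
    finally show ?thesis .
  qed
  define F where "F = (\<lambda>(s, x). indicator {t<..<1} s * (a s * ((weight x)\<^sup>2 * m n s x * (q n s x + N n s x))))"
  have Fm: "F \<in> borel_measurable (borel \<Otimes>\<^sub>M borel)" unfolding F_def by measurable
  have Fb: "\<bar>F (s, x)\<bar> \<le> (A * (8 * M * K)) * indicator {0..1} s * weight x" for s x
  proof (cases "s \<in> {t<..<1}")
    case True
    then have s: "s \<in> {0..1}" using t by auto
    have "\<bar>a s\<bar> * \<bar>(weight x)\<^sup>2 * m n s x * (q n s x + N n s x)\<bar> \<le> A * ((8 * M * K) * weight x)"
      using a_nonneg[of s] a_bound[of s] c0 by (intro mult_mono weight2_mult_bound m_bound[OF M s] K[OF s]) auto
    then show ?thesis using True s by (simp add: F_def abs_mult)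
  next
    case False
    have "0 \<le> \<bar>(weight x)\<^sup>2 * m n 0 x * (q n 0 x + N n 0 x)\<bar>" by simp
    also have "\<dots> \<le> (8 * M * K) * weight x"
      by (intro weight2_mult_bound m_bound[OF M] K) auto
    finally have "0 \<le> (8 * M * K) * weight x" .
    from mult_nonneg_nonneg[OF c0(3) this] have "0 \<le> A * ((8 * M * K) * weight x)" .
    then show ?thesis using False by (auto simp: F_def indicator_def mult.assoc)
  qed
  note sw = strip_swap[OF Fm Fb]
  have inner: "(\<integral>x. F (s, x) \<partial>lborel) = indicator {t<..<1} s * (a s * (\<integral>x. (weight x)\<^sup>2 * m n s x * (q n s x + N n s x) \<partial>lborel))" for s
    by (simp add: F_def)
  have outer: "(\<integral>s. F (s, x) \<partial>lborel) = (weight x)\<^sup>2 * (LINT s:{t<..<1}|lborel. m n s x * (a s * (q n s x + N n s x)))" for x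
  proof -
    have "(\<integral>s. F (s, x) \<partial>lborel) = (\<integral>s. (weight x)\<^sup>2 * (indicator {t<..<1} s * (m n s x * (a s * (q n s x + N n s x)))) \<partial>lborel)"
      by (rule Bochner_Integration.integral_cong) (auto simp: F_def)
    then show ?thesis by (simp add: set_lebesgue_integral_def)
  qed
  have "E n t = (\<integral>x. 2 * (\<integral>s. F (s, x) \<partial>lborel) \<partial>lborel)"
    unfolding E_def sq outer by (simp add: mult_ac)
  also have "\<dots> = 2 * (\<integral>s. \<integral>x. F (s, x) \<partial>lborel \<partial>lborel)" using sw(1) by simp
  finally show "E n t = 2 * (LINT s:{t<..<1}|lborel. a s * (\<integral>x. (weight x)\<^sup>2 * m n s x * (q n s x + N n s x) \<partial>lborel))"
    unfolding inner by (simp add: set_lebesgue_integral_def)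
  show "set_integrable lborel {t<..<1} (\<lambda>s. a s * (\<integral>x. (weight x)\<^sup>2 * m n s x * (q n s x + N n s x) \<partial>lborel))"
    using sw(2) unfolding inner by (simp add: set_integrable_def)
qed

definition err :: "nat \<Rightarrow> real" where "err n = (LINT s:{0<..<1}|lborel. e n s)"

text \<open>Both \<open>N\<close> and \<open>c * Z\<close> converge to \<open>c * z\<close> in the weighted \<open>L^1\<close> norm.\<close>

lemma e_tendsto: "(\<lambda>n. e n t) \<longlonglongrightarrow> 0"
proof -
  have czm: "(\<lambda>y. c (t, y) * z (t, y)) \<in> borel_measurable borel" by measurable
  have up: "e n t \<le> (\<integral>x. weight x * \<bar>N n t x - c (t, x) * z (t, x)\<bar> \<partial>lborel) + Cc * (\<integral>x. weight x * \<bar>Z n t x - z (t, x)\<bar> \<partial>lborel)" for n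
  proof -
    have b1: "\<bar>N n t x - c (t, x) * z (t, x)\<bar> \<le> 2 * (Cc * Cz)" for x using N_bound[of n t x] cz_bound[of "(t, x)"] by linarith
    have b2: "\<bar>Z n t x - z (t, x)\<bar> \<le> 2 * Cz" for x using Z_bound[of n t x] z_bound[of "(t, x)"] by linarith
    have i1: "integrable lborel (\<lambda>x. weight x * \<bar>N n t x - c (t, x) * z (t, x)\<bar>)"
      by (rule weight_abs_int(1)[OF _ b1]) measurable
    have i2: "integrable lborel (\<lambda>x. weight x * \<bar>Z n t x - z (t, x)\<bar>)"
      by (rule weight_abs_int(1)[OF _ b2]) measurable
    have i3: "integrable lborel (\<lambda>x. weight x * \<bar>N n t x - c (t, x) * Z n t x\<bar>)"
      by (rule weight_abs_int(1)[OF _ NcZ_bound]) measurable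
    have "e n t \<le> (\<integral>x. weight x * \<bar>N n t x - c (t, x) * z (t, x)\<bar> + Cc * (weight x * \<bar>Z n t x - z (t, x)\<bar>) \<partial>lborel)"
      unfolding e_def
    proof (rule integral_mono[OF i3])
      show "integrable lborel (\<lambda>x. weight x * \<bar>N n t x - c (t, x) * z (t, x)\<bar> + Cc * (weight x * \<bar>Z n t x - z (t, x)\<bar>))"
        by (intro Bochner_Integration.integrable_add integrable_mult_right i1 i2)
      fix x
      have "\<bar>c (t, x) * (Z n t x - z (t, x))\<bar> \<le> Cc * \<bar>Z n t x - z (t, x)\<bar>"
        unfolding abs_mult by (intro mult_right_mono c_bound) auto
      then have "\<bar>N n t x - c (t, x) * Z n t x\<bar> \<le> \<bar>N n t x - c (t, x) * z (t, x)\<bar> + Cc * \<bar>Z n t x - z (t, x)\<bar>"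
        unfolding right_diff_distrib by linarith
      from mult_left_mono[OF this less_imp_le[OF weight_pos[of x]]]
      show "weight x * \<bar>N n t x - c (t, x) * Z n t x\<bar> \<le> weight x * \<bar>N n t x - c (t, x) * z (t, x)\<bar> + Cc * (weight x * \<bar>Z n t x - z (t, x)\<bar>)"
        by (simp add: distrib_left mult_ac)
    qed
    then show ?thesis
      using Bochner_Integration.integral_add[OF i1 integrable_mult_right[OF i2, of Cc]] by simp
  qed
  have "(\<lambda>n. (\<integral>x. weight x * \<bar>N n t x - c (t, x) * z (t, x)\<bar> \<partial>lborel) + Cc * (\<integral>x. weight x * \<bar>Z n t x - z (t, x)\<bar> \<partial>lborel)) \<longlonglongrightarrow> 0 + Cc * 0"
    unfolding N_def Z_def eps_def
    by (intro tendsto_add tendsto_mult tendsto_const convolve_L1_tendsto[OF czm cz_bound] convolve_L1_tendsto[OF slice_meas(2) z_bound])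
  then have lim: "(\<lambda>n. (\<integral>x. weight x * \<bar>N n t x - c (t, x) * z (t, x)\<bar> \<partial>lborel) + Cc * (\<integral>x. weight x * \<bar>Z n t x - z (t, x)\<bar> \<partial>lborel)) \<longlonglongrightarrow> 0"
    by simp
  show ?thesis
    by (rule tendsto_sandwich[OF _ _ tendsto_const lim]) (auto intro!: always_eventually up e_bound(2))
qed

lemma e_set_integrable: "set_integrable lborel {0<..<1} (e n)"
  unfolding set_integrable_def
proof (rule Bochner_Integration.integrable_bound)
  show "integrable lborel (\<lambda>s. (2 * Cc * Cz * integral\<^sup>L lborel weight) * indicator {0..1::real} s :: real)"
    by (intro integrable_mult_right) auto
  have "norm (indicator {0<..<1} s *\<^sub>R e n s) \<le> norm ((2 * Cc * Cz * integral\<^sup>L lborel weight) * indicator {0..1::real} s :: real)" for s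
    using e_bound(1)[of n s] by (cases "s \<in> {0<..<1}") auto
  then show "AE s in lborel. norm (indicator {0<..<1} s *\<^sub>R e n s) \<le> norm ((2 * Cc * Cz * integral\<^sup>L lborel weight) * indicator {0..1::real} s :: real)"
    by (intro AE_I2)
qed measurable

lemma err_tendsto: "err \<longlonglongrightarrow> 0"
proof -
  have "(\<lambda>n. \<integral>s. indicator {0<..<1} s *\<^sub>R e n s \<partial>lborel) \<longlonglongrightarrow> (\<integral>s. 0 \<partial>(lborel :: real measure))"
  proof (rule integral_dominated_convergence)
    show "integrable lborel (\<lambda>s. (2 * Cc * Cz * integral\<^sup>L lborel weight) * indicator {0..1::real} s :: real)"
      by (intro integrable_mult_right) auto
    show "AE s in lborel. (\<lambda>n. indicator {0<..<1} s *\<^sub>R e n s) \<longlonglongrightarrow> 0"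
      using e_tendsto by (intro AE_I2) (auto intro!: tendsto_mult_right_zero)
    have "norm (indicator {0<..<1} s *\<^sub>R e n s) \<le> (2 * Cc * Cz * integral\<^sup>L lborel weight) * indicator {0..1::real} s" for s n
    proof (cases "s \<in> {0<..<1}")
      case False
      then show ?thesis using e_bound(1)[of n 0] by (auto simp: indicator_def)
    qed (use e_bound(1)[of n s] in auto)
    then show "AE s in lborel. norm (indicator {0<..<1} s *\<^sub>R e n s) \<le> (2 * Cc * Cz * integral\<^sup>L lborel weight) * indicator {0..1::real} s" for n
      by (intro AE_I2)
  qed measurable
  then show ?thesis by (simp add: err_def[abs_def] set_lebesgue_integral_def)
qed

lemma energy_bound:
  assumes M: "\<forall>t\<in>{0..1}. \<forall>x. \<bar>w (t, x)\<bar> \<le> M * (1 + \<bar>x\<bar>)" and t: "t \<in> {0..1}"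
  shows "0 \<le> E n t" "E n t \<le> 8 * M * M * integral\<^sup>L lborel weight"
proof -
  show "0 \<le> E n t" unfolding E_def by (intro integral_nonneg_AE AE_I2) simp
  have "\<bar>E n t\<bar> \<le> (8 * M * M) * integral\<^sup>L lborel weight"
    unfolding E_def
  proof (rule weight_int_bound(2))
    fix x show "\<bar>(weight x)\<^sup>2 * (m n t x)\<^sup>2\<bar> \<le> 8 * M * M * weight x"
      using weight2_mult_bound[OF m_bound[OF M t] m_bound[OF M t], of x n n] by (simp add: power2_eq_square mult.assoc)
  qed measurable
  then show "E n t \<le> 8 * M * M * integral\<^sup>L lborel weight" by simp
qed

lemma energy_inequality:
  assumes M: "\<forall>t\<in>{0..1}. \<forall>x. \<bar>w (t, x)\<bar> \<le> M * (1 + \<bar>x\<bar>)" and t: "t \<in> {0..1}"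
  shows "E n t \<le> (2 * A * ((2 + Cc)\<^sup>2 / 4)) * (LINT s:{t<..<1}|lborel. E n s) + 16 * A * M * err n"
proof -
  have "0 \<le> \<bar>w (0, 0)\<bar>" by simp
  also have "\<dots> \<le> M" using M[rule_format, of 0 0] by simp
  finally have M0: "0 \<le> M" .
  define k where "k = (2 + Cc)\<^sup>2 / 4"
  have k0: "0 \<le> k" by (simp add: k_def)
  define g where "g s = (\<integral>x. (weight x)\<^sup>2 * m n s x * (q n s x + N n s x) \<partial>lborel)" for s
  have iE: "set_integrable lborel {t<..<1} (E n)"
    unfolding set_integrable_def
  proof (rule Bochner_Integration.integrable_bound)
    show "integrable lborel (\<lambda>s. (8 * M * M * integral\<^sup>L lborel weight) * indicator {0..1::real} s :: real)"
      by (intro integrable_mult_right) auto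
    have "norm (indicator {t<..<1} s *\<^sub>R E n s) \<le> norm ((8 * M * M * integral\<^sup>L lborel weight) * indicator {0..1::real} s :: real)" for s
      using energy_bound[OF M, of s n] t by (cases "s \<in> {t<..<1}") auto
    then show "AE s in lborel. norm (indicator {t<..<1} s *\<^sub>R E n s) \<le> norm ((8 * M * M * integral\<^sup>L lborel weight) * indicator {0..1::real} s :: real)"
      by (intro AE_I2)
  qed measurable
  have ie: "set_integrable lborel {t<..<1} (e n)"
    by (rule set_integrable_subset[OF e_set_integrable]) (use t in auto)
  have iR: "set_integrable lborel {t<..<1} (\<lambda>s. A * (k * E n s) + A * (8 * M * e n s))"
    using iE ie by (intro set_integral_add set_integrable_mult_right) auto
  have "E n t = 2 * (LINT s:{t<..<1}|lborel. a s * g s)" unfolding g_def by (rule energy_identity(1)[OF M t])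
  also have "(LINT s:{t<..<1}|lborel. a s * g s) \<le> (LINT s:{t<..<1}|lborel. A * (k * E n s) + A * (8 * M * e n s))"
    unfolding set_lebesgue_integral_def
  proof (rule integral_mono_AE)
    show "integrable lborel (\<lambda>s. indicator {t<..<1} s *\<^sub>R (a s * g s))"
      using energy_identity(2)[OF M t, of n] unfolding g_def set_integrable_def .
    show "integrable lborel (\<lambda>s. indicator {t<..<1} s *\<^sub>R (A * (k * E n s) + A * (8 * M * e n s)))"
      using iR unfolding set_integrable_def .
    show "AE s in lborel. indicator {t<..<1} s *\<^sub>R (a s * g s) \<le> indicator {t<..<1} s *\<^sub>R (A * (k * E n s) + A * (8 * M * e n s))"
      using energy_rate[OF M, of n]
    proof eventually_elim
      case (elim s)
      show ?case
      proof (cases "s \<in> {t<..<1}")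
        case True
        then have s: "s \<in> {0<..<1}" using t by auto
        then have s': "s \<in> {0..1}" by auto
        have R: "0 \<le> k * E n s + 8 * M * e n s"
          using k0 M0 energy_bound(1)[OF M s', of n] e_bound(2)[of n s] by (intro add_nonneg_nonneg mult_nonneg_nonneg) auto
        have "a s * g s \<le> a s * (k * E n s + 8 * M * e n s)"
          using elim s a_nonneg[of s] unfolding g_def k_def by (intro mult_left_mono) auto
        also have "\<dots> \<le> A * (k * E n s + 8 * M * e n s)" by (rule mult_right_mono[OF a_bound R])
        finally show ?thesis using True by (simp add: distrib_left)
      qed simp
    qed
  qed
  also have "\<dots> = A * (k * (LINT s:{t<..<1}|lborel. E n s)) + A * (8 * M * (LINT s:{t<..<1}|lborel. e n s))"
    using set_integral_add(2)[of lborel "{t<..<1}" "\<lambda>s. A * (k * E n s)" "\<lambda>s. A * (8 * M * e n s)"] iE ie by simp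
  also have "(LINT s:{t<..<1}|lborel. e n s) \<le> err n"
    unfolding err_def set_lebesgue_integral_def
    using ie e_set_integrable[of n] e_bound(2)[of n] t
    by (intro integral_mono) (auto simp: set_integrable_def indicator_def)
  finally have "E n t \<le> 2 * (A * (k * (LINT s:{t<..<1}|lborel. E n s)) + A * (8 * M * err n))"
    using c0 M0 by (simp add: mult_left_mono)
  then show ?thesis by (simp add: k_def algebra_simps)
qed

text \<open>Gronwall bounds the energy by a multiple of the commutator error, so the energy tends to \<open>0\<close> as
the mollification is removed. In the limit \<open>w\<close> vanishes almost everywhere, and \<open>w\<close> is continuous.\<close>

theorem difference_zero:
  assumes t: "t \<in> {0..1}" shows "w (t, x) = 0"
proof -
  obtain M where M0: "0 \<le> M" and M: "\<forall>t\<in>{0..1}. \<forall>x. \<bar>w (t, x)\<bar> \<le> M * (1 + \<bar>x\<bar>)" using w_growth by blast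
  define k where "k = 2 * A * ((2 + Cc)\<^sup>2 / 4)"
  have k0: "0 \<le> k" using c0 by (simp add: k_def)
  have up: "E n t \<le> 2 * (16 * A * M * err n) * exp (2 * k + 1)" for n
    by (rule backward_gronwall[OF E_meas energy_bound(1)[OF M] energy_bound(2)[OF M] k0 _ t])
       (use energy_inequality[OF M] in \<open>simp_all add: k_def\<close>)
  have lim: "(\<lambda>n. 2 * (16 * A * M * err n) * exp (2 * k + 1)) \<longlonglongrightarrow> 2 * (16 * A * M * 0) * exp (2 * k + 1)"
    by (intro tendsto_intros err_tendsto)
  have E0: "(\<lambda>n. E n t) \<longlonglongrightarrow> 0"
  proof (rule tendsto_sandwich[OF _ _ tendsto_const])
    show "(\<lambda>n. 2 * (16 * A * M * err n) * exp (2 * k + 1)) \<longlonglongrightarrow> 0"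
      using lim by (simp only: mult_zero_right mult_zero_left)
    show "\<forall>\<^sub>F n in sequentially. E n t \<le> 2 * (16 * A * M * err n) * exp (2 * k + 1)"
      by (intro always_eventually allI up)
    show "\<forall>\<^sub>F n in sequentially. 0 \<le> E n t"
      by (intro always_eventually allI energy_bound(1)[OF M t])
  qed
  have mlim: "(\<lambda>n. m n t x) \<longlonglongrightarrow> w (t, x)" for x
    unfolding m_def eps_def by (rule convolve_tendsto[OF w_slice[OF t]])
  have mm: "\<bar>(weight x)\<^sup>2 * (m n t x)\<^sup>2\<bar> \<le> 8 * M * M * weight x" for n x
    using weight2_mult_bound[OF m_bound[OF M t] m_bound[OF M t], of x n n] by (simp add: power2_eq_square mult.assoc)
  have "(\<lambda>n. E n t) \<longlonglongrightarrow> (\<integral>x. (weight x)\<^sup>2 * (w (t, x))\<^sup>2 \<partial>lborel)"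
    unfolding E_def
  proof (rule integral_dominated_convergence)
    show "integrable lborel (\<lambda>x. 8 * M * M * weight x)" by (intro integrable_mult_right weight_integrable)
    show "AE x in lborel. (\<lambda>n. (weight x)\<^sup>2 * (m n t x)\<^sup>2) \<longlonglongrightarrow> (weight x)\<^sup>2 * (w (t, x))\<^sup>2"
      by (intro AE_I2 tendsto_intros mlim)
    show "AE x in lborel. norm ((weight x)\<^sup>2 * (m n t x)\<^sup>2) \<le> 8 * M * M * weight x" for n
      using mm[where n=n] by (intro AE_I2) (simp only: real_norm_def)
  qed measurable
  from LIMSEQ_unique[OF this E0] have int0: "(\<integral>x. (weight x)\<^sup>2 * (w (t, x))\<^sup>2 \<partial>lborel) = 0" .
  have "\<bar>(weight x)\<^sup>2 * (w (t, x))\<^sup>2\<bar> \<le> 8 * M * M * weight x" for x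
    by (rule LIMSEQ_le_const2[of "\<lambda>n. \<bar>(weight x)\<^sup>2 * (m n t x)\<^sup>2\<bar>"]) (use mm in \<open>auto intro!: tendsto_intros mlim\<close>)
  then have "integrable lborel (\<lambda>x. (weight x)\<^sup>2 * (w (t, x))\<^sup>2)" by (intro weight_int_bound(1)) measurable
  from integral_nonneg_eq_0_iff_AE[OF this] int0
  have "AE x in lborel. (weight x)\<^sup>2 * (w (t, x))\<^sup>2 = 0" by simp
  then have ae: "AE x in lborel. w (t, x) = 0"
    by eventually_elim (use weight_pos in \<open>auto dest: less_imp_neq[symmetric] simp: order.strict_iff_order\<close>)
  have op: "open {x. w (t, x) \<noteq> 0}"
    by (intro open_Collect_neq w_slice[OF t] continuous_intros)
  have "{x. w (t, x) \<noteq> 0} \<in> null_sets lborel"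
    using ae by (subst AE_iff_null_sets) (use op in auto)
  then have "negligible {x. w (t, x) \<noteq> 0}"
    by (simp add: negligible_iff_null_sets null_sets_completionI)
  then have "{x. w (t, x) \<noteq> 0} = {}" using open_not_negligible[OF op] by blast
  then show ?thesis by blast
qed

end

section \<open>The covariance function of a model\<close>

lemma power_series_deriv:
  fixes c :: "nat \<Rightarrow> real"
  assumes sm: "\<And>z. norm z < K \<Longrightarrow> summable (\<lambda>n. c n * z ^ n)" and t: "\<bar>t\<bar> < K"
    and f: "\<And>z. \<bar>z\<bar> < K \<Longrightarrow> f z = (\<Sum>n. c n * z ^ n)"
  shows "(f has_real_derivative (\<Sum>n. diffs c n * t ^ n)) (at t)"
proof (rule has_field_derivative_transform_within_open[where S="{-K<..<K}"])
  show "((\<lambda>z. \<Sum>n. c n * z ^ n) has_real_derivative (\<Sum>n. diffs c n * t ^ n)) (at t)"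
    using t by (intro termdiffs_strong'[OF sm]) auto
qed (use t f in auto)

text \<open>All coefficients of the power series are nonnegative and one of them, of order at least \<open>2\<close>, is
positive. The radius of convergence exceeds \<open>1\<close>, so that the derivatives at the endpoint \<open>1\<close> are
two-sided.\<close>

lemma model_xi:
  assumes "is_model \<xi>\<^sub>0" "\<beta> > 0"
  obtains K where "K > 1"
    "\<And>t. \<bar>t\<bar> < K \<Longrightarrow> (xi' \<xi>\<^sub>0 \<beta> has_real_derivative xi'' \<xi>\<^sub>0 \<beta> t) (at t)"
    "\<And>t. \<bar>t\<bar> < K \<Longrightarrow> isCont (xi'' \<xi>\<^sub>0 \<beta>) t"
    "xi' \<xi>\<^sub>0 \<beta> 0 = 0"
    "\<And>t. 0 \<le> t \<Longrightarrow> t < K \<Longrightarrow> 0 \<le> xi'' \<xi>\<^sub>0 \<beta> t"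
    "\<And>t. 0 < t \<Longrightarrow> t < K \<Longrightarrow> 0 < xi'' \<xi>\<^sub>0 \<beta> t"
    "\<And>s t. 0 \<le> s \<Longrightarrow> s \<le> t \<Longrightarrow> t < K \<Longrightarrow> xi'' \<xi>\<^sub>0 \<beta> s \<le> xi'' \<xi>\<^sub>0 \<beta> t"
proof -
  obtain b e p where b: "\<xi>\<^sub>0 = mixture b" and p: "p \<ge> 2" "b p \<noteq> 0" and e: "e > 0"
    and sm: "summable (\<lambda>p. (b (p + 2))\<^sup>2 * (1 + e) ^ (p + 2))"
    using assms(1) unfolding is_model_def by blast
  define K where "K = 1 + e"
  define c where "c n = (if n < 2 then 0 else \<beta>\<^sup>2 * (b n)\<^sup>2)" for n
  have c0: "0 \<le> c n" for n by (simp add: c_def)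
  have smK: "summable (\<lambda>n. c n * K ^ n)"
  proof (subst summable_iff_shift[symmetric, of _ 2])
    show "summable (\<lambda>n. c (n + 2) * K ^ (n + 2))"
      using summable_mult[OF sm, of "\<beta>\<^sup>2"] by (simp add: c_def K_def mult_ac)
  qed
  have s0: "summable (\<lambda>n. c n * z ^ n)" if "norm z < K" for z :: real
    by (rule powser_inside[OF smK]) (use that in auto)
  have s1: "summable (\<lambda>n. diffs c n * z ^ n)" if "norm z < K" for z :: real
    by (rule termdiff_converges[OF that s0])
  have s2: "summable (\<lambda>n. diffs (diffs c) n * z ^ n)" if "norm z < K" for z :: real
    by (rule termdiff_converges[OF that s1])
  have f0: "xi \<xi>\<^sub>0 \<beta> z = (\<Sum>n. c n * z ^ n)" if "\<bar>z\<bar> < K" for z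
  proof -
    have "(\<Sum>n. c n * z ^ n) = (\<Sum>n. c (n + 2) * z ^ (n + 2)) + (\<Sum>i<2. c i * z ^ i)"
      by (rule suminf_split_initial_segment[OF s0]) (use that in simp)
    also have "(\<Sum>i<2. c i * z ^ i) = 0" by (simp add: c_def)
    also have "(\<Sum>n. c (n + 2) * z ^ (n + 2)) = (\<Sum>n. \<beta>\<^sup>2 * ((b (n + 2))\<^sup>2 * z ^ (n + 2)))"
      by (simp add: c_def mult.assoc)
    also have "\<dots> = \<beta>\<^sup>2 * (\<Sum>n. (b (n + 2))\<^sup>2 * z ^ (n + 2))"
    proof (rule suminf_mult)
      have "summable (\<lambda>n. inverse (\<beta>\<^sup>2) * (c (n + 2) * z ^ (n + 2)))"
        using s0[of z] that by (intro summable_mult summable_ignore_initial_segment) simp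
      moreover have "inverse (\<beta>\<^sup>2) * (c (n + 2) * z ^ (n + 2)) = (b (n + 2))\<^sup>2 * z ^ (n + 2)" for n
        using assms(2) by (simp add: c_def)
      ultimately show "summable (\<lambda>n. (b (n + 2))\<^sup>2 * z ^ (n + 2))" by (simp only:)
    qed
    finally show ?thesis by (simp add: b xi_def mixture_def)
  qed
  have d0: "(xi \<xi>\<^sub>0 \<beta> has_real_derivative (\<Sum>n. diffs c n * z ^ n)) (at z)" if "\<bar>z\<bar> < K" for z
    by (rule power_series_deriv[OF s0 that f0])
  have f1: "xi' \<xi>\<^sub>0 \<beta> z = (\<Sum>n. diffs c n * z ^ n)" if "\<bar>z\<bar> < K" for z
    by (rule DERIV_imp_deriv[OF d0[OF that]])
  have d1: "(xi' \<xi>\<^sub>0 \<beta> has_real_derivative (\<Sum>n. diffs (diffs c) n * z ^ n)) (at z)" if "\<bar>z\<bar> < K" for z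
    by (rule power_series_deriv[OF s1 that f1])
  have f2: "xi'' \<xi>\<^sub>0 \<beta> z = (\<Sum>n. diffs (diffs c) n * z ^ n)" if "\<bar>z\<bar> < K" for z
    by (rule DERIV_imp_deriv[OF d1[OF that]])
  have d2: "(xi'' \<xi>\<^sub>0 \<beta> has_real_derivative (\<Sum>n. diffs (diffs (diffs c)) n * z ^ n)) (at z)" if "\<bar>z\<bar> < K" for z
    by (rule power_series_deriv[OF s2 that f2])
  have dc: "0 \<le> diffs (diffs c) n" for n using c0 by (simp add: diffs_def)
  show ?thesis
  proof (rule that)
    show "K > 1" using e by (simp add: K_def)
    then have K0: "0 < K" by simp
    show "(xi' \<xi>\<^sub>0 \<beta> has_real_derivative xi'' \<xi>\<^sub>0 \<beta> t) (at t)" if "\<bar>t\<bar> < K" for t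
      using d1[OF that] f2[OF that] by simp
    show "isCont (xi'' \<xi>\<^sub>0 \<beta>) t" if "\<bar>t\<bar> < K" for t
      by (rule DERIV_isCont[OF d2[OF that]])
    show "xi' \<xi>\<^sub>0 \<beta> 0 = 0"
      using f1[of 0] K0 by (simp only: powser_zero abs_zero) (simp add: diffs_def c_def)
    show "0 \<le> xi'' \<xi>\<^sub>0 \<beta> t" if "0 \<le> t" "t < K" for t
    proof -
      have "0 \<le> (\<Sum>n. diffs (diffs c) n * t ^ n)"
        using that by (intro suminf_nonneg s2) (auto simp: dc)
      then show ?thesis using f2[of t] that by simp
    qed
    show "0 < xi'' \<xi>\<^sub>0 \<beta> t" if "0 < t" "t < K" for t
    proof -
      obtain k where k: "p = Suc (Suc k)" using p(1) by (metis add_2_eq_Suc le_Suc_ex)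
      then have "0 < diffs (diffs c) (p - 2)"
        using p assms(2) by (simp add: diffs_def c_def zero_less_mult_iff)
      then have "0 < (\<Sum>n. diffs (diffs c) n * t ^ n)"
        using that by (intro suminf_pos2[of _ "p - 2"] s2) (auto simp: dc)
      then show ?thesis using f2[of t] that by simp
    qed
    show "xi'' \<xi>\<^sub>0 \<beta> s \<le> xi'' \<xi>\<^sub>0 \<beta> t" if "0 \<le> s" "s \<le> t" "t < K" for s t
    proof -
      have "(\<Sum>n. diffs (diffs c) n * s ^ n) \<le> (\<Sum>n. diffs (diffs c) n * t ^ n)"
        using that dc by (intro suminf_le s2 mult_left_mono power_mono) auto
      then show ?thesis using f2[of s] f2[of t] that by simp
    qed
  qed
qed

section \<open>Gaussian averages and the heat equation\<close>

abbreviation gauss :: "real measure" where "gauss \<equiv> density lborel std_normal_density"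

lemma gauss_prob: "prob_space gauss"
  by (rule prob_space_normal_density) simp

lemma gauss_space [simp]: "space gauss = UNIV" "sets gauss = sets borel"
  by auto

lemma gauss_meas_iff [simp]: "borel_measurable gauss = borel_measurable (borel :: real measure)"
  by (rule measurable_cong_sets) auto

lemma gauss_integral:
  fixes f :: "real \<Rightarrow> real"
  assumes "f \<in> borel_measurable borel"
  shows "integral\<^sup>L gauss f = (\<integral>z. std_normal_density z * f z \<partial>lborel)"
    "integrable gauss f \<longleftrightarrow> integrable lborel (\<lambda>z. std_normal_density z * f z)"
  using assms by (auto simp: integral_density integrable_density)

lemma gauss_exp: "integrable gauss (\<lambda>z. exp (B * z))" "(\<integral>z. exp (B * z) \<partial>gauss) = exp (B\<^sup>2 / 2)"
proof -
  have e: "std_normal_density z * exp (B * z) = exp (B\<^sup>2 / 2) * normal_density B 1 z" for z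
  proof -
    have "- (z\<^sup>2 / 2) + B * z = B\<^sup>2 / 2 - (z - B)\<^sup>2 / 2"
      by (simp add: power2_eq_square field_simps)
    then have "exp (- (z\<^sup>2 / 2)) * exp (B * z) = exp (B\<^sup>2 / 2) * exp (- ((z - B)\<^sup>2 / 2))"
      by (simp add: exp_add[symmetric])
    then show ?thesis by (simp add: normal_density_def)
  qed
  show "integrable gauss (\<lambda>z. exp (B * z))" "(\<integral>z. exp (B * z) \<partial>gauss) = exp (B\<^sup>2 / 2)"
    by (subst gauss_integral; simp add: e)+
qed

lemma gauss_exp_abs: "integrable gauss (\<lambda>z. exp (B * \<bar>z\<bar>))"
proof (rule Bochner_Integration.integrable_bound)
  show "integrable gauss (\<lambda>z. exp (B * z) + exp ((- B) * z))"
    by (intro Bochner_Integration.integrable_add gauss_exp)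
  show "AE z in gauss. norm (exp (B * \<bar>z\<bar>)) \<le> norm (exp (B * z) + exp ((- B) * z))"
  proof (rule AE_I2)
    fix z
    have "0 \<le> exp (B * z) + exp ((- B) * z)" by (intro add_nonneg_nonneg) auto
    moreover have "exp (B * \<bar>z\<bar>) \<le> exp (B * z) + exp ((- B) * z)" by (cases "z \<ge> 0") auto
    ultimately show "norm (exp (B * \<bar>z\<bar>)) \<le> norm (exp (B * z) + exp ((- B) * z))" by simp
  qed
qed simp

text \<open>The class of functions on which Gaussian averages are taken: it contains \<open>cosh\<close> and \<open>log cosh\<close>,
is closed under all operations needed below, and guarantees integrability against every Gaussian.\<close>

definition exp_growth :: "(real \<Rightarrow> real) \<Rightarrow> bool" where
  "exp_growth f \<longleftrightarrow> continuous_on UNIV f \<and> (\<exists>A B. \<forall>x. \<bar>f x\<bar> \<le> A * exp (B * \<bar>x\<bar>))"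

lemma exp_growthE:
  assumes "exp_growth f"
  obtains A B where "0 \<le> A" "0 \<le> B" "\<And>x. \<bar>f x\<bar> \<le> A * exp (B * \<bar>x\<bar>)"
proof -
  obtain A B where b: "\<And>x. \<bar>f x\<bar> \<le> A * exp (B * \<bar>x\<bar>)" using assms unfolding exp_growth_def by blast
  have A: "0 \<le> A" using b[of 0] by simp
  have "\<bar>f x\<bar> \<le> A * exp (\<bar>B\<bar> * \<bar>x\<bar>)" for x
    by (rule order_trans[OF b]) (use A in \<open>auto intro!: mult_left_mono mult_right_mono\<close>)
  then show ?thesis using that[OF A, of "\<bar>B\<bar>"] by simp
qed

lemma exp_growth_cont: "exp_growth f \<Longrightarrow> continuous_on S f"
  unfolding exp_growth_def by (auto intro: continuous_on_subset)

lemma exp_growth_meas [measurable_dest]: "exp_growth f \<Longrightarrow> f \<in> borel_measurable borel"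
  by (rule borel_measurable_continuous_onI[OF exp_growth_cont])

lemma exp_growthI: "continuous_on UNIV f \<Longrightarrow> (\<And>x. \<bar>f x\<bar> \<le> A * exp (B * \<bar>x\<bar>)) \<Longrightarrow> exp_growth f"
  unfolding exp_growth_def by blast

lemma exp_growth_bounded: "continuous_on UNIV f \<Longrightarrow> (\<And>x. \<bar>f x\<bar> \<le> C) \<Longrightarrow> exp_growth f"
  by (rule exp_growthI[of f C 0]) auto

lemma exp_growth_mult: assumes "exp_growth f" "exp_growth g" shows "exp_growth (\<lambda>x. f x * g x)"
proof -
  obtain A B where f: "0 \<le> A" "\<And>x. \<bar>f x\<bar> \<le> A * exp (B * \<bar>x\<bar>)" using exp_growthE[OF assms(1)] by metis
  obtain A' B' where g: "0 \<le> A'" "\<And>x. \<bar>g x\<bar> \<le> A' * exp (B' * \<bar>x\<bar>)" using exp_growthE[OF assms(2)] by metis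
  show ?thesis
  proof (rule exp_growthI[of _ "A * A'" "B + B'"])
    show "continuous_on UNIV (\<lambda>x. f x * g x)" by (intro continuous_intros exp_growth_cont assms)
    fix x
    have "\<bar>f x\<bar> * \<bar>g x\<bar> \<le> (A * exp (B * \<bar>x\<bar>)) * (A' * exp (B' * \<bar>x\<bar>))"
      using f g by (intro mult_mono) auto
    then show "\<bar>f x * g x\<bar> \<le> A * A' * exp ((B + B') * \<bar>x\<bar>)"
      unfolding distrib_right exp_add abs_mult by (simp only: mult_ac)
  qed
qed

lemma exp_growth_add: assumes "exp_growth f" "exp_growth g" shows "exp_growth (\<lambda>x. f x + g x)"
proof -
  obtain A B where f: "0 \<le> A" "0 \<le> B" "\<And>x. \<bar>f x\<bar> \<le> A * exp (B * \<bar>x\<bar>)" using exp_growthE[OF assms(1)] by metis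
  obtain A' B' where g: "0 \<le> A'" "0 \<le> B'" "\<And>x. \<bar>g x\<bar> \<le> A' * exp (B' * \<bar>x\<bar>)" using exp_growthE[OF assms(2)] by metis
  show ?thesis
  proof (rule exp_growthI[of _ "A + A'" "B + B'"])
    show "continuous_on UNIV (\<lambda>x. f x + g x)" by (intro continuous_intros exp_growth_cont assms)
    fix x
    have "A * exp (B * \<bar>x\<bar>) \<le> A * exp ((B + B') * \<bar>x\<bar>)" "A' * exp (B' * \<bar>x\<bar>) \<le> A' * exp ((B + B') * \<bar>x\<bar>)"
      using f g by (auto intro!: mult_left_mono mult_right_mono)
    then show "\<bar>f x + g x\<bar> \<le> (A + A') * exp ((B + B') * \<bar>x\<bar>)"
      using f(3)[of x] g(3)[of x] abs_triangle_ineq[of "f x" "g x"] unfolding distrib_right[of A A'] by linarith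
  qed
qed

lemma exp_growth_const: "exp_growth (\<lambda>x. c)"
  by (rule exp_growth_bounded[of _ "\<bar>c\<bar>"]) auto

lemma exp_growth_cmult: "exp_growth f \<Longrightarrow> exp_growth (\<lambda>x. c * f x)"
  by (rule exp_growth_mult[OF exp_growth_const])

lemma exp_growth_id: "exp_growth (\<lambda>x. x)"
proof (rule exp_growthI[of _ 1 1])
  fix x :: real
  have "\<bar>x\<bar> \<le> exp \<bar>x\<bar>" using exp_ge_add_one_self[of "\<bar>x\<bar>"] by linarith
  then show "\<bar>x\<bar> \<le> 1 * exp (1 * \<bar>x\<bar>)" by simp
qed simp

lemma exp_growth_affine: assumes "exp_growth f" shows "exp_growth (\<lambda>z. f (x + s * z))"
proof -
  obtain A B where f: "0 \<le> A" "0 \<le> B" "\<And>x. \<bar>f x\<bar> \<le> A * exp (B * \<bar>x\<bar>)" using exp_growthE[OF assms] by metis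
  show ?thesis
  proof (rule exp_growthI[of _ "A * exp (B * \<bar>x\<bar>)" "B * \<bar>s\<bar>"])
    show "continuous_on UNIV (\<lambda>z. f (x + s * z))"
      by (intro continuous_on_compose2[OF exp_growth_cont[OF assms, of UNIV]] continuous_intros) auto
    fix z
    have "B * \<bar>x + s * z\<bar> \<le> B * (\<bar>x\<bar> + \<bar>s\<bar> * \<bar>z\<bar>)"
      using abs_triangle_ineq[of x "s * z"] f(2) by (intro mult_left_mono) (auto simp: abs_mult)
    then have "A * exp (B * \<bar>x + s * z\<bar>) \<le> A * exp (B * \<bar>x\<bar> + B * \<bar>s\<bar> * \<bar>z\<bar>)"
      using f(1) by (intro mult_left_mono) (auto simp: distrib_left mult.assoc)
    then show "\<bar>f (x + s * z)\<bar> \<le> A * exp (B * \<bar>x\<bar>) * exp (B * \<bar>s\<bar> * \<bar>z\<bar>)"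
      using f(3)[of "x + s * z"] by (simp add: exp_add mult.assoc)
  qed
qed

lemma exp_growth_integrable: assumes "exp_growth f" shows "integrable gauss f"
proof -
  obtain A B where f: "0 \<le> A" "\<And>x. \<bar>f x\<bar> \<le> A * exp (B * \<bar>x\<bar>)" using exp_growthE[OF assms] by metis
  show ?thesis
    by (rule Bochner_Integration.integrable_bound[OF integrable_mult_right[OF gauss_exp_abs, of A B]])
       (use f exp_growth_meas[OF assms] in \<open>auto\<close>)
qed

text \<open>The expectation of \<open>f (x + s Z)\<close>. The standard deviation \<open>s\<close> is the parameter, rather than the
variance, because the average is differentiable in \<open>s\<close> at \<open>0\<close>; the heat semigroup is
\<open>v \<mapsto> gauss_avg (sqrt v) f\<close>.\<close>

definition gauss_avg :: "real \<Rightarrow> (real \<Rightarrow> real) \<Rightarrow> real \<Rightarrow> real" where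
  "gauss_avg s f x = (\<integral>z. f (x + s * z) \<partial>gauss)"

lemma gauss_avg_0: "gauss_avg 0 f x = f x"
  using prob_space.prob_space[OF gauss_prob] by (simp add: gauss_avg_def)

lemma gauss_avg_integrable: "exp_growth f \<Longrightarrow> integrable gauss (\<lambda>z. f (x + s * z))"
  by (intro exp_growth_integrable exp_growth_affine)

lemma exp_growth_uniform:
  assumes "exp_growth f"
  shows "\<exists>C D. 0 \<le> C \<and> (\<forall>x s z. \<bar>x\<bar> \<le> X \<longrightarrow> \<bar>s\<bar> \<le> S \<longrightarrow> \<bar>f (x + s * z)\<bar> \<le> C * exp (D * \<bar>z\<bar>))"
proof -
  obtain A B where f: "0 \<le> A" "0 \<le> B" "\<And>x. \<bar>f x\<bar> \<le> A * exp (B * \<bar>x\<bar>)" using exp_growthE[OF assms] by metis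
  have "\<bar>f (x + s * z)\<bar> \<le> (A * exp (B * X)) * exp ((B * S) * \<bar>z\<bar>)" if "\<bar>x\<bar> \<le> X" "\<bar>s\<bar> \<le> S" for x s z
  proof -
    have "\<bar>x + s * z\<bar> \<le> \<bar>x\<bar> + \<bar>s\<bar> * \<bar>z\<bar>" using abs_triangle_ineq[of x "s * z"] by (simp add: abs_mult)
    also have "\<dots> \<le> X + S * \<bar>z\<bar>" using that by (intro add_mono mult_right_mono) auto
    finally have "B * \<bar>x + s * z\<bar> \<le> B * (X + S * \<bar>z\<bar>)" using f(2) by (rule mult_left_mono)
    then have "A * exp (B * \<bar>x + s * z\<bar>) \<le> A * exp (B * X + B * S * \<bar>z\<bar>)"
      using f(1) by (intro mult_left_mono) (auto simp: distrib_left mult.assoc)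
    then show ?thesis
      using f(3)[of "x + s * z"] by (simp add: exp_add mult.assoc)
  qed
  then show ?thesis using f(1) by (intro exI[of _ "A * exp (B * X)"] exI[of _ "B * S"]) auto
qed

lemma gauss_avg_continuous:
  assumes f: "exp_growth f"
  shows "continuous_on UNIV (\<lambda>(s, x). gauss_avg s f x)"
proof (rule continuous_on_sequentiallyI)
  fix u :: "nat \<Rightarrow> real \<times> real" and a assume u: "u \<longlonglongrightarrow> a"
  have l: "(\<lambda>n. fst (u n)) \<longlonglongrightarrow> fst a" "(\<lambda>n. snd (u n)) \<longlonglongrightarrow> snd a"
    using u by (auto intro: tendsto_fst tendsto_snd)
  obtain S where S: "\<And>n. \<bar>fst (u n)\<bar> \<le> S"
    using convergent_imp_Bseq[OF convergentI[OF l(1)]] unfolding Bseq_def by auto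
  obtain X where X: "\<And>n. \<bar>snd (u n)\<bar> \<le> X"
    using convergent_imp_Bseq[OF convergentI[OF l(2)]] unfolding Bseq_def by auto
  obtain C D where CD: "\<forall>x s z. \<bar>x\<bar> \<le> X \<longrightarrow> \<bar>s\<bar> \<le> S \<longrightarrow> \<bar>f (x + s * z)\<bar> \<le> C * exp (D * \<bar>z\<bar>)"
    using exp_growth_uniform[OF f] by blast
  have fm [measurable]: "f \<in> borel_measurable borel" by (rule exp_growth_meas[OF f])
  have "(\<lambda>n. \<integral>z. f (snd (u n) + fst (u n) * z) \<partial>gauss) \<longlonglongrightarrow> (\<integral>z. f (snd a + fst a * z) \<partial>gauss)"
  proof (rule integral_dominated_convergence)
    show "integrable gauss (\<lambda>z. C * exp (D * \<bar>z\<bar>))" by (intro integrable_mult_right gauss_exp_abs)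
    show "AE z in gauss. (\<lambda>n. f (snd (u n) + fst (u n) * z)) \<longlonglongrightarrow> f (snd a + fst a * z)"
      by (intro AE_I2 isCont_tendsto_compose[of _ f] tendsto_intros l)
         (use exp_growth_cont[OF f, of UNIV] in \<open>simp add: continuous_on_eq_continuous_at\<close>)
    show "AE z in gauss. norm (f (snd (u n) + fst (u n) * z)) \<le> C * exp (D * \<bar>z\<bar>)" for n
      using CD S[of n] X[of n] by (intro AE_I2) simp
  qed simp_all
  then show "(\<lambda>n. case u n of (s, x) \<Rightarrow> gauss_avg s f x) \<longlonglongrightarrow> (case a of (s, x) \<Rightarrow> gauss_avg s f x)"
    by (simp add: gauss_avg_def case_prod_beta)
qed

text \<open>Differentiation under the Gaussian integral by dominated convergence, with an argument affine in
the parameter; the derivatives of \<open>gauss_avg\<close> in \<open>s\<close> and in \<open>x\<close> are the two instances.\<close>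

lemma deriv_under_gauss:
  fixes f f' :: "real \<Rightarrow> real" and k d :: "real \<Rightarrow> real"
  assumes d: "\<And>x. (f has_real_derivative f' x) (at x)" and e: "exp_growth f" "exp_growth f'"
    and [measurable]: "k \<in> borel_measurable borel" "d \<in> borel_measurable borel"
    and k: "\<And>z. \<bar>k z\<bar> \<le> k0 * (1 + \<bar>z\<bar>)" and dz: "\<And>z. \<bar>d z\<bar> \<le> 1 + \<bar>z\<bar>"
  shows "((\<lambda>h. \<integral>z. f (k z + h * d z) \<partial>gauss) has_real_derivative (\<integral>z. f' (k z + h * d z) * d z \<partial>gauss)) (at h)"
proof -
  have fm [measurable]: "f \<in> borel_measurable borel" "f' \<in> borel_measurable borel" by (intro exp_growth_meas e)+
  have cf': "isCont f' x" for x using exp_growth_cont[OF e(2), of UNIV] by (simp add: continuous_on_eq_continuous_at)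
  obtain A B where f: "0 \<le> A" "0 \<le> B" "\<And>x. \<bar>f x\<bar> \<le> A * exp (B * \<bar>x\<bar>)" using exp_growthE[OF e(1)] by metis
  obtain A' B' where f': "0 \<le> A'" "0 \<le> B'" "\<And>x. \<bar>f' x\<bar> \<le> A' * exp (B' * \<bar>x\<bar>)" using exp_growthE[OF e(2)] by metis
  have k00: "0 \<le> k0" using k[of 0] by simp
  have lin: "\<bar>k z + h * d z\<bar> \<le> (k0 + \<bar>h\<bar>) * (1 + \<bar>z\<bar>)" for h z
  proof -
    have "\<bar>k z + h * d z\<bar> \<le> k0 * (1 + \<bar>z\<bar>) + \<bar>h\<bar> * (1 + \<bar>z\<bar>)"
      using k[of z] mult_left_mono[OF dz[of z], of "\<bar>h\<bar>"] abs_triangle_ineq[of "k z" "h * d z"] by (simp add: abs_mult)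
    then show ?thesis by (simp add: distrib_right)
  qed
  have int: "integrable gauss (\<lambda>z. f (k z + h * d z))" for h
  proof (rule Bochner_Integration.integrable_bound)
    show "integrable gauss (\<lambda>z. (A * exp (B * (k0 + \<bar>h\<bar>))) * exp ((B * (k0 + \<bar>h\<bar>)) * \<bar>z\<bar>))"
      by (intro integrable_mult_right gauss_exp_abs)
    show "AE z in gauss. norm (f (k z + h * d z)) \<le> norm ((A * exp (B * (k0 + \<bar>h\<bar>))) * exp ((B * (k0 + \<bar>h\<bar>)) * \<bar>z\<bar>))"
    proof (rule AE_I2)
      fix z
      have "A * exp (B * \<bar>k z + h * d z\<bar>) \<le> A * exp (B * ((k0 + \<bar>h\<bar>) * (1 + \<bar>z\<bar>)))"
        using f lin by (intro mult_left_mono) (auto intro!: mult_left_mono)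
      also have "\<dots> = (A * exp (B * (k0 + \<bar>h\<bar>))) * exp ((B * (k0 + \<bar>h\<bar>)) * \<bar>z\<bar>)"
        by (simp add: distrib_left mult.assoc exp_add)
      finally have "A * exp (B * \<bar>k z + h * d z\<bar>) \<le> (A * exp (B * (k0 + \<bar>h\<bar>))) * exp ((B * (k0 + \<bar>h\<bar>)) * \<bar>z\<bar>)" .
      with f(3)[of "k z + h * d z"] f(1)
      show "norm (f (k z + h * d z)) \<le> norm ((A * exp (B * (k0 + \<bar>h\<bar>))) * exp ((B * (k0 + \<bar>h\<bar>)) * \<bar>z\<bar>))" by simp
    qed
  qed simp
  show ?thesis
    unfolding has_field_derivative_iff tendsto_at_iff_sequentially comp_def
  proof (intro allI impI)
    fix X :: "nat \<Rightarrow> real" assume X: "\<forall>i. X i \<in> UNIV - {h}" "X \<longlonglongrightarrow> h"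
    obtain H0 where H0: "\<And>n. \<bar>X n\<bar> \<le> H0"
      using convergent_imp_bounded[OF X(2)] unfolding bounded_iff by auto
    define H where "H = max H0 \<bar>h\<bar>"
    have H: "\<bar>X n\<bar> \<le> H" "\<bar>h\<bar> \<le> H" for n using H0[of n] by (auto simp: H_def)
    have H00: "0 \<le> H" using H(2) by linarith
    define D where "D = B' * (k0 + H)"
    have "(\<lambda>n. \<integral>z. (f (k z + X n * d z) - f (k z + h * d z)) / (X n - h) \<partial>gauss)
       \<longlonglongrightarrow> (\<integral>z. f' (k z + h * d z) * d z \<partial>gauss)"
    proof (rule integral_dominated_convergence)
      show "integrable gauss (\<lambda>z. (A' * exp D) * exp ((D + 1) * \<bar>z\<bar>))" by (intro integrable_mult_right gauss_exp_abs)
      show "AE z in gauss. (\<lambda>n. (f (k z + X n * d z) - f (k z + h * d z)) / (X n - h)) \<longlonglongrightarrow> f' (k z + h * d z) * d z"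
      proof (rule AE_I2)
        fix z
        have "((\<lambda>h. k z + h * d z) has_real_derivative d z) (at h)"
          by (auto intro!: derivative_eq_intros)
        from DERIV_chain2[OF d this]
        show "(\<lambda>n. (f (k z + X n * d z) - f (k z + h * d z)) / (X n - h)) \<longlonglongrightarrow> f' (k z + h * d z) * d z"
          using X unfolding has_field_derivative_iff tendsto_at_iff_sequentially comp_def by blast
      qed
      show "AE z in gauss. norm ((f (k z + X n * d z) - f (k z + h * d z)) / (X n - h)) \<le> (A' * exp D) * exp ((D + 1) * \<bar>z\<bar>)" for n
      proof (rule AE_I2)
        fix z
        define R where "R = (k0 + H) * (1 + \<bar>z\<bar>)"
        have "norm (f (k z + X n * d z) - f (k z + h * d z)) \<le> (A' * exp (B' * R)) * norm ((k z + X n * d z) - (k z + h * d z))"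
        proof (rule field_differentiable_bound[of "{-R..R}" f f'])
          show "convex {-R..R}" by simp
          show "(f has_real_derivative f' x) (at x within {-R..R})" for x by (rule has_field_derivative_at_within[OF d])
          show "norm (f' x) \<le> A' * exp (B' * R)" if "x \<in> {-R..R}" for x
          proof -
            have "A' * exp (B' * \<bar>x\<bar>) \<le> A' * exp (B' * R)"
              using f' that by (intro mult_left_mono) (auto intro!: mult_left_mono)
            then show ?thesis using f'(3)[of x] by simp
          qed
          have R: "\<bar>k z + h' * d z\<bar> \<le> R" if "\<bar>h'\<bar> \<le> H" for h'
            by (rule order_trans[OF lin]) (use that in \<open>auto simp: R_def intro!: mult_right_mono\<close>)
          show "k z + X n * d z \<in> {-R..R}" "k z + h * d z \<in> {-R..R}" using R[OF H(1)[of n]] R[OF H(2)] by auto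
        qed
        also have "(k z + X n * d z) - (k z + h * d z) = (X n - h) * d z" by (simp add: algebra_simps)
        finally have "norm ((f (k z + X n * d z) - f (k z + h * d z)) / (X n - h)) \<le> (A' * exp (B' * R)) * \<bar>d z\<bar>"
          using X(1)[rule_format, of n] by (simp add: abs_mult divide_le_eq mult_ac)
        also have "\<dots> \<le> (A' * exp (B' * R)) * exp \<bar>z\<bar>"
          using f'(1) order_trans[OF dz[of z] exp_ge_add_one_self[of "\<bar>z\<bar>"]] by (intro mult_left_mono) auto
        also have "\<dots> = (A' * exp D) * exp ((D + 1) * \<bar>z\<bar>)"
          by (simp add: R_def D_def exp_add distrib_left distrib_right mult_ac)
        finally show "norm ((f (k z + X n * d z) - f (k z + h * d z)) / (X n - h)) \<le> (A' * exp D) * exp ((D + 1) * \<bar>z\<bar>)" .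
      qed
    qed simp_all
    moreover have "(\<integral>z. (f (k z + X n * d z) - f (k z + h * d z)) / (X n - h) \<partial>gauss)
      = ((\<integral>z. f (k z + X n * d z) \<partial>gauss) - (\<integral>z. f (k z + h * d z) \<partial>gauss)) / (X n - h)" for n
      using int by simp
    ultimately show "(\<lambda>n. ((\<integral>z. f (k z + X n * d z) \<partial>gauss) - (\<integral>z. f (k z + h * d z) \<partial>gauss)) / (X n - h))
      \<longlonglongrightarrow> (\<integral>z. f' (k z + h * d z) * d z \<partial>gauss)" by (simp only:)
  qed
qed

lemma gauss_avg_deriv_x:
  assumes "\<And>x. (f has_real_derivative f' x) (at x)" "exp_growth f" "exp_growth f'"
  shows "(gauss_avg s f has_real_derivative gauss_avg s f' x) (at x)"
proof -
  have "((\<lambda>h. \<integral>z. f (s * z + h * 1) \<partial>gauss) has_real_derivative (\<integral>z. f' (s * z + x * 1) * 1 \<partial>gauss)) (at x)"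
    by (rule deriv_under_gauss[OF assms, of _ _ "\<bar>s\<bar>"]) (auto simp: abs_mult distrib_left)
  then show ?thesis by (simp add: gauss_avg_def[abs_def] add.commute)
qed

lemma gauss_avg_deriv_s:
  assumes "\<And>x. (f has_real_derivative f' x) (at x)" "exp_growth f" "exp_growth f'"
  shows "((\<lambda>s. gauss_avg s f x) has_real_derivative (\<integral>z. f' (x + s * z) * z \<partial>gauss)) (at s)"
  unfolding gauss_avg_def
  by (rule deriv_under_gauss[OF assms, of _ _ "\<bar>x\<bar>"]) (auto simp: distrib_left)

lemma exp_linear_gauss_tendsto: "((\<lambda>x::real. exp (B * \<bar>x\<bar>) * std_normal_density x) \<longlongrightarrow> 0) at_top"
  "((\<lambda>x::real. exp (B * \<bar>x\<bar>) * std_normal_density x) \<longlongrightarrow> 0) at_bot"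
proof -
  have t: "((\<lambda>x::real. exp (B * x) * std_normal_density x) \<longlongrightarrow> 0) at_top"
  proof -
    have lim: "((\<lambda>x::real. 1 / sqrt (2 * pi) * exp (- x)) \<longlongrightarrow> 0) at_top" by real_asymp
    show ?thesis
    proof (rule Lim_null_comparison[OF _ lim])
      show "\<forall>\<^sub>F x in at_top. norm (exp (B * x) * std_normal_density x) \<le> 1 / sqrt (2 * pi) * exp (- x)"
        using eventually_ge_at_top[of "2 * \<bar>B\<bar> + 2"]
      proof eventually_elim
        case (elim x)
        then have "B + 1 \<le> x / 2" "0 \<le> x" by linarith+
        then have "(B + 1) * x \<le> x / 2 * x" by (rule mult_right_mono)
        then have "B * x + - x\<^sup>2 / 2 \<le> - x" by (simp add: power2_eq_square distrib_right)
        then have "exp (B * x) * exp (- x\<^sup>2 / 2) \<le> exp (- x)" by (simp only: exp_add[symmetric] exp_le_cancel_iff)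
        then show ?case by (simp add: std_normal_density_def divide_right_mono)
      qed
    qed
  qed
  show t1: "((\<lambda>x::real. exp (B * \<bar>x\<bar>) * std_normal_density x) \<longlongrightarrow> 0) at_top"
    by (rule Lim_transform_eventually[OF t]) (auto intro!: eventually_mono[OF eventually_ge_at_top[of 0]])
  show "((\<lambda>x::real. exp (B * \<bar>x\<bar>) * std_normal_density x) \<longlongrightarrow> 0) at_bot"
    unfolding filterlim_at_bot_mirror using t1 by (simp add: std_normal_density_def)
qed

text \<open>Gaussian integration by parts: \<open>g z * z - g' z\<close> times the density is minus the derivative of \<open>g\<close>
times the density.\<close>

lemma stein:
  assumes d: "\<And>x. (g has_real_derivative g' x) (at x)" and e: "exp_growth g" "exp_growth g'"
  shows "(\<integral>z. g z * z \<partial>gauss) = (\<integral>z. g' z \<partial>gauss)"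
proof -
  obtain A B where f: "0 \<le> A" "\<And>x. \<bar>g x\<bar> \<le> A * exp (B * \<bar>x\<bar>)" using exp_growthE[OF e(1)] by metis
  have i1: "integrable gauss (\<lambda>z. g z * z)" by (intro exp_growth_integrable exp_growth_mult e exp_growth_id)
  have i2: "integrable gauss g'" by (intro exp_growth_integrable e)
  have m [measurable]: "g \<in> borel_measurable borel" "g' \<in> borel_measurable borel" by (intro exp_growth_meas e)+
  define G where "G z = std_normal_density z * g z" for z
  have cn: "continuous_on UNIV std_normal_density"
    unfolding std_normal_density_def by (intro continuous_intros) auto
  have "(\<integral>z. std_normal_density z * (g' z - g z * z) \<partial>lborel) = 0"
  proof (rule integral_deriv_zero[of G])
    show "(G has_real_derivative std_normal_density x * (g' x - g x * x)) (at x)" for x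
    proof -
      have "(std_normal_density has_real_derivative std_normal_density x * (- x)) (at x)"
      proof -
        have "((\<lambda>x. exp (- x\<^sup>2 / 2)) has_real_derivative exp (- x\<^sup>2 / 2) * (- x)) (at x)"
          by (auto intro!: derivative_eq_intros)
        from DERIV_cmult[OF this, of "1 / sqrt (2 * pi)"] show ?thesis
          by (simp only: std_normal_density_def[abs_def] mult.assoc)
      qed
      from DERIV_mult[OF this d[of x]] show ?thesis by (simp add: G_def[abs_def] algebra_simps)
    qed
    show "continuous_on UNIV (\<lambda>x. std_normal_density x * (g' x - g x * x))"
      by (intro continuous_intros cn exp_growth_cont e)
    show "integrable lborel (\<lambda>x. std_normal_density x * (g' x - g x * x))"
      using Bochner_Integration.integrable_diff[OF i2 i1] by (subst (asm) gauss_integral(2)) auto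
    have b: "norm (G x) \<le> A * (exp (B * \<bar>x\<bar>) * std_normal_density x)" for x
      using mult_right_mono[OF f(2)[of x] normal_density_nonneg[of 0 1 x]] by (simp add: G_def abs_mult mult_ac)
    show "(G \<longlongrightarrow> 0) at_top"
      by (rule Lim_null_comparison[OF _ tendsto_mult_right_zero[OF exp_linear_gauss_tendsto(1)], of _ A B]) (intro always_eventually allI b)
    show "(G \<longlongrightarrow> 0) at_bot"
      by (rule Lim_null_comparison[OF _ tendsto_mult_right_zero[OF exp_linear_gauss_tendsto(2)], of _ A B]) (intro always_eventually allI b)
  qed
  then have "(\<integral>z. g' z - g z * z \<partial>gauss) = 0" by (subst gauss_integral(1)) auto
  then show ?thesis using i1 i2 by simp
qed

text \<open>The derivative in \<open>s = sqrt v\<close> is the expectation of \<open>f' (x + s Z) * Z\<close>, which Stein's identity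
turns into \<open>s\<close> times the average of \<open>f''\<close>; the factor \<open>s\<close> cancels against the derivative of the
square root.\<close>

lemma heat_deriv:
  assumes d1: "\<And>x. (f has_real_derivative f' x) (at x)" and d2: "\<And>x. (f' has_real_derivative f'' x) (at x)"
    and e: "exp_growth f" "exp_growth f'" "exp_growth f''" and v: "v > 0"
  shows "((\<lambda>v. gauss_avg (sqrt v) f x) has_real_derivative 1 / 2 * gauss_avg (sqrt v) f'' x) (at v)"
proof -
  define s where "s = sqrt v"
  have s: "s > 0" using v by (simp add: s_def)
  have dd: "((\<lambda>z. f' (x + s * z)) has_real_derivative s * f'' (x + s * z)) (at z)" for z
  proof -
    have "((\<lambda>z. x + s * z) has_real_derivative s) (at z)" by (auto intro!: derivative_eq_intros)
    from DERIV_chain2[OF d2 this] show ?thesis by (simp add: mult.commute)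
  qed
  have st: "(\<integral>z. f' (x + s * z) * z \<partial>gauss) = s * gauss_avg s f'' x"
    unfolding gauss_avg_def using stein[OF dd exp_growth_affine[OF e(2)] exp_growth_cmult[OF exp_growth_affine[OF e(3)]]] by simp
  have "((\<lambda>v. gauss_avg (sqrt v) f x) has_real_derivative (s * gauss_avg s f'' x) * (inverse (sqrt v) / 2)) (at v)"
    using DERIV_chain2[OF gauss_avg_deriv_s[OF d1 e(1,2)] DERIV_real_sqrt[OF v], of x] st by (simp add: s_def)
  moreover have "(s * gauss_avg s f'' x) * (inverse (sqrt v) / 2) = 1 / 2 * gauss_avg (sqrt v) f'' x"
    using s by (simp add: s_def field_simps)
  ultimately show ?thesis by (simp only:)
qed

lemma heat_continuous:
  assumes "exp_growth f"
  shows "continuous_on ({0..} \<times> UNIV) (\<lambda>(v, x). gauss_avg (sqrt v) f x)"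
  unfolding case_prod_beta
  by (rule continuous_on_compose2[OF gauss_avg_continuous[OF assms], of _ "\<lambda>z. (sqrt (fst z), snd z)", unfolded case_prod_beta fst_conv snd_conv])
     (auto intro!: continuous_intros)

section \<open>Uniqueness of weak solutions\<close>

lemma smooth_on_strip_product:
  assumes "smooth_fun \<alpha>" "smooth_fun b"
  shows "smooth_on_strip I (\<lambda>(t, x). \<alpha> t * b x)"
  unfolding smooth_on_strip_def
proof (intro exI[of _ "\<lambda>i j (t, x). (deriv ^^ i) \<alpha> t * (deriv ^^ j) b x"] conjI allI ballI)
  fix i j and t x :: real
  note s1 = smooth_fun_deriv_n[OF assms(1), of i] and s2 = smooth_fun_deriv_n[OF assms(2), of j]
  show "continuous_on (I \<times> UNIV) (\<lambda>(t, x). (deriv ^^ i) \<alpha> t * (deriv ^^ j) b x)"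
    unfolding case_prod_beta
    by (intro continuous_on_mult continuous_on_compose2[OF smooth_fun_continuous[OF s1, of UNIV], of _ fst]
        continuous_on_compose2[OF smooth_fun_continuous[OF s2, of UNIV], of _ snd] continuous_on_fst continuous_on_snd continuous_on_id) auto
  show "((\<lambda>s. case (s, x) of (t, x) \<Rightarrow> (deriv ^^ i) \<alpha> t * (deriv ^^ j) b x) has_real_derivative
      (case (t, x) of (t, x) \<Rightarrow> (deriv ^^ Suc i) \<alpha> t * (deriv ^^ j) b x)) (at t within I)"
    using DERIV_cmult_right[OF has_field_derivative_at_within[OF smooth_fun_deriv(1)[OF s1, of t], of I], of "(deriv ^^ j) b x"] by simp
  show "((\<lambda>y. case (t, y) of (t, x) \<Rightarrow> (deriv ^^ i) \<alpha> t * (deriv ^^ j) b x) has_real_derivative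
      (case (t, x) of (t, x) \<Rightarrow> (deriv ^^ i) \<alpha> t * (deriv ^^ Suc j) b x)) (at x)"
    using DERIV_cmult[OF smooth_fun_deriv(1)[OF s2, of x], of "(deriv ^^ i) \<alpha> t"] by simp
qed auto

text \<open>Products of one-variable functions are the only test functions needed for uniqueness.\<close>

lemma test_function_product:
  assumes "smooth_fun \<alpha>" "smooth_fun b" and b: "\<And>x. R < \<bar>x\<bar> \<Longrightarrow> b x = 0"
    and L: "{l..u} \<subseteq> I" "\<And>t. t \<in> I \<Longrightarrow> t \<notin> {l..u} \<Longrightarrow> \<alpha> t = 0"
  shows "test_function I (\<lambda>(t, x). \<alpha> t * b x)"
  unfolding test_function_def
proof (intro conjI smooth_on_strip_product assms(1,2), intro exI[of _ "{l..u} \<times> {-R..R}"] conjI ballI)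
  fix z assume "z \<in> I \<times> UNIV - {l..u} \<times> {-R..R}"
  then have z: "fst z \<in> I" "fst z \<notin> {l..u} \<or> \<not> (- R \<le> snd z \<and> snd z \<le> R)" by (auto simp: mem_Times_iff)
  then have "fst z \<notin> {l..u} \<or> R < \<bar>snd z\<bar>" by linarith
  then have "\<alpha> (fst z) = 0 \<or> b (snd z) = 0" using L(2)[OF z(1)] b[of "snd z"] by blast
  then show "(case z of (t, x) \<Rightarrow> \<alpha> t * b x) = 0" by (auto simp: case_prod_beta)
qed (use L(1) in \<open>auto intro: compact_Times\<close>)

lemma d_product:
  assumes "smooth_fun \<alpha>" "smooth_fun b"
  shows "d_t (\<lambda>(t, x). \<alpha> t * b x) (t, x) = deriv \<alpha> t * b x"
    "d_x (\<lambda>(t, x). \<alpha> t * b x) (t, x) = \<alpha> t * deriv b x"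
    "d_x (d_x (\<lambda>(t, x). \<alpha> t * b x)) (t, x) = \<alpha> t * deriv (deriv b) x"
proof -
  show "d_t (\<lambda>(t, x). \<alpha> t * b x) (t, x) = deriv \<alpha> t * b x"
    using DERIV_imp_deriv[OF DERIV_cmult_right[OF smooth_fun_deriv(1)[OF assms(1)]]] by (simp add: d_t_def)
  have x: "d_x (\<lambda>(t, x). \<alpha> t * f x) (t, x) = \<alpha> t * deriv f x" if "smooth_fun f" for f t x
    using DERIV_imp_deriv[OF DERIV_cmult[OF smooth_fun_deriv(1)[OF that]]] by (simp add: d_x_def)
  show "d_x (\<lambda>(t, x). \<alpha> t * b x) (t, x) = \<alpha> t * deriv b x" by (rule x[OF assms(2)])
  have "d_x (\<lambda>(t, x). \<alpha> t * b x) = (\<lambda>(t, x). \<alpha> t * deriv b x)" using x[OF assms(2)] by auto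
  then show "d_x (d_x (\<lambda>(t, x). \<alpha> t * b x)) (t, x) = \<alpha> t * deriv (deriv b) x"
    using x[OF smooth_fun_deriv(2)[OF assms(2)]] by simp
qed

lemma strip_integral:
  fixes F :: "real \<times> real \<Rightarrow> real"
  assumes m: "(\<lambda>z. indicator open_strip z * F z) \<in> borel_measurable borel"
    and C_all: "\<forall>t\<in>{0<..<1}. \<forall>x. \<bar>F (t, x)\<bar> \<le> C" and R_all: "\<forall>t\<in>{0<..<1}. \<forall>x. R < \<bar>x\<bar> \<longrightarrow> F (t, x) = 0"
  shows "set_integrable lborel open_strip F"
    and "(LINT z:open_strip|lborel. F z) = (LINT t:{0<..<1}|lborel. \<integral>x. F (t, x) \<partial>lborel)"
    and "t \<in> {0<..<1} \<Longrightarrow> integrable lborel (\<lambda>x. F (t, x))"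
    and "(LINT z:open_strip|lborel. F z) = (\<integral>x. (LINT t:{0<..<1}|lborel. F (t, x)) \<partial>lborel)"
proof -
  have C: "\<And>t x. t \<in> {0<..<1} \<Longrightarrow> \<bar>F (t, x)\<bar> \<le> C" using C_all by blast
  have R: "\<And>t x. t \<in> {0<..<1} \<Longrightarrow> R < \<bar>x\<bar> \<Longrightarrow> F (t, x) = 0" using R_all by blast
  define G where "G z = indicator open_strip z * F z" for z
  have Gm [measurable]: "G \<in> borel_measurable (borel \<Otimes>\<^sub>M borel)" using m unfolding G_def borel_prod .
  have C0: "0 \<le> C" using C[of "1/2" 0] by auto
  define D where "D = C * (1 + R\<^sup>2)"
  have G1: "G (t, x) = indicator {0<..<1} t * F (t, x)" for t x by (simp add: G_def indicator_def)
  have b: "\<bar>G (t, x)\<bar> \<le> D * indicator {0..1} t * weight x" for t x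
  proof (cases "t \<in> {0<..<1} \<and> \<bar>x\<bar> \<le> R")
    case True
    then have "\<bar>x\<bar> \<le> \<bar>R\<bar>" by linarith
    then have "x\<^sup>2 \<le> R\<^sup>2" by (simp add: abs_le_square_iff)
    then have "1 \<le> (1 + R\<^sup>2) * weight x" using one_plus_square_pos[of x] by (simp add: weight_def le_divide_eq)
    then have "C * 1 \<le> C * ((1 + R\<^sup>2) * weight x)" using C0 by (rule mult_left_mono)
    moreover have "\<bar>F (t, x)\<bar> \<le> C" using True C by blast
    ultimately have "\<bar>F (t, x)\<bar> \<le> C * ((1 + R\<^sup>2) * weight x)" by linarith
    then show ?thesis using True by (simp add: G1 D_def mult.assoc)
  next
    case False
    then have "G (t, x) = 0" using R[of t x] by (auto simp: G1 indicator_def)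
    moreover have "0 \<le> D * indicator {0..1} t * weight x"
      using C0 weight_pos[of x] by (intro mult_nonneg_nonneg) (auto simp: D_def less_imp_le)
    ultimately show ?thesis by simp
  qed
  note i = integrable_strip[OF Gm b]
  show "set_integrable lborel open_strip F"
    using i unfolding set_integrable_def lborel_prod G_def by simp
  have e: "(LINT z:open_strip|lborel. F z) = integral\<^sup>L (lborel \<Otimes>\<^sub>M lborel) G"
    unfolding set_lebesgue_integral_def lborel_prod G_def by simp
  also have e2: "\<dots> = (\<integral>t. \<integral>x. G (t, x) \<partial>lborel \<partial>lborel)"
    by (rule lborel_pair.integral_fst'[OF i, symmetric])
  finally show "(LINT z:open_strip|lborel. F z) = (LINT t:{0<..<1}|lborel. \<integral>x. F (t, x) \<partial>lborel)"
    by (simp add: G1 set_lebesgue_integral_def)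
  have "(\<integral>x. \<integral>t. G (t, x) \<partial>lborel \<partial>lborel) = (\<integral>t. \<integral>x. G (t, x) \<partial>lborel \<partial>lborel)"
    by (rule strip_swap(1)[OF Gm b])
  then show "(LINT z:open_strip|lborel. F z) = (\<integral>x. (LINT t:{0<..<1}|lborel. F (t, x)) \<partial>lborel)"
    using e e2 by (simp add: G1 set_lebesgue_integral_def)
  show "integrable lborel (\<lambda>x. F (t, x))" if t: "t \<in> {0<..<1}"
  proof -
    have "integrable lborel (\<lambda>x. G (t, x))"
      by (rule Bochner_Integration.integrable_bound[OF integrable_mult_right[OF weight_integrable, of "D * indicator {0..1} t"]])
         (auto intro!: AE_I2 order_trans[OF b])
    then show ?thesis using t by (simp add: G1)
  qed
qed

text \<open>A test function is differentiable in the classical sense on the open strip, with derivatives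
that are bounded, continuous, and supported in a fixed rectangle. The derivatives \<open>d_t\<close> and \<open>d_x\<close>
are two-sided there and agree with the one-sided ones of \<open>smooth_on_strip\<close>.\<close>

lemma test_function_regular:
  assumes test: "test_function I \<phi>" and I: "{0<..<1} \<subseteq> I" "I \<subseteq> {0<..1}"
  obtains l R B where "0 < l" "0 \<le> R"
    "\<And>t x. t \<in> I \<Longrightarrow> t < l \<or> R < \<bar>x\<bar> \<Longrightarrow> \<phi> (t, x) = 0"
    "\<And>t x. t \<in> {0<..<1} \<Longrightarrow> ((\<lambda>s. \<phi> (s, x)) has_real_derivative d_t \<phi> (t, x)) (at t)"
    "\<And>t x. t \<in> {0<..<1} \<Longrightarrow> ((\<lambda>y. \<phi> (t, y)) has_real_derivative d_x \<phi> (t, x)) (at x)"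
    "\<And>t x. t \<in> {0<..<1} \<Longrightarrow> ((\<lambda>y. d_x \<phi> (t, y)) has_real_derivative d_x (d_x \<phi>) (t, x)) (at x)"
    "continuous_on (I \<times> UNIV) \<phi>" "continuous_on open_strip (d_t \<phi>)" "continuous_on open_strip (d_x \<phi>)"
    "continuous_on open_strip (d_x (d_x \<phi>))"
    "\<And>t x. t \<in> {0<..<1} \<Longrightarrow> R < \<bar>x\<bar> \<Longrightarrow> d_t \<phi> (t, x) = 0 \<and> d_x \<phi> (t, x) = 0 \<and> d_x (d_x \<phi>) (t, x) = 0"
    "\<And>t x. t \<in> {0<..<1} \<Longrightarrow> \<bar>\<phi> (t, x)\<bar> \<le> B \<and> \<bar>d_t \<phi> (t, x)\<bar> \<le> B \<and> \<bar>d_x \<phi> (t, x)\<bar> \<le> B \<and> \<bar>d_x (d_x \<phi>) (t, x)\<bar> \<le> B"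
proof -
  obtain D :: "nat \<Rightarrow> nat \<Rightarrow> real \<times> real \<Rightarrow> real" where D: "\<forall>t\<in>I. \<forall>x. D 0 0 (t, x) = \<phi> (t, x)"
    "\<forall>i j. continuous_on (I \<times> UNIV) (D i j) \<and>
       (\<forall>t\<in>I. \<forall>x.
         ((\<lambda>s. D i j (s, x)) has_real_derivative D (Suc i) j (t, x)) (at t within I) \<and>
         ((\<lambda>y. D i j (t, y)) has_real_derivative D i (Suc j) (t, x)) (at x))"
    using test unfolding test_function_def smooth_on_strip_def by (elim conjE exE)
  have D0: "\<And>t x. t \<in> I \<Longrightarrow> D 0 0 (t, x) = \<phi> (t, x)"
    and Dc: "\<And>i j. continuous_on (I \<times> UNIV) (D i j)"
    and Dt: "\<And>i j t x. t \<in> I \<Longrightarrow> ((\<lambda>s. D i j (s, x)) has_real_derivative D (Suc i) j (t, x)) (at t within I)"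
    and Dx: "\<And>i j t x. t \<in> I \<Longrightarrow> ((\<lambda>y. D i j (t, y)) has_real_derivative D i (Suc j) (t, x)) (at x)"
    using D by simp_all
  obtain K where K0: "compact K" "K \<subseteq> I \<times> UNIV" "\<forall>z\<in>I \<times> UNIV - K. \<phi> z = 0"
    using test unfolding test_function_def by (elim conjE exE)
  note K = K0(1,2) K0(3)[rule_format]
  obtain l u R where lu: "{l..u} \<subseteq> I" "0 < l" and R: "0 \<le> R" and sub: "K \<subseteq> {l..u} \<times> {-R..R}"
  proof (cases "K = {}")
    case True
    show ?thesis by (rule that[of "1/2" "1/2" 0]) (use True I in auto)
  next
    case False
    have cf: "compact (fst ` K)" "fst ` K \<noteq> {}"
      using K(1) False by (auto intro!: compact_continuous_image continuous_intros)
    obtain l where l: "l \<in> fst ` K" "\<And>s. s \<in> fst ` K \<Longrightarrow> l \<le> s" using compact_attains_inf[OF cf] by blast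
    obtain u where u: "u \<in> fst ` K" "\<And>s. s \<in> fst ` K \<Longrightarrow> s \<le> u" using compact_attains_sup[OF cf] by blast
    have lI: "l \<in> I" "u \<in> I" using l(1) u(1) K(2) by auto
    have "bounded (snd ` K)" using K(1) by (intro compact_imp_bounded compact_continuous_image continuous_intros) auto
    then obtain R where R: "\<And>x. x \<in> snd ` K \<Longrightarrow> \<bar>x\<bar> \<le> R" unfolding bounded_iff by auto
    show ?thesis
    proof (rule that[of l u "\<bar>R\<bar>"])
      show "{l..u} \<subseteq> I"
      proof
        fix s assume s: "s \<in> {l..u}"
        show "s \<in> I"
        proof (cases "s < 1")
          case True then show ?thesis using s lI(1) I by force
        next
          case False then have "s = u" using s lI(2) I(2) by force
          then show ?thesis using lI(2) by simp
        qed
      qed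
      show "0 < l" using lI(1) I(2) by auto
      show "K \<subseteq> {l..u} \<times> {-\<bar>R\<bar>..\<bar>R\<bar>}"
      proof
        fix z assume "z \<in> K"
        then have "l \<le> fst z" "fst z \<le> u" "\<bar>snd z\<bar> \<le> R" using l(2) u(2) R by auto
        then show "z \<in> {l..u} \<times> {-\<bar>R\<bar>..\<bar>R\<bar>}" by (auto simp: mem_Times_iff)
      qed
    qed simp
  qed
  have zero: "\<phi> (t, x) = 0" if "t \<in> I" "t \<notin> {l..u} \<or> R < \<bar>x\<bar>" for t x
  proof (rule K(3))
    have "(t, x) \<notin> K"
    proof
      assume "(t, x) \<in> K"
      then have "t \<in> {l..u}" "- R \<le> x" "x \<le> R" using sub by auto
      then show False using that(2) by auto
    qed
    then show "(t, x) \<in> I \<times> UNIV - K" using that(1) by simp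
  qed
  have at: "at t within I = at t" if "t \<in> {0<..<1}" for t
    by (rule at_within_interior, rule interiorI[of "{0<..<1}"]) (use that I in auto)
  have dt: "((\<lambda>s. \<phi> (s, x)) has_real_derivative D 1 0 (t, x)) (at t)" if t: "t \<in> {0<..<1}" for t x
  proof -
    have "((\<lambda>s. D 0 0 (s, x)) has_real_derivative D (Suc 0) 0 (t, x)) (at t)"
      using Dt[of t 0 0 x] t I(1) at[OF t] by auto
    then show ?thesis
      by (intro has_field_derivative_transform_within_open[of "\<lambda>s. D 0 0 (s, x)" _ t "{0<..<1}" "\<lambda>s. \<phi> (s, x)"])
         (use t I(1) D0 in auto)
  qed
  have ft: "d_t \<phi> (t, x) = D 1 0 (t, x)" if "t \<in> {0<..<1}" for t x
    using DERIV_imp_deriv[OF dt[OF that]] by (simp add: d_t_def)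
  have dx: "((\<lambda>y. \<phi> (t, y)) has_real_derivative D 0 1 (t, x)) (at x)" if t: "t \<in> {0<..<1}" for t x
    using Dx[of t 0 0 x] D0[of t] t I(1) by auto
  have fx: "d_x \<phi> (t, x) = D 0 1 (t, x)" if "t \<in> {0<..<1}" for t x
    using DERIV_imp_deriv[OF dx[OF that]] by (simp add: d_x_def)
  have dxx: "((\<lambda>y. d_x \<phi> (t, y)) has_real_derivative D 0 2 (t, x)) (at x)" if t: "t \<in> {0<..<1}" for t x
    using Dx[of t 0 1 x] fx[OF t] t I(1) by (auto simp: numeral_2_eq_2)
  have fxx: "d_x (d_x \<phi>) (t, x) = D 0 2 (t, x)" if "t \<in> {0<..<1}" for t x
    using DERIV_imp_deriv[OF dxx[OF that]] by (simp add: d_x_def[of "d_x \<phi>"])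
  have zI: "\<phi> (t, x) = 0" if "t \<in> {0<..<1}" "t \<notin> {l..u} \<or> R < \<bar>x\<bar>" for t x
    by (rule zero[OF subsetD[OF I(1) that(1)] that(2)])
  have zt: "d_t \<phi> (t, x) = 0" if t: "t \<in> {0<..<1}" and o: "t \<notin> {l..u} \<or> R < \<bar>x\<bar>" for t x
  proof -
    define S where "S = (if R < \<bar>x\<bar> then {0<..<1} else {0<..<1} - {l..u})"
    have S: "open S" "t \<in> S" using t o by (auto simp: S_def intro!: open_Diff)
    have "0 = \<phi> (s, x)" if "s \<in> S" for s
    proof -
      have "s \<in> {0<..<1}" "s \<notin> {l..u} \<or> R < \<bar>x\<bar>" using that by (auto simp: S_def split: if_splits)
      from zI[OF this] show ?thesis by (rule sym)
    qed
    then have "((\<lambda>s. \<phi> (s, x)) has_real_derivative 0) (at t)"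
      by (rule has_field_derivative_transform_within_open[OF DERIV_const S])
    then have "deriv (\<lambda>s. \<phi> (s, x)) t = 0" by (rule DERIV_imp_deriv)
    then show ?thesis by (simp only: d_t_def prod.case)
  qed
  have z1: "d_x \<phi> (t, y) = 0" if t: "t \<in> {0<..<1}" and o: "t \<notin> {l..u} \<or> R < \<bar>y\<bar>" for t y
  proof (cases "R < \<bar>y\<bar>")
    case True
    have "deriv (\<lambda>y. \<phi> (t, y)) y = 0"
      by (rule deriv_zero_outside[OF _ True]) (rule zI[OF t], simp)
    then show ?thesis by (simp only: d_x_def prod.case)
  next
    case False
    then have "t \<notin> {l..u}" using o by blast
    then have "\<phi> (t, y) = 0" for y using zI[OF t, of y] by blast
    then show ?thesis by (simp add: d_x_def)
  qed
  have zx: "d_x \<phi> (t, x) = 0 \<and> d_x (d_x \<phi>) (t, x) = 0" if t: "t \<in> {0<..<1}" and o: "t \<notin> {l..u} \<or> R < \<bar>x\<bar>" for t x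
  proof
    show "d_x \<phi> (t, x) = 0" by (rule z1[OF t o])
    have "deriv (\<lambda>y. d_x \<phi> (t, y)) x = 0"
    proof (cases "R < \<bar>x\<bar>")
      case True
      show ?thesis by (rule deriv_zero_outside[OF _ True]) (rule z1[OF t], simp)
    next
      case False
      then have "t \<notin> {l..u}" using o by blast
      then have "d_x \<phi> (t, y) = 0" for y using z1[OF t, of y] by blast
      then show ?thesis by simp
    qed
    then show "d_x (d_x \<phi>) (t, x) = 0" unfolding d_x_def[of "d_x \<phi>"] by simp
  qed
  have bdd: "\<exists>B. \<forall>z\<in>{l..u} \<times> {-R..R}. \<bar>D i j z\<bar> \<le> B" for i j
  proof -
    have "bounded (D i j ` ({l..u} \<times> {-R..R}))"
      by (intro compact_imp_bounded compact_continuous_image continuous_on_subset[OF Dc] compact_Times) (use lu in auto)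
    then show ?thesis unfolding bounded_iff by auto
  qed
  obtain B0 where B0: "\<forall>z\<in>{l..u} \<times> {-R..R}. \<bar>D 0 0 z\<bar> \<le> B0" using bdd[of 0 0] by (rule exE)
  obtain B1 where B1: "\<forall>z\<in>{l..u} \<times> {-R..R}. \<bar>D 1 0 z\<bar> \<le> B1" using bdd[of 1 0] by (rule exE)
  obtain B2 where B2: "\<forall>z\<in>{l..u} \<times> {-R..R}. \<bar>D 0 1 z\<bar> \<le> B2" using bdd[of 0 1] by (rule exE)
  obtain B3 where B3: "\<forall>z\<in>{l..u} \<times> {-R..R}. \<bar>D 0 2 z\<bar> \<le> B3" using bdd[of 0 2] by (rule exE)
  define B where "B = \<bar>B0\<bar> + \<bar>B1\<bar> + \<bar>B2\<bar> + \<bar>B3\<bar>"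
  have cs: "continuous_on open_strip (D i j)" for i j by (rule continuous_on_subset[OF Dc]) (use I in auto)
  show ?thesis
  proof (rule that[of l R B])
    show "\<bar>\<phi> (t, x)\<bar> \<le> B \<and> \<bar>d_t \<phi> (t, x)\<bar> \<le> B \<and> \<bar>d_x \<phi> (t, x)\<bar> \<le> B \<and> \<bar>d_x (d_x \<phi>) (t, x)\<bar> \<le> B" if t: "t \<in> {0<..<1}" for t x
    proof (cases "t \<in> {l..u} \<and> \<bar>x\<bar> \<le> R")
      case True
      then have "(t, x) \<in> {l..u} \<times> {-R..R}" by auto
      moreover have "\<phi> (t, x) = D 0 0 (t, x)" using D0[of t x] t I(1) by auto
      ultimately have "\<bar>\<phi> (t, x)\<bar> \<le> B0" "\<bar>d_t \<phi> (t, x)\<bar> \<le> B1" "\<bar>d_x \<phi> (t, x)\<bar> \<le> B2" "\<bar>d_x (d_x \<phi>) (t, x)\<bar> \<le> B3"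
        using B0 B1 B2 B3 unfolding ft[OF t] fx[OF t] fxx[OF t] by auto
      moreover have "B0 \<le> B" "B1 \<le> B" "B2 \<le> B" "B3 \<le> B" by (auto simp: B_def)
      ultimately show ?thesis by (meson order_trans)
    next
      case False
      then have o: "t \<notin> {l..u} \<or> R < \<bar>x\<bar>" by auto
      show ?thesis using zI[OF t o] zt[OF t o] zx[OF t o] by (simp add: B_def)
    qed
    show "\<phi> (t, x) = 0" if "t \<in> I" "t < l \<or> R < \<bar>x\<bar>" for t x
      by (rule zero[OF that(1)]) (use that(2) in \<open>auto simp: not_le\<close>)
    show "continuous_on (I \<times> UNIV) \<phi>" by (rule continuous_on_eq[OF Dc[of 0 0]]) (use D0 in auto)
    show "continuous_on open_strip (d_t \<phi>)" by (rule continuous_on_eq[OF cs[of 1 0]]) (use ft in auto)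
    show "continuous_on open_strip (d_x \<phi>)" by (rule continuous_on_eq[OF cs[of 0 1]]) (use fx in auto)
    show "continuous_on open_strip (d_x (d_x \<phi>))" by (rule continuous_on_eq[OF cs[of 0 2]]) (use fxx in auto)
    show "d_t \<phi> (t, x) = 0 \<and> d_x \<phi> (t, x) = 0 \<and> d_x (d_x \<phi>) (t, x) = 0" if "t \<in> {0<..<1}" "R < \<bar>x\<bar>" for t x
      using zt[OF that(1) disjI2[OF that(2)]] zx[OF that(1) disjI2[OF that(2)]] by simp
    show "((\<lambda>s. \<phi> (s, x)) has_real_derivative d_t \<phi> (t, x)) (at t)" if "t \<in> {0<..<1}" for t x
      using dt[OF that] ft[OF that] by simp
    show "((\<lambda>y. \<phi> (t, y)) has_real_derivative d_x \<phi> (t, x)) (at x)" if "t \<in> {0<..<1}" for t x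
      using dx[OF that] fx[OF that] by simp
    show "((\<lambda>y. d_x \<phi> (t, y)) has_real_derivative d_x (d_x \<phi>) (t, x)) (at x)" if "t \<in> {0<..<1}" for t x
      using dxx[OF that] fxx[OF that] by simp
  qed (use lu R in auto)
qed

lemma strip_measurable:
  fixes f :: "real \<times> real \<Rightarrow> real"
  assumes "continuous_on open_strip f"
  shows "(\<lambda>z. indicator open_strip z * f z) \<in> borel_measurable borel"
  using borel_measurable_continuous_on_indicator[OF _ assms] by (simp add: borel_open open_Times)

lemma fst_snd_borel [measurable]:
  "fst \<in> borel_measurable (borel :: (real \<times> real) measure)"
  "snd \<in> borel_measurable (borel :: (real \<times> real) measure)"
  by (intro borel_measurable_continuous_onI continuous_intros)+

lemma open_strip_borel [measurable]: "open_strip \<in> sets (borel :: (real \<times> real) measure)"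
  by (simp add: borel_open open_Times)

text \<open>Tested with a product, an integral over the strip becomes an integral in time of integrals in
\<open>x\<close>, which is the form of the weak equations in \<open>weak_difference\<close>.\<close>

lemma product_integral:
  fixes g :: "real \<times> real \<Rightarrow> real"
  assumes [measurable]: "g \<in> borel_measurable borel" "k \<in> borel_measurable borel"
    and g: "\<forall>R. \<exists>B. \<forall>t\<in>{0<..<1}. \<forall>x. \<bar>x\<bar> \<le> R \<longrightarrow> \<bar>g (t, x)\<bar> \<le> B"
    and k_all: "\<forall>t\<in>{0<..<1}. \<bar>k t\<bar> \<le> k0"
    and b_all: "continuous_on UNIV b" "\<forall>x. R < \<bar>x\<bar> \<longrightarrow> b x = 0"
  shows "set_integrable lborel open_strip (\<lambda>z. g z * (k (fst z) * b (snd z)))"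
    and "(LINT z:open_strip|lborel. g z * (k (fst z) * b (snd z))) = (LINT t:{0<..<1}|lborel. k t * (\<integral>x. g (t, x) * b x \<partial>lborel))"
    and "\<And>t. t \<in> {0<..<1} \<Longrightarrow> integrable lborel (\<lambda>x. g (t, x) * b x)"
    and "set_integrable lborel {0<..<1} (\<lambda>t. k t * (\<integral>x. g (t, x) * b x \<partial>lborel))"
proof -
  have k: "\<And>t. t \<in> {0<..<1} \<Longrightarrow> \<bar>k t\<bar> \<le> k0" using k_all by blast
  have b: "continuous_on UNIV b" "\<And>x. R < \<bar>x\<bar> \<Longrightarrow> b x = 0" using b_all by blast+
  have bm [measurable]: "b \<in> borel_measurable borel" by (rule borel_measurable_continuous_onI[OF b(1)])
  obtain B where B: "\<And>t x. t \<in> {0<..<1} \<Longrightarrow> \<bar>x\<bar> \<le> R \<Longrightarrow> \<bar>g (t, x)\<bar> \<le> B" using g by metis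
  have "bounded (b ` {-R..R})" by (intro compact_imp_bounded compact_continuous_image continuous_on_subset[OF b(1)]) auto
  then obtain b0 where b0': "\<forall>y\<in>b ` {-R..R}. norm y \<le> b0" unfolding bounded_iff by blast
  have b0: "\<bar>b x\<bar> \<le> b0" if "\<bar>x\<bar> \<le> R" for x using b0' that by (auto simp: abs_le_iff)
  have gen: "\<bar>g (t, x) * (h t * b x)\<bar> \<le> \<bar>B\<bar> * (\<bar>h0\<bar> * \<bar>b0\<bar>)" if "t \<in> {0<..<1}" "\<bar>h t\<bar> \<le> h0" for t x h h0
  proof (cases "\<bar>x\<bar> \<le> R")
    case True
    have "\<bar>g (t, x)\<bar> * (\<bar>h t\<bar> * \<bar>b x\<bar>) \<le> \<bar>B\<bar> * (\<bar>h0\<bar> * \<bar>b0\<bar>)"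
      using B[OF that(1) True] that(2) b0[OF True] by (intro mult_mono) auto
    then show ?thesis by (simp add: abs_mult)
  qed (use b(2)[of x] in auto)
  have sup: "g (t, x) * (h t * b x) = 0" if "R < \<bar>x\<bar>" for t x h using b(2)[OF that] by simp
  note S = strip_integral[of "\<lambda>z. g z * (k (fst z) * b (snd z))" "\<bar>B\<bar> * (\<bar>k0\<bar> * \<bar>b0\<bar>)" R]
  have ms: "(\<lambda>z. indicator open_strip z * (g z * (k (fst z) * b (snd z)))) \<in> borel_measurable borel" by measurable
  have mk: "\<forall>t\<in>{0<..<1}. \<forall>x. \<bar>g (t, x) * (k (fst (t, x)) * b (snd (t, x)))\<bar> \<le> \<bar>B\<bar> * (\<bar>k0\<bar> * \<bar>b0\<bar>)"
    using gen[where h=k and ?h0.0=k0, OF _ k] by simp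
  have mz: "\<forall>t\<in>{0<..<1}. \<forall>x. R < \<bar>x\<bar> \<longrightarrow> g (t, x) * (k (fst (t, x)) * b (snd (t, x))) = 0" using sup by simp
  show i: "set_integrable lborel open_strip (\<lambda>z. g z * (k (fst z) * b (snd z)))" by (rule S(1)[OF ms mk mz])
  have e: "(\<integral>x. g (t, x) * (k t * b x) \<partial>lborel) = k t * (\<integral>x. g (t, x) * b x \<partial>lborel)" for t
  proof -
    have "(\<integral>x. g (t, x) * (k t * b x) \<partial>lborel) = (\<integral>x. k t * (g (t, x) * b x) \<partial>lborel)"
      by (rule Bochner_Integration.integral_cong) auto
    then show ?thesis by simp
  qed
  show "(LINT z:open_strip|lborel. g z * (k (fst z) * b (snd z))) = (LINT t:{0<..<1}|lborel. k t * (\<integral>x. g (t, x) * b x \<partial>lborel))"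
    using S(2)[OF ms mk mz] by (simp add: e)
  have ms1: "(\<lambda>z. indicator open_strip z * (g z * (1 * b (snd z)))) \<in> borel_measurable borel" by measurable
  show "integrable lborel (\<lambda>x. g (t, x) * b x)" if t: "t \<in> {0<..<1}" for t
    using strip_integral(3)[of "\<lambda>z. g z * (1 * b (snd z))" "\<bar>B\<bar> * (\<bar>1\<bar> * \<bar>b0\<bar>)" R, OF ms1 _ _ t] gen[of _ "\<lambda>_. 1" 1] b(2)
    by simp
  have "integrable (lborel \<Otimes>\<^sub>M lborel) (\<lambda>z. indicator open_strip z * (g z * (k (fst z) * b (snd z))))"
    using i unfolding set_integrable_def lborel_prod by simp
  from lborel_pair.integrable_fst'[OF this]
  have "integrable lborel (\<lambda>t. \<integral>x. indicator open_strip (t, x) * (g (t, x) * (k t * b x)) \<partial>lborel)" by simp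
  moreover have "(\<integral>x. indicator open_strip (t, x) * (g (t, x) * (k t * b x)) \<partial>lborel) =
      indicator {0<..<1} t * (k t * (\<integral>x. g (t, x) * b x \<partial>lborel))" for t
  proof -
    have "(\<integral>x. indicator open_strip (t, x) * (g (t, x) * (k t * b x)) \<partial>lborel) =
      (\<integral>x. indicator {0<..<1} t * (g (t, x) * (k t * b x)) \<partial>lborel)"
      by (rule Bochner_Integration.integral_cong) (auto simp: indicator_def)
    then show ?thesis using e[of t] by simp
  qed
  ultimately show "set_integrable lborel {0<..<1} (\<lambda>t. k t * (\<integral>x. g (t, x) * b x \<partial>lborel))"
    unfolding set_integrable_def by simp
qed

text \<open>The distribution function of a measure on the unit interval, with clamped argument: this makes it
monotone, hence Borel measurable, on the whole line.\<close>

definition cdf01 :: "real measure \<Rightarrow> real \<Rightarrow> real" where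
  "cdf01 \<mu> t = measure \<mu> {0..max 0 (min 1 t)}"

lemma cdf01:
  assumes "\<mu> \<in> Pr01"
  shows "cdf01 \<mu> \<in> borel_measurable borel" "0 \<le> cdf01 \<mu> t" "cdf01 \<mu> t \<le> 1"
    and "t \<in> {0..1} \<Longrightarrow> cdf01 \<mu> t = measure \<mu> {0..t}"
proof -
  interpret prob_space \<mu> using assms by (simp add: Pr01_def)
  have s: "{0..t} \<in> sets \<mu>" if "t \<le> 1" for t
    using assms that by (auto simp: Pr01_def sets_restrict_space image_iff intro!: bexI[of _ "{0..t}"])
  have "mono (cdf01 \<mu>)"
    unfolding cdf01_def by (intro monoI finite_measure_mono) (auto intro!: s)
  then show "cdf01 \<mu> \<in> borel_measurable borel" by (rule borel_measurable_mono)
  show "0 \<le> cdf01 \<mu> t" "cdf01 \<mu> t \<le> 1" by (auto simp: cdf01_def)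
  show "t \<in> {0..1} \<Longrightarrow> cdf01 \<mu> t = measure \<mu> {0..t}" by (simp add: cdf01_def)
qed

definition clamp_strip :: "real \<Rightarrow> (real \<times> real \<Rightarrow> real) \<Rightarrow> real \<times> real \<Rightarrow> real" where
  "clamp_strip C v z = indicator open_strip z * max (- C) (min C (v z))"

text \<open>Cutting off the weak derivative at its essential bound changes it only on a null set. This
provides a representative that is Borel measurable and bounded everywhere.\<close>

lemma weak_solution_clamped:
  assumes mu: "\<mu> \<in> Pr01" and u: "parisi_weak_solution \<xi>\<^sub>0 \<beta> \<mu> u"
    and xm: "continuous_on {0..1} (xi'' \<xi>\<^sub>0 \<beta>)"
  obtains v C where "0 \<le> C" "v \<in> borel_measurable borel" "\<And>z. \<bar>v z\<bar> \<le> C"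
    "\<And>\<phi>. test_function {0<..<1} \<phi> \<Longrightarrow>
        (LINT z:open_strip|lborel. u z * d_x \<phi> z) = - (LINT z:open_strip|lborel. v z * \<phi> z)"
    "\<And>\<phi>. test_function {0<..1} \<phi> \<Longrightarrow>
         (LINT z:open_strip|lborel.
            - u z * d_t \<phi> z + xi'' \<xi>\<^sub>0 \<beta> (fst z) / 2 *
              (u z * d_x (d_x \<phi>) z + cdf01 \<mu> (fst z) * (v z)\<^sup>2 * \<phi> z))
         + (LINT x|lborel. \<phi> (1, x) * ln (cosh x)) = 0"
proof -
  obtain v where v: "ess_bounded_weak_dx u v"
    and wt: "\<And>\<phi>. test_function {0<..1} \<phi> \<Longrightarrow>
         (LINT z:open_strip|lborel.
            - u z * d_t \<phi> z + xi'' \<xi>\<^sub>0 \<beta> (fst z) / 2 *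
              (u z * d_x (d_x \<phi>) z + measure \<mu> {0..fst z} * (v z)\<^sup>2 * \<phi> z))
         + (LINT x|lborel. \<phi> (1, x) * ln (cosh x)) = 0"
    using u unfolding parisi_weak_solution_def by blast
  obtain C0 where C0: "AE z\<in>open_strip in lborel. \<bar>v z\<bar> \<le> C0" using v unfolding ess_bounded_weak_dx_def by blast
  define C where "C = \<bar>C0\<bar>"
  define v' where "v' = clamp_strip C v"
  have vm: "(\<lambda>z. indicator open_strip z * v z) \<in> borel_measurable borel"
    using v unfolding ess_bounded_weak_dx_def set_borel_measurable_def by simp
  have v'e: "v' = (\<lambda>z. max (- C) (min C (indicator open_strip z * v z)))"
    by (auto simp: v'_def clamp_strip_def indicator_def C_def)
  have v'm: "v' \<in> borel_measurable borel" unfolding v'e using vm by measurable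
  have eq: "AE z in lborel. z \<in> open_strip \<longrightarrow> v' z = v z"
    using C0 by eventually_elim (auto simp: v'_def clamp_strip_def C_def)
  have rep: "(LINT z:open_strip|lborel. F z (v' z)) = (LINT z:open_strip|lborel. F z (v z))"
    if "\<And>g. g \<in> borel_measurable borel \<Longrightarrow> (\<lambda>z. indicator open_strip z * F z (g z)) \<in> borel_measurable borel"
    for F :: "real \<times> real \<Rightarrow> real \<Rightarrow> real"
    unfolding set_lebesgue_integral_def
  proof (rule integral_cong_AE)
    show "(\<lambda>z. indicator open_strip z *\<^sub>R F z (v' z)) \<in> borel_measurable lborel" using that[OF v'm] by simp
    have "(\<lambda>z. indicator open_strip z *\<^sub>R F z (v z)) = (\<lambda>z. indicator open_strip z * F z (indicator open_strip z * v z))"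
      by (intro ext) (simp add: indicator_def)
    moreover have "(\<lambda>z. indicator open_strip z * F z (indicator open_strip z * v z)) \<in> borel_measurable lborel"
      using that[OF vm] by simp
    ultimately show "(\<lambda>z. indicator open_strip z *\<^sub>R F z (v z)) \<in> borel_measurable lborel" by (simp only:)
    show "AE z in lborel. indicator open_strip z *\<^sub>R F z (v' z) = indicator open_strip z *\<^sub>R F z (v z)"
      using eq by eventually_elim (auto simp: indicator_def)
  qed
  have um [measurable]: "(\<lambda>z. indicator open_strip z * u z) \<in> borel_measurable borel"
    using u by (intro strip_measurable) (auto simp: parisi_weak_solution_def intro: continuous_on_subset)
  have am [measurable]: "(\<lambda>t. indicator {0<..<1} t * xi'' \<xi>\<^sub>0 \<beta> t) \<in> borel_measurable borel"
  proof -
    have "continuous_on {0<..<1} (xi'' \<xi>\<^sub>0 \<beta>)" by (rule continuous_on_subset[OF xm]) auto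
    from borel_measurable_continuous_on_indicator[OF _ this] show ?thesis by simp
  qed
  show ?thesis
  proof (rule that[of C v'])
    show "0 \<le> C" by (simp add: C_def)
    show "v' \<in> borel_measurable borel" by (rule v'm)
    show "\<bar>v' z\<bar> \<le> C" for z unfolding v'e by (auto simp: C_def)
    show "(LINT z:open_strip|lborel. u z * d_x \<phi> z) = - (LINT z:open_strip|lborel. v' z * \<phi> z)" if "test_function {0<..<1} \<phi>" for \<phi>
    proof -
      have "continuous_on open_strip \<phi>" by (rule test_function_regular[OF that]) auto
      note pm [measurable] = strip_measurable[OF this]
      have "(LINT z:open_strip|lborel. v' z * \<phi> z) = (LINT z:open_strip|lborel. v z * \<phi> z)"
      proof (rule rep[of "\<lambda>z v. v * \<phi> z"])
        fix g :: "real \<times> real \<Rightarrow> real" assume [measurable]: "g \<in> borel_measurable borel"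
        have "(\<lambda>z. g z * (indicator open_strip z * \<phi> z)) \<in> borel_measurable borel" by measurable
        then show "(\<lambda>z. indicator open_strip z * (g z * \<phi> z)) \<in> borel_measurable borel" by (simp add: mult_ac)
      qed
      then show ?thesis using v that unfolding ess_bounded_weak_dx_def by simp
    qed
    show "(LINT z:open_strip|lborel.
            - u z * d_t \<phi> z + xi'' \<xi>\<^sub>0 \<beta> (fst z) / 2 *
              (u z * d_x (d_x \<phi>) z + cdf01 \<mu> (fst z) * (v' z)\<^sup>2 * \<phi> z))
         + (LINT x|lborel. \<phi> (1, x) * ln (cosh x)) = 0" if "test_function {0<..1} \<phi>" for \<phi>
    proof -
      have "continuous_on open_strip \<phi>" "continuous_on open_strip (d_t \<phi>)" "continuous_on open_strip (d_x (d_x \<phi>))"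
        by (rule test_function_regular[OF that]; auto intro: continuous_on_subset)+
      note pm [measurable] = this[THEN strip_measurable]
      have me: "(\<lambda>z. indicator open_strip z * (- u z * d_t \<phi> z + xi'' \<xi>\<^sub>0 \<beta> (fst z) / 2 *
              (u z * d_x (d_x \<phi>) z + cdf01 \<mu> (fst z) * (g z)\<^sup>2 * \<phi> z))) \<in> borel_measurable borel"
        if [measurable]: "g \<in> borel_measurable borel" for g
      proof -
        note [measurable] = cdf01(1)[OF mu]
        have "(\<lambda>z. - (indicator open_strip z * u z) * (indicator open_strip z * d_t \<phi> z) + (indicator {0<..<1} (fst z) * xi'' \<xi>\<^sub>0 \<beta> (fst z)) / 2 *
              ((indicator open_strip z * u z) * (indicator open_strip z * d_x (d_x \<phi>) z) + cdf01 \<mu> (fst z) * (g z)\<^sup>2 * (indicator open_strip z * \<phi> z))) \<in> borel_measurable borel"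
          by measurable
        then show ?thesis by (rule measurable_cong[THEN iffD1, rotated]) (auto simp: indicator_def)
      qed
      have "(LINT z:open_strip|lborel.
            - u z * d_t \<phi> z + xi'' \<xi>\<^sub>0 \<beta> (fst z) / 2 *
              (u z * d_x (d_x \<phi>) z + cdf01 \<mu> (fst z) * (v' z)\<^sup>2 * \<phi> z)) =
        (LINT z:open_strip|lborel.
            - u z * d_t \<phi> z + xi'' \<xi>\<^sub>0 \<beta> (fst z) / 2 *
              (u z * d_x (d_x \<phi>) z + cdf01 \<mu> (fst z) * (v z)\<^sup>2 * \<phi> z))"
        by (rule rep[of "\<lambda>z v. - u z * d_t \<phi> z + xi'' \<xi>\<^sub>0 \<beta> (fst z) / 2 *
              (u z * d_x (d_x \<phi>) z + cdf01 \<mu> (fst z) * v\<^sup>2 * \<phi> z)"]) (rule me)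
      also have "\<dots> = (LINT z:open_strip|lborel.
            - u z * d_t \<phi> z + xi'' \<xi>\<^sub>0 \<beta> (fst z) / 2 *
              (u z * d_x (d_x \<phi>) z + measure \<mu> {0..fst z} * (v z)\<^sup>2 * \<phi> z))"
      proof (rule set_lebesgue_integral_cong)
        have "cdf01 \<mu> (fst z) = measure \<mu> {0..fst z}" if "z \<in> open_strip" for z
          by (rule cdf01(4)[OF mu]) (use that in auto)
        then show "\<forall>z. z \<in> open_strip \<longrightarrow> - u z * d_t \<phi> z + xi'' \<xi>\<^sub>0 \<beta> (fst z) / 2 *
              (u z * d_x (d_x \<phi>) z + cdf01 \<mu> (fst z) * (v z)\<^sup>2 * \<phi> z) =
            - u z * d_t \<phi> z + xi'' \<xi>\<^sub>0 \<beta> (fst z) / 2 *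
              (u z * d_x (d_x \<phi>) z + measure \<mu> {0..fst z} * (v z)\<^sup>2 * \<phi> z)" by simp
      qed simp
      finally have "(LINT z:open_strip|lborel.
            - u z * d_t \<phi> z + xi'' \<xi>\<^sub>0 \<beta> (fst z) / 2 *
              (u z * d_x (d_x \<phi>) z + cdf01 \<mu> (fst z) * (v' z)\<^sup>2 * \<phi> z)) =
        (LINT z:open_strip|lborel.
            - u z * d_t \<phi> z + xi'' \<xi>\<^sub>0 \<beta> (fst z) / 2 *
              (u z * d_x (d_x \<phi>) z + measure \<mu> {0..fst z} * (v z)\<^sup>2 * \<phi> z))" .
      then show ?thesis using wt[OF that] by (simp only:)
    qed
  qed
qed

text \<open>The quadratic terms of two solutions differ by \<open>\<mu>[0, t] (v1 + v2) (v1 - v2)\<close>, which is the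
bounded coefficient \<open>c\<close> times the weak derivative of the difference; the terminal values cancel.\<close>

theorem weak_solution_unique:
  assumes model: "is_model \<xi>\<^sub>0" "\<beta> > 0" and mu: "\<mu> \<in> Pr01"
    and u1: "parisi_weak_solution \<xi>\<^sub>0 \<beta> \<mu> u1" and u2: "parisi_weak_solution \<xi>\<^sub>0 \<beta> \<mu> u2"
    and t: "t \<in> {0..1}"
  shows "u1 (t, x) = u2 (t, x)"
proof -
  obtain K where K: "K > 1" "\<And>t. \<bar>t\<bar> < K \<Longrightarrow> isCont (xi'' \<xi>\<^sub>0 \<beta>) t"
    "\<And>t. 0 \<le> t \<Longrightarrow> t < K \<Longrightarrow> 0 \<le> xi'' \<xi>\<^sub>0 \<beta> t"
    using model_xi[OF model] by metis
  have cx: "continuous_on {0..1} (xi'' \<xi>\<^sub>0 \<beta>)"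
    using K by (intro continuous_at_imp_continuous_on) auto
  define a where "a s = indicator {0..1} s * (xi'' \<xi>\<^sub>0 \<beta> s / 2)" for s
  have "continuous_on {0..1} (\<lambda>s. xi'' \<xi>\<^sub>0 \<beta> s / 2)" by (intro continuous_intros cx) auto
  then have am [measurable]: "a \<in> borel_measurable borel"
    unfolding a_def using borel_measurable_continuous_on_indicator[of "{0..1}" "\<lambda>s. xi'' \<xi>\<^sub>0 \<beta> s / 2"] by simp
  have a0: "0 \<le> a s" for s using K by (auto simp: a_def indicator_def)
  obtain A0 where "\<forall>s\<in>{0..1}. \<bar>xi'' \<xi>\<^sub>0 \<beta> s\<bar> \<le> A0" using bounded_on_unit[OF cx] by blast
  then have A: "a s \<le> \<bar>A0\<bar>" for s
  proof (cases "s \<in> {0..1}")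
    case True
    then have "\<bar>xi'' \<xi>\<^sub>0 \<beta> s\<bar> \<le> A0" using \<open>\<forall>s\<in>{0..1}. \<bar>xi'' \<xi>\<^sub>0 \<beta> s\<bar> \<le> A0\<close> by blast
    then have "xi'' \<xi>\<^sub>0 \<beta> s / 2 \<le> \<bar>A0\<bar>" by linarith
    then show ?thesis using True by (simp add: a_def)
  qed (simp add: a_def)
  obtain v1 C1 where v1: "0 \<le> C1" "v1 \<in> borel_measurable borel" "\<And>z. \<bar>v1 z\<bar> \<le> C1"
    and wx1: "\<And>\<phi>. test_function {0<..<1} \<phi> \<Longrightarrow>
        (LINT z:open_strip|lborel. u1 z * d_x \<phi> z) = - (LINT z:open_strip|lborel. v1 z * \<phi> z)"
    and wt1: "\<And>\<phi>. test_function {0<..1} \<phi> \<Longrightarrow>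
         (LINT z:open_strip|lborel.
            - u1 z * d_t \<phi> z + xi'' \<xi>\<^sub>0 \<beta> (fst z) / 2 *
              (u1 z * d_x (d_x \<phi>) z + cdf01 \<mu> (fst z) * (v1 z)\<^sup>2 * \<phi> z))
         + (LINT x|lborel. \<phi> (1, x) * ln (cosh x)) = 0"
    by (rule weak_solution_clamped[OF mu u1 cx]) blast
  obtain v2 C2 where v2: "0 \<le> C2" "v2 \<in> borel_measurable borel" "\<And>z. \<bar>v2 z\<bar> \<le> C2"
    and wx2: "\<And>\<phi>. test_function {0<..<1} \<phi> \<Longrightarrow>
        (LINT z:open_strip|lborel. u2 z * d_x \<phi> z) = - (LINT z:open_strip|lborel. v2 z * \<phi> z)"
    and wt2: "\<And>\<phi>. test_function {0<..1} \<phi> \<Longrightarrow>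
         (LINT z:open_strip|lborel.
            - u2 z * d_t \<phi> z + xi'' \<xi>\<^sub>0 \<beta> (fst z) / 2 *
              (u2 z * d_x (d_x \<phi>) z + cdf01 \<mu> (fst z) * (v2 z)\<^sup>2 * \<phi> z))
         + (LINT x|lborel. \<phi> (1, x) * ln (cosh x)) = 0"
    by (rule weak_solution_clamped[OF mu u2 cx]) blast
  define ind where "ind = (indicator ({0..1} \<times> UNIV) :: real \<times> real \<Rightarrow> real)"
  define U1 where "U1 z = ind z * u1 z" for z
  define U2 where "U2 z = ind z * u2 z" for z
  define w where "w z = U1 z - U2 z" for z
  define z where "z p = v1 p - v2 p" for p
  define c where "c p = cdf01 \<mu> (fst p) * (v1 p + v2 p)" for p
  have cu: "continuous_on ({0..1} \<times> UNIV) u1" "continuous_on ({0..1} \<times> UNIV) u2"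
    using u1 u2 unfolding parisi_weak_solution_def by auto
  have Um [measurable]: "U1 \<in> borel_measurable borel" "U2 \<in> borel_measurable borel"
    unfolding U1_def U2_def ind_def
    using borel_measurable_continuous_on_indicator[OF _ cu(1)] borel_measurable_continuous_on_indicator[OF _ cu(2)]
    by (auto simp: borel_closed closed_Times)
  note vm [measurable] = v1(2) v2(2)
  note pm = Um vm
  have mm [measurable]: "cdf01 \<mu> \<in> borel_measurable borel" by (rule cdf01(1)[OF mu])
  have ub: "\<exists>B. \<forall>t\<in>{0<..<1}. \<forall>x. \<bar>x\<bar> \<le> R \<longrightarrow> \<bar>ind (t, x) * u (t, x)\<bar> \<le> B" if "continuous_on ({0..1} \<times> UNIV) u" for u R
  proof -
    have "bounded (u ` ({0..1} \<times> {-R..R}))"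
      by (intro compact_imp_bounded compact_continuous_image continuous_on_subset[OF that] compact_Times) auto
    then obtain B where B: "\<And>z. z \<in> {0..1} \<times> {-R..R} \<Longrightarrow> \<bar>u z\<bar> \<le> B" unfolding bounded_iff by auto
    show ?thesis
    proof (intro exI[of _ B] ballI allI impI)
      fix t x :: real assume "t \<in> {0<..<1}" "\<bar>x\<bar> \<le> R"
      then have "(t, x) \<in> {0..1} \<times> {-R..R}" "ind (t, x) = 1" by (auto simp: ind_def)
      then show "\<bar>ind (t, x) * u (t, x)\<bar> \<le> B" using B by simp
    qed
  qed
  have Ub: "\<forall>R. \<exists>B. \<forall>t\<in>{0<..<1}. \<forall>x. \<bar>x\<bar> \<le> R \<longrightarrow> \<bar>U1 (t, x)\<bar> \<le> B" "\<forall>R. \<exists>B. \<forall>t\<in>{0<..<1}. \<forall>x. \<bar>x\<bar> \<le> R \<longrightarrow> \<bar>U2 (t, x)\<bar> \<le> B"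
    unfolding U1_def U2_def by (rule allI, rule ub[OF cu(1)], rule allI, rule ub[OF cu(2)])
  have Ue: "U1 p = u1 p" "U2 p = u2 p" if "p \<in> open_strip" for p
    using that by (auto simp: U1_def U2_def ind_def indicator_def)
  have ae: "xi'' \<xi>\<^sub>0 \<beta> (fst p) / 2 = a (fst p)" if "p \<in> open_strip" for p
    using that by (auto simp: a_def)
  define Q1 where "Q1 p = cdf01 \<mu> (fst p) * (v1 p)\<^sup>2" for p
  define Q2 where "Q2 p = cdf01 \<mu> (fst p) * (v2 p)\<^sup>2" for p
  have Qm [measurable]: "Q1 \<in> borel_measurable borel" "Q2 \<in> borel_measurable borel"
    unfolding Q1_def Q2_def by measurable
  have bd: "\<forall>R. \<exists>B. \<forall>t\<in>{0<..<1}. \<forall>x. \<bar>x\<bar> \<le> R \<longrightarrow> \<bar>f (t, x)\<bar> \<le> B" if "\<And>p. \<bar>f p\<bar> \<le> C" for f :: "real \<times> real \<Rightarrow> real" and C :: real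
    by (intro allI exI[of _ C] ballI allI impI that)
  have Qb: "\<bar>cdf01 \<mu> (fst p) * (v p)\<^sup>2\<bar> \<le> C\<^sup>2" if "\<And>p. \<bar>v p\<bar> \<le> C" for p C and v :: "real \<times> real \<Rightarrow> real"
  proof -
    have "(v p)\<^sup>2 \<le> C\<^sup>2" using that[of p] abs_le_square_iff[of "v p" C] by simp
    then have "cdf01 \<mu> (fst p) * (v p)\<^sup>2 \<le> 1 * C\<^sup>2" using cdf01(2,3)[OF mu] by (intro mult_mono) auto
    then show ?thesis using cdf01(2)[OF mu] by (simp add: abs_mult)
  qed
  note bv1 = bd[of v1, OF v1(3)] and bv2 = bd[of v2, OF v2(3)]
  have bQ1: "\<forall>R. \<exists>B. \<forall>t\<in>{0<..<1}. \<forall>x. \<bar>x\<bar> \<le> R \<longrightarrow> \<bar>Q1 (t, x)\<bar> \<le> B"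
    by (rule bd) (use Qb[OF v1(3)] in \<open>auto simp: Q1_def\<close>)
  have bQ2: "\<forall>R. \<exists>B. \<forall>t\<in>{0<..<1}. \<forall>x. \<bar>x\<bar> \<le> R \<longrightarrow> \<bar>Q2 (t, x)\<bar> \<le> B"
    by (rule bd) (use Qb[OF v2(3)] in \<open>auto simp: Q2_def\<close>)
  have set1: "(LINT t:{0<..<1}|lborel. F t) = (LINT t:{0<..<1}|lborel. G t)" if "\<And>t. t \<in> {0<..<1} \<Longrightarrow> F t = G t" for F G :: "real \<Rightarrow> real"
    by (rule set_lebesgue_integral_cong) (use that in auto)
  interpret weak_difference w z c a "C1 + C2" "C1 + C2" "\<bar>A0\<bar>"
  proof
    show "continuous_on ({0..1} \<times> UNIV) w"
      by (rule continuous_on_eq[OF continuous_on_diff[OF cu]]) (auto simp: w_def U1_def U2_def ind_def)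
    show "w \<in> borel_measurable (borel \<Otimes>\<^sub>M borel)" "z \<in> borel_measurable (borel \<Otimes>\<^sub>M borel)" "c \<in> borel_measurable (borel \<Otimes>\<^sub>M borel)"
      unfolding borel_prod w_def z_def c_def by measurable
    show zb: "\<bar>z p\<bar> \<le> C1 + C2" for p using v1(3)[of p] v2(3)[of p] by (auto simp: z_def)
    show "\<bar>c p\<bar> \<le> C1 + C2" for p
    proof -
      have "\<bar>v1 p + v2 p\<bar> \<le> C1 + C2" using v1(3)[of p] v2(3)[of p] by linarith
      then have "cdf01 \<mu> (fst p) * \<bar>v1 p + v2 p\<bar> \<le> 1 * (C1 + C2)" using cdf01(2,3)[OF mu] by (intro mult_mono) auto
      then show ?thesis using cdf01(2)[OF mu] by (simp add: c_def abs_mult)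
    qed
    show "a \<in> borel_measurable borel" "\<And>t. 0 \<le> a t" "\<And>t. a t \<le> \<bar>A0\<bar>" using am a0 A by auto
  next
    fix \<psi> b :: "real \<Rightarrow> real" and R :: real
    assume s: "smooth_fun \<psi>" "\<exists>l u. 0 < l \<and> u < 1 \<and> (\<forall>t. t \<notin> {l..u} \<longrightarrow> \<psi> t = 0)" "smooth_fun b" and sup: "\<And>x. R < \<bar>x\<bar> \<Longrightarrow> b x = 0"
    obtain l u where lu: "0 < l" "u < 1" "\<And>t. t \<notin> {l..u} \<Longrightarrow> \<psi> t = 0" using s(2) by blast
    define \<phi> where "\<phi> = (\<lambda>(t, x). \<psi> t * b x)"
    have test: "test_function {0<..<1} \<phi>"
      unfolding \<phi>_def by (rule test_function_product[OF s(1,3) sup, of _ l u]) (use lu in auto)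
    have sup': "\<And>x. R < \<bar>x\<bar> \<Longrightarrow> deriv b x = 0" by (rule deriv_zero_outside[of R]) (use sup in auto)
    note cb = smooth_fun_continuous[OF s(3)] and cb' = smooth_fun_continuous[OF smooth_fun_deriv(2)[OF s(3)]]
    have km: "\<psi> \<in> borel_measurable borel" by (rule borel_measurable_continuous_onI[OF smooth_fun_continuous[OF s(1)]])
    obtain k0 where k0: "\<forall>t\<in>{0..1}. \<bar>\<psi> t\<bar> \<le> k0" using bounded_on_unit[OF smooth_fun_continuous[OF s(1)]] by blast
    then have k: "\<forall>t\<in>{0<..<1}. \<bar>\<psi> t\<bar> \<le> k0" by auto
    have supA: "\<forall>x. R < \<bar>x\<bar> \<longrightarrow> b x = 0" "\<forall>x. R < \<bar>x\<bar> \<longrightarrow> deriv b x = 0" using sup sup' by blast+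
    note P1 = product_integral[OF Um(1) km Ub(1) k cb' supA(2)] and P2 = product_integral[OF Um(2) km Ub(2) k cb' supA(2)]
      and P3 = product_integral[OF vm(1) km bv1 k cb supA(1)] and P4 = product_integral[OF vm(2) km bv2 k cb supA(1)]
    have dxp: "d_x \<phi> p = \<psi> (fst p) * deriv b (snd p)" for p
      using d_product(2)[OF s(1,3), of "fst p" "snd p"] by (simp add: \<phi>_def)
    have pp: "\<phi> p = \<psi> (fst p) * b (snd p)" for p by (simp add: \<phi>_def case_prod_beta)
    have sc: "(LINT p:open_strip|lborel. U1 p * (\<psi> (fst p) * deriv b (snd p))) = (LINT p:open_strip|lborel. u1 p * d_x \<phi> p)"
      "(LINT p:open_strip|lborel. U2 p * (\<psi> (fst p) * deriv b (snd p))) = (LINT p:open_strip|lborel. u2 p * d_x \<phi> p)"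
      by (rule set_lebesgue_integral_cong; use Ue in \<open>auto simp: dxp\<close>)+
    have e1: "(LINT t:{0<..<1}|lborel. \<psi> t * (\<integral>x. U1 (t, x) * deriv b x \<partial>lborel)) = - (LINT t:{0<..<1}|lborel. \<psi> t * (\<integral>x. v1 (t, x) * b x \<partial>lborel))"
      using wx1[OF test] sc(1) P1(2) P3(2) by (simp add: pp)
    have e2: "(LINT t:{0<..<1}|lborel. \<psi> t * (\<integral>x. U2 (t, x) * deriv b x \<partial>lborel)) = - (LINT t:{0<..<1}|lborel. \<psi> t * (\<integral>x. v2 (t, x) * b x \<partial>lborel))"
      using wx2[OF test] sc(2) P2(2) P4(2) by (simp add: pp)
    have "(LINT t:{0<..<1}|lborel. \<psi> t * ((\<integral>x. w (t, x) * deriv b x \<partial>lborel) + (\<integral>x. z (t, x) * b x \<partial>lborel))) =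
      (LINT t:{0<..<1}|lborel. (\<psi> t * (\<integral>x. U1 (t, x) * deriv b x \<partial>lborel) - \<psi> t * (\<integral>x. U2 (t, x) * deriv b x \<partial>lborel))
        + (\<psi> t * (\<integral>x. v1 (t, x) * b x \<partial>lborel) - \<psi> t * (\<integral>x. v2 (t, x) * b x \<partial>lborel)))"
    proof (rule set1)
      fix t :: real assume t: "t \<in> {0<..<1}"
      have "(\<integral>x. w (t, x) * deriv b x \<partial>lborel) = (\<integral>x. U1 (t, x) * deriv b x \<partial>lborel) - (\<integral>x. U2 (t, x) * deriv b x \<partial>lborel)"
        "(\<integral>x. z (t, x) * b x \<partial>lborel) = (\<integral>x. v1 (t, x) * b x \<partial>lborel) - (\<integral>x. v2 (t, x) * b x \<partial>lborel)"
        unfolding w_def z_def left_diff_distrib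
        by (rule Bochner_Integration.integral_diff[OF P1(3)[OF t] P2(3)[OF t]],
            rule Bochner_Integration.integral_diff[OF P3(3)[OF t] P4(3)[OF t]])
      then show "\<psi> t * ((\<integral>x. w (t, x) * deriv b x \<partial>lborel) + (\<integral>x. z (t, x) * b x \<partial>lborel)) =
        (\<psi> t * (\<integral>x. U1 (t, x) * deriv b x \<partial>lborel) - \<psi> t * (\<integral>x. U2 (t, x) * deriv b x \<partial>lborel))
        + (\<psi> t * (\<integral>x. v1 (t, x) * b x \<partial>lborel) - \<psi> t * (\<integral>x. v2 (t, x) * b x \<partial>lborel))"
        by (simp only: distrib_left right_diff_distrib)
    qed
    also have "\<dots> = ((LINT t:{0<..<1}|lborel. \<psi> t * (\<integral>x. U1 (t, x) * deriv b x \<partial>lborel)) - (LINT t:{0<..<1}|lborel. \<psi> t * (\<integral>x. U2 (t, x) * deriv b x \<partial>lborel)))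
        + ((LINT t:{0<..<1}|lborel. \<psi> t * (\<integral>x. v1 (t, x) * b x \<partial>lborel)) - (LINT t:{0<..<1}|lborel. \<psi> t * (\<integral>x. v2 (t, x) * b x \<partial>lborel)))"
      by (simp only: set_integral_add(2) set_integral_diff(2) set_integral_diff(1) P1(4) P2(4) P3(4) P4(4))
    also have "\<dots> = 0" unfolding e1 e2 by simp
    finally show "(LINT t:{0<..<1}|lborel. \<psi> t * ((\<integral>x. w (t, x) * deriv b x \<partial>lborel) + (\<integral>x. z (t, x) * b x \<partial>lborel))) = 0" .
  next
    fix \<alpha> b :: "real \<Rightarrow> real" and R :: real
    assume s: "smooth_fun \<alpha>" "\<exists>l>0. \<forall>t\<le>l. \<alpha> t = 0" "smooth_fun b" and sup: "\<And>x. R < \<bar>x\<bar> \<Longrightarrow> b x = 0"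
    obtain l where l: "0 < l" "\<And>t. t \<le> l \<Longrightarrow> \<alpha> t = 0" using s(2) by blast
    define \<phi> where "\<phi> = (\<lambda>(t, x). \<alpha> t * b x)"
    have test: "test_function {0<..1} \<phi>"
      unfolding \<phi>_def by (rule test_function_product[OF s(1,3) sup, of _ l 1]) (use l in auto)
    have sup': "\<And>x. R < \<bar>x\<bar> \<Longrightarrow> deriv b x = 0" by (rule deriv_zero_outside[of R]) (use sup in auto)
    have sup'': "\<And>x. R < \<bar>x\<bar> \<Longrightarrow> deriv (deriv b) x = 0" by (rule deriv_zero_outside[of R]) (use sup' in auto)
    note cb = smooth_fun_continuous[OF s(3)] and cb'' = smooth_fun_continuous[OF smooth_fun_deriv(2)[OF smooth_fun_deriv(2)[OF s(3)]]]
    note c\<alpha> = smooth_fun_continuous[OF s(1)] and c\<alpha>' = smooth_fun_continuous[OF smooth_fun_deriv(2)[OF s(1)]]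
    have [measurable]: "\<alpha> \<in> borel_measurable borel" "deriv \<alpha> \<in> borel_measurable borel"
      by (intro borel_measurable_continuous_onI c\<alpha> c\<alpha>')+
    define k1 where "k1 t = - deriv \<alpha> t" for t
    define k2 where "k2 t = a t * \<alpha> t" for t
    have km: "k1 \<in> borel_measurable borel" "k2 \<in> borel_measurable borel" unfolding k1_def k2_def by measurable
    obtain b1 where b1: "\<forall>t\<in>{0..1}. \<bar>deriv \<alpha> t\<bar> \<le> b1" using bounded_on_unit[OF c\<alpha>'] by blast
    then have kb1: "\<forall>t\<in>{0<..<1}. \<bar>k1 t\<bar> \<le> b1" by (auto simp: k1_def)
    have supA: "\<forall>x. R < \<bar>x\<bar> \<longrightarrow> b x = 0" "\<forall>x. R < \<bar>x\<bar> \<longrightarrow> deriv (deriv b) x = 0" using sup sup'' by blast+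
    obtain b2 where b2: "\<forall>t\<in>{0..1}. \<bar>\<alpha> t\<bar> \<le> b2" using bounded_on_unit[OF c\<alpha>] by blast
    have "\<bar>k2 t\<bar> \<le> \<bar>A0\<bar> * b2" if "t \<in> {0<..<1}" for t
      unfolding k2_def abs_mult using b2 that a0[of t] A[of t] by (intro mult_mono) auto
    then have kb2: "\<forall>t\<in>{0<..<1}. \<bar>k2 t\<bar> \<le> \<bar>A0\<bar> * b2" by blast
    have single: "(LINT t:{0<..<1}|lborel. k1 t * (\<integral>x. U (t, x) * b x \<partial>lborel)) +
        ((LINT t:{0<..<1}|lborel. k2 t * (\<integral>x. U (t, x) * deriv (deriv b) x \<partial>lborel)) +
         (LINT t:{0<..<1}|lborel. k2 t * (\<integral>x. Q (t, x) * b x \<partial>lborel))) = - (LINT x|lborel. \<phi> (1, x) * ln (cosh x))"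
      if P1: "set_integrable lborel open_strip (\<lambda>p. U p * (k1 (fst p) * b (snd p)))"
        "(LINT p:open_strip|lborel. U p * (k1 (fst p) * b (snd p))) = (LINT t:{0<..<1}|lborel. k1 t * (\<integral>x. U (t, x) * b x \<partial>lborel))"
        and P2: "set_integrable lborel open_strip (\<lambda>p. U p * (k2 (fst p) * deriv (deriv b) (snd p)))"
        "(LINT p:open_strip|lborel. U p * (k2 (fst p) * deriv (deriv b) (snd p))) = (LINT t:{0<..<1}|lborel. k2 t * (\<integral>x. U (t, x) * deriv (deriv b) x \<partial>lborel))"
        and P3: "set_integrable lborel open_strip (\<lambda>p. Q p * (k2 (fst p) * b (snd p)))"
        "(LINT p:open_strip|lborel. Q p * (k2 (fst p) * b (snd p))) = (LINT t:{0<..<1}|lborel. k2 t * (\<integral>x. Q (t, x) * b x \<partial>lborel))"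
        and Uu: "\<And>p. p \<in> open_strip \<Longrightarrow> U p = u p" and Q: "\<And>p. Q p = cdf01 \<mu> (fst p) * (v p)\<^sup>2"
        and wt: "(LINT z:open_strip|lborel. - u z * d_t \<phi> z + xi'' \<xi>\<^sub>0 \<beta> (fst z) / 2 *
              (u z * d_x (d_x \<phi>) z + cdf01 \<mu> (fst z) * (v z)\<^sup>2 * \<phi> z))
         + (LINT x|lborel. \<phi> (1, x) * ln (cosh x)) = 0" for U u v Q :: "real \<times> real \<Rightarrow> real"
    proof -
      have dd: "d_t \<phi> p = deriv \<alpha> (fst p) * b (snd p)" "d_x (d_x \<phi>) p = \<alpha> (fst p) * deriv (deriv b) (snd p)"
        "\<phi> p = \<alpha> (fst p) * b (snd p)" for p
        using d_product(1,3)[OF s(1,3), of "fst p" "snd p"] by (simp_all add: \<phi>_def case_prod_beta)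
      have "(LINT z:open_strip|lborel. - u z * d_t \<phi> z + xi'' \<xi>\<^sub>0 \<beta> (fst z) / 2 *
              (u z * d_x (d_x \<phi>) z + cdf01 \<mu> (fst z) * (v z)\<^sup>2 * \<phi> z)) =
        (LINT p:open_strip|lborel. U p * (k1 (fst p) * b (snd p)) + (U p * (k2 (fst p) * deriv (deriv b) (snd p)) + Q p * (k2 (fst p) * b (snd p))))"
      proof (rule set_lebesgue_integral_cong)
        show "\<forall>p. p \<in> open_strip \<longrightarrow> - u p * d_t \<phi> p + xi'' \<xi>\<^sub>0 \<beta> (fst p) / 2 *
              (u p * d_x (d_x \<phi>) p + cdf01 \<mu> (fst p) * (v p)\<^sup>2 * \<phi> p) =
           U p * (k1 (fst p) * b (snd p)) + (U p * (k2 (fst p) * deriv (deriv b) (snd p)) + Q p * (k2 (fst p) * b (snd p)))"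
          unfolding dd using Uu ae by (auto simp: k1_def k2_def Q algebra_simps simp del: times_divide_eq_left)
      qed simp
      also have "\<dots> = (LINT p:open_strip|lborel. U p * (k1 (fst p) * b (snd p))) + ((LINT p:open_strip|lborel. U p * (k2 (fst p) * deriv (deriv b) (snd p)))
        + (LINT p:open_strip|lborel. Q p * (k2 (fst p) * b (snd p))))"
        by (simp only: set_integral_add P1(1) P2(1) P3(1))
      finally show ?thesis using wt P1(2) P2(2) P3(2) by linarith
    qed
    note R1 = product_integral[OF Um(1) km(1) Ub(1) kb1 cb supA(1)] and R2 = product_integral[OF Um(1) km(2) Ub(1) kb2 cb'' supA(2)]
      and R3 = product_integral[OF Qm(1) km(2) bQ1 kb2 cb supA(1)]
    note S1 = product_integral[OF Um(2) km(1) Ub(2) kb1 cb supA(1)] and S2 = product_integral[OF Um(2) km(2) Ub(2) kb2 cb'' supA(2)]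
      and S3 = product_integral[OF Qm(2) km(2) bQ2 kb2 cb supA(1)]
    note E1 = single[OF R1(1,2) R2(1,2) R3(1,2) Ue(1) Q1_def wt1[OF test]]
    note E2 = single[OF S1(1,2) S2(1,2) S3(1,2) Ue(2) Q2_def wt2[OF test]]
    have cz: "c p * z p = Q1 p - Q2 p" for p by (simp add: c_def z_def Q1_def Q2_def power2_eq_square algebra_simps)
    have "(LINT t:{0<..<1}|lborel. - deriv \<alpha> t * (\<integral>x. w (t, x) * b x \<partial>lborel) + \<alpha> t * (a t *
          ((\<integral>x. w (t, x) * deriv (deriv b) x \<partial>lborel) + (\<integral>x. c (t, x) * z (t, x) * b x \<partial>lborel)))) =
      (LINT t:{0<..<1}|lborel. (k1 t * (\<integral>x. U1 (t, x) * b x \<partial>lborel) - k1 t * (\<integral>x. U2 (t, x) * b x \<partial>lborel)) +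
        ((k2 t * (\<integral>x. U1 (t, x) * deriv (deriv b) x \<partial>lborel) - k2 t * (\<integral>x. U2 (t, x) * deriv (deriv b) x \<partial>lborel)) +
         (k2 t * (\<integral>x. Q1 (t, x) * b x \<partial>lborel) - k2 t * (\<integral>x. Q2 (t, x) * b x \<partial>lborel))))"
    proof (rule set1)
      fix t :: real assume t: "t \<in> {0<..<1}"
      have "(\<integral>x. w (t, x) * b x \<partial>lborel) = (\<integral>x. U1 (t, x) * b x \<partial>lborel) - (\<integral>x. U2 (t, x) * b x \<partial>lborel)"
        "(\<integral>x. w (t, x) * deriv (deriv b) x \<partial>lborel) = (\<integral>x. U1 (t, x) * deriv (deriv b) x \<partial>lborel) - (\<integral>x. U2 (t, x) * deriv (deriv b) x \<partial>lborel)"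
        "(\<integral>x. c (t, x) * z (t, x) * b x \<partial>lborel) = (\<integral>x. Q1 (t, x) * b x \<partial>lborel) - (\<integral>x. Q2 (t, x) * b x \<partial>lborel)"
        unfolding cz using R1(3)[OF t] R2(3)[OF t] R3(3)[OF t] S1(3)[OF t] S2(3)[OF t] S3(3)[OF t]
        by (simp_all add: w_def left_diff_distrib)
      then show "- deriv \<alpha> t * (\<integral>x. w (t, x) * b x \<partial>lborel) + \<alpha> t * (a t *
          ((\<integral>x. w (t, x) * deriv (deriv b) x \<partial>lborel) + (\<integral>x. c (t, x) * z (t, x) * b x \<partial>lborel))) =
        (k1 t * (\<integral>x. U1 (t, x) * b x \<partial>lborel) - k1 t * (\<integral>x. U2 (t, x) * b x \<partial>lborel)) +
        ((k2 t * (\<integral>x. U1 (t, x) * deriv (deriv b) x \<partial>lborel) - k2 t * (\<integral>x. U2 (t, x) * deriv (deriv b) x \<partial>lborel)) +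
         (k2 t * (\<integral>x. Q1 (t, x) * b x \<partial>lborel) - k2 t * (\<integral>x. Q2 (t, x) * b x \<partial>lborel)))"
        by (simp only: k1_def k2_def) (simp add: algebra_simps)
    qed
    also have "\<dots> = ((LINT t:{0<..<1}|lborel. k1 t * (\<integral>x. U1 (t, x) * b x \<partial>lborel)) - (LINT t:{0<..<1}|lborel. k1 t * (\<integral>x. U2 (t, x) * b x \<partial>lborel))) +
        (((LINT t:{0<..<1}|lborel. k2 t * (\<integral>x. U1 (t, x) * deriv (deriv b) x \<partial>lborel)) - (LINT t:{0<..<1}|lborel. k2 t * (\<integral>x. U2 (t, x) * deriv (deriv b) x \<partial>lborel))) +
         ((LINT t:{0<..<1}|lborel. k2 t * (\<integral>x. Q1 (t, x) * b x \<partial>lborel)) - (LINT t:{0<..<1}|lborel. k2 t * (\<integral>x. Q2 (t, x) * b x \<partial>lborel))))"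
      by (simp only: set_integral_add set_integral_diff R1(4) R2(4) R3(4) S1(4) S2(4) S3(4))
    also have "\<dots> = 0" using E1 E2 by linarith
    finally show "(LINT t:{0<..<1}|lborel. - deriv \<alpha> t * (\<integral>x. w (t, x) * b x \<partial>lborel) + \<alpha> t * (a t *
          ((\<integral>x. w (t, x) * deriv (deriv b) x \<partial>lborel) + (\<integral>x. c (t, x) * z (t, x) * b x \<partial>lborel)))) = 0" .
  qed
  have "w (t, x) = 0" by (rule difference_zero[OF t])
  then show ?thesis using t by (auto simp: w_def U1_def U2_def ind_def)
qed

text \<open>Uniqueness makes the definite description in \<open>parisi_u\<close> meaningful. The restriction of a weak
solution to the closed strip is the extensional one.\<close>

lemma parisi_u_eq:
  assumes model: "is_model \<xi>\<^sub>0" "\<beta> > 0" and mu: "\<mu> \<in> Pr01"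
    and u: "parisi_weak_solution \<xi>\<^sub>0 \<beta> \<mu> u" and t: "t \<in> {0..1}"
  shows "parisi_u \<xi>\<^sub>0 \<beta> \<mu> (t, x) = u (t, x)"
proof -
  define r where "r = restrict u ({0..1} \<times> UNIV)"
  have re: "r p = u p" if "p \<in> open_strip" for p using that by (auto simp: r_def)
  have c: "(LINT p:open_strip|lborel. F p (r p)) = (LINT p:open_strip|lborel. F p (u p))" for F :: "real \<times> real \<Rightarrow> real \<Rightarrow> real"
    by (rule set_lebesgue_integral_cong) (use re in auto)
  have "continuous_on ({0..1} \<times> UNIV) r"
    by (rule continuous_on_eq[of _ u]) (use u in \<open>auto simp: r_def parisi_weak_solution_def\<close>)
  then have r: "parisi_weak_solution \<xi>\<^sub>0 \<beta> \<mu> r"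
    using u unfolding parisi_weak_solution_def ess_bounded_weak_dx_def
      c[of "\<lambda>p y. y * d_x _ p"] c[of "\<lambda>p y. - y * d_t _ p + xi'' \<xi>\<^sub>0 \<beta> (fst p) / 2 * (y * d_x (d_x _) p + measure \<mu> {0..fst p} * (_ p)\<^sup>2 * _ p)"]
    by blast
  have "parisi_u \<xi>\<^sub>0 \<beta> \<mu> = r"
    unfolding parisi_u_def
  proof (rule the_equality)
    show "r \<in> extensional ({0..1} \<times> UNIV) \<and> parisi_weak_solution \<xi>\<^sub>0 \<beta> \<mu> r"
      using r by (simp add: r_def)
    fix u' assume u': "u' \<in> extensional ({0..1} \<times> UNIV) \<and> parisi_weak_solution \<xi>\<^sub>0 \<beta> \<mu> u'"
    show "u' = r"
    proof (rule extensionalityI[of _ "{0..1} \<times> UNIV"])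
      show "u' \<in> extensional ({0..1} \<times> UNIV)" "r \<in> extensional ({0..1} \<times> UNIV)" using u' by (auto simp: r_def)
      fix p :: "real \<times> real" assume p: "p \<in> {0..1} \<times> UNIV"
      have "u' (fst p, snd p) = r (fst p, snd p)"
        by (rule weak_solution_unique[OF model mu _ r]) (use u' p in auto)
      then show "u' p = r p" by simp
    qed
  qed
  then show ?thesis using t by (simp add: r_def)
qed

section \<open>Classical solutions are weak solutions\<close>

lemma compact_deriv_zero:
  fixes G G' :: "real \<Rightarrow> real"
  assumes d: "\<And>x. (G has_real_derivative G' x) (at x)" and c: "continuous_on UNIV G'"
    and z: "\<And>x. R < \<bar>x\<bar> \<Longrightarrow> G x = 0"
  shows "integral\<^sup>L lborel G' = 0"
proof (rule integral_deriv_zero[OF d c])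
  have "deriv G = G'" using DERIV_imp_deriv[OF d] by blast
  then have z': "G' x = 0" if "R < \<bar>x\<bar>" for x using deriv_zero_outside[of R G x, OF z that] by simp
  show "integrable lborel G'"
    by (rule lborel_integral_compact_support(1)[of "-R" R]) (use z' in \<open>auto intro: continuous_on_subset[OF c]\<close>)
  show "(G \<longlongrightarrow> 0) at_top"
    by (rule tendsto_eventually, rule eventually_mono[OF eventually_gt_at_top[of R]]) (auto intro: z)
  show "(G \<longlongrightarrow> 0) at_bot"
    by (rule tendsto_eventually, rule eventually_mono[OF eventually_le_at_bot[of "- \<bar>R\<bar> - 1"]]) (auto intro: z)
qed

lemma strip_integrable_snd:
  fixes F :: "real \<times> real \<Rightarrow> real"
  assumes "set_integrable lborel open_strip F"
  shows "integrable lborel (\<lambda>x. LINT t:{0<..<1}|lborel. F (t, x))"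
proof -
  have "integrable (lborel \<Otimes>\<^sub>M lborel) (\<lambda>z. indicator open_strip z * F z)"
    using assms unfolding set_integrable_def lborel_prod by simp
  then have "integrable (lborel \<Otimes>\<^sub>M lborel) (case_prod (\<lambda>t x. indicator open_strip (t, x) * F (t, x)))"
    by (simp only: split_beta' prod.collapse)
  from lborel_pair.integrable_snd[OF this]
  show ?thesis by (simp add: set_lebesgue_integral_def indicator_def)
qed

text \<open>The equation is only required in integrated form at each fixed \<open>x\<close>, because the coefficient
\<open>\<mu>[0, t]\<close> jumps at the atoms of \<open>\<mu>\<close> and \<open>u\<close> is not differentiable in time there. Against a test
function one integrates by parts in \<open>x\<close> at fixed \<open>t\<close>, and in \<open>t\<close> at fixed \<open>x\<close> by exchanging
integrals over a triangle.\<close>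

lemma weak_solution_criterion:
  fixes u ux uxx :: "real \<times> real \<Rightarrow> real"
  assumes model: "is_model \<xi>\<^sub>0" "\<beta> > 0" and mu: "\<mu> \<in> Pr01"
    and cu: "continuous_on ({0..1} \<times> UNIV) u"
    and dx: "\<And>t x. t \<in> {0..1} \<Longrightarrow> ((\<lambda>y. u (t, y)) has_real_derivative ux (t, x)) (at x)"
    and dxx: "\<And>t x. t \<in> {0..1} \<Longrightarrow> ((\<lambda>y. ux (t, y)) has_real_derivative uxx (t, x)) (at x)"
    and cux: "continuous_on ({0..1} \<times> UNIV) ux" and cuxx: "continuous_on ({0..1} \<times> UNIV) uxx"
    and b: "\<And>t x. t \<in> {0..1} \<Longrightarrow> \<bar>ux (t, x)\<bar> \<le> C \<and> \<bar>uxx (t, x)\<bar> \<le> C"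
    and evo: "\<And>t x. t \<in> {0..1} \<Longrightarrow> u (t, x) = ln (cosh x) + (LINT s:{t<..<1}|lborel.
      xi'' \<xi>\<^sub>0 \<beta> s / 2 * (uxx (s, x) + cdf01 \<mu> s * (ux (s, x))\<^sup>2))"
  shows "parisi_weak_solution \<xi>\<^sub>0 \<beta> \<mu> u"
proof -
  obtain K where K: "K > 1" "\<And>t. \<bar>t\<bar> < K \<Longrightarrow> isCont (xi'' \<xi>\<^sub>0 \<beta>) t"
    using model_xi[OF model] by metis
  have cx: "continuous_on {0..1} (xi'' \<xi>\<^sub>0 \<beta>)"
    using K by (intro continuous_at_imp_continuous_on) auto
  define a where "a s = indicator {0..1} s * (xi'' \<xi>\<^sub>0 \<beta> s / 2)" for s
  have "continuous_on {0..1} (\<lambda>s. xi'' \<xi>\<^sub>0 \<beta> s / 2)" by (intro continuous_intros cx) auto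
  then have am [measurable]: "a \<in> borel_measurable borel"
    unfolding a_def using borel_measurable_continuous_on_indicator[of "{0..1}" "\<lambda>s. xi'' \<xi>\<^sub>0 \<beta> s / 2"] by simp
  obtain A0 where A0: "\<forall>s\<in>{0..1}. \<bar>xi'' \<xi>\<^sub>0 \<beta> s\<bar> \<le> A0" using bounded_on_unit[OF cx] by blast
  have A: "\<bar>a s\<bar> \<le> \<bar>A0\<bar>" for s
  proof (cases "s \<in> {0..1}")
    case True
    then have "\<bar>xi'' \<xi>\<^sub>0 \<beta> s\<bar> \<le> A0" using A0 by blast
    then have "\<bar>xi'' \<xi>\<^sub>0 \<beta> s / 2\<bar> \<le> \<bar>A0\<bar>" by linarith
    then show ?thesis using True by (simp add: a_def)
  qed (simp add: a_def)
  have C0: "0 \<le> C" using b[of 0 0] by auto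
  have sub: "open_strip \<subseteq> {0..1::real} \<times> UNIV" by auto
  note cs = continuous_on_subset[OF cu sub] continuous_on_subset[OF cux sub] continuous_on_subset[OF cuxx sub]
  note ms = cs[THEN strip_measurable]
  define U Ux Uxx where "U z = indicator open_strip z * u z" and "Ux z = indicator open_strip z * ux z"
    and "Uxx z = indicator open_strip z * uxx z" for z
  have Um [measurable]: "U \<in> borel_measurable borel" "Ux \<in> borel_measurable borel" "Uxx \<in> borel_measurable borel"
    using ms unfolding U_def Ux_def Uxx_def by auto
  have Ue: "U z = u z" "Ux z = ux z" "Uxx z = uxx z" if "z \<in> open_strip" for z
    using that by (auto simp: U_def Ux_def Uxx_def)
  have cm [measurable]: "cdf01 \<mu> \<in> borel_measurable borel" by (rule cdf01(1)[OF mu])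
  have ub: "\<exists>B. \<forall>t\<in>{0<..<1}. \<forall>x. \<bar>x\<bar> \<le> R \<longrightarrow> \<bar>u (t, x)\<bar> \<le> B" for R
  proof -
    have "bounded (u ` ({0..1} \<times> {-R..R}))"
      by (intro compact_imp_bounded compact_continuous_image continuous_on_subset[OF cu] compact_Times) auto
    then obtain B where B: "\<forall>y\<in>u ` ({0..1} \<times> {-R..R}). norm y \<le> B" unfolding bounded_iff by blast
    show ?thesis
    proof (intro exI[of _ B] ballI allI impI)
      fix t x :: real assume "t \<in> {0<..<1}" "\<bar>x\<bar> \<le> R"
      then have "(t, x) \<in> {0..1} \<times> {-R..R}" by auto
      then show "\<bar>u (t, x)\<bar> \<le> B" using B by force
    qed
  qed
  have slice: "continuous_on UNIV (\<lambda>x. f (t, x))" if "continuous_on S f" "\<And>x. (t, x) \<in> S" for f :: "real \<times> real \<Rightarrow> real" and S t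
    by (rule continuous_on_compose2[OF that(1), of _ "\<lambda>x. (t, x)"]) (use that(2) in \<open>auto intro!: continuous_intros\<close>)
  have "ess_bounded_weak_dx u ux"
    unfolding ess_bounded_weak_dx_def
  proof (intro conjI allI impI)
    show "set_borel_measurable lborel open_strip ux" using ms(2) unfolding set_borel_measurable_def by simp
    show "\<exists>C. AE z\<in>open_strip in lborel. \<bar>ux z\<bar> \<le> C"
    proof (intro exI[of _ C] AE_I2 impI)
      fix z assume "z \<in> open_strip"
      then have "fst z \<in> {0..1}" by auto
      from b[OF this, of "snd z"] show "\<bar>ux z\<bar> \<le> C" by simp
    qed
    fix \<phi> assume test: "test_function {0<..<1} \<phi>"
    obtain l R B where t: "0 < l" "0 \<le> R"
      "\<And>t x. t \<in> {0<..<1} \<Longrightarrow> t < l \<or> R < \<bar>x\<bar> \<Longrightarrow> \<phi> (t, x) = 0"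
      "\<And>t x. t \<in> {0<..<1} \<Longrightarrow> ((\<lambda>y. \<phi> (t, y)) has_real_derivative d_x \<phi> (t, x)) (at x)"
      "continuous_on open_strip \<phi>" "continuous_on open_strip (d_x \<phi>)"
      "\<And>t x. t \<in> {0<..<1} \<Longrightarrow> R < \<bar>x\<bar> \<Longrightarrow> d_t \<phi> (t, x) = 0 \<and> d_x \<phi> (t, x) = 0 \<and> d_x (d_x \<phi>) (t, x) = 0"
      "\<And>t x. t \<in> {0<..<1} \<Longrightarrow> \<bar>\<phi> (t, x)\<bar> \<le> B \<and> \<bar>d_t \<phi> (t, x)\<bar> \<le> B \<and> \<bar>d_x \<phi> (t, x)\<bar> \<le> B \<and> \<bar>d_x (d_x \<phi>) (t, x)\<bar> \<le> B"
      by (rule test_function_regular[OF test], force, force, rule that, assumption+)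
    have t7: "d_x \<phi> (t, x) = 0" if "t \<in> {0<..<1}" "R < \<bar>x\<bar>" for t x using t(7)[OF that] by blast
    have t8: "\<bar>\<phi> (t, x)\<bar> \<le> B \<and> \<bar>d_x \<phi> (t, x)\<bar> \<le> B" if "t \<in> {0<..<1}" for t x using t(8)[OF that, of x] by blast
    note r = t(1-6) t7 t8
    note pm [measurable] = strip_measurable[OF r(5)] strip_measurable[OF r(6)]
    have B0: "0 \<le> B" using r(8)[of "1/2" 0] by auto
    obtain Bu where Bu: "\<forall>t\<in>{0<..<1}. \<forall>x. \<bar>x\<bar> \<le> R \<longrightarrow> \<bar>u (t, x)\<bar> \<le> Bu" using ub by blast
    have Bu0: "0 \<le> Bu" using Bu[rule_format, of "1/2" 0] r(2) by auto
    define F1 where "F1 z = u z * d_x \<phi> z" for z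
    define F2 where "F2 z = ux z * \<phi> z" for z
    have 1: "(\<lambda>z. indicator open_strip z * F1 z) \<in> borel_measurable borel"
    proof -
      have "(\<lambda>z. U z * (indicator open_strip z * d_x \<phi> z)) \<in> borel_measurable borel" by measurable
      then show ?thesis by (rule measurable_cong[THEN iffD1, rotated]) (auto simp: U_def F1_def indicator_def)
    qed
    have 2: "(\<lambda>z. indicator open_strip z * F2 z) \<in> borel_measurable borel"
    proof -
      have "(\<lambda>z. Ux z * (indicator open_strip z * \<phi> z)) \<in> borel_measurable borel" by measurable
      then show ?thesis by (rule measurable_cong[THEN iffD1, rotated]) (auto simp: Ux_def F2_def indicator_def)
    qed
    have b1: "\<bar>F1 (t, x)\<bar> \<le> Bu * B" if t: "t \<in> {0<..<1}" for t x
    proof (cases "R < \<bar>x\<bar>")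
      case False
      then have "\<bar>u (t, x)\<bar> \<le> Bu" using Bu t by force
      then show ?thesis using r(8)[OF t, of x] Bu0 unfolding F1_def abs_mult by (intro mult_mono) auto
    qed (use r(7)[OF t] Bu0 B0 in \<open>simp add: F1_def\<close>)
    have b2: "\<bar>F2 (t, x)\<bar> \<le> C * B" if t: "t \<in> {0<..<1}" for t x
      using r(8)[OF t, of x] b[of t x] t C0 unfolding F2_def abs_mult by (intro mult_mono) auto
    have z1: "F1 (t, x) = 0" if "t \<in> {0<..<1}" "R < \<bar>x\<bar>" for t x using r(7)[OF that] by (simp add: F1_def)
    have z2: "F2 (t, x) = 0" if "t \<in> {0<..<1}" "R < \<bar>x\<bar>" for t x using r(3)[OF that(1)] that(2) by (simp add: F2_def)
    have o: "\<forall>t\<in>{0<..<1}. \<forall>x. \<bar>F1 (t, x)\<bar> \<le> Bu * B" "\<forall>t\<in>{0<..<1}. \<forall>x. R < \<bar>x\<bar> \<longrightarrow> F1 (t, x) = 0"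
      "\<forall>t\<in>{0<..<1}. \<forall>x. \<bar>F2 (t, x)\<bar> \<le> C * B" "\<forall>t\<in>{0<..<1}. \<forall>x. R < \<bar>x\<bar> \<longrightarrow> F2 (t, x) = 0"
      using b1 b2 z1 z2 by blast+
    note S1 = strip_integral[OF 1 o(1,2)] and S2 = strip_integral[OF 2 o(3,4)]
    have in0: "(\<integral>x. F1 (t, x) \<partial>lborel) + (\<integral>x. F2 (t, x) \<partial>lborel) = 0" if t: "t \<in> {0<..<1}" for t
    proof -
      have t': "t \<in> {0..1}" using t by auto
      have "(\<integral>x. F1 (t, x) + F2 (t, x) \<partial>lborel) = 0"
      proof (rule compact_deriv_zero[of "\<lambda>x. u (t, x) * \<phi> (t, x)" _ R])
        show "((\<lambda>x. u (t, x) * \<phi> (t, x)) has_real_derivative F1 (t, x) + F2 (t, x)) (at x)" for x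
          using DERIV_mult[OF dx[OF t', of x] r(4)[OF t, of x]] by (simp add: F1_def F2_def algebra_simps)
        show "continuous_on UNIV (\<lambda>x. F1 (t, x) + F2 (t, x))"
          unfolding F1_def F2_def
          by (intro continuous_on_add continuous_on_mult slice[OF cu] slice[OF cux] slice[OF r(5)] slice[OF r(6)]) (use t in auto)
      qed (use r(3)[OF t] in auto)
      then show ?thesis using Bochner_Integration.integral_add[OF S1(3)[OF t] S2(3)[OF t]] by simp
    qed
    have "(LINT z:open_strip|lborel. F1 z) + (LINT z:open_strip|lborel. F2 z) = (LINT z:open_strip|lborel. F1 z + F2 z)"
      by (rule set_integral_add(2)[OF S1(1) S2(1), symmetric])
    also have "\<dots> = (LINT t:{0<..<1}|lborel. \<integral>x. F1 (t, x) + F2 (t, x) \<partial>lborel)"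
    proof (rule strip_integral(2)[of _ "Bu * B + C * B" R])
      show "(\<lambda>z. indicator open_strip z * (F1 z + F2 z)) \<in> borel_measurable borel"
        using borel_measurable_add[OF 1 2] by (simp add: distrib_left)
      have "\<bar>F1 (t, x) + F2 (t, x)\<bar> \<le> Bu * B + C * B" if "t \<in> {0<..<1}" for t x
        using b1[OF that, of x] b2[OF that, of x] by linarith
      then show "\<forall>t\<in>{0<..<1}. \<forall>x. \<bar>F1 (t, x) + F2 (t, x)\<bar> \<le> Bu * B + C * B" by blast
    qed (simp add: z1 z2)
    also have "\<dots> = (LINT t:{0<..<1::real}|lborel. (0::real))"
    proof (rule set_lebesgue_integral_cong)
      have "(\<integral>x. F1 (t, x) + F2 (t, x) \<partial>lborel) = 0" if "t \<in> {0<..<1}" for t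
        using in0[OF that] Bochner_Integration.integral_add[OF S1(3)[OF that] S2(3)[OF that]] by simp
      then show "\<forall>t. t \<in> {0<..<1} \<longrightarrow> (\<integral>x. F1 (t, x) + F2 (t, x) \<partial>lborel) = 0" by blast
    qed simp
    finally show "(LINT z:open_strip|lborel. u z * d_x \<phi> z) = - (LINT z:open_strip|lborel. ux z * \<phi> z)"
      by (simp add: F1_def F2_def set_lebesgue_integral_def)
  qed
  moreover have "(LINT z:open_strip|lborel.
            - u z * d_t \<phi> z + xi'' \<xi>\<^sub>0 \<beta> (fst z) / 2 *
              (u z * d_x (d_x \<phi>) z + measure \<mu> {0..fst z} * (ux z)\<^sup>2 * \<phi> z))
         + (LINT x|lborel. \<phi> (1, x) * ln (cosh x)) = 0" if test: "test_function {0<..1} \<phi>" for \<phi>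
  proof -
    obtain l R B where r: "0 < l" "0 \<le> R"
      "\<And>t x. t \<in> {0<..1} \<Longrightarrow> t < l \<or> R < \<bar>x\<bar> \<Longrightarrow> \<phi> (t, x) = 0"
      "\<And>t x. t \<in> {0<..<1} \<Longrightarrow> ((\<lambda>s. \<phi> (s, x)) has_real_derivative d_t \<phi> (t, x)) (at t)"
      "\<And>t x. t \<in> {0<..<1} \<Longrightarrow> ((\<lambda>y. \<phi> (t, y)) has_real_derivative d_x \<phi> (t, x)) (at x)"
      "\<And>t x. t \<in> {0<..<1} \<Longrightarrow> ((\<lambda>y. d_x \<phi> (t, y)) has_real_derivative d_x (d_x \<phi>) (t, x)) (at x)"
      "continuous_on ({0<..1} \<times> UNIV) \<phi>" "continuous_on open_strip (d_t \<phi>)"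
      "continuous_on open_strip (d_x (d_x \<phi>))"
      "\<And>t x. t \<in> {0<..<1} \<Longrightarrow> R < \<bar>x\<bar> \<Longrightarrow> d_t \<phi> (t, x) = 0 \<and> d_x \<phi> (t, x) = 0 \<and> d_x (d_x \<phi>) (t, x) = 0"
      "\<And>t x. t \<in> {0<..<1} \<Longrightarrow> \<bar>\<phi> (t, x)\<bar> \<le> B \<and> \<bar>d_t \<phi> (t, x)\<bar> \<le> B \<and> \<bar>d_x \<phi> (t, x)\<bar> \<le> B \<and> \<bar>d_x (d_x \<phi>) (t, x)\<bar> \<le> B"
      by (rule test_function_regular[OF test], force, force, rule that, assumption+)
    have cp: "continuous_on open_strip \<phi>" by (rule continuous_on_subset[OF r(7)]) auto
    note pm [measurable] = strip_measurable[OF cp] strip_measurable[OF r(8)] strip_measurable[OF r(9)]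
    have B0: "0 \<le> B" using r(11)[of "1/2" 0] by auto
    obtain Bu where Bu: "\<forall>t\<in>{0<..<1}. \<forall>x. \<bar>x\<bar> \<le> R \<longrightarrow> \<bar>u (t, x)\<bar> \<le> Bu" using ub by blast
    have Bu0: "0 \<le> Bu" using Bu[rule_format, of "1/2" 0] r(2) by auto
    define g where "g z = a (fst z) * (Uxx z + cdf01 \<mu> (fst z) * (Ux z)\<^sup>2)" for z
    have gm [measurable]: "g \<in> borel_measurable borel" unfolding g_def by measurable
    have gb: "\<bar>g z\<bar> \<le> \<bar>A0\<bar> * (C + C\<^sup>2)" for z
    proof -
      have U: "\<bar>Uxx z\<bar> \<le> C" "\<bar>Ux z\<bar> \<le> C"
        using b[of "fst z" "snd z"] C0 by (cases "z \<in> open_strip"; auto simp: Uxx_def Ux_def)+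
      then have "(Ux z)\<^sup>2 \<le> C\<^sup>2" using abs_le_square_iff[of "Ux z" C] C0 by simp
      then have "cdf01 \<mu> (fst z) * (Ux z)\<^sup>2 \<le> 1 * C\<^sup>2" using cdf01(2,3)[OF mu] by (intro mult_mono) auto
      moreover have "0 \<le> cdf01 \<mu> (fst z) * (Ux z)\<^sup>2" using cdf01(2)[OF mu] by simp
      ultimately have "\<bar>Uxx z + cdf01 \<mu> (fst z) * (Ux z)\<^sup>2\<bar> \<le> C + C\<^sup>2" using U by linarith
      then show ?thesis unfolding g_def abs_mult using A by (intro mult_mono) auto
    qed
    define D where "D = \<bar>A0\<bar> * (C + C\<^sup>2)"
    have D0: "0 \<le> D" using C0 by (simp add: D_def)
    define F1 where "F1 z = u z * d_t \<phi> z" for z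
    define F2 where "F2 z = a (fst z) * (u z * d_x (d_x \<phi>) z)" for z
    define F3 where "F3 z = a (fst z) * (cdf01 \<mu> (fst z) * (ux z)\<^sup>2 * \<phi> z)" for z
    define F4 where "F4 z = a (fst z) * (uxx z * \<phi> z)" for z
    have m1: "(\<lambda>z. indicator open_strip z * F1 z) \<in> borel_measurable borel"
    proof -
      have "(\<lambda>z. U z * (indicator open_strip z * d_t \<phi> z)) \<in> borel_measurable borel" by measurable
      then show ?thesis by (rule measurable_cong[THEN iffD1, rotated]) (auto simp: U_def F1_def indicator_def)
    qed
    have m2: "(\<lambda>z. indicator open_strip z * F2 z) \<in> borel_measurable borel"
    proof -
      have "(\<lambda>z. a (fst z) * (U z * (indicator open_strip z * d_x (d_x \<phi>) z))) \<in> borel_measurable borel" by measurable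
      then show ?thesis by (rule measurable_cong[THEN iffD1, rotated]) (auto simp: U_def F2_def indicator_def)
    qed
    have m3: "(\<lambda>z. indicator open_strip z * F3 z) \<in> borel_measurable borel"
    proof -
      have "(\<lambda>z. a (fst z) * (cdf01 \<mu> (fst z) * (Ux z)\<^sup>2 * (indicator open_strip z * \<phi> z))) \<in> borel_measurable borel" by measurable
      then show ?thesis by (rule measurable_cong[THEN iffD1, rotated]) (auto simp: Ux_def F3_def indicator_def)
    qed
    have m4: "(\<lambda>z. indicator open_strip z * F4 z) \<in> borel_measurable borel"
    proof -
      have "(\<lambda>z. a (fst z) * (Uxx z * (indicator open_strip z * \<phi> z))) \<in> borel_measurable borel" by measurable
      then show ?thesis by (rule measurable_cong[THEN iffD1, rotated]) (auto simp: Uxx_def F4_def indicator_def)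
    qed
    have uR: "\<bar>u (t, x)\<bar> \<le> Bu" if "t \<in> {0<..<1}" "\<not> R < \<bar>x\<bar>" for t x using Bu that by force
    have rb: "\<bar>\<phi> (t, x)\<bar> \<le> B" "\<bar>d_t \<phi> (t, x)\<bar> \<le> B" "\<bar>d_x (d_x \<phi>) (t, x)\<bar> \<le> B" if "t \<in> {0<..<1}" for t x
      by (rule conjunct1[OF r(11)[OF that]], rule conjunct1[OF conjunct2[OF r(11)[OF that]]],
          rule conjunct2[OF conjunct2[OF conjunct2[OF r(11)[OF that]]]])
    have rz: "d_t \<phi> (t, x) = 0" "d_x (d_x \<phi>) (t, x) = 0" if "t \<in> {0<..<1}" "R < \<bar>x\<bar>" for t x
      by (rule conjunct1[OF r(10)[OF that]], rule conjunct2[OF conjunct2[OF r(10)[OF that]]])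
    have BB: "0 \<le> Bu * B" by (rule mult_nonneg_nonneg[OF Bu0 B0])
    have b1: "\<bar>F1 (t, x)\<bar> \<le> Bu * B" if t: "t \<in> {0<..<1}" for t x
    proof (cases "R < \<bar>x\<bar>")
      case True
      then show ?thesis using rz(1)[OF t True] BB by (simp add: F1_def)
    next
      case False
      show ?thesis unfolding F1_def abs_mult by (rule mult_mono[OF uR[OF t False] rb(2)[OF t] Bu0 abs_ge_zero])
    qed
    have b2: "\<bar>F2 (t, x)\<bar> \<le> \<bar>A0\<bar> * (Bu * B)" if t: "t \<in> {0<..<1}" for t x
    proof (cases "R < \<bar>x\<bar>")
      case True
      then show ?thesis using rz(2)[OF t True] BB by (simp add: F2_def)
    next
      case False
      have "\<bar>u (t, x)\<bar> * \<bar>d_x (d_x \<phi>) (t, x)\<bar> \<le> Bu * B" by (rule mult_mono[OF uR[OF t False] rb(3)[OF t] Bu0 abs_ge_zero])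
      from mult_mono[OF A[of t] this] show ?thesis unfolding F2_def abs_mult fst_conv by simp
    qed
    have b3: "\<bar>F3 (t, x)\<bar> \<le> \<bar>A0\<bar> * (1 * C\<^sup>2 * B)" if t: "t \<in> {0<..<1}" for t x
    proof -
      have "\<bar>ux (t, x)\<bar> \<le> C" using b[of t x] t by auto
      then have "\<bar>(ux (t, x))\<^sup>2\<bar> \<le> C\<^sup>2" using abs_le_square_iff[of "ux (t, x)" C] C0 by simp
      moreover have "\<bar>cdf01 \<mu> t\<bar> \<le> 1" using cdf01(2,3)[OF mu, of t] by simp
      ultimately have "\<bar>cdf01 \<mu> t\<bar> * \<bar>(ux (t, x))\<^sup>2\<bar> \<le> 1 * C\<^sup>2"
        by (intro mult_mono) auto
      from mult_mono[OF this rb(1)[OF t, of x]]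
      have "\<bar>cdf01 \<mu> t\<bar> * \<bar>(ux (t, x))\<^sup>2\<bar> * \<bar>\<phi> (t, x)\<bar> \<le> 1 * C\<^sup>2 * B" by simp
      from mult_mono[OF A[of t] this] show ?thesis unfolding F3_def abs_mult fst_conv by simp
    qed
    have b4: "\<bar>F4 (t, x)\<bar> \<le> \<bar>A0\<bar> * (C * B)" if t: "t \<in> {0<..<1}" for t x
    proof -
      have "\<bar>uxx (t, x)\<bar> \<le> C" using b[of t x] t by auto
      then have "\<bar>uxx (t, x)\<bar> * \<bar>\<phi> (t, x)\<bar> \<le> C * B" by (rule mult_mono[OF _ rb(1)[OF t] C0 abs_ge_zero])
      from mult_mono[OF A[of t] this] show ?thesis unfolding F4_def abs_mult fst_conv by simp
    qed
    have I1: "{0<..<1::real} \<subseteq> {0<..1}" by auto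
    have pz: "\<phi> (t, x) = 0" if "t \<in> {0<..<1}" "R < \<bar>x\<bar>" for t x by (rule r(3)) (use that in auto)
    have z1: "F1 (t, x) = 0" if "t \<in> {0<..<1}" "R < \<bar>x\<bar>" for t x using rz(1)[OF that] by (simp add: F1_def)
    have z2: "F2 (t, x) = 0" if "t \<in> {0<..<1}" "R < \<bar>x\<bar>" for t x using rz(2)[OF that] by (simp add: F2_def)
    have z3: "F3 (t, x) = 0" if "t \<in> {0<..<1}" "R < \<bar>x\<bar>" for t x using pz[OF that] by (simp add: F3_def)
    have z4: "F4 (t, x) = 0" if "t \<in> {0<..<1}" "R < \<bar>x\<bar>" for t x using pz[OF that] by (simp add: F4_def)
    have ob: "\<forall>t\<in>{0<..<1}. \<forall>x. \<bar>F1 (t, x)\<bar> \<le> Bu * B" "\<forall>t\<in>{0<..<1}. \<forall>x. \<bar>F2 (t, x)\<bar> \<le> \<bar>A0\<bar> * (Bu * B)"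
      "\<forall>t\<in>{0<..<1}. \<forall>x. \<bar>F3 (t, x)\<bar> \<le> \<bar>A0\<bar> * (1 * C\<^sup>2 * B)" "\<forall>t\<in>{0<..<1}. \<forall>x. \<bar>F4 (t, x)\<bar> \<le> \<bar>A0\<bar> * (C * B)"
      using b1 b2 b3 b4 by blast+
    have oz: "\<forall>t\<in>{0<..<1}. \<forall>x. R < \<bar>x\<bar> \<longrightarrow> F1 (t, x) = 0" "\<forall>t\<in>{0<..<1}. \<forall>x. R < \<bar>x\<bar> \<longrightarrow> F2 (t, x) = 0"
      "\<forall>t\<in>{0<..<1}. \<forall>x. R < \<bar>x\<bar> \<longrightarrow> F3 (t, x) = 0" "\<forall>t\<in>{0<..<1}. \<forall>x. R < \<bar>x\<bar> \<longrightarrow> F4 (t, x) = 0"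
      using z1 z2 z3 z4 by blast+
    note S1 = strip_integral[OF m1 ob(1) oz(1)] and S2 = strip_integral[OF m2 ob(2) oz(2)]
      and S3 = strip_integral[OF m3 ob(3) oz(3)] and S4 = strip_integral[OF m4 ob(4) oz(4)]
    have i34: "set_integrable lborel open_strip (\<lambda>z. F4 z + F3 z)" by (rule set_integral_add(1)[OF S4(1) S3(1)])
    have ge: "F4 z + F3 z = g z * \<phi> z" if "z \<in> open_strip" for z
      using Ue[OF that] by (simp add: F3_def F4_def g_def algebra_simps)
    have time: "(LINT t:{0<..<1}|lborel. F1 (t, x)) = \<phi> (1, x) * ln (cosh x) + (LINT t:{0<..<1}|lborel. F4 (t, x) + F3 (t, x))" for x
    proof -
      have dm [measurable]: "(\<lambda>t. indicator {0<..<1} t * d_t \<phi> (t, x)) \<in> borel_measurable borel"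
      proof -
        have "continuous_on {0<..<1} (\<lambda>t. d_t \<phi> (t, x))"
          by (rule continuous_on_compose2[OF r(8), of _ "\<lambda>t. (t, x)"]) (auto intro!: continuous_intros)
        from borel_measurable_continuous_on_indicator[OF _ this] show ?thesis by simp
      qed
      have pint: "(LINT t:{0<..<s}|lborel. d_t \<phi> (t, x)) = \<phi> (s, x)" if s: "s \<in> {0<..1}" for s
      proof -
        \<comment> \<open>The test function is supported away from \<open>t = 0\<close>, so extending it by \<open>0\<close> gives a continuous
         function on the closed interval to which the fundamental theorem applies.\<close>
        define f where "f t = (if t \<le> 0 then 0 else \<phi> (t, x))" for t
        have f1: "continuous_on {0..s} f"
        proof -
          have "continuous_on ({0..min (l/2) s} \<union> {min (l/2) s..s}) (\<lambda>t. if t \<le> min (l/2) s then 0 else \<phi> (t, x))"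
          proof (rule continuous_on_cases)
            show "continuous_on {min (l/2) s..s} (\<lambda>t. \<phi> (t, x))"
              by (rule continuous_on_compose2[OF r(7), of _ "\<lambda>t. (t, x)"]) (use s r(1) in \<open>auto intro!: continuous_intros\<close>)
            show "\<forall>t. t \<in> {0..min (l/2) s} \<and> \<not> t \<le> min (l/2) s \<or> t \<in> {min (l/2) s..s} \<and> t \<le> min (l/2) s \<longrightarrow> 0 = \<phi> (t, x)"
            proof (intro allI impI)
              fix t assume "t \<in> {0..min (l/2) s} \<and> \<not> t \<le> min (l/2) s \<or> t \<in> {min (l/2) s..s} \<and> t \<le> min (l/2) s"
              then have t: "t = min (l/2) s" by auto
              have "\<phi> (t, x) = 0" by (rule r(3)) (use s r(1) t in \<open>auto simp: min_def\<close>)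
              then show "0 = \<phi> (t, x)" by simp
            qed
          qed auto
          moreover have "{0..min (l/2) s} \<union> {min (l/2) s..s} = {0..s}" using s r(1) by auto
          ultimately have "continuous_on {0..s} (\<lambda>t. if t \<le> min (l/2) s then 0 else \<phi> (t, x))" by simp
          then show ?thesis
          proof (rule continuous_on_eq)
            fix t assume t: "t \<in> {0..s}"
            have "\<phi> (t, x) = 0" if "0 < t" "t \<le> min (l/2) s" by (rule r(3)) (use s r(1) t that in auto)
            then show "(if t \<le> min (l/2) s then 0 else \<phi> (t, x)) = f t"
              using s r(1) t by (auto simp: f_def)
          qed
        qed
        have f2: "(f has_vector_derivative d_t \<phi> (t, x)) (at t)" if "t \<in> {0<..<s}" for t
        proof -
          have t: "t \<in> {0<..<1}" using that s by auto
          have "(f has_real_derivative d_t \<phi> (t, x)) (at t)"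
            by (rule has_field_derivative_transform_within_open[OF r(4)[OF t], of "{0<..}"]) (use t in \<open>auto simp: f_def\<close>)
          then show ?thesis by (simp add: has_real_derivative_iff_has_vector_derivative)
        qed
        have hi: "((\<lambda>t. d_t \<phi> (t, x)) has_integral (f s - f 0)) {0..s}"
          by (rule fundamental_theorem_of_calculus_interior[OF _ f1 f2]) (use s in auto)
        have si: "set_integrable lborel {0<..<s} (\<lambda>t. d_t \<phi> (t, x))"
          unfolding set_integrable_def
        proof (rule Bochner_Integration.integrable_bound[where f="\<lambda>t. B * indicator {0..1::real} t :: real"])
          show "integrable lborel (\<lambda>t. B * indicator {0..1::real} t :: real)" by (intro integrable_mult_right) auto
          have "(\<lambda>t. indicator {0<..<s} t * (indicator {0<..<1} t * d_t \<phi> (t, x))) \<in> borel_measurable lborel" by measurable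
          then show "(\<lambda>t. indicator {0<..<s} t *\<^sub>R d_t \<phi> (t, x)) \<in> borel_measurable lborel"
            by (rule measurable_cong[THEN iffD1, rotated]) (use s in \<open>auto simp: indicator_def\<close>)
          have "norm (indicator {0<..<s} t *\<^sub>R d_t \<phi> (t, x)) \<le> norm (B * indicator {0..1::real} t :: real)" for t
          proof (cases "t \<in> {0<..<s}")
            case True
            then have "t \<in> {0<..<1}" using s by auto
            then show ?thesis using True rb(2)[of t x] B0 by simp
          qed simp
          then show "AE t in lborel. norm (indicator {0<..<s} t *\<^sub>R d_t \<phi> (t, x)) \<le> norm (B * indicator {0..1::real} t :: real)"
            by (intro AE_I2)
        qed
        have "(LINT t:{0<..<s}|lborel. d_t \<phi> (t, x)) = integral {0..s} (\<lambda>t. d_t \<phi> (t, x))"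
          by (simp only: set_borel_integral_eq_integral(2)[OF si] integral_open_interval_real)
        also have "\<dots> = \<phi> (s, x)" using integral_unique[OF hi] s by (simp add: f_def)
        finally show ?thesis .
      qed
      define T where "T t = (LINT s:{t<..<1}|lborel. g (s, x))" for t
      have u': "u (t, x) = ln (cosh x) + T t" if t: "t \<in> {0<..<1}" for t
      proof -
        have "T t = (LINT s:{t<..<1}|lborel. xi'' \<xi>\<^sub>0 \<beta> s / 2 * (uxx (s, x) + cdf01 \<mu> s * (ux (s, x))\<^sup>2))"
          unfolding T_def by (rule set_lebesgue_integral_cong) (use t Ue in \<open>auto simp: g_def a_def\<close>)
        then show ?thesis using evo[of t x] t by simp
      qed
      have gx [measurable]: "(\<lambda>s. g (s, x)) \<in> borel_measurable borel"
        using gm by (rule measurable_compose[rotated]) (intro borel_measurable_continuous_onI continuous_intros)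
      have Tb: "\<bar>T t\<bar> \<le> D" if "t \<in> {0..1}" for t
      proof -
        have i0: "integrable lborel (\<lambda>s. D * indicator {0..1::real} s :: real)"
          by (intro integrable_mult_right) auto
        have le: "\<bar>indicator {t<..<1} s *\<^sub>R g (s, x)\<bar> \<le> D * indicator {0..1} s" for s
        proof (cases "s \<in> {t<..<1}")
          case True
          then show ?thesis using that gb[of "(s, x)"] by (simp add: D_def)
        qed (simp add: D0)
        have i: "integrable lborel (\<lambda>s. indicator {t<..<1} s *\<^sub>R g (s, x))"
        proof (rule Bochner_Integration.integrable_bound[OF i0])
          show "AE s in lborel. norm (indicator {t<..<1} s *\<^sub>R g (s, x)) \<le> norm (D * indicator {0..1::real} s :: real)"
            unfolding real_norm_def by (intro AE_I2 order_trans[OF le abs_ge_self])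
        qed measurable
        have "\<bar>T t\<bar> \<le> (\<integral>s. D * indicator {0..1::real} s \<partial>lborel)"
          unfolding T_def set_lebesgue_integral_def by (rule integral_abs_bound_integral[OF i i0 le])
        then show ?thesis by simp
      qed
      have cT: "continuous_on {0..1} T" unfolding T_def by (rule tail_integral_continuous[OF gx]) (rule gb)
      have sw: "(LINT t:{0<..<1}|lborel. d_t \<phi> (t, x) * T t) = (LINT s:{0<..<1}|lborel. g (s, x) * \<phi> (s, x))"
      proof -
        define H where "H = (\<lambda>(s, t). of_bool (t < s) * ((indicator {0<..<1} t * d_t \<phi> (t, x)) * (indicator {0<..<1} s * g (s, x))))"
        have "(\<integral>t. \<integral>s. H (s, t) \<partial>lborel \<partial>lborel) = (\<integral>s. \<integral>t. H (s, t) \<partial>lborel \<partial>lborel)"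
        proof (rule square_swap[where C="B * D"])
          show "H \<in> borel_measurable (borel \<Otimes>\<^sub>M borel)" unfolding H_def by measurable
          fix s t :: real
          show "\<bar>H (s, t)\<bar> \<le> B * D * indicator {0..1} s * indicator {0..1} t"
          proof (cases "t \<in> {0<..<1} \<and> s \<in> {0<..<1} \<and> t < s")
            case True
            then have "\<bar>d_t \<phi> (t, x)\<bar> * \<bar>g (s, x)\<bar> \<le> B * D"
              using gb[of "(s, x)"] B0 unfolding D_def by (intro mult_mono rb(2)) auto
            then show ?thesis using True by (simp add: H_def abs_mult)
          next
            case False
            then have "H (s, t) = 0" by (auto simp: H_def indicator_def)
            then show ?thesis using B0 D0 by simp
          qed
        qed
        moreover have "(\<integral>s. H (s, t) \<partial>lborel) = indicator {0<..<1} t * (d_t \<phi> (t, x) * T t)" for t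
        proof -
          have "(\<integral>s. H (s, t) \<partial>lborel) = (\<integral>s. (indicator {0<..<1} t * d_t \<phi> (t, x)) * (indicator {t<..<1} s * g (s, x)) \<partial>lborel)"
            by (rule Bochner_Integration.integral_cong) (auto simp: H_def indicator_def)
          then show ?thesis by (simp add: T_def set_lebesgue_integral_def)
        qed
        moreover have "(\<integral>t. H (s, t) \<partial>lborel) = indicator {0<..<1} s * (g (s, x) * \<phi> (s, x))" for s
        proof (cases "s \<in> {0<..<1}")
          case True
          have "(\<integral>t. H (s, t) \<partial>lborel) = (\<integral>t. g (s, x) * (indicator {0<..<s} t * d_t \<phi> (t, x)) \<partial>lborel)"
            by (rule Bochner_Integration.integral_cong) (use True in \<open>auto simp: H_def indicator_def\<close>)
          then show ?thesis using pint[of s] True by (simp add: set_lebesgue_integral_def)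
        qed (simp add: H_def)
        ultimately show ?thesis by (simp add: set_lebesgue_integral_def)
      qed
      have p1: "(LINT t:{0<..<1}|lborel. d_t \<phi> (t, x)) = \<phi> (1, x)" by (rule pint) simp
      have si1: "set_integrable lborel {0<..<1} (\<lambda>t. h t * d_t \<phi> (t, x))"
        if h: "continuous_on {0..1} h" for h :: "real \<Rightarrow> real"
      proof -
        obtain hb where hb: "\<forall>t\<in>{0..1}. \<bar>h t\<bar> \<le> hb" using bounded_on_unit[OF h] by blast
        have hm: "(\<lambda>t. indicator {0..1} t * h t) \<in> borel_measurable borel"
          using borel_measurable_continuous_on_indicator[OF _ h] by simp
        show ?thesis
          unfolding set_integrable_def
        proof (rule Bochner_Integration.integrable_bound[where f="\<lambda>t. hb * B * indicator {0..1::real} t :: real"])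
          show "integrable lborel (\<lambda>t. hb * B * indicator {0..1::real} t :: real)" by (intro integrable_mult_right) auto
          have "(\<lambda>t. (indicator {0..1} t * h t) * (indicator {0<..<1} t * d_t \<phi> (t, x))) \<in> borel_measurable lborel"
            using hm by measurable
          then show "(\<lambda>t. indicator {0<..<1} t *\<^sub>R (h t * d_t \<phi> (t, x))) \<in> borel_measurable lborel"
            by (rule measurable_cong[THEN iffD1, rotated]) (auto simp: indicator_def)
          have "norm (indicator {0<..<1} t *\<^sub>R (h t * d_t \<phi> (t, x))) \<le> norm (hb * B * indicator {0..1::real} t :: real)" for t
          proof (cases "t \<in> {0<..<1}")
            case True
            have "\<bar>h t\<bar> * \<bar>d_t \<phi> (t, x)\<bar> \<le> hb * B" using True hb[rule_format, of t] by (intro mult_mono rb(2)) auto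
            then show ?thesis using True abs_ge_self[of "hb * B"] by (simp add: abs_mult)
          qed simp
          then show "AE t in lborel. norm (indicator {0<..<1} t *\<^sub>R (h t * d_t \<phi> (t, x))) \<le> norm (hb * B * indicator {0..1::real} t :: real)"
            by (intro AE_I2)
        qed
      qed
      have "(LINT t:{0<..<1}|lborel. F1 (t, x)) = (LINT t:{0<..<1}|lborel. ln (cosh x) * d_t \<phi> (t, x) + T t * d_t \<phi> (t, x))"
        by (rule set_lebesgue_integral_cong) (use u' in \<open>auto simp: F1_def distrib_right\<close>)
      also have "\<dots> = (LINT t:{0<..<1}|lborel. ln (cosh x) * d_t \<phi> (t, x)) + (LINT t:{0<..<1}|lborel. T t * d_t \<phi> (t, x))"
        by (intro set_integral_add(2) si1 cT continuous_intros)
      also have "\<dots> = \<phi> (1, x) * ln (cosh x) + (LINT s:{0<..<1}|lborel. g (s, x) * \<phi> (s, x))"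
        using p1 sw by (simp add: mult.commute)
      also have "(LINT s:{0<..<1}|lborel. g (s, x) * \<phi> (s, x)) = (LINT t:{0<..<1}|lborel. F4 (t, x) + F3 (t, x))"
        by (rule set_lebesgue_integral_cong) (use ge in auto)
      finally show ?thesis .
    qed
    have ilc: "integrable lborel (\<lambda>x. \<phi> (1, x) * ln (cosh x))"
    proof (rule lborel_integral_compact_support(1)[of "-R" R])
      show "continuous_on {-R..R} (\<lambda>x. \<phi> (1, x) * ln (cosh x))"
        by (intro continuous_on_mult continuous_on_subset[OF slice[OF r(7)]] continuous_intros) auto
      show "\<phi> (1, y) * ln (cosh y) = 0" if "y \<notin> {-R..R}" for y
      proof -
        have "\<phi> (1, y) = 0" by (rule r(3)) (use that in auto)
        then show ?thesis by simp
      qed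
    qed
    have L1: "(LINT z:open_strip|lborel. F1 z) = (LINT x|lborel. \<phi> (1, x) * ln (cosh x)) + (LINT z:open_strip|lborel. F4 z + F3 z)"
    proof -
      have m34: "(\<lambda>z. indicator open_strip z * (F4 z + F3 z)) \<in> borel_measurable borel"
        using borel_measurable_add[OF m4 m3] by (simp add: distrib_left)
      have "\<bar>F4 (t, x) + F3 (t, x)\<bar> \<le> \<bar>A0\<bar> * (C * B) + \<bar>A0\<bar> * (1 * C\<^sup>2 * B)" if "t \<in> {0<..<1}" for t x
        using b3[OF that, of x] b4[OF that, of x] by linarith
      then have b34: "\<forall>t\<in>{0<..<1}. \<forall>x. \<bar>F4 (t, x) + F3 (t, x)\<bar> \<le> \<bar>A0\<bar> * (C * B) + \<bar>A0\<bar> * (1 * C\<^sup>2 * B)" by blast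
      have z34: "\<forall>t\<in>{0<..<1}. \<forall>x. R < \<bar>x\<bar> \<longrightarrow> F4 (t, x) + F3 (t, x) = 0" using z3 z4 by simp
      have "(LINT z:open_strip|lborel. F1 z) = (\<integral>x. \<phi> (1, x) * ln (cosh x) + (LINT t:{0<..<1}|lborel. F4 (t, x) + F3 (t, x)) \<partial>lborel)"
        using S1(4) time by simp
      also have "\<dots> = (LINT x|lborel. \<phi> (1, x) * ln (cosh x)) + (\<integral>x. (LINT t:{0<..<1}|lborel. F4 (t, x) + F3 (t, x)) \<partial>lborel)"
        by (rule Bochner_Integration.integral_add[OF ilc strip_integrable_snd[OF i34]])
      also have "(\<integral>x. (LINT t:{0<..<1}|lborel. F4 (t, x) + F3 (t, x)) \<partial>lborel) = (LINT z:open_strip|lborel. F4 z + F3 z)"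
        by (rule strip_integral(4)[OF m34 b34 z34, symmetric])
      finally show ?thesis .
    qed
    have L2: "(LINT z:open_strip|lborel. F2 z) = (LINT z:open_strip|lborel. F4 z)"
    proof -
      have "(\<integral>x. F2 (t, x) \<partial>lborel) = (\<integral>x. F4 (t, x) \<partial>lborel)" if t: "t \<in> {0<..<1}" for t
      proof -
        have t': "t \<in> {0..1}" using t by auto
        have "(\<integral>x. F2 (t, x) - F4 (t, x) \<partial>lborel) = 0"
        proof (rule compact_deriv_zero[of "\<lambda>x. a t * (u (t, x) * d_x \<phi> (t, x) - ux (t, x) * \<phi> (t, x))" _ R])
          show "((\<lambda>x. a t * (u (t, x) * d_x \<phi> (t, x) - ux (t, x) * \<phi> (t, x))) has_real_derivative F2 (t, x) - F4 (t, x)) (at x)" for x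
            using DERIV_cmult[OF DERIV_diff[OF DERIV_mult[OF dx[OF t', of x] r(6)[OF t, of x]] DERIV_mult[OF dxx[OF t', of x] r(5)[OF t, of x]]], of "a t"]
            by (simp add: F2_def F4_def algebra_simps)
          show "continuous_on UNIV (\<lambda>x. F2 (t, x) - F4 (t, x))"
            unfolding F2_def F4_def fst_conv
            by (intro continuous_on_diff continuous_on_mult continuous_on_const slice[OF cu] slice[OF cuxx] slice[OF cp] slice[OF r(9)]) (use t in auto)
        qed (use pz[OF t] r(10)[OF t] in auto)
        then show ?thesis using Bochner_Integration.integral_diff[OF S2(3)[OF t] S4(3)[OF t]] by simp
      qed
      then have "(LINT t:{0<..<1}|lborel. \<integral>x. F2 (t, x) \<partial>lborel) = (LINT t:{0<..<1}|lborel. \<integral>x. F4 (t, x) \<partial>lborel)"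
        by (intro set_lebesgue_integral_cong) auto
      then show ?thesis using S2(2) S4(2) by simp
    qed
    have "(LINT z:open_strip|lborel.
            - u z * d_t \<phi> z + xi'' \<xi>\<^sub>0 \<beta> (fst z) / 2 *
              (u z * d_x (d_x \<phi>) z + measure \<mu> {0..fst z} * (ux z)\<^sup>2 * \<phi> z)) = (LINT z:open_strip|lborel. (F2 z + F3 z) - F1 z)"
    proof (rule set_lebesgue_integral_cong)
      show "\<forall>z. z \<in> open_strip \<longrightarrow> - u z * d_t \<phi> z + xi'' \<xi>\<^sub>0 \<beta> (fst z) / 2 *
              (u z * d_x (d_x \<phi>) z + measure \<mu> {0..fst z} * (ux z)\<^sup>2 * \<phi> z) = (F2 z + F3 z) - F1 z"
      proof (intro allI impI)
        fix z :: "real \<times> real" assume z: "z \<in> open_strip"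
        have e1: "measure \<mu> {0..fst z} = cdf01 \<mu> (fst z)"
          by (rule cdf01(4)[OF mu, symmetric]) (use z in auto)
        have e2: "xi'' \<xi>\<^sub>0 \<beta> (fst z) / 2 = a (fst z)" using z by (auto simp: a_def)
        show "- u z * d_t \<phi> z + xi'' \<xi>\<^sub>0 \<beta> (fst z) / 2 *
              (u z * d_x (d_x \<phi>) z + measure \<mu> {0..fst z} * (ux z)\<^sup>2 * \<phi> z) = (F2 z + F3 z) - F1 z"
          unfolding e1 e2 F1_def F2_def F3_def by (simp add: distrib_left)
      qed
    qed simp
    also have "\<dots> = ((LINT z:open_strip|lborel. F2 z) + (LINT z:open_strip|lborel. F3 z)) - (LINT z:open_strip|lborel. F1 z)"
      by (simp only: set_integral_diff set_integral_add S1(1) S2(1) S3(1))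
    finally show ?thesis using L1 L2 set_integral_add(2)[OF S4(1) S3(1)] by linarith
  qed
  ultimately show ?thesis unfolding parisi_weak_solution_def using cu by blast
qed

section \<open>The Cole--Hopf transformation of powers of cosh\<close>

definition lncosh :: "real \<Rightarrow> real" where "lncosh x = ln (cosh x)"

lemma lncosh_deriv: "(lncosh has_real_derivative tanh x) (at x)"
  unfolding lncosh_def by (auto intro!: derivative_eq_intros simp: tanh_def cosh_real_pos)

lemma tanh_deriv: "(tanh has_real_derivative 1 - (tanh x)\<^sup>2) (at x)"
  by (auto intro!: derivative_eq_intros)

lemma tanh_abs_le: "\<bar>tanh x\<bar> \<le> (1::real)"
  using tanh_real_lt_1[of x] tanh_real_gt_neg1[of x] by linarith

lemma tanh_sq: "0 \<le> (tanh x)\<^sup>2" "(tanh x)\<^sup>2 \<le> (1::real)"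
  using tanh_abs_le[of x] by (auto simp: abs_square_le_1)

lemma lncosh_nonneg: "0 \<le> lncosh x"
  unfolding lncosh_def using cosh_real_ge_1[of x] by simp

lemma cosh_le_exp: "cosh x \<le> exp \<bar>x :: real\<bar>"
  by (cases "x \<ge> 0") (auto simp: cosh_def)

lemma lncosh_le: "lncosh x \<le> \<bar>x\<bar>"
proof -
  have "ln (cosh x) \<le> ln (exp \<bar>x\<bar>)" by (subst ln_le_cancel_iff) (auto simp: cosh_real_pos cosh_le_exp)
  then show ?thesis by (simp add: lncosh_def)
qed

lemma exp_lncosh: "exp (lncosh x) = cosh x"
  by (simp add: lncosh_def cosh_real_pos)

lemma cont_lncosh: "continuous_on S lncosh" and cont_tanh: "continuous_on S (tanh :: real \<Rightarrow> real)"
  using DERIV_isCont[OF lncosh_deriv] DERIV_isCont[OF tanh_deriv] by (auto intro: continuous_at_imp_continuous_on)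

lemma exp_growth_tanh: "exp_growth tanh" by (rule exp_growth_bounded[OF cont_tanh tanh_abs_le])
lemma exp_growth_sech2: "exp_growth (\<lambda>x. 1 - (tanh x)\<^sup>2)"
  by (rule exp_growth_bounded[of _ 1]) (use tanh_sq in \<open>auto intro!: continuous_intros cont_tanh simp: abs_le_iff intro: order_trans[of _ 0]\<close>)

lemma exp_growth_lncosh: "exp_growth lncosh"
proof (rule exp_growthI[OF cont_lncosh])
  fix x :: real
  have "\<bar>x\<bar> \<le> exp \<bar>x\<bar>" using exp_ge_add_one_self[of "\<bar>x\<bar>"] by linarith
  then show "\<bar>lncosh x\<bar> \<le> 1 * exp (1 * \<bar>x\<bar>)" using lncosh_le[of x] lncosh_nonneg[of x] by simp
qed

lemma gauss_avg_mono:
  assumes "exp_growth f" "exp_growth g" "\<And>y. f y \<le> g y"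
  shows "gauss_avg s f x \<le> gauss_avg s g x"
  unfolding gauss_avg_def by (rule integral_mono[OF gauss_avg_integrable[OF assms(1)] gauss_avg_integrable[OF assms(2)] assms(3)])

lemma gauss_avg_const: "gauss_avg s (\<lambda>_. c) x = c"
  using prob_space.prob_space[OF gauss_prob] by (simp add: gauss_avg_def)

lemma gauss_avg_linear:
  assumes "exp_growth f" "exp_growth g"
  shows "gauss_avg s (\<lambda>y. f y + g y) x = gauss_avg s f x + gauss_avg s g x" "gauss_avg s (\<lambda>y. c * f y) x = c * gauss_avg s f x"
  unfolding gauss_avg_def using gauss_avg_integrable[OF assms(1)] gauss_avg_integrable[OF assms(2)] by simp_all

lemma gauss_avg_abs_le:
  assumes "exp_growth f" "exp_growth g" "\<And>y. \<bar>f y\<bar> \<le> g y"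
  shows "\<bar>gauss_avg s f x\<bar> \<le> gauss_avg s g x"
proof -
  have "gauss_avg s f x \<le> gauss_avg s g x" by (rule gauss_avg_mono[OF assms(1,2)]) (use assms(3) in \<open>auto simp: abs_le_iff\<close>)
  moreover have "gauss_avg s (\<lambda>y. (-1) * f y) x \<le> gauss_avg s g x"
    by (rule gauss_avg_mono[OF exp_growth_cmult[OF assms(1)] assms(2)]) (use assms(3) in \<open>auto simp: abs_le_iff\<close>)
  ultimately show ?thesis unfolding gauss_avg_linear(2)[OF assms(1,1)] by (simp add: abs_le_iff)
qed

text \<open>The function \<open>cosh x\<close> to the power \<open>m\<close> and its first two derivatives.\<close>

definition cosh_pow :: "real \<Rightarrow> real \<Rightarrow> real" where "cosh_pow m x = exp (m * lncosh x)"
definition cosh_pow_x :: "real \<Rightarrow> real \<Rightarrow> real" where "cosh_pow_x m x = m * tanh x * cosh_pow m x"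
definition cosh_pow_xx :: "real \<Rightarrow> real \<Rightarrow> real" where "cosh_pow_xx m x = m * (1 - (1 - m) * (tanh x)\<^sup>2) * cosh_pow m x"

lemma cosh_pow_deriv: "(cosh_pow m has_real_derivative cosh_pow_x m x) (at x)"
  unfolding cosh_pow_def[abs_def] cosh_pow_x_def by (auto intro!: derivative_eq_intros DERIV_chain2[OF DERIV_exp] DERIV_cmult lncosh_deriv simp: cosh_pow_def)

lemma cosh_pow_x_deriv: "(cosh_pow_x m has_real_derivative cosh_pow_xx m x) (at x)"
proof -
  have "((\<lambda>x. m * tanh x * cosh_pow m x) has_real_derivative (m * (1 - (tanh x)\<^sup>2)) * cosh_pow m x + cosh_pow_x m x * (m * tanh x)) (at x)"
    by (rule DERIV_mult[OF DERIV_cmult[OF tanh_deriv] cosh_pow_deriv])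
  moreover have "(m * (1 - (tanh x)\<^sup>2)) * cosh_pow m x + cosh_pow_x m x * (m * tanh x) = cosh_pow_xx m x"
    by (simp add: cosh_pow_x_def cosh_pow_xx_def power2_eq_square algebra_simps)
  ultimately show ?thesis by (simp add: cosh_pow_x_def[abs_def])
qed

lemma cosh_pow_ge: "0 \<le> m \<Longrightarrow> 1 \<le> cosh_pow m x"
  using lncosh_nonneg[of x] by (simp add: cosh_pow_def)

lemma exp_growth_cosh_pow: assumes "0 \<le> m" shows "exp_growth (cosh_pow m)"
proof (rule exp_growthI[of _ 1 m])
  show "continuous_on UNIV (cosh_pow m)" using DERIV_isCont[OF cosh_pow_deriv] by (auto intro: continuous_at_imp_continuous_on)
  show "\<bar>cosh_pow m x\<bar> \<le> 1 * exp (m * \<bar>x\<bar>)" for x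
    using mult_left_mono[OF lncosh_le[of x] assms] by (simp add: cosh_pow_def)
qed

lemma exp_growth_cosh_pow_x: "0 \<le> m \<Longrightarrow> exp_growth (cosh_pow_x m)"
  unfolding cosh_pow_x_def[abs_def] by (intro exp_growth_mult exp_growth_cosh_pow exp_growth_const exp_growth_tanh)

lemma exp_growth_cosh_pow_xx: assumes "0 \<le> m" shows "exp_growth (cosh_pow_xx m)"
proof -
  have "exp_growth (\<lambda>x. m * (1 + (- (1 - m)) * (tanh x * tanh x)) * cosh_pow m x)"
    by (intro exp_growth_mult exp_growth_add exp_growth_cosh_pow assms exp_growth_const exp_growth_tanh)
  moreover have "(\<lambda>x. m * (1 + (- (1 - m)) * (tanh x * tanh x)) * cosh_pow m x) = cosh_pow_xx m"
    by (intro ext) (simp add: cosh_pow_xx_def power2_eq_square algebra_simps)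
  ultimately show ?thesis by (simp only:)
qed

lemma cosh_pow_bounds: assumes "0 \<le> m" "m \<le> 1" shows "\<bar>cosh_pow_x m x\<bar> \<le> m * cosh_pow m x" "\<bar>cosh_pow_xx m x\<bar> \<le> m * cosh_pow m x"
proof -
  have p: "0 \<le> m * cosh_pow m x" using assms cosh_pow_ge[OF assms(1), of x] by simp
  have "\<bar>tanh x\<bar> * (m * cosh_pow m x) \<le> 1 * (m * cosh_pow m x)" by (rule mult_right_mono[OF tanh_abs_le p])
  then show "\<bar>cosh_pow_x m x\<bar> \<le> m * cosh_pow m x" using p assms by (simp add: cosh_pow_x_def abs_mult cosh_pow_def mult_ac)
  have c: "0 \<le> (1 - m) * (tanh x)\<^sup>2" "(1 - m) * (tanh x)\<^sup>2 \<le> 1"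
    using assms tanh_sq[of x] mult_mono[of "1 - m" 1 "(tanh x)\<^sup>2" 1] by auto
  then have "\<bar>1 - (1 - m) * (tanh x)\<^sup>2\<bar> * (m * cosh_pow m x) \<le> 1 * (m * cosh_pow m x)" by (intro mult_right_mono p) auto
  then show "\<bar>cosh_pow_xx m x\<bar> \<le> m * cosh_pow m x" using p assms by (simp add: cosh_pow_xx_def abs_mult cosh_pow_def mult_ac)
qed

text \<open>The heat evolution of \<open>cosh^m\<close> and of its derivatives; its logarithm divided by \<open>m\<close> is the
Cole--Hopf solution of \<open>u_v = (u_xx + m (u_x)^2) / 2\<close> with initial value \<open>log cosh\<close>.\<close>

definition pow_avg where "pow_avg m v x = gauss_avg (sqrt v) (cosh_pow m) x"
definition pow_avg_x where "pow_avg_x m v x = gauss_avg (sqrt v) (cosh_pow_x m) x"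
definition pow_avg_xx where "pow_avg_xx m v x = gauss_avg (sqrt v) (cosh_pow_xx m) x"

definition cole_hopf :: "real \<Rightarrow> real \<Rightarrow> real \<Rightarrow> real" where "cole_hopf m v x = ln (pow_avg m v x) / m"
definition cole_hopf_x :: "real \<Rightarrow> real \<Rightarrow> real \<Rightarrow> real" where "cole_hopf_x m v x = pow_avg_x m v x / (m * pow_avg m v x)"
definition cole_hopf_xx :: "real \<Rightarrow> real \<Rightarrow> real \<Rightarrow> real" where
  "cole_hopf_xx m v x = pow_avg_xx m v x / (m * pow_avg m v x) - m * (cole_hopf_x m v x)\<^sup>2"

lemma pow_avg_ge: assumes "0 \<le> m" shows "1 \<le> pow_avg m v x"
proof -
  have "gauss_avg (sqrt v) (\<lambda>_. 1) x \<le> gauss_avg (sqrt v) (cosh_pow m) x"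
    by (rule gauss_avg_mono[OF exp_growth_const exp_growth_cosh_pow[OF assms] cosh_pow_ge[OF assms]])
  then show ?thesis by (simp add: pow_avg_def gauss_avg_const)
qed

context
  fixes m :: real assumes m: "0 < m" "m \<le> 1"
begin

lemma m_nonneg: "0 \<le> m" using m by simp

lemma pow_avg_pos: "0 < pow_avg m v x"
  using pow_avg_ge[OF m_nonneg, of v x] by linarith

lemma pow_avg_deriv_x: "(pow_avg m v has_real_derivative pow_avg_x m v x) (at x)" "(pow_avg_x m v has_real_derivative pow_avg_xx m v x) (at x)"
  unfolding pow_avg_def[abs_def] pow_avg_x_def[abs_def] pow_avg_xx_def[abs_def]
  by (rule gauss_avg_deriv_x[OF cosh_pow_deriv exp_growth_cosh_pow[OF m_nonneg] exp_growth_cosh_pow_x[OF m_nonneg]], rule gauss_avg_deriv_x[OF cosh_pow_x_deriv exp_growth_cosh_pow_x[OF m_nonneg] exp_growth_cosh_pow_xx[OF m_nonneg]])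

lemma pow_avg_deriv_v: "0 < v \<Longrightarrow> ((\<lambda>v. pow_avg m v x) has_real_derivative 1 / 2 * pow_avg_xx m v x) (at v)"
  unfolding pow_avg_def pow_avg_xx_def by (rule heat_deriv[OF cosh_pow_deriv cosh_pow_x_deriv exp_growth_cosh_pow[OF m_nonneg] exp_growth_cosh_pow_x[OF m_nonneg] exp_growth_cosh_pow_xx[OF m_nonneg]])

lemma cole_hopf_deriv_x: "(cole_hopf m v has_real_derivative cole_hopf_x m v x) (at x)"
  and cole_hopf_x_deriv_x: "(cole_hopf_x m v has_real_derivative cole_hopf_xx m v x) (at x)"
proof -
  have "((\<lambda>x. ln (pow_avg m v x) / m) has_real_derivative (pow_avg_x m v x / pow_avg m v x) / m) (at x)"
    using DERIV_cdivide[OF DERIV_chain2[OF DERIV_ln[OF pow_avg_pos] pow_avg_deriv_x(1)]] by (simp add: divide_inverse mult_ac)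
  then show "(cole_hopf m v has_real_derivative cole_hopf_x m v x) (at x)"
    by (simp add: cole_hopf_def[abs_def] cole_hopf_x_def mult.commute)
  have p: "m * pow_avg m v x \<noteq> 0" using m pow_avg_pos[of v x] by simp
  have "((\<lambda>x. pow_avg_x m v x / (m * pow_avg m v x)) has_real_derivative
      (pow_avg_xx m v x * (m * pow_avg m v x) - pow_avg_x m v x * (m * pow_avg_x m v x)) / ((m * pow_avg m v x) * (m * pow_avg m v x))) (at x)"
    by (rule DERIV_divide[OF pow_avg_deriv_x(2) DERIV_cmult[OF pow_avg_deriv_x(1)] p])
  moreover have "(pow_avg_xx m v x * (m * pow_avg m v x) - pow_avg_x m v x * (m * pow_avg_x m v x)) / ((m * pow_avg m v x) * (m * pow_avg m v x)) = cole_hopf_xx m v x"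
    using p by (simp add: cole_hopf_xx_def cole_hopf_x_def field_simps power2_eq_square)
  ultimately show "(cole_hopf_x m v has_real_derivative cole_hopf_xx m v x) (at x)" by (simp add: cole_hopf_x_def[abs_def])
qed

text \<open>The Parisi equation in the time variable \<open>v\<close>, for a constant coefficient \<open>m\<close>.\<close>

lemma cole_hopf_deriv_v:
  assumes v: "0 < v"
  shows "((\<lambda>v. cole_hopf m v x) has_real_derivative 1 / 2 * (cole_hopf_xx m v x + m * (cole_hopf_x m v x)\<^sup>2)) (at v)"
proof -
  have "((\<lambda>v. ln (pow_avg m v x)) has_real_derivative 1 / pow_avg m v x * (1 / 2 * pow_avg_xx m v x)) (at v)"
    using DERIV_ln_divide[OF pow_avg_pos] pow_avg_deriv_v[OF v] by (rule DERIV_chain2)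
  from DERIV_cdivide[OF this, of m]
  have "((\<lambda>v. cole_hopf m v x) has_real_derivative 1 / pow_avg m v x * (1 / 2 * pow_avg_xx m v x) / m) (at v)"
    by (simp only: cole_hopf_def)
  moreover have "1 / pow_avg m v x * (1 / 2 * pow_avg_xx m v x) / m = 1 / 2 * (cole_hopf_xx m v x + m * (cole_hopf_x m v x)\<^sup>2)"
    by (simp add: cole_hopf_xx_def)
  ultimately show ?thesis by (simp only:)
qed

lemma cole_hopf_zero: "cole_hopf m 0 x = lncosh x" "cole_hopf_x m 0 x = tanh x" "cole_hopf_xx m 0 x = 1 - (tanh x)\<^sup>2"
proof -
  have p: "cosh_pow m x > 0" by (simp add: cosh_pow_def)
  show "cole_hopf m 0 x = lncosh x" using m by (simp add: cole_hopf_def pow_avg_def gauss_avg_0 cosh_pow_def)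
  show 1: "cole_hopf_x m 0 x = tanh x" using m p by (simp add: cole_hopf_x_def pow_avg_def pow_avg_x_def gauss_avg_0 cosh_pow_x_def)
  have "pow_avg_xx m 0 x / (m * pow_avg m 0 x) = 1 - (1 - m) * (tanh x)\<^sup>2"
    using m p by (simp add: pow_avg_def pow_avg_xx_def gauss_avg_0 cosh_pow_xx_def)
  then show "cole_hopf_xx m 0 x = 1 - (tanh x)\<^sup>2" unfolding cole_hopf_xx_def 1 by (simp add: algebra_simps)
qed

lemma cole_hopf_x_bound: "\<bar>cole_hopf_x m v x\<bar> \<le> 1" and cole_hopf_xx_bound: "\<bar>cole_hopf_xx m v x\<bar> \<le> 2"
proof -
  have e: "gauss_avg s (\<lambda>y. m * cosh_pow m y) x = m * gauss_avg s (cosh_pow m) x" for s by (rule gauss_avg_linear(2)[OF exp_growth_cosh_pow[OF m_nonneg] exp_growth_cosh_pow[OF m_nonneg]])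
  have p: "0 < m * pow_avg m v x" using m pow_avg_pos[of v x] by simp
  have "\<bar>pow_avg_x m v x\<bar> \<le> m * pow_avg m v x"
    unfolding pow_avg_x_def pow_avg_def e[symmetric]
    by (rule gauss_avg_abs_le[OF exp_growth_cosh_pow_x[OF m_nonneg] exp_growth_cmult[OF exp_growth_cosh_pow[OF m_nonneg]] cosh_pow_bounds(1)[OF m_nonneg m(2)]])
  then show 1: "\<bar>cole_hopf_x m v x\<bar> \<le> 1" using p by (simp add: cole_hopf_x_def divide_le_eq_1)
  have "\<bar>pow_avg_xx m v x\<bar> \<le> m * pow_avg m v x"
    unfolding pow_avg_xx_def pow_avg_def e[symmetric]
    by (rule gauss_avg_abs_le[OF exp_growth_cosh_pow_xx[OF m_nonneg] exp_growth_cmult[OF exp_growth_cosh_pow[OF m_nonneg]] cosh_pow_bounds(2)[OF m_nonneg m(2)]])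
  then have 2: "\<bar>pow_avg_xx m v x / (m * pow_avg m v x)\<bar> \<le> 1" using p by (simp add: divide_le_eq_1)
  have "(cole_hopf_x m v x)\<^sup>2 \<le> 1" using 1 by (simp add: abs_square_le_1)
  then have "m * (cole_hopf_x m v x)\<^sup>2 \<le> 1 * 1" using m by (intro mult_mono) auto
  moreover have "0 \<le> m * (cole_hopf_x m v x)\<^sup>2" using m by simp
  ultimately show "\<bar>cole_hopf_xx m v x\<bar> \<le> 2" using 2 unfolding cole_hopf_xx_def by linarith
qed

lemma cole_hopf_cont: "continuous_on ({0..} \<times> UNIV) (\<lambda>(v, x). cole_hopf m v x)" "continuous_on ({0..} \<times> UNIV) (\<lambda>(v, x). cole_hopf_x m v x)"
  "continuous_on ({0..} \<times> UNIV) (\<lambda>(v, x). cole_hopf_xx m v x)"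
proof -
  note h = heat_continuous[OF exp_growth_cosh_pow[OF m_nonneg]] heat_continuous[OF exp_growth_cosh_pow_x[OF m_nonneg]] heat_continuous[OF exp_growth_cosh_pow_xx[OF m_nonneg]]
  note c = h[unfolded case_prod_beta, folded pow_avg_def pow_avg_x_def pow_avg_xx_def]
  have p: "pow_avg m v x \<noteq> 0" "m * pow_avg m v x \<noteq> 0" "m \<noteq> 0" for v x using m pow_avg_pos[of v x] by auto
  show "continuous_on ({0..} \<times> UNIV) (\<lambda>(v, x). cole_hopf m v x)"
    unfolding case_prod_beta cole_hopf_def by (intro continuous_intros c) (use p pow_avg_pos in auto)
  show 1: "continuous_on ({0..} \<times> UNIV) (\<lambda>(v, x). cole_hopf_x m v x)"
    unfolding case_prod_beta cole_hopf_x_def by (intro continuous_intros c) (use p in auto)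
  show "continuous_on ({0..} \<times> UNIV) (\<lambda>(v, x). cole_hopf_xx m v x)"
    unfolding case_prod_beta cole_hopf_xx_def by (intro continuous_intros c 1[unfolded case_prod_beta]) (use p in auto)
qed

lemma exp_growth_cole_hopf: assumes "0 \<le> v" shows "exp_growth (cole_hopf m v)" "exp_growth (cole_hopf_x m v)" "exp_growth (cole_hopf_xx m v)"
proof -
  have c: "continuous_on UNIV (\<lambda>x. f v x)" if "continuous_on ({0..} \<times> UNIV) (\<lambda>(v, x). f v x)" for f :: "real \<Rightarrow> real \<Rightarrow> real"
    by (rule continuous_on_compose2[OF that[unfolded case_prod_beta], of UNIV "\<lambda>x. (v, x)", unfolded fst_conv snd_conv])
       (use assms in \<open>auto intro!: continuous_intros\<close>)
  show "exp_growth (cole_hopf_x m v)" "exp_growth (cole_hopf_xx m v)" by (rule exp_growth_bounded[OF c[OF cole_hopf_cont(2)] cole_hopf_x_bound], rule exp_growth_bounded[OF c[OF cole_hopf_cont(3)] cole_hopf_xx_bound])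
  show "exp_growth (cole_hopf m v)"
  proof (rule exp_growthI[OF c[OF cole_hopf_cont(1)]])
    fix x
    have "\<bar>cole_hopf m v x - cole_hopf m v 0\<bar> \<le> 1 * \<bar>x - 0\<bar>"
      using field_differentiable_bound[of UNIV "cole_hopf m v" "cole_hopf_x m v" 1 x 0] cole_hopf_deriv_x cole_hopf_x_bound by auto
    then have "\<bar>cole_hopf m v x\<bar> \<le> \<bar>cole_hopf m v 0\<bar> + \<bar>x\<bar>"
      using abs_triangle_ineq[of "cole_hopf m v x - cole_hopf m v 0" "cole_hopf m v 0"] by simp
    also have "\<dots> \<le> \<bar>cole_hopf m v 0\<bar> * exp \<bar>x\<bar> + exp \<bar>x\<bar>"
    proof (rule add_mono)
      have e: "1 + \<bar>x\<bar> \<le> exp \<bar>x\<bar>" by (rule exp_ge_add_one_self)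
      then show "\<bar>x\<bar> \<le> exp \<bar>x\<bar>" by linarith
      have "1 \<le> exp \<bar>x\<bar>" by simp
      from mult_left_mono[OF this abs_ge_zero[of "cole_hopf m v 0"]] show "\<bar>cole_hopf m v 0\<bar> \<le> \<bar>cole_hopf m v 0\<bar> * exp \<bar>x\<bar>" by simp
    qed
    finally show "\<bar>cole_hopf m v x\<bar> \<le> (\<bar>cole_hopf m v 0\<bar> + 1) * exp (1 * \<bar>x\<bar>)" by (simp add: distrib_right)
  qed
qed

end

lemma glue_continuous:
  fixes P N :: "real \<times> real \<Rightarrow> real"
  assumes q: "0 \<le> q" "q \<le> 1" and P: "continuous_on ({q..1} \<times> UNIV) P" and N: "continuous_on ({0..q} \<times> UNIV) N"
    and a: "\<And>x. P (q, x) = N (q, x)"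
  shows "continuous_on ({0..1} \<times> UNIV) (\<lambda>z. if q \<le> fst z then P z else N z)"
proof -
  have "continuous_on ({q..1} \<times> UNIV \<union> {0..q} \<times> UNIV) (\<lambda>z. if q \<le> fst z then P z else N z)"
  proof (rule continuous_on_cases[OF _ _ P N])
    show "\<forall>z. z \<in> {q..1} \<times> UNIV \<and> \<not> q \<le> fst z \<or> z \<in> {0..q} \<times> UNIV \<and> q \<le> fst z \<longrightarrow> P z = N z"
    proof (intro allI impI)
      fix z :: "real \<times> real"
      assume "z \<in> {q..1} \<times> UNIV \<and> \<not> q \<le> fst z \<or> z \<in> {0..q} \<times> UNIV \<and> q \<le> fst z"
      then have "z = (q, snd z)" by (auto simp: prod_eq_iff mem_Times_iff)
      then show "P z = N z" using a by metis
    qed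
  qed (auto intro: closed_Times)
  moreover have "{q..1} \<times> UNIV \<union> {0..q} \<times> UNIV = {0..1} \<times> (UNIV :: real set)" using q by auto
  ultimately show ?thesis by simp
qed

text \<open>After the last atom the coefficient is \<open>1\<close> and \<open>log cosh x + (T 1 - T t) / 2\<close> is a solution;
between the atoms the coefficient is \<open>m\<close> and the Cole--Hopf formula applies; before the first atom
it is \<open>0\<close> and the equation is the heat equation. The pieces and their \<open>x\<close>-derivatives agree at
the atoms. The case \<open>q = r\<close> covers point masses, whatever \<open>m\<close> is.\<close>

theorem two_atom_solution:
  assumes model: "is_model \<xi>\<^sub>0" "\<beta> > 0" and mu: "\<mu> \<in> Pr01"
    and qr: "0 \<le> q" "q \<le> r" "r \<le> 1" and m: "0 < m" "m \<le> 1"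
    and cdf: "\<And>t. t \<in> {0<..<1} \<Longrightarrow> cdf01 \<mu> t = (if r \<le> t then 1 else if q \<le> t then m else 0)"
  shows "parisi_u \<xi>\<^sub>0 \<beta> \<mu> (0, x) = gauss_avg (sqrt (xi' \<xi>\<^sub>0 \<beta> q)) (cole_hopf m (xi' \<xi>\<^sub>0 \<beta> r - xi' \<xi>\<^sub>0 \<beta> q)) x
    + (xi' \<xi>\<^sub>0 \<beta> 1 - xi' \<xi>\<^sub>0 \<beta> r) / 2"
proof -
  define T where "T = xi' \<xi>\<^sub>0 \<beta>"
  define X where "X = xi'' \<xi>\<^sub>0 \<beta>"
  obtain K where K: "K > 1" "\<And>t. \<bar>t\<bar> < K \<Longrightarrow> (T has_real_derivative X t) (at t)"
    "\<And>t. \<bar>t\<bar> < K \<Longrightarrow> isCont X t" "T 0 = 0" "\<And>t. 0 \<le> t \<Longrightarrow> t < K \<Longrightarrow> 0 \<le> X t"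
    using model_xi[OF model] unfolding T_def X_def by metis
  have Xpos: "0 < X t" if "0 < t" "t \<le> 1" for t
    using model_xi[OF model] that unfolding X_def by (metis order.strict_trans1)
  have dT: "(T has_real_derivative X t) (at t)" if "t \<in> {0..1}" for t using K(1,2) that by auto
  have cT: "continuous_on {0..1} T" using dT DERIV_isCont by (blast intro: continuous_at_imp_continuous_on)
  have cX: "continuous_on {0..1} X" using K(1,3) by (intro continuous_at_imp_continuous_on) auto
  have Tm: "T s \<le> T t" if "0 \<le> s" "s \<le> t" "t \<le> 1" for s t
  proof (rule DERIV_nonneg_imp_nondecreasing[OF that(2)])
    fix y assume y: "s \<le> y" "y \<le> t"
    show "\<exists>d. (T has_real_derivative d) (at y) \<and> 0 \<le> d"
      by (intro exI[of _ "X y"] conjI dT K(5)) (use y that K(1) in auto)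
  qed
  \<comment> \<open>The clock \<open>V\<close> stops at \<open>r\<close>, where the formula degenerates to \<open>log cosh\<close>, and \<open>c\<close> runs only
     after \<open>r\<close>: a single formula then covers all \<open>t \<ge> q\<close>.\<close>
  define V where "V t = T r - T (min t r)" for t
  define c where "c t = (T 1 - T (max t r)) / 2" for t
  define w where "w = T r - T q"
  have w0: "0 \<le> w" using Tm[of q r] qr by (simp add: w_def)
  have V0: "0 \<le> V t" if "t \<in> {0..1}" for t using Tm[of "min t r" r] that qr by (simp add: V_def)
  have cV: "continuous_on {0..1} V" unfolding V_def
    by (intro continuous_intros continuous_on_compose2[OF cT]) (use qr in auto)
  have cc: "continuous_on {0..1} c" unfolding c_def
    by (intro continuous_intros continuous_on_compose2[OF cT]) (use qr in auto)
  define u where "u z = (if q \<le> fst z then cole_hopf m (V (fst z)) (snd z) + c (fst z)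
     else gauss_avg (sqrt (T q - T (fst z))) (cole_hopf m w) (snd z) + c (fst z))" for z
  define ux where "ux z = (if q \<le> fst z then cole_hopf_x m (V (fst z)) (snd z)
     else gauss_avg (sqrt (T q - T (fst z))) (cole_hopf_x m w) (snd z))" for z
  define uxx where "uxx z = (if q \<le> fst z then cole_hopf_xx m (V (fst z)) (snd z)
     else gauss_avg (sqrt (T q - T (fst z))) (cole_hopf_xx m w) (snd z))" for z
  have Vq: "V q = w" using qr by (simp add: V_def w_def)
  note eL = exp_growth_cole_hopf[OF m w0]
  have cP: "continuous_on ({q..1} \<times> UNIV) (\<lambda>z. F (V (fst z)) (snd z))"
    if "continuous_on ({0..} \<times> UNIV) (\<lambda>(v, x). F v x)" for F :: "real \<Rightarrow> real \<Rightarrow> real"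
    by (rule continuous_on_compose2[OF that[unfolded case_prod_beta], of _ "\<lambda>z. (V (fst z), snd z)", unfolded fst_conv snd_conv])
       (use V0 qr in \<open>auto intro!: continuous_on_Pair continuous_on_compose2[OF cV, of _ fst] continuous_on_fst continuous_on_snd continuous_on_id\<close>)
  have cN: "continuous_on ({0..q} \<times> UNIV) (\<lambda>z. gauss_avg (sqrt (T q - T (fst z))) f (snd z))" if "exp_growth f" for f
    by (rule continuous_on_compose2[OF heat_continuous[OF that, unfolded case_prod_beta], of _ "\<lambda>z. (T q - T (fst z), snd z)", unfolded fst_conv snd_conv])
       (use Tm qr in \<open>auto intro!: continuous_on_Pair continuous_on_diff continuous_on_const continuous_on_compose2[OF cT, of _ fst] continuous_on_fst continuous_on_snd continuous_on_id\<close>)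
  have cc': "continuous_on (S \<times> UNIV) (\<lambda>z. c (fst z))" if "S \<subseteq> {0..1}" for S
    by (rule continuous_on_compose2[OF cc]) (use that in \<open>auto intro!: continuous_on_fst continuous_on_id\<close>)
  have cu: "continuous_on ({0..1} \<times> UNIV) u"
    unfolding u_def
  proof (rule glue_continuous[OF _ _ continuous_on_add[OF cP[OF cole_hopf_cont(1)[OF m]] cc'] continuous_on_add[OF cN[OF eL(1)] cc']])
    show "cole_hopf m (V (fst (q, x))) (snd (q, x)) + c (fst (q, x)) = gauss_avg (sqrt (T q - T (fst (q, x)))) (cole_hopf m w) (snd (q, x)) + c (fst (q, x))" for x
      by (simp add: Vq gauss_avg_0)
  qed (use qr in auto)
  have cux: "continuous_on ({0..1} \<times> UNIV) ux"
    unfolding ux_def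
  proof (rule glue_continuous[OF _ _ cP[OF cole_hopf_cont(2)[OF m]] cN[OF eL(2)]])
    show "cole_hopf_x m (V (fst (q, x))) (snd (q, x)) = gauss_avg (sqrt (T q - T (fst (q, x)))) (cole_hopf_x m w) (snd (q, x))" for x
      by (simp add: Vq gauss_avg_0)
  qed (use qr in auto)
  have cuxx: "continuous_on ({0..1} \<times> UNIV) uxx"
    unfolding uxx_def
  proof (rule glue_continuous[OF _ _ cP[OF cole_hopf_cont(3)[OF m]] cN[OF eL(3)]])
    show "cole_hopf_xx m (V (fst (q, x))) (snd (q, x)) = gauss_avg (sqrt (T q - T (fst (q, x)))) (cole_hopf_xx m w) (snd (q, x))" for x
      by (simp add: Vq gauss_avg_0)
  qed (use qr in auto)
  have dx: "((\<lambda>y. u (t, y)) has_real_derivative ux (t, x)) (at x)" for t x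
  proof (cases "q \<le> t")
    case True
    have "((\<lambda>y. cole_hopf m (V t) y + c t) has_real_derivative cole_hopf_x m (V t) x + 0) (at x)"
      by (rule DERIV_add[OF cole_hopf_deriv_x[OF m] DERIV_const])
    then show ?thesis using True by (simp add: u_def ux_def)
  next
    case False
    have "((\<lambda>y. gauss_avg (sqrt (T q - T t)) (cole_hopf m w) y + c t) has_real_derivative gauss_avg (sqrt (T q - T t)) (cole_hopf_x m w) x + 0) (at x)"
      by (rule DERIV_add[OF gauss_avg_deriv_x[OF cole_hopf_deriv_x[OF m] eL(1,2)] DERIV_const])
    then show ?thesis using False by (simp add: u_def ux_def)
  qed
  have dxx: "((\<lambda>y. ux (t, y)) has_real_derivative uxx (t, x)) (at x)" for t x
    using cole_hopf_x_deriv_x[OF m, of "V t" x] gauss_avg_deriv_x[OF cole_hopf_x_deriv_x[OF m] eL(2,3), of "sqrt (T q - T t)" x]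
    by (cases "q \<le> t") (simp_all add: ux_def uxx_def)
  have hb: "\<bar>gauss_avg s f x\<bar> \<le> C" if "exp_growth f" "\<And>y. \<bar>f y\<bar> \<le> C" for s f x C
    using gauss_avg_abs_le[OF that(1) exp_growth_const that(2)] unfolding gauss_avg_const .
  have b: "\<bar>ux (t, x)\<bar> \<le> 2 \<and> \<bar>uxx (t, x)\<bar> \<le> 2" for t x
    using cole_hopf_x_bound[OF m, of "V t" x] cole_hopf_xx_bound[OF m, of "V t" x] hb[OF eL(2) cole_hopf_x_bound[OF m], of "sqrt (T q - T t)" x]
      hb[OF eL(3) cole_hopf_xx_bound[OF m], of "sqrt (T q - T t)" x]
    by (auto simp: ux_def uxx_def)
  have u1: "u (1, x) = lncosh x" for x
    using qr by (simp add: u_def V_def c_def cole_hopf_zero[OF m] max_def)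
  have Ts: "T s < T t" if "0 < s" "s < t" "t \<le> 1" for s t
  proof (rule DERIV_pos_imp_increasing_open[OF that(2)])
    show "\<exists>y. (T has_real_derivative y) (at x) \<and> 0 < y" if x: "s < x" "x < t" for x
      using dT[of x] Xpos[of x] x \<open>0 < s\<close> \<open>t \<le> 1\<close> by (intro exI[of _ "X x"] conjI) auto
    show "continuous_on {s..t} T"
      by (rule continuous_on_subset[OF cT]) (use that in auto)
  qed
  define G where "G x s = X s / 2 * (uxx (s, x) + cdf01 \<mu> s * (ux (s, x))\<^sup>2)" for x s
  have du: "((\<lambda>s. u (s, x)) has_real_derivative - G x s) (at s)" if s: "s \<in> {0<..<1} - {q, r}" for s x
  proof -
    have sK: "s \<in> {0..1}" "s \<in> {0<..<1}" using s by auto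
    consider "r < s" | "q < s" "s < r" | "s < q" using s by auto linarith
    then show ?thesis
    proof cases
      case 1
      have G: "G x s = X s / 2"
        using 1 qr cdf[OF sK(2)] by (simp add: G_def uxx_def ux_def V_def cole_hopf_zero[OF m])
      have "((\<lambda>s. lncosh x + (T 1 - T s) / 2) has_real_derivative - (X s / 2)) (at s)"
        using dT[OF sK(1)] by (auto intro!: derivative_eq_intros)
      then show ?thesis unfolding G
        by (rule has_field_derivative_transform_within_open[where S="{r<..}"])
           (use 1 qr in \<open>auto simp: u_def V_def c_def cole_hopf_zero[OF m] max_def\<close>)
    next
      case 2
      have G: "G x s = X s / 2 * (cole_hopf_xx m (V s) x + m * (cole_hopf_x m (V s) x)\<^sup>2)"
        using 2 cdf[OF sK(2)] by (simp add: G_def uxx_def ux_def)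
      have pos: "0 < T r - T s"
      using Ts[of s r] 2 sK qr by simp
      have V: "V s = T r - T s" using 2 by (simp add: V_def)
      have "((\<lambda>s. T r - T s) has_real_derivative - X s) (at s)"
        using dT[OF sK(1)] by (auto intro!: derivative_eq_intros)
      from DERIV_chain2[OF cole_hopf_deriv_v[OF m pos] this, of x]
      have "((\<lambda>s. cole_hopf m (T r - T s) x + (T 1 - T r) / 2) has_real_derivative - G x s) (at s)"
        unfolding G V by (auto intro!: derivative_eq_intros)
      then show ?thesis
        by (rule has_field_derivative_transform_within_open[where S="{q<..<r}"])
           (use 2 in \<open>auto simp: u_def V_def c_def max_def\<close>)
    next
      case 3
      have G: "G x s = X s / 2 * gauss_avg (sqrt (T q - T s)) (cole_hopf_xx m w) x"
        using 3 qr cdf[OF sK(2)] by (simp add: G_def uxx_def ux_def)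
      have pos: "0 < T q - T s"
      using Ts[of s q] 3 sK qr by simp
      have "((\<lambda>s. T q - T s) has_real_derivative - X s) (at s)"
        using dT[OF sK(1)] by (auto intro!: derivative_eq_intros)
      from DERIV_chain2[OF heat_deriv[OF cole_hopf_deriv_x[OF m] cole_hopf_x_deriv_x[OF m] eL pos] this, of x]
      have "((\<lambda>s. gauss_avg (sqrt (T q - T s)) (cole_hopf m w) x + (T 1 - T r) / 2) has_real_derivative - G x s) (at s)"
        unfolding G by (auto intro!: derivative_eq_intros)
      then show ?thesis
        by (rule has_field_derivative_transform_within_open[where S="{..<q}"])
           (use 3 qr in \<open>auto simp: u_def c_def max_def\<close>)
    qed
  qed
  have sol: "parisi_weak_solution \<xi>\<^sub>0 \<beta> \<mu> u"
  proof (rule weak_solution_criterion[OF model mu cu dx dxx cux cuxx b])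
    fix t x :: real assume t: "t \<in> {0..1}"
    have "((\<lambda>s. - G x s) has_integral (u (1, x) - u (t, x))) {t..1}"
    proof (rule fundamental_theorem_of_calculus_interior_strong[of "{q, r}"])
      show "((\<lambda>s. u (s, x)) has_vector_derivative - G x s) (at s)" if "s \<in> {t<..<1} - {q, r}" for s
        using du[of s x] that t by (auto simp: has_real_derivative_iff_has_vector_derivative)
      show "continuous_on {t..1} (\<lambda>s. u (s, x))"
        by (rule continuous_on_compose2[OF cu]) (use t in \<open>auto intro!: continuous_intros\<close>)
    qed (use t in auto)
    from has_integral_neg[OF this] have hi: "(G x has_integral (u (t, x) - u (1, x))) {t..1}" by simp
    have Gm: "(\<lambda>s. indicator {t<..<1} s *\<^sub>R G x s) \<in> borel_measurable borel"
    proof -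
      have c: "(\<lambda>s. indicator {0..1} s * f s) \<in> borel_measurable borel" if "continuous_on {0..1} f" for f :: "real \<Rightarrow> real"
        using borel_measurable_continuous_on_indicator[OF _ that] by simp
      have cs: "continuous_on {0..1} (\<lambda>s. f (s, x))" if "continuous_on ({0..1} \<times> UNIV) f" for f :: "real \<times> real \<Rightarrow> real"
        by (rule continuous_on_compose2[OF that]) (auto intro!: continuous_intros)
      note [measurable] = c[OF cX] c[OF cs[OF cux]] c[OF cs[OF cuxx]] cdf01(1)[OF mu]
      have "(\<lambda>s. indicator {t<..<1} s * ((indicator {0..1} s * X s) / 2 * ((indicator {0..1} s * uxx (s, x)) + cdf01 \<mu> s * (indicator {0..1} s * ux (s, x))\<^sup>2)))
         \<in> borel_measurable borel" by measurable
      then show ?thesis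
        by (rule measurable_cong[THEN iffD1, rotated]) (use t in \<open>auto simp: G_def indicator_def\<close>)
    qed
    obtain X0 where X0: "\<forall>s\<in>{0..1}. \<bar>X s\<bar> \<le> X0" using bounded_on_unit[OF cX] by blast
    have "X0 \<ge> 0" using X0[rule_format, of 0] by auto
    have Gb: "\<bar>indicator {t<..<1} s *\<^sub>R G x s\<bar> \<le> (X0 * 6) * indicator {0..1} s" for s
    proof (cases "s \<in> {t<..<1}")
      case True
      then have s: "s \<in> {0..1}" using t by auto
      have "(ux (s, x))\<^sup>2 \<le> 2\<^sup>2" using b[of s x] abs_le_square_iff[of "ux (s, x)" 2] by simp
      then have "cdf01 \<mu> s * (ux (s, x))\<^sup>2 \<le> 1 * 4" using cdf01(2,3)[OF mu] by (intro mult_mono) auto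
      moreover have "0 \<le> cdf01 \<mu> s * (ux (s, x))\<^sup>2" using cdf01(2)[OF mu] by simp
      ultimately have B: "\<bar>uxx (s, x) + cdf01 \<mu> s * (ux (s, x))\<^sup>2\<bar> \<le> 6" using b[of s x] by auto
      have "\<bar>X s / 2\<bar> \<le> X0" using X0[rule_format, OF s] by auto
      from mult_mono[OF this B] have "\<bar>G x s\<bar> \<le> X0 * 6" unfolding G_def abs_mult using \<open>X0 \<ge> 0\<close> by simp
      then show ?thesis using True s by simp
    qed (use \<open>X0 \<ge> 0\<close> in simp)
    have si: "set_integrable lborel {t<..<1} (G x)"
      unfolding set_integrable_def
    proof (rule Bochner_Integration.integrable_bound)
      show "integrable lborel (\<lambda>s. (X0 * 6) * indicator {0..1::real} s :: real)" by (intro integrable_mult_right) auto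
      show "AE s in lborel. norm (indicator {t<..<1} s *\<^sub>R G x s) \<le> norm ((X0 * 6) * indicator {0..1::real} s :: real)"
        unfolding real_norm_def by (intro AE_I2 order_trans[OF Gb abs_ge_self])
    qed (use Gm in simp)
    have "(LINT s:{t<..<1}|lborel. G x s) = integral {t..1} (G x)"
      by (simp only: set_borel_integral_eq_integral(2)[OF si] integral_open_interval_real)
    also have "\<dots> = u (t, x) - u (1, x)" by (rule integral_unique[OF hi])
    finally show "u (t, x) = ln (cosh x) + (LINT s:{t<..<1}|lborel. xi'' \<xi>\<^sub>0 \<beta> s / 2 * (uxx (s, x) + cdf01 \<mu> s * (ux (s, x))\<^sup>2))"
      unfolding G_def X_def u1 lncosh_def by linarith
  qed
  have "parisi_u \<xi>\<^sub>0 \<beta> \<mu> (0, x) = u (0, x)" by (rule parisi_u_eq[OF model mu sol]) simp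
  also have "\<dots> = gauss_avg (sqrt (T q)) (cole_hopf m w) x + (T 1 - T r) / 2"
  proof (cases "q = 0")
    case True
    then show ?thesis using qr K(4) by (simp add: u_def V_def w_def c_def gauss_avg_0 max_def)
  next
    case False
    then show ?thesis using qr K(4) by (simp add: u_def c_def max_def)
  qed
  finally show ?thesis by (simp add: T_def w_def)
qed

section \<open>The relative entropy of the cosh tilt\<close>

lemma exp_growth_hsg:
  assumes "exp_growth f" shows "exp_growth (gauss_avg s f)"
proof -
  obtain A B where b: "0 \<le> A" "0 \<le> B" "\<And>x. \<bar>f x\<bar> \<le> A * exp (B * \<bar>x\<bar>)" using exp_growthE[OF assms] by metis
  have c: "continuous_on UNIV (gauss_avg s f)"
    by (rule continuous_on_compose2[OF gauss_avg_continuous[OF assms, unfolded case_prod_beta], of UNIV "\<lambda>x. (s, x)", unfolded fst_conv snd_conv])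
       (auto intro!: continuous_intros)
  define C where "C = gauss_avg 1 (\<lambda>z. exp (B * \<bar>s\<bar> * \<bar>z\<bar>)) 0"
  have e: "exp_growth (\<lambda>z. exp (D * \<bar>z\<bar>))" for D
    by (rule exp_growthI[of _ 1 D]) (auto intro!: continuous_intros)
  show ?thesis
  proof (rule exp_growthI[OF c])
    fix x
    have "\<bar>gauss_avg 1 (\<lambda>z. f (x + s * z)) 0\<bar> \<le> gauss_avg 1 (\<lambda>z. A * exp (B * \<bar>x\<bar>) * exp (B * \<bar>s\<bar> * \<bar>z\<bar>)) 0"
    proof (rule gauss_avg_abs_le[OF exp_growth_affine[OF assms] exp_growth_cmult[OF e]])
      fix z
      have "B * \<bar>x + s * z\<bar> \<le> B * (\<bar>x\<bar> + \<bar>s\<bar> * \<bar>z\<bar>)"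
        using b(2) abs_triangle_ineq[of x "s * z"] by (intro mult_left_mono) (auto simp: abs_mult)
      then have "A * exp (B * \<bar>x + s * z\<bar>) \<le> A * exp (B * \<bar>x\<bar> + B * \<bar>s\<bar> * \<bar>z\<bar>)"
        using b(1) by (intro mult_left_mono) (auto simp: distrib_left mult.assoc)
      then show "\<bar>f (x + s * z)\<bar> \<le> A * exp (B * \<bar>x\<bar>) * exp (B * \<bar>s\<bar> * \<bar>z\<bar>)"
        using b(3)[of "x + s * z"] by (simp add: exp_add mult.assoc)
    qed
    also have "\<dots> = (A * exp (B * \<bar>x\<bar>)) * C" unfolding C_def by (rule gauss_avg_linear(2)[OF e e])
    finally show "\<bar>gauss_avg s f x\<bar> \<le> (A * C) * exp (B * \<bar>x\<bar>)" by (simp add: gauss_avg_def mult_ac)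
  qed
qed

definition sech :: "real \<Rightarrow> real" where "sech x = 1 / cosh x"

lemma sech_pos: "0 < sech x" and sech_le_1: "sech x \<le> 1"
  using cosh_real_ge_1[of x] by (auto simp: sech_def)

lemma sech_cosh: "sech x * cosh x = 1"
  using cosh_real_pos[of x] by (simp add: sech_def)

lemma sech_sq: "(sech x)\<^sup>2 = 1 - (tanh x)\<^sup>2"
proof -
  have p: "cosh x \<noteq> 0" using cosh_real_pos[of x] by simp
  have "1 - (tanh x)\<^sup>2 = ((cosh x)\<^sup>2 - (sinh x)\<^sup>2) / (cosh x)\<^sup>2"
    using p by (simp add: tanh_def power_divide diff_divide_distrib)
  then show ?thesis unfolding hyperbolic_pythagoras by (simp add: sech_def power_divide)
qed

lemma sech_deriv: "(sech has_real_derivative - sech x * tanh x) (at x)"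
  unfolding sech_def[abs_def] tanh_def
  by (auto intro!: derivative_eq_intros simp: cosh_real_pos less_imp_neq[THEN not_sym] power2_eq_square)

lemma sech_power_le_1: "\<bar>sech x ^ n\<bar> \<le> 1"
  using sech_pos[of x] sech_le_1[of x] by (simp add: power_le_one)

lemma exp_growth_sech_power: "exp_growth (\<lambda>x. sech x ^ n)"
proof (rule exp_growth_bounded[OF _ sech_power_le_1])
  have "continuous_on UNIV sech" using DERIV_isCont[OF sech_deriv] by (auto intro: continuous_at_imp_continuous_on)
  then show "continuous_on UNIV (\<lambda>x. sech x ^ n)" by (intro continuous_intros)
qed

lemma exp_growth_sech: "exp_growth sech" using exp_growth_sech_power[of 1] by simp

lemma exp_growth_cosh: "exp_growth (cosh :: real \<Rightarrow> real)"
  by (rule exp_growthI[of _ 1 1]) (auto intro!: continuous_intros cosh_le_exp simp: cosh_real_nonneg)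

lemma gauss_avg_cosh: "gauss_avg s cosh x = exp (s\<^sup>2 / 2) * cosh x"
proof -
  have e: "cosh (x + s * z) = exp x / 2 * exp (s * z) + exp (- x) / 2 * exp ((- s) * z)" for z
    unfolding cosh_def minus_add_distrib exp_add by (simp add: add_divide_distrib)
  show ?thesis
    unfolding gauss_avg_def e
    by (subst Bochner_Integration.integral_add)
       (use gauss_exp[of s] gauss_exp[of "- s"] in \<open>auto simp: cosh_def field_simps\<close>)
qed

text \<open>The heat evolution with the factor \<open>exp (- v / 2)\<close>, the reciprocal of the growth of \<open>cosh\<close>
under the heat flow. It satisfies \<open>\<partial>\<^sub>v damped f = damped (f'' - f) / 2\<close> and leaves \<open>cosh\<close> fixed.
Divided by \<open>cosh y\<close> it is the expectation of \<open>f / cosh\<close> under the tilted Gaussian law.\<close>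

definition damped :: "(real \<Rightarrow> real) \<Rightarrow> real \<Rightarrow> real \<Rightarrow> real" where
  "damped f y v = exp (- v / 2) * gauss_avg (sqrt v) f y"

lemma damped_cosh: "0 \<le> v \<Longrightarrow> damped cosh y v = cosh y"
  by (simp add: damped_def gauss_avg_cosh mult.assoc[symmetric] exp_add[symmetric])

lemma damped_zero: "damped f y 0 = f y"
  by (simp add: damped_def gauss_avg_0)

lemma damped_linear:
  assumes "exp_growth f" "exp_growth g"
  shows "damped (\<lambda>x. f x + g x) y v = damped f y v + damped g y v" "damped (\<lambda>x. c * f x) y v = c * damped f y v"
  by (simp_all only: damped_def gauss_avg_linear[OF assms] distrib_left) (simp add: mult_ac)

text \<open>A comparison principle: a lower bound for the \<open>v\<close>-derivative, in terms of \<open>g = f'' - f\<close>,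
integrates to a lower bound for the evolution. It is applied three times in a row, to the functions
\<open>sech^3\<close>, \<open>- sech\<close> and \<open>cosh * log cosh\<close>, where each bound feeds the next one.\<close>

lemma damped_lower:
  fixes P :: "real \<Rightarrow> real"
  assumes d1: "\<And>x. (f has_real_derivative f' x) (at x)" and d2: "\<And>x. (f' has_real_derivative f x + g x) (at x)"
    and e: "exp_growth f" "exp_growth f'" "exp_growth g" and v: "0 \<le> v"
    and P: "\<And>s. (P has_real_derivative P' s) (at s)" and le: "\<And>s. 0 < s \<Longrightarrow> P' s \<le> 1 / 2 * damped g y s"
  shows "f y + (P v - P 0) \<le> damped f y v"
proof -
  have "damped f y 0 - P 0 \<le> damped f y v - P v"
  proof (rule DERIV_nonneg_imp_increasing_open[OF v])
    fix s assume s: "0 < s" "s < v"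
    note e2 = exp_growth_add[OF e(1,3)]
    have "((\<lambda>s. exp (- s / 2) * gauss_avg (sqrt s) f y - P s) has_real_derivative
      (exp (- s / 2) * (- 1 / 2) * gauss_avg (sqrt s) f y + 1 / 2 * gauss_avg (sqrt s) (\<lambda>x. f x + g x) y * exp (- s / 2)) - P' s) (at s)"
      by (rule DERIV_diff[OF DERIV_mult[OF _ heat_deriv[OF d1 d2 e(1,2) e2 s(1)]] P])
         (auto intro!: derivative_eq_intros)
    moreover have "(exp (- s / 2) * (- 1 / 2) * gauss_avg (sqrt s) f y + 1 / 2 * gauss_avg (sqrt s) (\<lambda>x. f x + g x) y * exp (- s / 2)) - P' s
      = 1 / 2 * damped g y s - P' s"
      unfolding gauss_avg_linear(1)[OF e(1,3)] by (simp add: damped_def algebra_simps)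
    ultimately have "((\<lambda>s. damped f y s - P s) has_real_derivative 1 / 2 * damped g y s - P' s) (at s)"
      unfolding damped_def[of f] by (simp only:)
    moreover have "0 \<le> 1 / 2 * damped g y s - P' s" using le[OF s(1)] by simp
    ultimately show "\<exists>d. ((\<lambda>s. damped f y s - P s) has_real_derivative d) (at s) \<and> 0 \<le> d" by blast
  next
    have "continuous_on {0..v} (\<lambda>s. gauss_avg (sqrt s) f y)"
      by (rule continuous_on_compose2[OF heat_continuous[OF e(1), unfolded case_prod_beta], of _ "\<lambda>s. (s, y)", unfolded fst_conv snd_conv])
         (auto intro!: continuous_intros)
    moreover have "continuous_on {0..v} P" using DERIV_isCont[OF P] by (auto intro: continuous_at_imp_continuous_on)
    ultimately show "continuous_on {0..v} (\<lambda>s. damped f y s - P s)"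
      unfolding damped_def by (intro continuous_intros) auto
  qed
  then show ?thesis by (simp add: damped_zero)
qed

lemma sech_power_deriv:
  "((\<lambda>x. sech x ^ n) has_real_derivative - real n * (tanh x * sech x ^ n)) (at x)"
proof -
  have "((\<lambda>x. sech x ^ n) has_real_derivative real n * (- sech x * tanh x * sech x ^ (n - Suc 0))) (at x)"
    by (rule DERIV_power[OF sech_deriv])
  moreover have "real n * (- sech x * tanh x * sech x ^ (n - Suc 0)) = - real n * (tanh x * sech x ^ n)"
    by (cases n) (simp_all add: algebra_simps)
  ultimately show ?thesis by (simp only:)
qed

lemma sech_power_deriv2:
  "((\<lambda>x. - real n * (tanh x * sech x ^ n)) has_real_derivative
     (real n)\<^sup>2 * sech x ^ n - real n * (real n + 1) * sech x ^ (n + 2)) (at x)"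
proof -
  have s: "(tanh x)\<^sup>2 = 1 - (sech x)\<^sup>2" by (simp add: sech_sq)
  have "((\<lambda>x. - real n * (tanh x * sech x ^ n)) has_real_derivative
    - real n * ((1 - (tanh x)\<^sup>2) * sech x ^ n + (- real n * (tanh x * sech x ^ n)) * tanh x)) (at x)"
    by (rule DERIV_cmult[OF DERIV_mult[OF tanh_deriv sech_power_deriv]])
  moreover have "- real n * ((1 - (tanh x)\<^sup>2) * sech x ^ n + (- real n * (tanh x * sech x ^ n)) * tanh x)
    = - real n * ((1 - (tanh x)\<^sup>2) * sech x ^ n - real n * ((tanh x)\<^sup>2 * sech x ^ n))"
    by (simp add: power2_eq_square)
  moreover have "\<dots> = (real n)\<^sup>2 * sech x ^ n - real n * (real n + 1) * sech x ^ (n + 2)"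
    unfolding s by (simp add: power_add power2_eq_square algebra_simps)
  ultimately show ?thesis by (simp only:)
qed

lemma exp_growth_tanh_sech: "exp_growth (\<lambda>x. c * (tanh x * sech x ^ n))"
  by (intro exp_growth_cmult exp_growth_mult exp_growth_tanh exp_growth_sech_power)

text \<open>For \<open>f = sech^3\<close> one has \<open>f'' - f = 8 sech^3 - 12 sech^5 \<ge> - 12\<close>.\<close>

lemma damped_sech3: assumes "0 \<le> v" shows "sech y ^ 3 - 6 * v \<le> damped (\<lambda>x. sech x ^ 3) y v"
proof -
  define g where "g x = 8 * sech x ^ 3 + (-12) * sech x ^ 5" for x
  have eg: "exp_growth g" unfolding g_def by (intro exp_growth_add exp_growth_cmult exp_growth_sech_power)
  have "sech y ^ 3 + (-6 * v - (-6 * 0)) \<le> damped (\<lambda>x. sech x ^ 3) y v"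
  proof (rule damped_lower[OF sech_power_deriv _ exp_growth_sech_power exp_growth_tanh_sech eg assms, where P' = "\<lambda>_. -6"])
    show "((\<lambda>x. - real 3 * (tanh x * sech x ^ 3)) has_real_derivative sech x ^ 3 + g x) (at x)" for x
      using sech_power_deriv2[of 3 x] by (simp add: g_def algebra_simps)
    show "((\<lambda>s. -6 * s) has_real_derivative -6) (at s)" for s :: real
      by (auto intro!: derivative_eq_intros)
    fix s :: real assume s: "0 < s"
    have "gauss_avg (sqrt s) (\<lambda>_. -12) y \<le> gauss_avg (sqrt s) g y"
    proof (rule gauss_avg_mono[OF exp_growth_const eg])
      show "-12 \<le> g x" for x
        using sech_power_le_1[of x 5] zero_less_power[OF sech_pos[of x], of 3] unfolding g_def by (simp only: abs_le_iff) linarith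
    qed
    then have "-12 \<le> gauss_avg (sqrt s) g y" by (simp add: gauss_avg_const)
    from mult_left_mono[OF this, of "exp (- s / 2)"] have "exp (- s / 2) * (-12) \<le> damped g y s" by (simp add: damped_def)
    moreover have "exp (- s / 2) \<le> 1" using s by simp
    ultimately show "-6 \<le> 1 / 2 * damped g y s" by linarith
  qed
  then show ?thesis by simp
qed

text \<open>For \<open>f = sech\<close> one has \<open>f'' - f = - 2 sech^3\<close>, and the evolution of \<open>sech^3\<close> is bounded below
by \<open>damped_sech3\<close>.\<close>

lemma damped_sech: assumes "0 \<le> v" shows "damped sech y v \<le> sech y - v * sech y ^ 3 + 3 * v\<^sup>2"
proof -
  have n: "damped (\<lambda>x. (-1) * sech x) y v = (-1) * damped sech y v" by (rule damped_linear(2)[OF exp_growth_sech exp_growth_sech])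
  have "(-1) * sech y + ((v * sech y ^ 3 - 3 * v\<^sup>2) - (0 * sech y ^ 3 - 3 * 0\<^sup>2)) \<le> damped (\<lambda>x. (-1) * sech x) y v"
  proof (rule damped_lower[where f' = "\<lambda>x. 1 * (tanh x * sech x ^ 1)" and g = "\<lambda>x. 2 * sech x ^ 3" and P' = "\<lambda>s. sech y ^ 3 - 6 * s"
       and P = "\<lambda>v. v * sech y ^ 3 - 3 * v\<^sup>2"])
    show "((\<lambda>x. (-1) * sech x) has_real_derivative 1 * (tanh x * sech x ^ 1)) (at x)" for x
      using DERIV_cmult[OF sech_deriv[of x], of "-1"] by (simp add: mult_ac)
    show "((\<lambda>x. 1 * (tanh x * sech x ^ 1)) has_real_derivative (-1) * sech x + 2 * sech x ^ 3) (at x)" for x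
      using DERIV_cmult[OF sech_power_deriv2[of 1 x], of "-1"] by (simp add: numeral_3_eq_3 power2_eq_square)
    show "((\<lambda>v. v * sech y ^ 3 - 3 * v\<^sup>2) has_real_derivative sech y ^ 3 - 6 * s) (at s)" for s
      by (auto intro!: derivative_eq_intros)
    show "sech y ^ 3 - 6 * s \<le> 1 / 2 * damped (\<lambda>x. 2 * sech x ^ 3) y s" if "0 < s" for s
      using damped_sech3[of s y] that unfolding damped_linear(2)[OF exp_growth_sech_power exp_growth_sech_power] by simp
  qed (intro exp_growth_cmult exp_growth_sech exp_growth_tanh_sech exp_growth_sech_power assms)+
  then show ?thesis unfolding n by simp
qed

text \<open>Its evolution, divided by that of \<open>cosh\<close>, is the expectation of \<open>log cosh\<close> under the Gaussian
law tilted by \<open>cosh\<close>.\<close>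

definition cosh_lncosh :: "real \<Rightarrow> real" where "cosh_lncosh x = cosh x * lncosh x"

lemma exp_growth_sinh: "exp_growth (sinh :: real \<Rightarrow> real)"
proof -
  have "exp_growth (\<lambda>x. cosh x * tanh x)" by (intro exp_growth_mult exp_growth_cosh exp_growth_tanh)
  then show ?thesis by (simp add: tanh_def cosh_real_pos less_imp_neq[THEN not_sym])
qed

lemma exp_growth_cosh_lncosh: "exp_growth cosh_lncosh"
  unfolding cosh_lncosh_def[abs_def] by (intro exp_growth_mult exp_growth_cosh exp_growth_lncosh)

text \<open>For \<open>f = cosh * log cosh\<close> one has \<open>f'' - f = 2 cosh - sech\<close>; the evolution of \<open>cosh\<close> is explicit
and that of \<open>sech\<close> is bounded above by \<open>damped_sech\<close>.\<close>

lemma damped_cosh_lncosh: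
  assumes "0 \<le> v"
  shows "cosh_lncosh y + v * cosh y - 1 / 2 * (v * sech y - 1 / 2 * v\<^sup>2 * sech y ^ 3 + v ^ 3) \<le> damped cosh_lncosh y v"
proof -
  define P where "P v = v * cosh y - 1 / 2 * (v * sech y - 1 / 2 * v\<^sup>2 * sech y ^ 3 + v ^ 3)" for v
  have eg: "exp_growth (\<lambda>x. 2 * cosh x)" "exp_growth (\<lambda>x. (-1) * sech x)" by (intro exp_growth_cmult exp_growth_cosh exp_growth_sech)+
  have "cosh_lncosh y + (P v - P 0) \<le> damped cosh_lncosh y v"
  proof (rule damped_lower[where f' = "\<lambda>x. sinh x * lncosh x + sinh x" and g = "\<lambda>x. 2 * cosh x + (-1) * sech x"
       and P' = "\<lambda>s. cosh y - 1 / 2 * (sech y - s * sech y ^ 3 + 3 * s\<^sup>2)"])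
    have t: "cosh x * tanh x = sinh x" for x :: real by (simp add: tanh_def cosh_real_pos less_imp_neq[THEN not_sym])
    have dc: "(cosh has_real_derivative sinh x) (at x)" "(sinh has_real_derivative cosh x) (at x)" for x :: real
      by (auto intro!: derivative_eq_intros)
    show "(cosh_lncosh has_real_derivative sinh x * lncosh x + sinh x) (at x)" for x
      using DERIV_mult[OF dc(1) lncosh_deriv, of x] t[of x]
      by (simp add: cosh_lncosh_def[abs_def] mult.commute[of "tanh x"])
    have st: "sinh x * tanh x = cosh x - sech x" for x
    proof -
      have "sinh x * tanh x = cosh x * (tanh x)\<^sup>2" using t[of x] by (simp add: power2_eq_square mult.assoc[symmetric])
      also have "(tanh x)\<^sup>2 = 1 - (sech x)\<^sup>2" by (simp add: sech_sq)
      also have "cosh x * (1 - (sech x)\<^sup>2) = cosh x - sech x * (sech x * cosh x)"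
        by (simp add: power2_eq_square algebra_simps)
      finally show ?thesis by (simp add: sech_cosh)
    qed
    show "((\<lambda>x. sinh x * lncosh x + sinh x) has_real_derivative cosh_lncosh x + (2 * cosh x + (-1) * sech x)) (at x)" for x
    proof -
      have "((\<lambda>x. sinh x * lncosh x + sinh x) has_real_derivative (cosh x * lncosh x + tanh x * sinh x) + cosh x) (at x)"
        by (rule DERIV_add[OF DERIV_mult[OF dc(2) lncosh_deriv] dc(2)])
      moreover have "(cosh x * lncosh x + tanh x * sinh x) + cosh x = cosh_lncosh x + (2 * cosh x + (-1) * sech x)"
        using st[of x] by (simp add: cosh_lncosh_def mult.commute[of "tanh x"])
      ultimately show ?thesis by (simp only:)
    qed
    show "(P has_real_derivative cosh y - 1 / 2 * (sech y - s * sech y ^ 3 + 3 * s\<^sup>2)) (at s)" for s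
      unfolding P_def by (auto intro!: derivative_eq_intros)
    show "cosh y - 1 / 2 * (sech y - s * sech y ^ 3 + 3 * s\<^sup>2) \<le> 1 / 2 * damped (\<lambda>x. 2 * cosh x + (-1) * sech x) y s" if "0 < s" for s
      using damped_sech[of s y] damped_cosh[of s y] that
      unfolding damped_linear(1)[OF eg] damped_linear(2)[OF exp_growth_cosh exp_growth_cosh] damped_linear(2)[OF exp_growth_sech exp_growth_sech] by simp
  qed (intro exp_growth_cosh_lncosh exp_growth_add exp_growth_mult exp_growth_sinh exp_growth_lncosh eg assms)+
  then show ?thesis by (simp add: P_def)
qed

lemma cole_hopf_one: assumes "0 \<le> v" shows "cole_hopf 1 v y = lncosh y + v / 2"
proof -
  have "cosh_pow 1 = cosh" by (auto simp: cosh_pow_def exp_lncosh)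
  then have "pow_avg 1 v y = exp (v / 2) * cosh y" using assms by (simp add: pow_avg_def gauss_avg_cosh)
  then show ?thesis by (simp add: cole_hopf_def ln_mult cosh_real_pos lncosh_def)
qed

text \<open>The relative entropy, with respect to the Gaussian law with mean \<open>y\<close> and variance \<open>v\<close>, of that
law tilted by \<open>cosh\<close>: the tilted expectation of \<open>log cosh\<close> minus the logarithm of the
normalisation.\<close>

definition tilt_entropy :: "real \<Rightarrow> real \<Rightarrow> real" where
  "tilt_entropy v y = damped cosh_lncosh y v * sech y - cole_hopf 1 v y"

lemma tilt_entropy_lower:
  assumes "0 \<le> v"
  shows "1 / 2 * v * (tanh y)\<^sup>2 + 1 / 4 * v\<^sup>2 * sech y ^ 4 - 1 / 2 * v ^ 3 \<le> tilt_entropy v y"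
proof -
  have "(cosh_lncosh y + v * cosh y - 1 / 2 * (v * sech y - 1 / 2 * v\<^sup>2 * sech y ^ 3 + v ^ 3)) * sech y \<le> damped cosh_lncosh y v * sech y"
    by (rule mult_right_mono[OF damped_cosh_lncosh[OF assms] less_imp_le[OF sech_pos]])
  moreover have "(cosh_lncosh y + v * cosh y - 1 / 2 * (v * sech y - 1 / 2 * v\<^sup>2 * sech y ^ 3 + v ^ 3)) * sech y
    = lncosh y * (sech y * cosh y) + v * (sech y * cosh y) - 1 / 2 * v * (sech y)\<^sup>2 + 1 / 4 * v\<^sup>2 * sech y ^ 4 - 1 / 2 * v ^ 3 * sech y"
    by (simp add: cosh_lncosh_def algebra_simps power2_eq_square power3_eq_cube power4_eq_xxxx)
  moreover have "v ^ 3 * sech y \<le> v ^ 3 * 1" using assms sech_le_1[of y] by (intro mult_left_mono) auto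
  ultimately show ?thesis
    unfolding tilt_entropy_def cole_hopf_one[OF assms] sech_cosh sech_sq by (simp add: algebra_simps)
qed

text \<open>Multiply by \<open>exp x \<ge> 1 + x + x^2 / 2\<close>: the product of the two polynomials is \<open>1 + x^4 / 4\<close>.\<close>

lemma exp_neg_le:
  fixes x :: real assumes "0 \<le> x" shows "exp (- x) \<le> 1 - x + x\<^sup>2 / 2"
proof -
  have p: "0 < 1 - x + x\<^sup>2 / 2"
    using zero_le_power2[of "x - 1"] by (simp add: power2_eq_square algebra_simps)
  have "1 \<le> (1 - x + x\<^sup>2 / 2) * (1 + x + x\<^sup>2 / 2)"
  proof -
    have "(1 - x + x\<^sup>2 / 2) * (1 + x + x\<^sup>2 / 2) = 1 + (x\<^sup>2 / 2)\<^sup>2" by (simp add: power2_eq_square algebra_simps)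
    then show ?thesis by simp
  qed
  also have "\<dots> \<le> (1 - x + x\<^sup>2 / 2) * exp x"
    using exp_lower_Taylor_quadratic[OF assms] p by (intro mult_left_mono) auto
  finally show ?thesis by (simp add: exp_minus field_simps)
qed

text \<open>The expectation of \<open>(log cosh)^2\<close> under the tilted law; it bounds the error of the first order
expansion in \<open>1 - m\<close>.\<close>

definition tilt_second_moment :: "real \<Rightarrow> real \<Rightarrow> real" where
  "tilt_second_moment v y = damped (\<lambda>x. cosh_lncosh x * lncosh x) y v * sech y"

lemma exp_growth_tilt_entropy: assumes "0 \<le> v" shows "exp_growth (tilt_entropy v)" "exp_growth (tilt_second_moment v)"
proof -
  have e: "exp_growth (\<lambda>y. damped f y v)" if "exp_growth f" for f
    unfolding damped_def by (intro exp_growth_cmult exp_growth_hsg that)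
  have m: "(0::real) < 1" "(1::real) \<le> 1" by auto
  have "exp_growth (\<lambda>y. damped cosh_lncosh y v * sech y + (-1) * cole_hopf 1 v y)"
    by (intro exp_growth_add exp_growth_mult e exp_growth_cosh_lncosh exp_growth_sech exp_growth_cmult exp_growth_cole_hopf[OF m assms])
  then show "exp_growth (tilt_entropy v)" by (simp add: tilt_entropy_def[abs_def])
  show "exp_growth (tilt_second_moment v)"
    unfolding tilt_second_moment_def[abs_def] by (intro exp_growth_mult e exp_growth_cosh_lncosh exp_growth_sech exp_growth_lncosh)
qed

text \<open>The relative entropy is the slope at \<open>m = 1\<close> of the Cole--Hopf solution. With \<open>k = 1 - m\<close> one has
\<open>cosh^m = cosh * exp (- k log cosh)\<close>; expand the exponential to second order by \<open>exp_neg_le\<close>, and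
use \<open>ln (1 + x) \<le> x\<close> for the logarithm of the average.\<close>

lemma cole_hopf_slope:
  assumes v: "0 \<le> v" and m: "0 < m" "m < 1"
  shows "(1 - m) * tilt_entropy v y - (1 - m)\<^sup>2 / 2 * tilt_second_moment v y \<le> m * (cole_hopf 1 v y - cole_hopf m v y)"
proof -
  define k where "k = 1 - m"
  have k: "0 < k" "k < 1" using m by (auto simp: k_def)
  define C where "C = exp (v / 2) * cosh y"
  have C: "0 < C" by (simp add: C_def cosh_real_pos)
  have lnC: "ln C = cole_hopf 1 v y" using v by (simp add: C_def cole_hopf_one ln_mult cosh_real_pos lncosh_def)
  define a where "a = damped cosh_lncosh y v * sech y"
  define b where "b = tilt_second_moment v y"
  have eX: "exp_growth (\<lambda>x. cosh_lncosh x * lncosh x)" by (intro exp_growth_mult exp_growth_cosh_lncosh exp_growth_lncosh)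
  have h: "gauss_avg (sqrt v) f y = C * (damped f y v * sech y)" for f
  proof -
    have "C * (damped f y v * sech y) = (exp (v / 2) * exp (- v / 2)) * gauss_avg (sqrt v) f y * (sech y * cosh y)"
      by (simp add: C_def damped_def)
    then show ?thesis by (simp add: sech_cosh exp_add[symmetric])
  qed
  have e1: "exp_growth (\<lambda>x. cosh x + (- k) * cosh_lncosh x)" by (intro exp_growth_add exp_growth_cosh exp_growth_cmult exp_growth_cosh_lncosh)
  have e2: "exp_growth (\<lambda>x. (k\<^sup>2 / 2) * (cosh_lncosh x * lncosh x))" by (intro exp_growth_cmult eX)
  have "pow_avg m v y \<le> gauss_avg (sqrt v) (\<lambda>x. (cosh x + (- k) * cosh_lncosh x) + (k\<^sup>2 / 2) * (cosh_lncosh x * lncosh x)) y"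
    unfolding pow_avg_def
  proof (rule gauss_avg_mono[OF exp_growth_cosh_pow exp_growth_add[OF e1 e2]])
    show "0 \<le> m" using m by simp
    fix x
    have "cosh_pow m x = cosh x * exp (- (k * lncosh x))"
      unfolding cosh_pow_def k_def exp_lncosh[symmetric] exp_add[symmetric] by (simp add: algebra_simps)
    also have "\<dots> \<le> cosh x * (1 - k * lncosh x + (k * lncosh x)\<^sup>2 / 2)"
      using k lncosh_nonneg[of x] by (intro mult_left_mono exp_neg_le) (auto simp: cosh_real_nonneg)
    also have "\<dots> = (cosh x + (- k) * cosh_lncosh x) + (k\<^sup>2 / 2) * (cosh_lncosh x * lncosh x)"
      by (simp add: cosh_lncosh_def power2_eq_square algebra_simps)
    finally show "cosh_pow m x \<le> (cosh x + (- k) * cosh_lncosh x) + (k\<^sup>2 / 2) * (cosh_lncosh x * lncosh x)" .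
  qed
  also have "\<dots> = gauss_avg (sqrt v) cosh y + (- k) * gauss_avg (sqrt v) cosh_lncosh y + (k\<^sup>2 / 2) * gauss_avg (sqrt v) (\<lambda>x. cosh_lncosh x * lncosh x) y"
    by (simp only: gauss_avg_linear(1)[OF e1 e2] gauss_avg_linear(1)[OF exp_growth_cosh exp_growth_cmult[OF exp_growth_cosh_lncosh]]
        gauss_avg_linear(2)[OF exp_growth_cosh_lncosh exp_growth_cosh_lncosh] gauss_avg_linear(2)[OF eX eX])
  also have "\<dots> = C + (- k) * (C * a) + (k\<^sup>2 / 2) * (C * b)"
    unfolding h[of cosh_lncosh] h[of "\<lambda>x. cosh_lncosh x * lncosh x"] a_def b_def tilt_second_moment_def
    using v by (simp add: gauss_avg_cosh C_def)
  also have "\<dots> = C * (1 + (- k * a + k\<^sup>2 / 2 * b))" by (simp add: algebra_simps)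
  finally have le: "pow_avg m v y \<le> C * (1 + (- k * a + k\<^sup>2 / 2 * b))" .
  have H: "0 < pow_avg m v y" using pow_avg_ge[of m v y] m by linarith
  then have p: "0 < 1 + (- k * a + k\<^sup>2 / 2 * b)" using le C by (intro zero_less_mult_pos[OF order.strict_trans2[OF H le]])
  have "ln (pow_avg m v y) \<le> ln (C * (1 + (- k * a + k\<^sup>2 / 2 * b)))"
    by (rule ln_mono[OF le H])
  also have "\<dots> = ln C + ln (1 + (- k * a + k\<^sup>2 / 2 * b))" using C p by (intro ln_mult_pos)
  also have "ln (1 + (- k * a + k\<^sup>2 / 2 * b)) \<le> - k * a + k\<^sup>2 / 2 * b"
    using ln_le_minus_one[OF p] by simp
  finally have "ln (pow_avg m v y) \<le> cole_hopf 1 v y - k * a + k\<^sup>2 / 2 * b" by (simp add: lnC)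
  moreover have "m * cole_hopf m v y = ln (pow_avg m v y)" using m by (simp add: cole_hopf_def)
  ultimately show ?thesis
    unfolding tilt_entropy_def a_def[symmetric] b_def[symmetric] k_def[symmetric] right_diff_distrib
    using arg_cong[OF k_def, of "\<lambda>k. k * cole_hopf 1 v y"] by (simp only: left_diff_distrib)
qed

section \<open>Stationarity and stability of a point mass\<close>

lemma sets_unit_borel_atMost: "t \<le> 1 \<Longrightarrow> {0..t::real} \<in> sets unit_borel"
  by (auto simp: sets_restrict_space image_iff intro!: bexI[of _ "{0..t}"])

lemma point_mass:
  assumes "q \<in> {0..1::real}"
  shows "return unit_borel q \<in> Pr01"
    and "t \<in> {0..1} \<Longrightarrow> measure (return unit_borel q) {0..t} = (if q \<le> t then 1 else 0)"
proof -
  show "return unit_borel q \<in> Pr01"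
    using prob_space_return[of q unit_borel] assms by (simp add: Pr01_def space_restrict_space)
  show "t \<in> {0..1} \<Longrightarrow> measure (return unit_borel q) {0..t} = (if q \<le> t then 1 else 0)"
    using assms sets_unit_borel_atMost[of t] by (auto simp: measure_return indicator_def)
qed

text \<open>Mass \<open>m\<close> at \<open>q\<close> and mass \<open>1 - m\<close> at \<open>r\<close>, as the law of a function of a coin toss.\<close>

definition two_atoms :: "real \<Rightarrow> real \<Rightarrow> real \<Rightarrow> real measure" where
  "two_atoms m q r = distr (measure_pmf (bernoulli_pmf m)) unit_borel (\<lambda>b. if b then q else r)"

lemma two_atoms:
  assumes q: "0 \<le> q" "q \<le> r" "r \<le> 1" and m: "0 < m" "m \<le> 1"
  shows "two_atoms m q r \<in> Pr01"
    and "t \<in> {0..1} \<Longrightarrow> measure (two_atoms m q r) {0..t} = (if r \<le> t then 1 else if q \<le> t then m else 0)"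
proof -
  have f: "(\<lambda>b. if b then q else r) \<in> measurable (measure_pmf (bernoulli_pmf m)) unit_borel"
    unfolding measurable_def using q by (auto simp: space_restrict_space)
  show "two_atoms m q r \<in> Pr01"
    using prob_space.prob_space_distr[OF prob_space_measure_pmf f] by (simp add: Pr01_def two_atoms_def)
  assume t: "t \<in> {0..1}"
  have "measure (two_atoms m q r) {0..t} = measure (measure_pmf (bernoulli_pmf m)) {b. (if b then q else r) \<le> t}"
    unfolding two_atoms_def using f t q
    by (subst measure_distr[OF f sets_unit_borel_atMost]) (auto intro!: arg_cong[where f="measure _"] simp: vimage_def split: if_splits)
  also have "\<dots> = (\<Sum>b\<in>{b. (if b then q else r) \<le> t}. pmf (bernoulli_pmf m) b)"
    by (rule measure_measure_pmf_finite) simp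
  also have "\<dots> = (\<Sum>b\<in>UNIV. if (if b then q else r) \<le> t then pmf (bernoulli_pmf m) b else 0)"
    by (simp add: sum.If_cases)
  also have "\<dots> = (if r \<le> t then 1 else if q \<le> t then m else 0)"
    using q m by (auto simp: UNIV_bool)
  finally show "measure (two_atoms m q r) {0..t} = (if r \<le> t then 1 else if q \<le> t then m else 0)" .
qed

text \<open>A fixed model at a fixed temperature; \<open>T\<close> and \<open>X\<close> stand for the first and second derivative of
\<open>\<xi>\<close>.\<close>

locale spin_model =
  fixes \<xi>\<^sub>0 :: "real \<Rightarrow> real" and \<beta> :: real
  assumes model: "is_model \<xi>\<^sub>0" "\<beta> > 0"
begin

abbreviation T :: "real \<Rightarrow> real" where "T \<equiv> xi' \<xi>\<^sub>0 \<beta>"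
abbreviation X :: "real \<Rightarrow> real" where "X \<equiv> xi'' \<xi>\<^sub>0 \<beta>"

lemma xi_facts:
  "t \<in> {0..1} \<Longrightarrow> (T has_real_derivative X t) (at t)"
  "t \<in> {0..1} \<Longrightarrow> isCont X t"
  "T 0 = 0"
  "t \<in> {0..1} \<Longrightarrow> 0 \<le> X t"
  "0 < t \<Longrightarrow> t \<le> 1 \<Longrightarrow> 0 < X t"
  "0 \<le> s \<Longrightarrow> s \<le> t \<Longrightarrow> t \<le> 1 \<Longrightarrow> X s \<le> X t"
  by (rule model_xi[OF model]; force)+

lemma T_cont: "continuous_on {0..1} T" and X_cont: "continuous_on {0..1} X"
  using xi_facts(1,2) DERIV_isCont by (blast intro: continuous_at_imp_continuous_on)+

lemma T_increment_lower:
  assumes "0 \<le> q" "q \<le> r" "r \<le> 1"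
  shows "X q * (r - q) \<le> T r - T q"
proof -
  have "T q - X q * q \<le> T r - X q * r"
  proof (rule DERIV_nonneg_imp_nondecreasing[OF assms(2)])
    fix x assume x: "q \<le> x" "x \<le> r"
    show "\<exists>y. ((\<lambda>x. T x - X q * x) has_real_derivative y) (at x) \<and> 0 \<le> y"
      using xi_facts(1)[of x] xi_facts(6)[of q x] x assms
      by (intro exI[of _ "X x - X q"] conjI) (auto intro!: derivative_eq_intros)
  qed
  then show ?thesis by (simp add: algebra_simps)
qed

lemma T_increment_upper:
  assumes "0 \<le> q" "q \<le> r" "r \<le> 1"
  shows "T r - T q \<le> X 1 * (r - q)"
proof -
  have "X 1 * q - T q \<le> X 1 * r - T r"
  proof (rule DERIV_nonneg_imp_nondecreasing[OF assms(2)])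
    fix x assume x: "q \<le> x" "x \<le> r"
    show "\<exists>y. ((\<lambda>x. X 1 * x - T x) has_real_derivative y) (at x) \<and> 0 \<le> y"
      using xi_facts(1)[of x] xi_facts(6)[of x 1] x assms
      by (intro exI[of _ "X 1 - X x"] conjI) (auto intro!: derivative_eq_intros)
  qed
  then show ?thesis by (simp add: algebra_simps)
qed

lemma T_mono: "0 \<le> q \<Longrightarrow> q \<le> r \<Longrightarrow> r \<le> 1 \<Longrightarrow> T q \<le> T r"
  using T_increment_lower[of q r] mult_nonneg_nonneg[OF xi_facts(4)[of q], of "r - q"] by auto

lemma T_nonneg: "0 \<le> r \<Longrightarrow> r \<le> 1 \<Longrightarrow> 0 \<le> T r"
  using T_mono[of 0 r] xi_facts(3) by simp

lemma T_pos: assumes "0 < r" "r \<le> 1" shows "0 < T r"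
proof -
  have "0 < X (r / 2) * (r - r / 2)" using xi_facts(5)[of "r / 2"] assms by simp
  also have "\<dots> \<le> T r - T (r / 2)" by (rule T_increment_lower) (use assms in auto)
  finally show ?thesis using T_nonneg[of "r / 2"] assms by simp
qed

text \<open>A primitive of the integrand \<open>X s * s\<close> of the linear term of the functional.\<close>

definition J :: "real \<Rightarrow> real" where "J t = integral {0..t} (\<lambda>s. X s * s)"

lemma J_deriv_within: "t \<in> {0..1} \<Longrightarrow> (J has_real_derivative X t * t) (at t within {0..1})"
  unfolding J_def[abs_def]
  by (rule integral_has_real_derivative) (auto intro!: continuous_intros X_cont)

lemma J_cont: "continuous_on {0..1} J"
  unfolding continuous_on_eq_continuous_within by (intro ballI DERIV_continuous[OF J_deriv_within])

lemma J_deriv: "0 < t \<Longrightarrow> t < 1 \<Longrightarrow> (J has_real_derivative X t * t) (at t)"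
  using J_deriv_within[of t] by (simp add: at_within_Icc_at)

lemma J_tail:
  assumes "q \<in> {0..1}"
  shows "integrable lborel (\<lambda>s. indicator {q..1} s * (X s * s))" "(\<integral>s. indicator {q..1} s * (X s * s) \<partial>lborel) = J 1 - J q"
proof -
  have c: "continuous_on {a..1} (\<lambda>s. X s * s)" if "0 \<le> a" for a
    by (intro continuous_intros continuous_on_subset[OF X_cont]) (use that in auto)
  have si: "set_integrable lborel {q..1} (\<lambda>s. X s * s)"
    by (rule borel_integrable_atLeastAtMost') (use c assms in auto)
  show "integrable lborel (\<lambda>s. indicator {q..1} s * (X s * s))"
    using si by (simp add: set_integrable_def)
  have "(\<integral>s. indicator {q..1} s * (X s * s) \<partial>lborel) = integral {q..1} (\<lambda>s. X s * s)"
    using set_borel_integral_eq_integral(2)[OF si] by (simp add: set_lebesgue_integral_def)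
  also have "\<dots> = J 1 - J q"
    using Henstock_Kurzweil_Integration.integral_combine[of 0 q 1 "\<lambda>s. X s * s"] assms
      integrable_continuous_real[OF c[of 0]] by (simp add: J_def)
  finally show "(\<integral>s. indicator {q..1} s * (X s * s) \<partial>lborel) = J 1 - J q" .
qed

text \<open>The distribution function is hypothesised rather than the measure, so that a point mass can be
treated as a degenerate pair of atoms at \<open>q\<close> and an arbitrary \<open>r\<close>, with \<open>m = 1\<close>.\<close>

lemma functional_two_atoms:
  assumes mu: "\<mu> \<in> Pr01" and qr: "0 \<le> q" "q \<le> r" "r \<le> 1" and m: "0 < m" "m \<le> 1"
    and cdf: "\<And>t. t \<in> {0..1} \<Longrightarrow> measure \<mu> {0..t} = (if r \<le> t then 1 else if q \<le> t then m else 0)"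
  shows "parisi_functional \<xi>\<^sub>0 \<beta> h \<mu> = gauss_avg (sqrt (T q)) (cole_hopf m (T r - T q)) h + (T 1 - T r) / 2
    - 1 / 2 * (m * (J 1 - J q) + (1 - m) * (J 1 - J r))"
proof -
  have "parisi_u \<xi>\<^sub>0 \<beta> \<mu> (0, h) = gauss_avg (sqrt (T q)) (cole_hopf m (T r - T q)) h + (T 1 - T r) / 2"
    by (rule two_atom_solution[OF model mu qr m]) (use cdf cdf01(4)[OF mu] in auto)
  moreover have "(LINT s:{0..1}|lborel. X s * measure \<mu> {0..s} * s)
    = (\<integral>s. m * (indicator {q..1} s * (X s * s)) + (1 - m) * (indicator {r..1} s * (X s * s)) \<partial>lborel)"
    unfolding set_lebesgue_integral_def
    by (rule Bochner_Integration.integral_cong) (use cdf qr in \<open>auto simp: indicator_def algebra_simps\<close>)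
  moreover have "\<dots> = m * (J 1 - J q) + (1 - m) * (J 1 - J r)"
    using J_tail[of q] J_tail[of r] qr by simp
  ultimately show ?thesis unfolding parisi_functional_def by simp
qed

lemma functional_point:
  assumes "0 \<le> r" "r \<le> 1"
  shows "parisi_functional \<xi>\<^sub>0 \<beta> h (return unit_borel r) = gauss_avg (sqrt (T r)) lncosh h + (T 1 - T r) / 2 - 1 / 2 * (J 1 - J r)"
proof -
  have r: "r \<in> {0..1}" using assms by simp
  have "cole_hopf 1 0 = lncosh" by (intro ext cole_hopf_zero) auto
  then show ?thesis
    using functional_two_atoms[OF point_mass(1)[OF r], of r r 1 h] point_mass(2)[OF r] assms by simp
qed

text \<open>Its zeros are the elements of \<open>Q_star\<close>; up to the factor \<open>X q / 2\<close> it is the derivative of the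
functional along point masses.\<close>

definition overlap_gap :: "real \<Rightarrow> real \<Rightarrow> real" where
  "overlap_gap h q = q - gauss_avg (sqrt (T q)) (\<lambda>x. (tanh x)\<^sup>2) h"

lemma exp_growth_tanh2: "exp_growth (\<lambda>x. (tanh x)\<^sup>2)"
  using exp_growth_mult[OF exp_growth_tanh exp_growth_tanh] by (simp add: power2_eq_square)

lemma gauss_avg_T_cont: "exp_growth f \<Longrightarrow> continuous_on {0..1} (\<lambda>q. gauss_avg (sqrt (T q)) f h)"
  by (rule continuous_on_compose2[OF gauss_avg_continuous[unfolded case_prod_beta], of _ _ "\<lambda>q. (sqrt (T q), h)", unfolded fst_conv snd_conv])
     (auto intro!: continuous_intros T_cont)

lemma overlap_gap_cont: "continuous_on {0..1} (overlap_gap h)"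
  unfolding overlap_gap_def[abs_def] by (intro continuous_intros gauss_avg_T_cont exp_growth_tanh2)

text \<open>The heat equation for \<open>log cosh\<close>, whose second derivative is \<open>1 - tanh^2\<close>, contributes
\<open>X r (1 - E tanh^2) / 2\<close>; the other two terms contribute \<open>- X r / 2\<close> and \<open>X r * r / 2\<close>.\<close>

lemma functional_point_deriv:
  assumes "0 < r" "r < 1"
  shows "((\<lambda>r. gauss_avg (sqrt (T r)) lncosh h + (T 1 - T r) / 2 - 1 / 2 * (J 1 - J r)) has_real_derivative
    1 / 2 * X r * overlap_gap h r) (at r)"
proof -
  have r: "r \<in> {0..1}" using assms by simp
  have "((\<lambda>v. gauss_avg (sqrt v) lncosh h) has_real_derivative 1 / 2 * gauss_avg (sqrt (T r)) (\<lambda>x. 1 - (tanh x)\<^sup>2) h) (at (T r))"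
    by (rule heat_deriv[OF lncosh_deriv tanh_deriv exp_growth_lncosh exp_growth_tanh exp_growth_sech2]) (use T_pos assms in auto)
  note d = DERIV_chain2[OF this xi_facts(1)[OF r]]
  have "((\<lambda>r. gauss_avg (sqrt (T r)) lncosh h + (T 1 - T r) / 2 - 1 / 2 * (J 1 - J r)) has_real_derivative
    1 / 2 * gauss_avg (sqrt (T r)) (\<lambda>x. 1 - (tanh x)\<^sup>2) h * X r + (0 - X r) / 2 - 1 / 2 * (0 - X r * r)) (at r)"
    by (intro DERIV_diff DERIV_add DERIV_cdivide DERIV_cmult DERIV_const d xi_facts(1)[OF r] J_deriv assms)
  moreover have "gauss_avg (sqrt (T r)) (\<lambda>x. 1 - (tanh x)\<^sup>2) h = 1 - gauss_avg (sqrt (T r)) (\<lambda>x. (tanh x)\<^sup>2) h"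
    using gauss_avg_linear(1)[OF exp_growth_const[of 1] exp_growth_cmult[OF exp_growth_tanh2, of "-1"], of "sqrt (T r)" h]
    unfolding gauss_avg_linear(2)[OF exp_growth_tanh2 exp_growth_tanh2] gauss_avg_const by simp
  moreover have "1 / 2 * (1 - gauss_avg (sqrt (T r)) (\<lambda>x. (tanh x)\<^sup>2) h) * X r + (0 - X r) / 2 - 1 / 2 * (0 - X r * r)
    = 1 / 2 * X r * overlap_gap h r" by (simp add: overlap_gap_def algebra_simps)
  ultimately show ?thesis by (simp only:)
qed

text \<open>A quantitative form of \<open>E sech^2 > 0\<close>: completing the square,
\<open>sech^2 \<ge> 2 a - a^2 cosh^2\<close> for every \<open>a\<close>, and \<open>a = 1 / M\<close> gives \<open>E sech^2 \<ge> 1 / M\<close> for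
\<open>M = E cosh^2\<close>.\<close>

lemma tanh_sq_avg_less_1: "gauss_avg s (\<lambda>x. (tanh x)\<^sup>2) h < 1"
proof -
  define M where "M = gauss_avg s (\<lambda>x. cosh x * cosh x) h"
  note ec = exp_growth_mult[OF exp_growth_cosh exp_growth_cosh]
  have "gauss_avg s (\<lambda>_. 1) h \<le> M"
    unfolding M_def
  proof (rule gauss_avg_mono[OF exp_growth_const ec])
    show "1 \<le> cosh y * cosh y" for y :: real using mult_mono[OF cosh_real_ge_1 cosh_real_ge_1, of y y] by (simp add: cosh_real_nonneg)
  qed
  then have M: "1 \<le> M" by (simp add: gauss_avg_const)
  have "gauss_avg s (\<lambda>x. 2 / M + (- ((1 / M)\<^sup>2)) * (cosh x * cosh x)) h \<le> gauss_avg s (\<lambda>x. sech x ^ 2) h"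
  proof (rule gauss_avg_mono[OF exp_growth_add[OF exp_growth_const exp_growth_cmult[OF ec]] exp_growth_sech_power])
    fix y
    have "(sech y - 1 / M * cosh y)\<^sup>2 = sech y ^ 2 - 2 / M * (sech y * cosh y) + (1 / M)\<^sup>2 * (cosh y * cosh y)"
      by (simp add: power2_eq_square algebra_simps)
    with zero_le_power2[of "sech y - 1 / M * cosh y"] have "0 \<le> sech y ^ 2 - 2 / M * 1 + (1 / M)\<^sup>2 * (cosh y * cosh y)"
      unfolding sech_cosh by (simp only:)
    then show "2 / M + (- ((1 / M)\<^sup>2)) * (cosh y * cosh y) \<le> sech y ^ 2"
      by simp
  qed
  then have "2 / M + (- ((1 / M)\<^sup>2)) * M \<le> gauss_avg s (\<lambda>x. sech x ^ 2) h"
    unfolding gauss_avg_linear(1)[OF exp_growth_const exp_growth_cmult[OF ec]] gauss_avg_linear(2)[OF ec ec] gauss_avg_const M_def[symmetric] .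
  moreover have "2 / M + (- ((1 / M)\<^sup>2)) * M = 1 / M" using M by (simp add: power2_eq_square field_simps)
  moreover have "0 < 1 / M" using M by simp
  ultimately have "0 < gauss_avg s (\<lambda>x. sech x ^ 2) h" by linarith
  moreover have "gauss_avg s (\<lambda>x. (tanh x)\<^sup>2 + sech x ^ 2) h = 1" by (simp add: sech_sq gauss_avg_const)
  ultimately show ?thesis using gauss_avg_linear(1)[OF exp_growth_tanh2 exp_growth_sech_power[of 2], of s h] by simp
qed

text \<open>If the gap is positive at \<open>q\<close>, then \<open>q > 0\<close> and the functional increases strictly along point
masses just before \<open>q\<close>; if it is negative, then \<open>q < 1\<close> and the functional decreases strictly just
after \<open>q\<close>. A whole neighbourhood is used, and not the derivative at \<open>q\<close>, because \<open>X\<close> may vanish at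
\<open>q = 0\<close>.\<close>

lemma minimal_point:
  assumes q: "q \<in> {0..1}" and min: "is_parisi_measure \<xi>\<^sub>0 \<beta> h (return unit_borel q)"
  shows "overlap_gap h q = 0" "q < 1"
proof -
  define F where "F r = gauss_avg (sqrt (T r)) lncosh h + (T 1 - T r) / 2 - 1 / 2 * (J 1 - J r)" for r
  have F: "F q \<le> F r" if "0 \<le> r" "r \<le> 1" for r
  proof -
    have "parisi_functional \<xi>\<^sub>0 \<beta> h (return unit_borel q) \<le> parisi_functional \<xi>\<^sub>0 \<beta> h (return unit_borel r)"
      using min point_mass(1)[of r] that by (simp add: is_parisi_measure_def)
    then show ?thesis using that q by (simp add: functional_point F_def)
  qed
  have dF: "(F has_real_derivative 1 / 2 * X r * overlap_gap h r) (at r)" if "0 < r" "r < 1" for r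
    unfolding F_def[abs_def] by (rule functional_point_deriv[OF that])
  have cF: "continuous_on {a..b} F" if "0 \<le> a" "b \<le> 1" for a b
  proof (rule continuous_on_subset)
    show "continuous_on {0..1} F"
      unfolding F_def[abs_def] by (intro continuous_intros gauss_avg_T_cont exp_growth_lncosh T_cont J_cont) auto
  qed (use that in auto)
  have near: "\<exists>d>0. \<forall>r\<in>{0..1}. \<bar>r - q\<bar> < d \<longrightarrow> \<bar>overlap_gap h r - overlap_gap h q\<bar> < \<bar>overlap_gap h q\<bar>" if "overlap_gap h q \<noteq> 0"
    using bspec[OF iffD1[OF continuous_on_iff overlap_gap_cont] q, of h, rule_format, of "\<bar>overlap_gap h q\<bar>"] that
    by (simp add: dist_real_def)
  show zero: "overlap_gap h q = 0"
  proof (rule ccontr)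
    assume nz: "overlap_gap h q \<noteq> 0"
    obtain d where d: "d > 0" "\<And>r. r \<in> {0..1} \<Longrightarrow> \<bar>r - q\<bar> < d \<Longrightarrow> \<bar>overlap_gap h r - overlap_gap h q\<bar> < \<bar>overlap_gap h q\<bar>"
      using near[OF nz] by auto
    show False
    proof (cases "0 < overlap_gap h q")
      case True
      have "0 \<le> gauss_avg (sqrt (T q)) (\<lambda>x. (tanh x)\<^sup>2) h" unfolding gauss_avg_def by simp
      then have q0: "0 < q" using True by (simp add: overlap_gap_def)
      define r where "r = max 0 (q - d / 2)"
      have r: "0 \<le> r" "r < q" "q - d < r" using q0 d(1) by (auto simp: r_def max_def)
      have "F r < F q"
      proof (rule DERIV_pos_imp_increasing_open[OF r(2)])
        fix x assume x: "r < x" "x < q"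
        have "0 < overlap_gap h x" using d(2)[of x] x r q True by (auto simp: abs_if split: if_splits)
        then show "\<exists>y. (F has_real_derivative y) (at x) \<and> 0 < y"
          using dF[of x] xi_facts(5)[of x] x r q by (intro exI[of _ "1 / 2 * X x * overlap_gap h x"] conjI) auto
      qed (rule cF, use r q in auto)
      with F[of r] r q show False by auto
    next
      case False
      then have neg: "overlap_gap h q < 0" using nz by simp
      have q1: "q < 1" using neg tanh_sq_avg_less_1[of "sqrt (T q)" h] by (simp add: overlap_gap_def)
      define r where "r = min 1 (q + d / 2)"
      have r: "r \<le> 1" "q < r" "r < q + d" using q1 d(1) by (auto simp: r_def min_def)
      have "F r < F q"
      proof (rule DERIV_neg_imp_decreasing_open[OF r(2)])
        fix x assume x: "q < x" "x < r"
        have "overlap_gap h x < 0" using d(2)[of x] x r q neg by (auto simp: abs_if split: if_splits)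
        then show "\<exists>y. (F has_real_derivative y) (at x) \<and> y < 0"
          using dF[of x] xi_facts(5)[of x] x r q
          by (intro exI[of _ "1 / 2 * X x * overlap_gap h x"] conjI) (auto simp: mult_pos_neg)
      qed (rule cF, use r q in auto)
      with F[of r] r q show False by auto
    qed
  qed
  show "q < 1" using zero tanh_sq_avg_less_1[of "sqrt (T q)" h] by (simp add: overlap_gap_def)
qed

text \<open>Compare the point mass at \<open>q\<close> with the measure that moves the mass \<open>k = 1 - m\<close> to \<open>r\<close>. The
difference of the functionals is \<open>k\<close> times the difference of the two sides, up to \<open>O(k^2)\<close>; divide
by \<open>k\<close> and let \<open>k\<close> tend to \<open>0\<close>.\<close>

lemma tilt_entropy_le:
  assumes q: "0 \<le> q" and r: "q \<le> r" "r \<le> 1" and min: "is_parisi_measure \<xi>\<^sub>0 \<beta> h (return unit_borel q)"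
  shows "gauss_avg (sqrt (T q)) (tilt_entropy (T r - T q)) h \<le> 1 / 2 * (J r - J q)"
proof -
  define v where "v = T r - T q"
  have v: "0 \<le> v" using T_mono assms by (simp add: v_def)
  have q1: "q \<in> {0..1}" using q r by simp
  define s where "s = sqrt (T q)"
  define A where "A = gauss_avg s (tilt_entropy v) h"
  define B where "B = gauss_avg s (tilt_second_moment v) h"
  have key: "A - k / 2 * B \<le> 1 / 2 * (1 - k) * (J r - J q)" if k: "0 < k" "k < 1" for k
  proof -
    define m where "m = 1 - k"
    have m: "0 < m" "m \<le> 1" "m < 1" using k by (auto simp: m_def)
    have "parisi_functional \<xi>\<^sub>0 \<beta> h (return unit_borel q) \<le> parisi_functional \<xi>\<^sub>0 \<beta> h (two_atoms m q r)"
      using min two_atoms(1)[OF q r m(1,2)] by (simp add: is_parisi_measure_def)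
    moreover have "parisi_functional \<xi>\<^sub>0 \<beta> h (return unit_borel q)
      = gauss_avg s (cole_hopf 1 v) h + (T 1 - T r) / 2 - 1 / 2 * (1 * (J 1 - J q) + (1 - 1) * (J 1 - J r))"
      unfolding s_def v_def
      by (rule functional_two_atoms[OF point_mass(1)[OF q1] q r]) (use point_mass(2)[OF q1] r in auto)
    moreover have "parisi_functional \<xi>\<^sub>0 \<beta> h (two_atoms m q r)
      = gauss_avg s (cole_hopf m v) h + (T 1 - T r) / 2 - 1 / 2 * (m * (J 1 - J q) + (1 - m) * (J 1 - J r))"
      unfolding s_def v_def
      by (rule functional_two_atoms[OF two_atoms(1)[OF q r m(1,2)] q r m(1,2)]) (rule two_atoms(2)[OF q r m(1,2)])
    ultimately have D: "gauss_avg s (cole_hopf 1 v) h - gauss_avg s (cole_hopf m v) h \<le> 1 / 2 * (k * (J r - J q))"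
      by (simp add: m_def algebra_simps)
    have one: "(0::real) < 1" "(1::real) \<le> 1" by auto
    note eE = exp_growth_tilt_entropy[OF v] note eL = exp_growth_cole_hopf(1)[OF one v] exp_growth_cole_hopf(1)[OF m(1,2) v]
    have "gauss_avg s (\<lambda>y. k * tilt_entropy v y + (- (k\<^sup>2 / 2)) * tilt_second_moment v y) h \<le> gauss_avg s (\<lambda>y. m * cole_hopf 1 v y + (- m) * cole_hopf m v y) h"
    proof (rule gauss_avg_mono)
      show "k * tilt_entropy v y + (- (k\<^sup>2 / 2)) * tilt_second_moment v y \<le> m * cole_hopf 1 v y + (- m) * cole_hopf m v y" for y
        using cole_hopf_slope[OF v m(1,3), of y] by (simp add: m_def algebra_simps)
    qed (intro exp_growth_add exp_growth_cmult eE eL)+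
    then have "k * A + (- (k\<^sup>2 / 2)) * B \<le> m * gauss_avg s (cole_hopf 1 v) h + (- m) * gauss_avg s (cole_hopf m v) h"
      unfolding A_def B_def
      by (simp only: gauss_avg_linear(1)[OF exp_growth_cmult[OF eE(1)] exp_growth_cmult[OF eE(2)]] gauss_avg_linear(2)[OF eE(1) eE(1)] gauss_avg_linear(2)[OF eE(2) eE(2)]
          gauss_avg_linear(1)[OF exp_growth_cmult[OF eL(1)] exp_growth_cmult[OF eL(2)]] gauss_avg_linear(2)[OF eL(1) eL(1)] gauss_avg_linear(2)[OF eL(2) eL(2)])
    also have "\<dots> = m * (gauss_avg s (cole_hopf 1 v) h - gauss_avg s (cole_hopf m v) h)" by (simp add: right_diff_distrib)
    also have "\<dots> \<le> m * (1 / 2 * (k * (J r - J q)))" using D m by (intro mult_left_mono) auto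
    finally have "k * (A - k / 2 * B) \<le> k * (1 / 2 * (1 - k) * (J r - J q))"
      by (simp add: m_def power2_eq_square algebra_simps)
    then show ?thesis using k by (simp only: mult_le_cancel_left_pos)
  qed
  have "((\<lambda>k. 1 / 2 * (1 - k) * (J r - J q) - (A - k / 2 * B)) \<longlongrightarrow> 1 / 2 * (1 - 0) * (J r - J q) - (A - 0 / 2 * B)) (at_right 0)"
    by (intro tendsto_intros) auto
  moreover have "\<forall>\<^sub>F k in at_right 0. 0 \<le> 1 / 2 * (1 - k) * (J r - J q) - (A - k / 2 * B)"
    using eventually_at_right_less[of "0::real"] eventually_at_right_real[of 0 "1::real"]
    by (rule eventually_elim2) (use key in auto)
  ultimately have "0 \<le> 1 / 2 * (1 - 0) * (J r - J q) - (A - 0 / 2 * B)"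
    by (rule tendsto_lowerbound) simp
  then show ?thesis by (simp add: A_def s_def v_def)
qed

text \<open>As \<open>X\<close> is increasing, \<open>\<integral> X s (s - q) ds \<le> X r (r - q)^2 / 2\<close> over \<open>[q, r]\<close>.\<close>

lemma J_increment:
  assumes "0 \<le> q" "q \<le> r" "r \<le> 1"
  shows "J r - J q \<le> q * (T r - T q) + X r * (r - q)\<^sup>2 / 2"
proof -
  define D where "D s = X r * (s - q)\<^sup>2 / 2 - J s + q * T s" for s
  have "D q \<le> D r"
  proof (rule DERIV_nonneg_imp_increasing_open[OF assms(2)])
    fix x assume x: "q < x" "x < r"
    have "((\<lambda>s. X r * (s - q)\<^sup>2 / 2) has_real_derivative X r * (x - q)) (at x)"
      by (auto intro!: derivative_eq_intros)
    then have "(D has_real_derivative X r * (x - q) - X x * x + q * X x) (at x)"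
      unfolding D_def[abs_def] by (intro DERIV_add DERIV_diff DERIV_cmult J_deriv xi_facts(1)) (use x assms in auto)
    moreover have "X r * (x - q) - X x * x + q * X x = (X r - X x) * (x - q)" by (simp add: algebra_simps)
    moreover have "0 \<le> (X r - X x) * (x - q)" using xi_facts(6)[of x r] x assms by (intro mult_nonneg_nonneg) auto
    ultimately show "\<exists>y. (D has_real_derivative y) (at x) \<and> 0 \<le> y" by auto
  next
    show "continuous_on {q..r} D"
      unfolding D_def[abs_def]
      by (intro continuous_intros continuous_on_subset[OF J_cont] continuous_on_subset[OF T_cont]) (use assms in auto)
  qed
  then show ?thesis by (simp add: D_def algebra_simps)
qed

text \<open>Insert the lower bound \<open>tilt_entropy_lower\<close> into \<open>tilt_entropy_le\<close>. The first order terms are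
\<open>v/2 E tanh^2 Y\<close> on the left and \<open>v/2 q\<close> on the right; they cancel, as \<open>q\<close> is stationary. What
remains is of second order in \<open>r - q\<close>, where \<open>v\<close> lies between \<open>X q (r - q)\<close> and \<open>X 1 (r - q)\<close>.\<close>

lemma stability:
  assumes q: "q \<in> {0..1}" and min: "is_parisi_measure \<xi>\<^sub>0 \<beta> h (return unit_borel q)"
  shows "X q * gauss_avg (sqrt (T q)) (\<lambda>x. sech x ^ 4) h \<le> 1"
proof -
  define s where "s = sqrt (T q)"
  define S where "S = gauss_avg s (\<lambda>x. sech x ^ 4) h"
  define M where "M = X 1"
  note mp = minimal_point[OF q min]
  have S0: "0 \<le> S" unfolding S_def gauss_avg_def by simp
  have Xq: "0 \<le> X q" by (rule xi_facts(4)[OF q])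
  have tanh: "gauss_avg s (\<lambda>x. (tanh x)\<^sup>2) h = q" using mp(1) by (simp add: overlap_gap_def s_def)
  have ineq: "(X q)\<^sup>2 * S \<le> X r + 2 * M ^ 3 * (r - q)" if r: "q < r" "r < 1" for r
  proof -
    have r': "0 \<le> q" "q \<le> r" "r \<le> 1" using q r by auto
    define v where "v = T r - T q"
    have v: "0 \<le> v" "X q * (r - q) \<le> v" "v \<le> M * (r - q)"
      using T_mono T_increment_lower T_increment_upper r' by (simp_all add: v_def M_def)
    note e = exp_growth_cmult[OF exp_growth_tanh2, of "1 / 2 * v"] exp_growth_cmult[OF exp_growth_sech_power[of 4], of "1 / 4 * v\<^sup>2"]
    have "gauss_avg s (\<lambda>y. (1 / 2 * v * (tanh y)\<^sup>2 + 1 / 4 * v\<^sup>2 * sech y ^ 4) + (- (1 / 2 * v ^ 3))) h \<le> gauss_avg s (tilt_entropy v) h"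
      by (rule gauss_avg_mono[OF exp_growth_add[OF exp_growth_add[OF e] exp_growth_const] exp_growth_tilt_entropy(1)[OF v(1)]])
         (use tilt_entropy_lower[OF v(1)] in simp)
    then have "1 / 2 * v * q + 1 / 4 * v\<^sup>2 * S - 1 / 2 * v ^ 3 \<le> gauss_avg s (tilt_entropy v) h"
      unfolding S_def gauss_avg_linear(1)[OF exp_growth_add[OF e] exp_growth_const] gauss_avg_linear(1)[OF e] gauss_avg_const
        gauss_avg_linear(2)[OF exp_growth_tanh2 exp_growth_tanh2] gauss_avg_linear(2)[OF exp_growth_sech_power exp_growth_sech_power] tanh by simp
    also have "\<dots> \<le> 1 / 2 * (J r - J q)" unfolding s_def v_def by (rule tilt_entropy_le[OF r' min])
    also have "\<dots> \<le> 1 / 2 * (q * v + X r * (r - q)\<^sup>2 / 2)" using J_increment[OF r'] by (simp add: v_def)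
    finally have 1: "v\<^sup>2 * S \<le> X r * (r - q)\<^sup>2 + 2 * v ^ 3" by (simp add: field_simps)
    have "(X q * (r - q))\<^sup>2 * S \<le> v\<^sup>2 * S"
      using v(2) Xq r S0 by (intro mult_right_mono power_mono) auto
    moreover have "v ^ 3 \<le> (M * (r - q)) ^ 3" using v by (intro power_mono) auto
    ultimately have "(X q * (r - q))\<^sup>2 * S \<le> X r * (r - q)\<^sup>2 + 2 * (M * (r - q)) ^ 3" using 1 by linarith
    then have "(r - q)\<^sup>2 * ((X q)\<^sup>2 * S) \<le> (r - q)\<^sup>2 * (X r + 2 * M ^ 3 * (r - q))"
      by (simp add: power_mult_distrib algebra_simps power2_eq_square power3_eq_cube)
    moreover have "0 < (r - q)\<^sup>2" using r by simp
    ultimately show ?thesis by (simp only: mult_le_cancel_left_pos)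
  qed
  have "((\<lambda>r. X r + 2 * M ^ 3 * (r - q)) \<longlongrightarrow> X q + 2 * M ^ 3 * (q - q)) (at_right q)"
    using xi_facts(2)[OF q] by (intro tendsto_intros) (auto simp: isCont_def intro: tendsto_within_subset)
  moreover have "\<forall>\<^sub>F r in at_right q. (X q)\<^sup>2 * S \<le> X r + 2 * M ^ 3 * (r - q)"
    using eventually_at_right_real[OF mp(2)] by (rule eventually_mono) (use ineq in auto)
  ultimately have "(X q)\<^sup>2 * S \<le> X q + 2 * M ^ 3 * (q - q)"
    by (rule tendsto_lowerbound) simp
  then have "X q * (X q * S) \<le> X q * 1" by (simp add: power2_eq_square mult.assoc)
  then have "X q * S \<le> 1" using Xq by (cases "X q = 0") (auto simp: mult_le_cancel_left)
  then show ?thesis by (simp add: S_def s_def)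
qed

lemma Q_star_iff: "q \<in> Q_star \<xi>\<^sub>0 \<beta> h \<longleftrightarrow> q \<in> {0..1} \<and> overlap_gap h q = 0"
  by (auto simp: Q_star_def gauss_expectation_def overlap_gap_def gauss_avg_def add.commute)

lemma alpha_at_eq: "alpha_at \<xi>\<^sub>0 q \<beta> h = X q * gauss_avg (sqrt (T q)) (\<lambda>x. sech x ^ 4) h"
  by (simp add: alpha_at_def gauss_expectation_def gauss_avg_def sech_def add.commute)

text \<open>The set \<open>Q_star\<close> is a closed subset of the unit interval on which \<open>alpha_at\<close> is continuous, so the
minimum is attained and the \<open>LEAST\<close> in the definition of \<open>alpha\<close> is what it should be.\<close>

lemma alpha_le:
  assumes q: "q \<in> Q_star \<xi>\<^sub>0 \<beta> h"
  shows "alpha \<xi>\<^sub>0 \<beta> h \<le> alpha_at \<xi>\<^sub>0 q \<beta> h"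
proof -
  have Q: "Q_star \<xi>\<^sub>0 \<beta> h = {q \<in> {0..1}. overlap_gap h q = 0}" using Q_star_iff by auto
  have "closed (Q_star \<xi>\<^sub>0 \<beta> h)"
    unfolding Q by (rule continuous_closed_preimage_constant[OF overlap_gap_cont]) simp
  then have "compact (Q_star \<xi>\<^sub>0 \<beta> h)"
    using compact_Int_closed[of "{0..1::real}" "Q_star \<xi>\<^sub>0 \<beta> h"] by (simp add: Q Int_absorb1 subset_eq Collect_conj_eq)
  moreover have "continuous_on (Q_star \<xi>\<^sub>0 \<beta> h) (\<lambda>q. alpha_at \<xi>\<^sub>0 q \<beta> h)"
    unfolding alpha_at_eq
    by (rule continuous_on_subset[of "{0..1}"]) (auto intro!: continuous_intros X_cont gauss_avg_T_cont exp_growth_sech_power simp: Q)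
  ultimately obtain p where p: "p \<in> Q_star \<xi>\<^sub>0 \<beta> h" "\<And>q. q \<in> Q_star \<xi>\<^sub>0 \<beta> h \<Longrightarrow> alpha_at \<xi>\<^sub>0 p \<beta> h \<le> alpha_at \<xi>\<^sub>0 q \<beta> h"
    using continuous_attains_inf[of "Q_star \<xi>\<^sub>0 \<beta> h" "\<lambda>q. alpha_at \<xi>\<^sub>0 q \<beta> h"] q by auto
  have "alpha \<xi>\<^sub>0 \<beta> h = alpha_at \<xi>\<^sub>0 p \<beta> h"
    unfolding alpha_def by (rule Least_equality) (use p in auto)
  then show ?thesis using p(2)[OF q] by simp
qed

end

theorem theorem1p8:
  fixes \<xi>\<^sub>0 :: "real \<Rightarrow> real"
  assumes "is_model \<xi>\<^sub>0"
  shows "RS \<xi>\<^sub>0 \<subseteq> AT \<xi>\<^sub>0"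
proof (clarsimp simp: RS_def AT_def)
  fix \<beta> h q :: real
  assume b: "0 < \<beta>" "0 \<le> h" and min: "is_parisi_measure \<xi>\<^sub>0 \<beta> h (return unit_borel q)" and q: "0 \<le> q" "q \<le> 1"
  interpret spin_model \<xi>\<^sub>0 \<beta> using assms b by unfold_locales
  have q: "q \<in> {0..1}" using q by simp
  have "q \<in> Q_star \<xi>\<^sub>0 \<beta> h" using minimal_point(1)[OF q min] q by (simp add: Q_star_iff)
  from alpha_le[OF this] stability[OF q min] show "alpha \<xi>\<^sub>0 \<beta> h \<le> 1" by (simp add: alpha_at_eq)
qed

end
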